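(* Let $Y_i=h_0(X_i)+\epsilon_i$, $E[\epsilon_i|X_i]=0$, with $X_i$ valued in $\mathcal X\subseteq\mathbb R^d$, let $f:L^2(X)\cap L^\infty(X)\to\mathbb R$ be a functional, and let $\widehat h,\widetilde h,\widetilde B_w,\zeta_{K,n},\lambda_{K,n},v_K^*,V_K,\widehat\Omega,\Omega,N_{K,n}$ be as defined in the context. Suppose: (1) $\{X_i\}_{i=-\infty}^\infty$ is strictly stationary. (2) With $\mathcal F_{i-1}=\sigma(X_i,\epsilon_{i-1},X_{i-1},\ldots)$, $\{\epsilon_i,\mathcal F_{i-1}\}_{i=1}^n$ is a strictly stationary martingale difference sequence; $E[\epsilon_i^2|\mathcal F_{i-1}]$ is uniformly bounded for all $i\ge1$, almost surely; $\inf_{x\in\mathcal X}E[\epsilon_i^2|X_i=x]>0$; and $\sup_{x\in\mathcal X}E[\epsilon_i^2\mathbf 1\{|\epsilon_i|>\ell(n)\}|X_i=x]\to0$ as $n\to\infty$ for any positive sequence $\ell(n)\to\infty$. (3) $\lambda_{\min}(E[b_w^K(X_i)b_w^K(X_i)'])>0$ for each $K$ and $n$. (4) Either $\{X_i\}_{i=1}^n$ is i.i.d. and $\zeta_{K,n}\lambda_{K,n}\sqrt{(\log K)/n}=o(1)$, or $\|(\widetilde B_w'\widetilde B_w/n)-I_K\|=o_p(1)$. (5) (i) $v\mapsto\frac{\partial f(h_0)}{\partial h}[v]$ is a linear functional; (ii) $\sup_{h\in N_{K,n}}\sqrt n\|v_K^*\|_{L^2(X)}^{-1}\big|f(h)-f(h_0)-\frac{\partial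 f(h_0)}{\partial h}[h-h_0]\big|=o(1)$, where $\widehat h,\widetilde h\in N_{K,n}$ with probability approaching one; (iii) $\|v_K^*\|_{L^2(X)}\nearrow+\infty$ and $\sqrt n\|v_K^*\|_{L^2(X)}^{-1}\big|\frac{\partial f(h_0)}{\partial h}[\widetilde h-h_0]\big|=o_p(1)$. Then $$\frac{\sqrt n(f(\widehat h)-f(h_0))}{V_K^{1/2}}\to_dN(0,1)$$ as $n,K\to\infty$ provided that either (a) or (b) is satisfied: (a) $\{(X_i,Y_i)\}_{i=1}^n$ is i.i.d.; (b) $\{X_i\}_{i=1}^n$ is weakly dependent, with $\|\widehat\Omega-\Omega\|=o_p(1)$ and $\|\widetilde B_w'\widetilde B_w/n-I_K\|=o_p(K^{-1/2})$.
   Context: Asymptotics are as $n\to\infty$ with $K=K(n)\to\infty$. $\|\cdot\|$ is the Euclidean norm of a vector or the spectral norm of a matrix; $^-$ is the Moore–Penrose inverse; $\lambda_{\min}$ is the smallest eigenvalue. $\|g\|_{L^2(X)}=E[g(X_i)^2]^{1/2}$; $L^\infty(X)$ is the space of bounded functions on $\mathcal X$ with the sup norm. $\mathcal D_n\subseteq\mathcal X$ is compact, convex, with nonempty interior and $\mathcal D_n\subseteq\mathcal D_{n+1}$; $w_n(x)=1$ if $x\in\mathcal D_n$ and $0$ otherwise. For sieve basis functions $b_{K1},\ldots,b_{KK}$: $b_w^K(x)=(b_{K1}(x)w_n(x),\ldots,b_{KK}(x)w_n(x))'$, $B_{K,w}$ is the linear span of its entries, $B_w=(b_w^K(X_1),\ldots,b_w^K(X_n))'$,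 $Y=(Y_1,\ldots,Y_n)'$, $H_0=(h_0(X_1),\ldots,h_0(X_n))'$, $\widehat h(x)=b_w^K(x)'(B_w'B_w)^-B_w'Y$, $\widetilde h(x)=b_w^K(x)'(B_w'B_w)^-B_w'H_0$. $\zeta_{K,n}=\sup_x\|b_w^K(x)\|$, $\lambda_{K,n}=[\lambda_{\min}(E[b_w^K(X_i)b_w^K(X_i)'])]^{-1/2}$, $\widetilde b_w^K(x)=E[b_w^K(X_i)b_w^K(X_i)']^{-1/2}b_w^K(x)$, $\widetilde B_w=(\widetilde b_w^K(X_1),\ldots,\widetilde b_w^K(X_n))'$. Pathwise derivative of $f$ at $h_0$ in direction $v$: $\frac{\partial f(h_0)}{\partial h}[v]=\lim_{\tau\to0^+}\frac{f(h_0+\tau v)-f(h_0)}{\tau}$; applied to a vector of functions it acts elementwise. Sieve Riesz representer: $v_K^*$ is the unique element of $B_{K,w}$ with $\frac{\partial f(h_0)}{\partial h}[v]=E[v_K^*(X_i)v(X_i)]$ for all $v\in B_{K,w}$, i.e. $v_K^*(x)=\widetilde b_w^K(x)'\frac{\partial f(h_0)}{\partial h}[\widetilde b_w^K]$. Sieve variance: $V_K=\|v_K^*\|_{sd}^2=E[(\epsilon_iv_K^*(X_i))^2]$. $\widehat\Omega=n^{-1}\sum_{i=1}^n\epsilon_i^2\widetilde b_w^K(X_i)\widetilde b_w^K(X_i)'$, $\Omega=E[\epsilon_i^2\widetilde b_w^K(X_i)\widetilde b_w^K(X_i)']$. $N_{K,n}$ denotes a convex neighborhood of $h_0$ (a convex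 set of functions near $h_0$, e.g. the set of $h\in B_{K,w}$ within a prescribed $L^2(X)$ or sup-norm distance of $h_0$) such that $\widehat h,\widetilde h\in N_{K,n}$ with probability approaching one. *)

theory Defs
  imports "HOL-Probability.Probability" "Jordan_Normal_Form.Char_Poly"
begin

text \<open>
  The sieve dimension \<open>K = K(n)\<close> grows with the sample size, so vectors and matrices are those of
  \<^theory>\<open>Jordan_Normal_Form.Matrix\<close>, whose dimensions are terms.  Basis functions are numbered
  \<open>0, \<dots>, K - 1\<close>; row \<open>i\<close> of a design matrix belongs to observation \<open>i + 1\<close>.
\<close>

no_notation vec_nth (infixl \<open>$\<close> 90)
no_notation inner (infix \<open>\<bullet>\<close> 70)


subsection \<open>Matrices\<close>

definition vec_norm2 :: "real vec \<Rightarrow> real" where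
  "vec_norm2 v = sqrt (v \<bullet> v)"

definition spectral_norm :: "real mat \<Rightarrow> real" where
  "spectral_norm A = Sup {vec_norm2 (A *\<^sub>v v) | v. v \<in> carrier_vec (dim_col A) \<and> vec_norm2 v \<le> 1}"

definition lambda_min :: "real mat \<Rightarrow> real" where
  "lambda_min A = Min {k. eigenvalue A k}"

definition moore_penrose :: "real mat \<Rightarrow> real mat" where
  "moore_penrose A = (THE P. P \<in> carrier_mat (dim_col A) (dim_row A) \<and>
     A * P * A = A \<and> P * A * P = P \<and>
     transpose_mat (A * P) = A * P \<and> transpose_mat (P * A) = P * A)"

text \<open>\<open>A\<^sup>-\<^sup>1\<^sup>/\<^sup>2\<close> of a symmetric positive definite matrix: the unique symmetric positive semidefinite
  square root of the inverse of \<open>A\<close>.\<close>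

definition mat_inv_sqrt :: "real mat \<Rightarrow> real mat" where
  "mat_inv_sqrt A = (THE R. R \<in> carrier_mat (dim_row A) (dim_row A) \<and>
     transpose_mat R = R \<and> (\<forall>v \<in> carrier_vec (dim_row A). 0 \<le> v \<bullet> (R *\<^sub>v v)) \<and>
     inverts_mat (R * R) A \<and> inverts_mat A (R * R))"


subsection \<open>Stochastic order symbols\<close>

text \<open>The events are described through measurable subsets (inner probability), since
  \<^const>\<open>measure\<close> is \<open>0\<close> on non-measurable sets.  For measurable events this is the usual notion.\<close>

definition wp_approaching_one :: "'w measure \<Rightarrow> (nat \<Rightarrow> 'w \<Rightarrow> bool) \<Rightarrow> bool" where
  "wp_approaching_one M P \<longleftrightarrow>
     (\<exists>A. (\<forall>n. A n \<in> sets M \<and> (\<forall>\<omega> \<in> A n. P n \<omega>)) \<and> (\<lambda>n. measure M (A n)) \<longlonglongrightarrow> 1)"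

text \<open>\<open>Z\<^sub>n = o\<^sub>p(r\<^sub>n)\<close>\<close>

definition little_op :: "'w measure \<Rightarrow> (nat \<Rightarrow> 'w \<Rightarrow> real) \<Rightarrow> (nat \<Rightarrow> real) \<Rightarrow> bool" where
  "little_op M Z r \<longleftrightarrow> (\<forall>e>0. wp_approaching_one M (\<lambda>n \<omega>. \<bar>Z n \<omega>\<bar> \<le> e * r n))"


subsection \<open>Stochastic processes\<close>

definition strictly_stationary ::
    "'w measure \<Rightarrow> 'b measure \<Rightarrow> (int \<Rightarrow> 'w \<Rightarrow> 'b) \<Rightarrow> int set \<Rightarrow> bool" where
  "strictly_stationary M S Z I \<longleftrightarrow>
     (\<forall>i\<in>I. Z i \<in> measurable M S) \<and>
     (\<forall>J k. finite J \<and> J \<subseteq> I \<and> (\<forall>j\<in>J. j + k \<in> I) \<longrightarrow>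
        distr M (Pi\<^sub>M J (\<lambda>_. S)) (\<lambda>\<omega>. \<lambda>j\<in>J. Z (j + k) \<omega>) =
        distr M (Pi\<^sub>M J (\<lambda>_. S)) (\<lambda>\<omega>. \<lambda>j\<in>J. Z j \<omega>))"

definition iid :: "'w measure \<Rightarrow> 'b measure \<Rightarrow> (int \<Rightarrow> 'w \<Rightarrow> 'b) \<Rightarrow> int set \<Rightarrow> bool" where
  "iid M S Z I \<longleftrightarrow> prob_space.indep_vars M (\<lambda>_. S) Z I \<and>
     (\<forall>i\<in>I. \<forall>j\<in>I. distr M S (Z i) = distr M S (Z j))"

definition preimages ::
    "'w measure \<Rightarrow> (int \<Rightarrow> 'w \<Rightarrow> 'b::topological_space) \<Rightarrow> int set \<Rightarrow> 'w set set" where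
  "preimages M Z J = (\<Union>j\<in>J. {Z j -` A \<inter> space M | A. A \<in> sets borel})"

text \<open>\<open>\<F>\<^sub>i\<^sub>-\<^sub>1 = \<sigma>(X\<^sub>i, \<epsilon>\<^sub>i\<^sub>-\<^sub>1, X\<^sub>i\<^sub>-\<^sub>1, \<dots>)\<close>; note the index \<open>i\<close>, not \<open>i - 1\<close>.\<close>

definition past_algebra ::
    "'w measure \<Rightarrow> (int \<Rightarrow> 'w \<Rightarrow> 'x::topological_space) \<Rightarrow> (int \<Rightarrow> 'w \<Rightarrow> real) \<Rightarrow> int \<Rightarrow> 'w measure"
  where
  "past_algebra M X \<epsilon> i = sigma (space M) (preimages M X {..i} \<union> preimages M \<epsilon> {..<i})"

text \<open>Weak dependence of \<open>X\<^sub>1, X\<^sub>2, \<dots>\<close> is read as strong mixing without any rate, the weakest of the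
  classical mixing conditions (it is implied by \<open>\<beta>\<close>-, \<open>\<rho>\<close>- and \<open>\<phi>\<close>-mixing).\<close>

definition alpha_coeff ::
    "'w measure \<Rightarrow> (int \<Rightarrow> 'w \<Rightarrow> 'b::topological_space) \<Rightarrow> nat \<Rightarrow> real" where
  "alpha_coeff M Z k = Sup {\<bar>measure M (A \<inter> B) - measure M A * measure M B\<bar> | A B m.
     1 \<le> m \<and> A \<in> sigma_sets (space M) (preimages M Z {1..m})
           \<and> B \<in> sigma_sets (space M) (preimages M Z {m + int k..})}"

definition weakly_dependent :: "'w measure \<Rightarrow> (int \<Rightarrow> 'w \<Rightarrow> 'b::topological_space) \<Rightarrow> bool" where
  "weakly_dependent M Z \<longleftrightarrow> alpha_coeff M Z \<longlonglongrightarrow> 0"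

text \<open>\<open>g\<close> is a version on \<open>\<X>\<close> of \<open>x \<mapsto> E[Z | X\<^sub>0 = x]\<close>, for nonnegative \<open>Z\<close> and \<open>\<X>\<close>-valued
  \<open>X\<^sub>0\<close>.\<close>

definition is_cond_exp_given ::
    "'w measure \<Rightarrow> 'x::topological_space set \<Rightarrow> ('w \<Rightarrow> 'x) \<Rightarrow> ('w \<Rightarrow> real) \<Rightarrow> ('x \<Rightarrow> ennreal) \<Rightarrow> bool"
  where
  "is_cond_exp_given M \<X> X0 Z g \<longleftrightarrow>
     g \<in> borel_measurable (restrict_space borel \<X>) \<and>
     (\<forall>A \<in> sets borel. (\<integral>\<^sup>+ \<omega>. ennreal (Z \<omega>) * indicator A (X0 \<omega>) \<partial>M) =
                       (\<integral>\<^sup>+ \<omega>. g (X0 \<omega>) * indicator A (X0 \<omega>) \<partial>M))"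


subsection \<open>Functions and functionals\<close>

text \<open>Functions on \<open>\<X>\<close> are represented by total functions whose measurability and boundedness are
  required on \<open>\<X>\<close> only.  They are not identified when equal almost surely, because \<open>L\<^sup>\<infinity>(X)\<close> carries
  the supremum norm over \<open>\<X>\<close>.\<close>

definition L2_Linf ::
    "'w measure \<Rightarrow> 'x::topological_space set \<Rightarrow> ('w \<Rightarrow> 'x) \<Rightarrow> ('x \<Rightarrow> real) set" where
  "L2_Linf M \<X> X0 = {g \<in> borel_measurable (restrict_space borel \<X>).
     integrable M (\<lambda>\<omega>. (g (X0 \<omega>))\<^sup>2) \<and> bounded (g ` \<X>)}"

definition L2_norm :: "'w measure \<Rightarrow> ('w \<Rightarrow> 'x) \<Rightarrow> ('x \<Rightarrow> real) \<Rightarrow> real" where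
  "L2_norm M X0 g = sqrt (\<integral>\<omega>. (g (X0 \<omega>))\<^sup>2 \<partial>M)"

definition convex_functions :: "('x \<Rightarrow> real) set \<Rightarrow> bool" where
  "convex_functions C \<longleftrightarrow>
     (\<forall>g\<in>C. \<forall>h\<in>C. \<forall>t\<in>{0..1}. (\<lambda>x. (1 - t) * g x + t * h x) \<in> C)"

definition pathwise_quotient ::
    "(('x \<Rightarrow> real) \<Rightarrow> real) \<Rightarrow> ('x \<Rightarrow> real) \<Rightarrow> ('x \<Rightarrow> real) \<Rightarrow> real \<Rightarrow> real" where
  "pathwise_quotient f h v \<tau> = (f (\<lambda>x. h x + \<tau> * v x) - f h) / \<tau>"

definition pathwise_deriv ::
    "(('x \<Rightarrow> real) \<Rightarrow> real) \<Rightarrow> ('x \<Rightarrow> real) \<Rightarrow> ('x \<Rightarrow> real) \<Rightarrow> real" where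
  "pathwise_deriv f h v = Lim (at_right 0) (pathwise_quotient f h v)"

definition pathwise_linear_on ::
    "('x \<Rightarrow> real) set \<Rightarrow> (('x \<Rightarrow> real) \<Rightarrow> real) \<Rightarrow> ('x \<Rightarrow> real) \<Rightarrow> bool" where
  "pathwise_linear_on L f h \<longleftrightarrow>
     (\<forall>v\<in>L. \<exists>l. (pathwise_quotient f h v \<longlongrightarrow> l) (at_right 0)) \<and>
     (\<forall>u\<in>L. \<forall>v\<in>L. \<forall>a c. pathwise_deriv f h (\<lambda>x. a * u x + c * v x) =
        a * pathwise_deriv f h u + c * pathwise_deriv f h v)"


subsection \<open>Series regression\<close>

text \<open>\<open>b\<^sub>w\<^sup>K\<close>\<close>

definition sieve_vec ::
    "(nat \<Rightarrow> nat \<Rightarrow> 'x \<Rightarrow> real) \<Rightarrow> (nat \<Rightarrow> 'x set) \<Rightarrow> nat \<Rightarrow> nat \<Rightarrow> 'x \<Rightarrow> real vec" where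
  "sieve_vec b D K n x = vec K (\<lambda>k. b K k x * indicator (D n) x)"

text \<open>Below, \<open>p\<close> stands for a \<open>K\<close>-vector of functions, such as \<open>b\<^sub>w\<^sup>K\<close>.\<close>

definition fun_span :: "nat \<Rightarrow> ('x \<Rightarrow> real vec) \<Rightarrow> ('x \<Rightarrow> real) set" where
  "fun_span K p = {\<lambda>x. c \<bullet> p x | c. c \<in> carrier_vec K}"

text \<open>\<open>E[Z p(X\<^sub>0) p(X\<^sub>0)']\<close>\<close>

definition weighted_gram ::
    "'w measure \<Rightarrow> ('w \<Rightarrow> real) \<Rightarrow> ('w \<Rightarrow> 'x) \<Rightarrow> nat \<Rightarrow> ('x \<Rightarrow> real vec) \<Rightarrow> real mat" where
  "weighted_gram M Z X0 K p =
     mat K K (\<lambda>(j, k). \<integral>\<omega>. Z \<omega> * (p (X0 \<omega>) $ j * p (X0 \<omega>) $ k) \<partial>M)"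

abbreviation gram ::
    "'w measure \<Rightarrow> ('w \<Rightarrow> 'x) \<Rightarrow> nat \<Rightarrow> ('x \<Rightarrow> real vec) \<Rightarrow> real mat" where
  "gram M X0 K p \<equiv> weighted_gram M (\<lambda>_. 1) X0 K p"

text \<open>\<open>n\<^sup>-\<^sup>1 \<Sum>\<^sub>i Z\<^sub>i p(X\<^sub>i) p(X\<^sub>i)'\<close>\<close>

definition weighted_sample_gram ::
    "(int \<Rightarrow> 'w \<Rightarrow> real) \<Rightarrow> (int \<Rightarrow> 'w \<Rightarrow> 'x) \<Rightarrow> nat \<Rightarrow> ('x \<Rightarrow> real vec) \<Rightarrow> nat \<Rightarrow> 'w \<Rightarrow> real mat" where
  "weighted_sample_gram Z X K p n \<omega> =
     mat K K (\<lambda>(j, k). (\<Sum>i = 1..int n. Z i \<omega> * (p (X i \<omega>) $ j * p (X i \<omega>) $ k)) / real n)"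

definition normalized_vec ::
    "'w measure \<Rightarrow> ('w \<Rightarrow> 'x) \<Rightarrow> nat \<Rightarrow> ('x \<Rightarrow> real vec) \<Rightarrow> 'x \<Rightarrow> real vec" where
  "normalized_vec M X0 K p x = mat_inv_sqrt (gram M X0 K p) *\<^sub>v p x"

definition design_mat ::
    "(int \<Rightarrow> 'w \<Rightarrow> 'x) \<Rightarrow> nat \<Rightarrow> ('x \<Rightarrow> real vec) \<Rightarrow> nat \<Rightarrow> 'w \<Rightarrow> real mat" where
  "design_mat X K p n \<omega> = mat n K (\<lambda>(i, k). p (X (int i + 1) \<omega>) $ k)"

definition sample_vec :: "(int \<Rightarrow> 'w \<Rightarrow> real) \<Rightarrow> nat \<Rightarrow> 'w \<Rightarrow> real vec" where
  "sample_vec Z n \<omega> = vec n (\<lambda>i. Z (int i + 1) \<omega>)"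

text \<open>\<open>x \<mapsto> p(x)' (B'B)\<^sup>- B'Z\<close>: this is \<open>h\<close>-hat for \<open>Z = Y\<close> and \<open>h\<close>-tilde for \<open>Z\<^sub>i = h\<^sub>0(X\<^sub>i)\<close>.\<close>

definition series_ls ::
    "(int \<Rightarrow> 'w \<Rightarrow> 'x) \<Rightarrow> nat \<Rightarrow> ('x \<Rightarrow> real vec) \<Rightarrow> (int \<Rightarrow> 'w \<Rightarrow> real) \<Rightarrow> nat \<Rightarrow> 'w \<Rightarrow> 'x \<Rightarrow> real"
  where
  "series_ls X K p Z n \<omega> x =
     (let B = design_mat X K p n \<omega> in
      p x \<bullet> (moore_penrose (transpose_mat B * B) *\<^sub>v (transpose_mat B *\<^sub>v sample_vec Z n \<omega>)))"

definition riesz_representer ::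
    "'w measure \<Rightarrow> ('w \<Rightarrow> 'x) \<Rightarrow> (('x \<Rightarrow> real) \<Rightarrow> real) \<Rightarrow> ('x \<Rightarrow> real) set \<Rightarrow> 'x \<Rightarrow> real" where
  "riesz_representer M X0 F V =
     (THE v. v \<in> V \<and> (\<forall>u\<in>V. F u = (\<integral>\<omega>. v (X0 \<omega>) * u (X0 \<omega>) \<partial>M)))"

definition zeta :: "'x set \<Rightarrow> ('x \<Rightarrow> real vec) \<Rightarrow> real" where
  "zeta \<X> p = (SUP x\<in>\<X>. vec_norm2 (p x))"

definition lambda_factor ::
    "'w measure \<Rightarrow> ('w \<Rightarrow> 'x) \<Rightarrow> nat \<Rightarrow> ('x \<Rightarrow> real vec) \<Rightarrow> real" where
  "lambda_factor M X0 K p = lambda_min (gram M X0 K p) powr (- 1 / 2)"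

end

theory Submission
  imports Defs
begin

text \<open>The functional is linearized at \<open>h0\<close>.  Along the difference of the two estimators, which lies in the
sieve space, its derivative is an inner product with the sieve Riesz representer.  In the
orthonormalized basis \<open>q\<close> the representer is \<open>x \<mapsto> c \<bullet> q x\<close> for a vector \<open>c\<close> of length
\<open>\<parallel>v\<parallel>\<close>, its \<open>L\<^sup>2\<close> norm.  With \<open>\<gamma> = c / \<parallel>v\<parallel>\<close>, and \<open>G\<close> the sample Gram matrix of \<open>q\<close>, the linear
part of the standardized estimation error is the noise sum \<open>n\<^sup>-\<^sup>1\<^sup>/\<^sup>2 \<Sum>\<^sub>i \<epsilon>\<^sub>i (\<gamma> \<bullet> q X\<^sub>i)\<close>, divided by its
standard deviation, plus a residual that comes from replacing \<open>G\<^sup>-\<^sup>1 \<gamma>\<close> by \<open>\<gamma>\<close>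
(\<open>series_difference_linear_part\<close>).  The remaining terms are the linearization error and the bias of
the noiseless estimator, which vanish by assumption.

The residual.  For independent observations the weights \<open>(G\<^sup>-\<^sup>1 \<gamma> - \<gamma>) \<bullet> q X\<^sub>i\<close> are functions of the
regressors.  Given these the noise terms are uncorrelated, so the second moment of the residual is
of the order of the squared Gram deviation (\<open>residual_iid\<close>).  Under dependence the residual is
bounded by Cauchy-Schwarz against the \<open>K\<close> noise sums with the components of \<open>q\<close>, which costs a factor
\<open>K\<^sup>1\<^sup>/\<^sup>2\<close>; this is where the rate \<open>K\<^sup>-\<^sup>1\<^sup>/\<^sup>2\<close> for the Gram deviation enters (\<open>residual_mds\<close>).

The Gram deviation.  For independent observations the growth condition on \<open>K\<close> makes it small
(\<open>gram_concentration_iid\<close>).  Exchanging an observation for an independent copy gives a recursion for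
the expected traces of its powers (\<open>moment_recursion\<close>), and moments of an order proportional to
\<open>ln K\<close> bound the spectral norm (\<open>spectral_norm_tail\<close>).

The noise sum is normal in the limit by McLeish's argument (\<open>martingale_clt\<close>), which needs that no
single term is large and that the sum of squares tends to one.  Put \<open>z x = (\<gamma> \<bullet> q x)\<^sup>2 / n\<close>.  The sum
of the \<open>z X\<^sub>i\<close> is close to one because \<open>G\<close> is close to the identity.  If one of them exceeded a
constant with non-vanishing probability, then by stationarity and mixing this would happen in many
separated blocks of the sample at once, and the sum would be large (\<open>max_small_bound\<close>).  So the
Lindeberg condition holds for \<open>z X\<^sub>i\<close> (\<open>lindeberg_of_mixing\<close>), and by the uniform tail condition on
the noise also for \<open>\<epsilon>\<^sub>i\<^sup>2 z X\<^sub>i\<close> (\<open>lindeberg_noise\<close>).  The sum of squares is then controlled by a weak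
law for independent rows (\<open>wlln_triangular_iid\<close>), or directly by the assumption on the weighted Gram
matrix.\<close>

section \<open>Real symmetric matrices\<close>

lemma scalar_prod_sum:
  assumes "y \<in> carrier_vec n"
  shows "x \<bullet> y = (\<Sum>i<n. x $ i * y $ i)"
  using assms by (simp add: scalar_prod_def lessThan_atLeast0)

lemma mult_mat_vec_sum:
  assumes "A \<in> carrier_mat n m" "x \<in> carrier_vec m" "i < n"
  shows "(A *\<^sub>v x) $ i = (\<Sum>j<m. A $$ (i, j) * x $ j)"
  using assms by (simp add: scalar_prod_def lessThan_atLeast0)

lemma mult_mat_sum:
  assumes "A \<in> carrier_mat n m" "B \<in> carrier_mat m k" "i < n" "j < k"
  shows "(A * B) $$ (i, j) = (\<Sum>l<m. A $$ (i, l) * B $$ (l, j))"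
  using assms by (simp add: scalar_prod_def lessThan_atLeast0)

lemma quadratic_form_sum:
  fixes A :: "real mat"
  assumes "A \<in> carrier_mat n m" "x \<in> carrier_vec n" "y \<in> carrier_vec m"
  shows "x \<bullet> (A *\<^sub>v y) = (\<Sum>i<n. \<Sum>j<m. A $$ (i, j) * (x $ i * y $ j))"
proof -
  have "x \<bullet> (A *\<^sub>v y) = (\<Sum>i<n. x $ i * (A *\<^sub>v y) $ i)"
    using assms by (intro scalar_prod_sum) auto
  also have "\<dots> = (\<Sum>i<n. \<Sum>j<m. A $$ (i, j) * (x $ i * y $ j))"
    using assms
    by (intro sum.cong refl) (simp add: mult_mat_vec_sum[of A n m] sum_distrib_left mult.assoc mult.left_commute del: index_mult_mat_vec)
  finally show ?thesis .
qed

lemma symmetric_mat_move: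
  fixes A :: "real mat"
  assumes "A \<in> carrier_mat n n" "transpose_mat A = A" "x \<in> carrier_vec n" "y \<in> carrier_vec n"
  shows "(A *\<^sub>v x) \<bullet> y = x \<bullet> (A *\<^sub>v y)"
  using transpose_vec_mult_scalar[of A n n y x] assms by simp

lemma vec_norm2_square: "(vec_norm2 v)\<^sup>2 = v \<bullet> v"
  unfolding vec_norm2_def by (simp add: scalar_prod_def sum_nonneg)

lemma vec_norm2_nonneg [simp]: "0 \<le> vec_norm2 v"
  unfolding vec_norm2_def by (simp add: scalar_prod_def sum_nonneg)

lemma scalar_prod_self_nonneg [simp]: "0 \<le> v \<bullet> (v :: real vec)"
  by (simp add: scalar_prod_def sum_nonneg)

lemma vec_norm2_eq_L2_set:
  assumes "v \<in> carrier_vec n"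
  shows "vec_norm2 v = L2_set (\<lambda>i. v $ i) {..<n}"
  using assms by (simp add: vec_norm2_def L2_set_def scalar_prod_sum[of v n] power2_eq_square)

lemma scalar_prod_cauchy_schwarz:
  assumes "u \<in> carrier_vec n" "v \<in> carrier_vec n"
  shows "\<bar>u \<bullet> v\<bar> \<le> vec_norm2 u * vec_norm2 v"
proof -
  have "\<bar>u \<bullet> v\<bar> \<le> (\<Sum>i<n. \<bar>u $ i\<bar> * \<bar>v $ i\<bar>)"
    using assms by (simp add: scalar_prod_sum[of v n] abs_mult[symmetric] sum_abs)
  also have "\<dots> \<le> vec_norm2 u * vec_norm2 v"
    using assms L2_set_mult_ineq[of "\<lambda>i. u $ i" "\<lambda>i. v $ i" "{..<n}"]
    by (simp add: vec_norm2_eq_L2_set[of _ n])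
  finally show ?thesis .
qed

lemma vec_norm2_add_le:
  assumes "u \<in> carrier_vec n" "v \<in> carrier_vec n"
  shows "vec_norm2 (u + v) \<le> vec_norm2 u + vec_norm2 v"
  using assms L2_set_triangle_ineq[of "\<lambda>i. u $ i" "\<lambda>i. v $ i" "{..<n}"]
  by (simp add: vec_norm2_eq_L2_set[of _ n] L2_set_def)

lemma vec_norm2_smult: "vec_norm2 (c \<cdot>\<^sub>v v) = \<bar>c\<bar> * vec_norm2 v"
proof -
  have "(c \<cdot>\<^sub>v v) \<bullet> (c \<cdot>\<^sub>v v) = c\<^sup>2 * (v \<bullet> v)"
    by (simp add: scalar_prod_def sum_distrib_left power2_eq_square mult_ac)
  then show ?thesis
    unfolding vec_norm2_def by (simp add: real_sqrt_mult)
qed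

lemma scalar_prod_self_eq_0:
  assumes "v \<in> carrier_vec n" "v \<bullet> v = (0::real)"
  shows "v = 0\<^sub>v n"
proof (rule eq_vecI)
  fix i assume "i < dim_vec (0\<^sub>v n :: real vec)"
  then have i: "i < n" by simp
  have "(\<Sum>i<n. v $ i * v $ i) = 0"
    using assms by (simp add: scalar_prod_sum[of v n])
  then have "v $ i * v $ i = 0"
    using i by (subst (asm) sum_nonneg_eq_0_iff) auto
  then show "v $ i = 0\<^sub>v n $ i" using i by simp
qed (use assms in auto)

lemma vec_norm2_pos:
  assumes "v \<in> carrier_vec n" "v \<noteq> 0\<^sub>v n"
  shows "vec_norm2 v > 0" "v \<bullet> v > 0"
proof -
  show "v \<bullet> v > 0"
    using scalar_prod_self_eq_0[OF assms(1)] assms(2) scalar_prod_self_nonneg[of v] by linarith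
  then show "vec_norm2 v > 0" by (simp add: vec_norm2_def)
qed

lemma quadratic_form_bounded:
  fixes A :: "real mat"
  assumes A: "A \<in> carrier_mat n n"
  shows "\<exists>c>0. \<forall>x\<in>carrier_vec n. \<bar>x \<bullet> (A *\<^sub>v x)\<bar> \<le> c * (x \<bullet> (x :: real vec))"
proof (intro exI conjI ballI)
  let ?c = "(\<Sum>i<n. \<Sum>j<n. \<bar>A $$ (i, j)\<bar>) + 1"
  show "?c > 0" by (simp add: sum_nonneg add_nonneg_pos)
  fix x :: "real vec" assume x: "x \<in> carrier_vec n"
  have comp: "\<bar>x $ i\<bar> \<le> vec_norm2 x" if "i < n" for i
    using that x member_le_L2_set[of "{..<n}" i "\<lambda>i. \<bar>x $ i\<bar>"]
    by (simp add: vec_norm2_eq_L2_set[of _ n] L2_set_def)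
  have "\<bar>x \<bullet> (A *\<^sub>v x)\<bar> \<le> (\<Sum>i<n. \<Sum>j<n. \<bar>A $$ (i, j) * (x $ i * x $ j)\<bar>)"
    unfolding quadratic_form_sum[OF A x x] by (rule order_trans[OF sum_abs sum_mono[OF sum_abs]])
  also have "\<dots> \<le> (\<Sum>i<n. \<Sum>j<n. \<bar>A $$ (i, j)\<bar> * (x \<bullet> x))"
  proof (intro sum_mono)
    fix i j assume ij: "i \<in> {..<n}" "j \<in> {..<n}"
    have "\<bar>x $ i\<bar> * \<bar>x $ j\<bar> \<le> vec_norm2 x * vec_norm2 x"
      using comp ij by (intro mult_mono) auto
    then have "\<bar>x $ i * x $ j\<bar> \<le> x \<bullet> x"
      using vec_norm2_square[of x] by (simp add: abs_mult power2_eq_square)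
    then show "\<bar>A $$ (i, j) * (x $ i * x $ j)\<bar> \<le> \<bar>A $$ (i, j)\<bar> * (x \<bullet> x)"
      unfolding abs_mult[of "A $$ (i, j)"] by (rule mult_left_mono) simp
  qed
  also have "\<dots> \<le> ?c * (x \<bullet> x)"
    by (simp add: sum_distrib_right[symmetric] distrib_right)
  finally show "\<bar>x \<bullet> (A *\<^sub>v x)\<bar> \<le> ?c * (x \<bullet> x)" .
qed

lemma mult_mat_vec_bounded:
  fixes A :: "real mat"
  assumes A: "A \<in> carrier_mat m n"
  shows "\<exists>c>0. \<forall>x\<in>carrier_vec n. vec_norm2 (A *\<^sub>v x) \<le> c * vec_norm2 x"
proof -
  obtain c where c: "c > 0"
    "\<And>x. x \<in> carrier_vec n \<Longrightarrow> \<bar>x \<bullet> ((transpose_mat A * A) *\<^sub>v x)\<bar> \<le> c * (x \<bullet> x)"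
    using quadratic_form_bounded[of "transpose_mat A * A" n] A by auto
  have "vec_norm2 (A *\<^sub>v x) \<le> sqrt c * vec_norm2 x" if x: "x \<in> carrier_vec n" for x
  proof -
    have "(A *\<^sub>v x) \<bullet> (A *\<^sub>v x) = x \<bullet> (transpose_mat A *\<^sub>v (A *\<^sub>v x))"
      using A x transpose_vec_mult_scalar[OF A x, of "A *\<^sub>v x"]
      by (simp add: comm_scalar_prod[of x n])
    also have "transpose_mat A *\<^sub>v (A *\<^sub>v x) = (transpose_mat A * A) *\<^sub>v x"
      using A x by simp
    also have "x \<bullet> \<dots> \<le> c * (x \<bullet> x)" using c(2)[OF x] by linarith
    finally show ?thesis
      by (simp add: vec_norm2_def real_sqrt_mult[symmetric])
  qed
  then show ?thesis using c(1) by (intro exI[of _ "sqrt c"]) auto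
qed

lemma spectral_norm_bdd_above:
  assumes A: "A \<in> carrier_mat m n"
  shows "bdd_above {vec_norm2 (A *\<^sub>v v) | v. v \<in> carrier_vec (dim_col A) \<and> vec_norm2 v \<le> 1}"
proof -
  obtain c where c: "c > 0" "\<And>x. x \<in> carrier_vec n \<Longrightarrow> vec_norm2 (A *\<^sub>v x) \<le> c * vec_norm2 x"
    using mult_mat_vec_bounded[OF A] by auto
  show ?thesis
  proof (rule bdd_aboveI[of _ c])
    fix y assume "y \<in> {vec_norm2 (A *\<^sub>v v) | v. v \<in> carrier_vec (dim_col A) \<and> vec_norm2 v \<le> 1}"
    then obtain v where v: "y = vec_norm2 (A *\<^sub>v v)" "v \<in> carrier_vec n" "vec_norm2 v \<le> 1"
      using A by auto
    show "y \<le> c"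
      using c(2)[OF v(2)] v(1,3) c(1) mult_left_mono[OF v(3), of c] by linarith
  qed
qed

lemma vec_norm2_mult_le_spectral_norm:
  assumes A: "A \<in> carrier_mat m n" and x: "x \<in> carrier_vec n"
  shows "vec_norm2 (A *\<^sub>v x) \<le> spectral_norm A * vec_norm2 x"
proof (cases "x = 0\<^sub>v n")
  case True
  then show ?thesis using A by (simp add: vec_norm2_def scalar_prod_def)
next
  case False
  let ?r = "vec_norm2 x"
  have r: "?r > 0" using vec_norm2_pos[OF x False] by simp
  define v where "v = (1 / ?r) \<cdot>\<^sub>v x"
  have v: "v \<in> carrier_vec n" "vec_norm2 v \<le> 1" using x r by (auto simp: v_def vec_norm2_smult)
  have "vec_norm2 (A *\<^sub>v v) \<le> spectral_norm A"
    unfolding spectral_norm_def using v A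
    by (intro cSup_upper spectral_norm_bdd_above[OF A]) auto
  moreover have "A *\<^sub>v v = (1 / ?r) \<cdot>\<^sub>v (A *\<^sub>v x)"
    unfolding v_def using A x by (simp add: mult_mat_vec)
  ultimately show ?thesis using r by (simp add: vec_norm2_smult field_simps)
qed

lemma spectral_norm_le:
  assumes A: "A \<in> carrier_mat m n"
    and le: "\<And>x. x \<in> carrier_vec n \<Longrightarrow> vec_norm2 (A *\<^sub>v x) \<le> c * vec_norm2 x" and c: "0 \<le> c"
  shows "spectral_norm A \<le> c"
  unfolding spectral_norm_def
proof (rule cSup_least)
  have "vec_norm2 (A *\<^sub>v 0\<^sub>v n) \<in> {vec_norm2 (A *\<^sub>v v) | v. v \<in> carrier_vec (dim_col A) \<and> vec_norm2 v \<le> 1}"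
    using A by (auto intro!: exI[of _ "0\<^sub>v n"] simp: vec_norm2_def)
  then show "{vec_norm2 (A *\<^sub>v v) | v. v \<in> carrier_vec (dim_col A) \<and> vec_norm2 v \<le> 1} \<noteq> {}" by blast
  fix y assume "y \<in> {vec_norm2 (A *\<^sub>v v) | v. v \<in> carrier_vec (dim_col A) \<and> vec_norm2 v \<le> 1}"
  then obtain v where v: "y = vec_norm2 (A *\<^sub>v v)" "v \<in> carrier_vec n" "vec_norm2 v \<le> 1"
    using A by auto
  show "y \<le> c" using le[OF v(2)] v mult_left_mono[OF v(3) c] by linarith
qed

lemma spectral_norm_nonneg:
  assumes A: "A \<in> carrier_mat m n"
  shows "0 \<le> spectral_norm A"
proof -
  have "vec_norm2 (A *\<^sub>v 0\<^sub>v n) \<le> spectral_norm A"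
    unfolding spectral_norm_def using A
    by (intro cSup_upper spectral_norm_bdd_above[OF A]) (auto intro!: exI[of _ "0\<^sub>v n"] simp: vec_norm2_def)
  then show ?thesis using vec_norm2_nonneg order_trans by blast
qed

text \<open>The quadratic form of a positive semidefinite \<open>C\<close> controls \<open>C x\<close> itself: evaluate the form
  at \<open>x - t C x\<close> with a small \<open>t\<close>.\<close>

lemma psd_quadratic_form_dominates:
  fixes C :: "real mat"
  assumes C: "C \<in> carrier_mat n n" and sym: "transpose_mat C = C"
    and psd: "\<And>x. x \<in> carrier_vec n \<Longrightarrow> 0 \<le> x \<bullet> (C *\<^sub>v x)"
  shows "\<exists>c>0. \<forall>x\<in>carrier_vec n. (C *\<^sub>v x) \<bullet> (C *\<^sub>v x) \<le> c * (x \<bullet> (C *\<^sub>v x))"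
proof -
  obtain c where c: "c > 0" "\<And>x. x \<in> carrier_vec n \<Longrightarrow> \<bar>x \<bullet> (C *\<^sub>v x)\<bar> \<le> c * (x \<bullet> x)"
    using quadratic_form_bounded[OF C] by auto
  have "(C *\<^sub>v x) \<bullet> (C *\<^sub>v x) \<le> c * (x \<bullet> (C *\<^sub>v x))" if x: "x \<in> carrier_vec n" for x
  proof -
    define y where "y = C *\<^sub>v x"
    have y: "y \<in> carrier_vec n" unfolding y_def using mult_mat_vec_carrier[OF C x] .
    have Cy: "C *\<^sub>v y \<in> carrier_vec n" using mult_mat_vec_carrier[OF C y] .
    define z where "z = x + (- 1 / c) \<cdot>\<^sub>v y"
    have z: "z \<in> carrier_vec n" unfolding z_def using x y by simp
    have Cz: "C *\<^sub>v z = y + (- 1 / c) \<cdot>\<^sub>v (C *\<^sub>v y)"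
      unfolding z_def using C x y by (simp add: mult_add_distrib_mat_vec[OF C] mult_mat_vec[OF C] y_def[symmetric])
    have xCy: "x \<bullet> (C *\<^sub>v y) = y \<bullet> y"
      using symmetric_mat_move[OF C sym x y] by (simp add: y_def)
    have "z \<bullet> (C *\<^sub>v z) = x \<bullet> y + (- 1 / c) * (y \<bullet> y) + (- 1 / c) * (y \<bullet> y + (- 1 / c) * (y \<bullet> (C *\<^sub>v y)))"
      unfolding Cz unfolding z_def using x y Cy
      by (simp add: add_scalar_prod_distrib[of _ n] scalar_prod_add_distrib[of _ n] xCy diff_divide_distrib)
    then have "0 \<le> x \<bullet> y - 2 / c * (y \<bullet> y) + (1 / c\<^sup>2) * (y \<bullet> (C *\<^sub>v y))"
      using psd[OF z] by (simp add: power2_eq_square diff_divide_distrib add_divide_distrib)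
    also have "(1 / c\<^sup>2) * (y \<bullet> (C *\<^sub>v y)) \<le> (1 / c\<^sup>2) * (c * (y \<bullet> y))"
      using c(2)[OF y] by (intro mult_left_mono) auto
    finally show ?thesis
      using c(1) by (simp add: y_def[symmetric] power2_eq_square field_simps)
  qed
  then show ?thesis using c(1) by blast
qed

lemma det_nonzero_inverse:
  fixes A :: "real mat"
  assumes A: "A \<in> carrier_mat n n" and "det A \<noteq> 0"
  shows "(1 / det A) \<cdot>\<^sub>m adj_mat A \<in> carrier_mat n n"
    "A * ((1 / det A) \<cdot>\<^sub>m adj_mat A) = 1\<^sub>m n" "((1 / det A) \<cdot>\<^sub>m adj_mat A) * A = 1\<^sub>m n"
proof -
  note adj = adj_mat[OF A]
  show "(1 / det A) \<cdot>\<^sub>m adj_mat A \<in> carrier_mat n n" using adj by simp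
  have one: "(1 / det A) \<cdot>\<^sub>m (det A \<cdot>\<^sub>m 1\<^sub>m n) = (1\<^sub>m n :: real mat)"
    using assms(2) by (intro eq_matI) auto
  show "A * ((1 / det A) \<cdot>\<^sub>m adj_mat A) = 1\<^sub>m n"
    using adj A one by (simp add: mult_smult_distrib[of _ n n _ n])
  show "((1 / det A) \<cdot>\<^sub>m adj_mat A) * A = 1\<^sub>m n"
    using adj A one by (simp add: mult_smult_assoc_mat[of _ n n _ n])
qed

text \<open>The infimum of the Rayleigh quotient is an eigenvalue: shifted by it the matrix stays positive
  semidefinite, and an invertible positive semidefinite matrix has a quadratic form bounded away
  from \<open>0\<close> on the unit sphere.\<close>

lemma symmetric_mat_least_eigenvalue:
  fixes B :: "real mat"
  assumes B: "B \<in> carrier_mat n n" and sym: "transpose_mat B = B" and n: "n \<ge> 1"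
  shows "\<exists>s v. v \<in> carrier_vec n \<and> v \<noteq> 0\<^sub>v n \<and> B *\<^sub>v v = s \<cdot>\<^sub>v v \<and>
    (\<forall>x\<in>carrier_vec n. s * (x \<bullet> x) \<le> x \<bullet> (B *\<^sub>v x))"
proof -
  let ?S = "{x \<bullet> (B *\<^sub>v x) | x. x \<in> carrier_vec n \<and> x \<bullet> x = 1}"
  define s where "s = Inf ?S"
  obtain c where c: "c > 0" "\<And>x. x \<in> carrier_vec n \<Longrightarrow> \<bar>x \<bullet> (B *\<^sub>v x)\<bar> \<le> c * (x \<bullet> x)"
    using quadratic_form_bounded[OF B] by auto
  have bdd: "bdd_below ?S"
    by (rule bdd_belowI[of _ "- c"]) (use c(2) in fastforce)
  have "unit_vec n 0 \<in> carrier_vec n" "unit_vec n 0 \<bullet> unit_vec n 0 = (1 :: real)"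
    using n by auto
  then have ne: "?S \<noteq> {}" by blast
  have low: "s * (x \<bullet> x) \<le> x \<bullet> (B *\<^sub>v x)" if x: "x \<in> carrier_vec n" for x
  proof (cases "x = 0\<^sub>v n")
    case True
    then show ?thesis using B by simp
  next
    case False
    let ?r = "vec_norm2 x"
    have r: "?r > 0" using vec_norm2_pos[OF x False] by simp
    have rr: "?r * ?r = x \<bullet> x" using vec_norm2_square[of x] by (simp add: power2_eq_square)
    define v where "v = (1 / ?r) \<cdot>\<^sub>v x"
    have v: "v \<in> carrier_vec n" using x by (simp add: v_def)
    have "v \<bullet> v = (1 / ?r) * ((1 / ?r) * (x \<bullet> x))" unfolding v_def using x by simp
    then have v1: "v \<bullet> v = 1" using rr r vec_norm2_pos[OF x False] by (simp add: field_simps)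
    have "s \<le> v \<bullet> (B *\<^sub>v v)" unfolding s_def by (rule cInf_lower[OF _ bdd]) (use v v1 in auto)
    also have "v \<bullet> (B *\<^sub>v v) = (1 / ?r) * ((1 / ?r) * (x \<bullet> (B *\<^sub>v x)))"
    proof -
      have "B *\<^sub>v v = (1 / ?r) \<cdot>\<^sub>v (B *\<^sub>v x)" unfolding v_def by (rule mult_mat_vec[OF B x])
      moreover have "B *\<^sub>v x \<in> carrier_vec n" using mult_mat_vec_carrier[OF B x] .
      ultimately show ?thesis unfolding v_def using x by simp
    qed
    also have "\<dots> = x \<bullet> (B *\<^sub>v x) / (x \<bullet> x)" using rr by (simp add: field_simps)
    finally show ?thesis using vec_norm2_pos[OF x False] by (simp add: field_simps)
  qed
  define C where "C = B + (- s) \<cdot>\<^sub>m 1\<^sub>m n"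
  have C: "C \<in> carrier_mat n n" unfolding C_def using B by simp
  have Cx: "C *\<^sub>v x = B *\<^sub>v x + (- s) \<cdot>\<^sub>v x" if x: "x \<in> carrier_vec n" for x
  proof -
    have "((- s) \<cdot>\<^sub>m 1\<^sub>m n) *\<^sub>v x = (- s) \<cdot>\<^sub>v x"
      using x by (intro eq_vecI) auto
    then show ?thesis
      unfolding C_def using B x by (subst add_mult_distrib_mat_vec[of _ n n]) auto
  qed
  have Csym: "transpose_mat C = C"
    unfolding C_def using B sym by (subst transpose_add[of _ n n]) (auto intro!: eq_matI)
  have qC: "x \<bullet> (C *\<^sub>v x) = x \<bullet> (B *\<^sub>v x) - s * (x \<bullet> x)" if x: "x \<in> carrier_vec n" for x
    unfolding Cx[OF x] using x B by (subst scalar_prod_add_distrib[of _ n]) auto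
  obtain d where d: "d > 0" "\<And>x. x \<in> carrier_vec n \<Longrightarrow> (C *\<^sub>v x) \<bullet> (C *\<^sub>v x) \<le> d * (x \<bullet> (C *\<^sub>v x))"
    using psd_quadratic_form_dominates[OF C Csym] low qC by force
  have "det C = 0"
  proof (rule ccontr)
    assume "det C \<noteq> 0"
    from det_nonzero_inverse[OF C this] obtain Q where Q: "Q \<in> carrier_mat n n" "Q * C = 1\<^sub>m n" by blast
    obtain e where e: "e > 0" "\<And>x. x \<in> carrier_vec n \<Longrightarrow> vec_norm2 (Q *\<^sub>v x) \<le> e * vec_norm2 x"
      using mult_mat_vec_bounded[OF Q(1)] by auto
    have "s + 1 / (e\<^sup>2 * d) \<le> Inf ?S"
    proof (rule cInf_greatest[OF ne])
      fix y assume "y \<in> ?S"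
      then obtain x where x: "x \<in> carrier_vec n" "x \<bullet> x = 1" "y = x \<bullet> (B *\<^sub>v x)" by blast
      have "Q *\<^sub>v (C *\<^sub>v x) = x" using Q C x by (metis assoc_mult_mat_vec one_mult_mat_vec)
      then have "vec_norm2 x \<le> e * vec_norm2 (C *\<^sub>v x)" using e(2)[OF mult_mat_vec_carrier[OF C x(1)]] by simp
      then have "(vec_norm2 x)\<^sup>2 \<le> (e * vec_norm2 (C *\<^sub>v x))\<^sup>2" by (intro power_mono) auto
      then have "1 \<le> e\<^sup>2 * ((C *\<^sub>v x) \<bullet> (C *\<^sub>v x))"
        by (simp add: power_mult_distrib vec_norm2_square x)
      also have "\<dots> \<le> e\<^sup>2 * (d * (x \<bullet> (C *\<^sub>v x)))" using d(2)[OF x(1)] by (intro mult_left_mono) auto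
      also have "\<dots> = e\<^sup>2 * d * (y - s)" using qC[OF x(1)] x by simp
      finally show "s + 1 / (e\<^sup>2 * d) \<le> y" using e d by (simp add: field_simps)
    qed
    moreover have "0 < e\<^sup>2 * d" using e(1) d(1) by simp
    ultimately show False by (simp add: s_def[symmetric] zero_less_divide_iff not_le)
  qed
  then obtain v where v: "v \<in> carrier_vec n" "v \<noteq> 0\<^sub>v n" "C *\<^sub>v v = 0\<^sub>v n"
    using det_0_iff_vec_prod_zero[OF C] by blast
  have "B *\<^sub>v v = s \<cdot>\<^sub>v v"
  proof (rule eq_vecI)
    fix i assume "i < dim_vec (s \<cdot>\<^sub>v v)"
    then have i: "i < n" using v by simp
    have "(B *\<^sub>v v + (- s) \<cdot>\<^sub>v v) $ i = 0" using v(3) i unfolding Cx[OF v(1)] by simp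
    then show "(B *\<^sub>v v) $ i = (s \<cdot>\<^sub>v v) $ i" using i v(1) B by simp
  qed (use v B in auto)
  then show ?thesis using v low by blast
qed

lemma lambda_min_quadratic_form:
  assumes A: "A \<in> carrier_mat n n" and sym: "transpose_mat A = A" and n: "n \<ge> 1"
    and x: "x \<in> carrier_vec n"
  shows "lambda_min A * (x \<bullet> x) \<le> x \<bullet> (A *\<^sub>v x)"
proof -
  obtain s v where sv: "v \<in> carrier_vec n" "v \<noteq> 0\<^sub>v n" "A *\<^sub>v v = s \<cdot>\<^sub>v v"
    "\<And>x. x \<in> carrier_vec n \<Longrightarrow> s * (x \<bullet> x) \<le> x \<bullet> (A *\<^sub>v x)"
    using symmetric_mat_least_eigenvalue[OF A sym n] by blast
  have "eigenvalue A s" unfolding eigenvalue_def eigenvector_def using sv A by auto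
  moreover have "finite {k. eigenvalue A k}"
    unfolding eigenvalue_root_char_poly[OF A]
    by (rule poly_roots_finite) (use degree_monic_char_poly[OF A] in auto)
  ultimately have "lambda_min A \<le> s" unfolding lambda_min_def by (intro Min_le) auto
  then show ?thesis using sv(4)[OF x] scalar_prod_self_nonneg[of x] mult_right_mono order_trans by blast
qed

text \<open>The least eigenvalues of \<open>B\<close> and of \<open>-B\<close> are both \<open>0\<close>, so the quadratic form of \<open>B\<close> vanishes.\<close>

lemma symmetric_mat_zero_eigenvalues:
  fixes B :: "real mat"
  assumes B: "B \<in> carrier_mat n n" and sym: "transpose_mat B = B"
    and ev: "\<And>v s. v \<in> carrier_vec n \<Longrightarrow> v \<noteq> 0\<^sub>v n \<Longrightarrow> B *\<^sub>v v = s \<cdot>\<^sub>v v \<Longrightarrow> s = 0"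
  shows "B = 0\<^sub>m n n"
proof (cases "n \<ge> 1")
  case True
  have low: "0 \<le> x \<bullet> (B *\<^sub>v x)" if "x \<in> carrier_vec n" for x
    using symmetric_mat_least_eigenvalue[OF B sym True] ev that by fastforce
  have mB: "- B \<in> carrier_mat n n" "transpose_mat (- B) = - B"
    using B sym transpose_uminus[of B] by (auto intro!: eq_matI)
  have neg: "(- B) *\<^sub>v x = - (B *\<^sub>v x)" if "x \<in> carrier_vec n" for x
    using B that by auto
  have up: "0 \<le> x \<bullet> ((- B) *\<^sub>v x)" if x: "x \<in> carrier_vec n" for x
  proof -
    obtain s v where sv: "v \<in> carrier_vec n" "v \<noteq> 0\<^sub>v n" "(- B) *\<^sub>v v = s \<cdot>\<^sub>v v"
      "\<And>x. x \<in> carrier_vec n \<Longrightarrow> s * (x \<bullet> x) \<le> x \<bullet> ((- B) *\<^sub>v x)"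
      using symmetric_mat_least_eigenvalue[OF mB True] by blast
    have "B *\<^sub>v v = (- s) \<cdot>\<^sub>v v"
    proof -
      have "B *\<^sub>v v = - (s \<cdot>\<^sub>v v)" using neg[OF sv(1)] sv(3) by (metis uminus_uminus_vec)
      then show ?thesis by auto
    qed
    then have "- s = 0" using ev[OF sv(1,2)] by blast
    then show ?thesis using sv(4)[OF x] by simp
  qed
  obtain c where c: "\<And>x. x \<in> carrier_vec n \<Longrightarrow> (B *\<^sub>v x) \<bullet> (B *\<^sub>v x) \<le> c * (x \<bullet> (B *\<^sub>v x))"
    using psd_quadratic_form_dominates[OF B sym low] by blast
  have Bx: "B *\<^sub>v x = 0\<^sub>v n" if x: "x \<in> carrier_vec n" for x
  proof (rule scalar_prod_self_eq_0)
    have "x \<bullet> (- (B *\<^sub>v x)) = - (x \<bullet> (B *\<^sub>v x))" using x B by simp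
    then have "x \<bullet> (B *\<^sub>v x) = 0" using low[OF x] up[OF x] neg[OF x] by simp
    then show "(B *\<^sub>v x) \<bullet> (B *\<^sub>v x) = 0"
      using c[OF x] scalar_prod_self_nonneg[of "B *\<^sub>v x"] by simp
    show "B *\<^sub>v x \<in> carrier_vec n" using mult_mat_vec_carrier[OF B x] .
  qed
  show ?thesis
  proof (rule eq_matI)
    fix i j assume "i < dim_row (0\<^sub>m n n :: real mat)" "j < dim_col (0\<^sub>m n n :: real mat)"
    then have ij: "i < n" "j < n" by auto
    have "(B *\<^sub>v unit_vec n j) $ i = 0" using Bx[of "unit_vec n j"] ij by simp
    then show "B $$ (i, j) = 0\<^sub>m n n $$ (i, j)" using ij B by simp
  qed (use B in auto)
next
  case False
  then show ?thesis using B by (intro eq_matI) auto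
qed

text \<open>Deflation: an orthonormal family of eigenvectors with nonzero eigenvalues that cannot be
  extended exhausts the matrix, because an eigenvector of the remainder would be orthogonal to the
  family.  By Bessel's inequality such families have at most \<open>n\<close> members.\<close>

definition outer_sum :: "nat \<Rightarrow> nat \<Rightarrow> (nat \<Rightarrow> real vec) \<Rightarrow> (nat \<Rightarrow> real) \<Rightarrow> real mat" where
  "outer_sum n m u c = mat n n (\<lambda>(a, b). \<Sum>j<m. c j * (u j $ a * u j $ b))"

definition orthonormal_family :: "nat \<Rightarrow> nat \<Rightarrow> (nat \<Rightarrow> real vec) \<Rightarrow> bool" where
  "orthonormal_family n m u \<longleftrightarrow> (\<forall>j<m. u j \<in> carrier_vec n) \<and>
     (\<forall>j<m. \<forall>k<m. u j \<bullet> u k = (if j = k then 1 else 0))"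

lemma outer_sum_carrier [simp]: "outer_sum n m u c \<in> carrier_mat n n"
  and outer_sum_dims [simp]: "dim_row (outer_sum n m u c) = n" "dim_col (outer_sum n m u c) = n"
  by (simp_all add: outer_sum_def)

lemma outer_sum_symmetric: "transpose_mat (outer_sum n m u c) = outer_sum n m u c"
  by (rule eq_matI) (auto simp: outer_sum_def mult_ac)

lemma orthonormal_familyD:
  assumes "orthonormal_family n m u" "j < m" "k < m"
  shows "u j \<in> carrier_vec n" "(\<Sum>a<n. u j $ a * u k $ a) = (if j = k then 1 else 0)"
  using assms by (auto simp: orthonormal_family_def scalar_prod_sum[of _ n, symmetric])

lemma outer_sum_mult_vec:
  assumes u: "\<And>j. j < m \<Longrightarrow> u j \<in> carrier_vec n" and x: "x \<in> carrier_vec n" and a: "a < n"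
  shows "(outer_sum n m u c *\<^sub>v x) $ a = (\<Sum>j<m. c j * (u j \<bullet> x) * u j $ a)"
proof -
  have "(outer_sum n m u c *\<^sub>v x) $ a = (\<Sum>b<n. (\<Sum>j<m. c j * (u j $ a * u j $ b)) * x $ b)"
    using a x by (subst mult_mat_vec_sum[of _ n n]) (auto simp: outer_sum_def)
  also have "\<dots> = (\<Sum>j<m. \<Sum>b<n. c j * (u j $ a * u j $ b) * x $ b)"
    unfolding sum_distrib_right by (rule sum.swap)
  also have "\<dots> = (\<Sum>j<m. c j * (\<Sum>b<n. u j $ b * x $ b) * u j $ a)"
    by (simp add: sum_distrib_left sum_distrib_right mult_ac)
  finally show ?thesis using x by (simp add: scalar_prod_sum[of x n])
qed

lemma outer_sum_mult:
  assumes u: "orthonormal_family n m u"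
  shows "outer_sum n m u c * outer_sum n m u d = outer_sum n m u (\<lambda>j. c j * d j)"
proof (rule eq_matI)
  fix a b assume "a < dim_row (outer_sum n m u (\<lambda>j. c j * d j))" "b < dim_col (outer_sum n m u (\<lambda>j. c j * d j))"
  then have ab: "a < n" "b < n" by auto
  have "(outer_sum n m u c * outer_sum n m u d) $$ (a, b)
      = (\<Sum>l<n. (\<Sum>j<m. c j * (u j $ a * u j $ l)) * (\<Sum>k<m. d k * (u k $ l * u k $ b)))"
    using ab by (subst mult_mat_sum[of _ n n _ n]) (auto simp: outer_sum_def)
  also have "\<dots> = (\<Sum>l<n. \<Sum>j<m. \<Sum>k<m. c j * d k * (u j $ a * u k $ b) * (u j $ l * u k $ l))"
    unfolding sum_product by (intro sum.cong refl) (simp add: mult_ac)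
  also have "\<dots> = (\<Sum>j<m. \<Sum>k<m. \<Sum>l<n. c j * d k * (u j $ a * u k $ b) * (u j $ l * u k $ l))"
    by (subst sum.swap, rule sum.cong[OF refl], rule sum.swap)
  also have "\<dots> = (\<Sum>j<m. \<Sum>k<m. c j * d k * (u j $ a * u k $ b) * (if j = k then 1 else 0))"
    unfolding sum_distrib_left[symmetric]
    by (intro sum.cong refl) (simp add: orthonormal_familyD(2)[OF u])
  also have "\<dots> = (\<Sum>j<m. c j * d j * (u j $ a * u j $ b))"
    by (intro sum.cong refl) (simp add: if_distrib[of "\<lambda>x. _ * x"] cong: if_cong)
  finally show "(outer_sum n m u c * outer_sum n m u d) $$ (a, b) = outer_sum n m u (\<lambda>j. c j * d j) $$ (a, b)"
    using ab by (simp add: outer_sum_def)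
qed auto

lemma orthonormal_family_card_le:
  assumes u: "orthonormal_family n m u"
  shows "m \<le> n"
proof -
  have bessel: "(\<Sum>j<m. u j $ a * u j $ a) \<le> 1" if a: "a < n" for a
  proof -
    let ?P = "outer_sum n m u (\<lambda>_. 1)"
    define p where "p = (\<Sum>j<m. u j $ a * u j $ a)"
    have Paa: "?P $$ (a, a) = p" using a by (simp add: outer_sum_def p_def)
    have "(?P * ?P) $$ (a, a) = p" by (simp add: outer_sum_mult[OF u] Paa)
    moreover have "(?P * ?P) $$ (a, a) = (\<Sum>l<n. ?P $$ (a, l) * ?P $$ (l, a))"
      using a by (subst mult_mat_sum[of _ n n _ n]) auto
    moreover have "\<dots> = (\<Sum>l<n. (?P $$ (a, l))\<^sup>2)"
      using a by (intro sum.cong refl) (auto simp: outer_sum_def power2_eq_square mult_ac)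
    moreover have "p\<^sup>2 \<le> (\<Sum>l<n. (?P $$ (a, l))\<^sup>2)"
      using a member_le_sum[of a "{..<n}" "\<lambda>l. (?P $$ (a, l))\<^sup>2"] by (simp add: Paa)
    ultimately have "p\<^sup>2 \<le> p" by simp
    show ?thesis
    proof (rule ccontr)
      assume "\<not> ?thesis"
      then have "p > 1" by (simp add: p_def)
      then have "p * 1 < p * p" by (intro mult_strict_left_mono) auto
      then show False using \<open>p\<^sup>2 \<le> p\<close> by (simp add: power2_eq_square)
    qed
  qed
  have "real m = (\<Sum>j<m. \<Sum>a<n. u j $ a * u j $ a)"
    by (simp add: orthonormal_familyD(2)[OF u])
  also have "\<dots> = (\<Sum>a<n. \<Sum>j<m. u j $ a * u j $ a)" by (rule sum.swap)
  also have "\<dots> \<le> (\<Sum>a<n. 1)" using bessel by (intro sum_mono) auto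
  finally show ?thesis by simp
qed

lemma symmetric_mat_diagonalization:
  fixes A :: "real mat"
  assumes A: "A \<in> carrier_mat n n" and sym: "transpose_mat A = A"
  shows "\<exists>m u c. orthonormal_family n m u \<and> (\<forall>j<m. A *\<^sub>v u j = c j \<cdot>\<^sub>v u j) \<and> A = outer_sum n m u c"
proof -
  define Q where "Q m \<longleftrightarrow> (\<exists>u c. orthonormal_family n m u \<and>
    (\<forall>j<m. A *\<^sub>v u j = c j \<cdot>\<^sub>v u j))" for m
  have Q0: "Q 0" by (simp add: Q_def orthonormal_family_def)
  have Qle: "m \<le> n" if "Q m" for m
    using that orthonormal_family_card_le by (auto simp: Q_def)
  define m where "m = (GREATEST m. Q m)"
  have Qm: "Q m" unfolding m_def by (rule GreatestI_nat[where P=Q, OF Q0]) (use Qle in auto)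
  have maxi: "k \<le> m" if "Q k" for k unfolding m_def by (rule Greatest_le_nat[where P=Q, OF that]) (use Qle in auto)
  from Qm obtain u c where u: "orthonormal_family n m u" and ev: "\<And>j. j < m \<Longrightarrow> A *\<^sub>v u j = c j \<cdot>\<^sub>v u j"
    by (auto simp: Q_def)
  note uc = orthonormal_familyD(1)[OF u]
  define B where "B = A - outer_sum n m u c"
  have B: "B \<in> carrier_mat n n" unfolding B_def by (rule minus_carrier_mat) simp
  have Bsym: "transpose_mat B = B"
  proof (rule eq_matI)
    fix i j assume "i < dim_row B" "j < dim_col B"
    then have ij: "i < n" "j < n" using B by auto
    have "A $$ (j, i) = A $$ (i, j)" using arg_cong[OF sym, of "\<lambda>M. M $$ (i, j)"] ij A by simp
    then show "transpose_mat B $$ (i, j) = B $$ (i, j)"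
      using ij A by (simp add: B_def outer_sum_def mult_ac)
  qed (use B in auto)
  have Bx: "B *\<^sub>v x = A *\<^sub>v x - outer_sum n m u c *\<^sub>v x" if "x \<in> carrier_vec n" for x
    unfolding B_def using A that by (intro minus_mult_distrib_mat_vec) auto
  have Bu: "B *\<^sub>v u k = 0\<^sub>v n" if k: "k < m" for k
  proof (rule eq_vecI)
    fix a assume "a < dim_vec (0\<^sub>v n :: real vec)"
    then have a: "a < n" by simp
    have "(outer_sum n m u c *\<^sub>v u k) $ a = (\<Sum>j<m. c j * (u j \<bullet> u k) * u j $ a)"
      using outer_sum_mult_vec[OF _ uc[OF k k] a] uc by blast
    also have "\<dots> = (\<Sum>j<m. if j = k then c k * u k $ a else 0)"
      using u k by (intro sum.cong refl) (auto simp: orthonormal_family_def)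
    also have "\<dots> = c k * u k $ a" using k by (simp add: sum.delta)
    finally show "(B *\<^sub>v u k) $ a = 0\<^sub>v n $ a"
      using ev[OF k] a uc[OF k k] by (simp add: Bx[OF uc[OF k k]] del: index_mult_mat_vec)
  qed (use B in auto)
  have "B = 0\<^sub>m n n"
  proof (rule symmetric_mat_zero_eigenvalues[OF B Bsym], rule ccontr)
    fix v s assume v: "v \<in> carrier_vec n" "v \<noteq> 0\<^sub>v n" and vs: "B *\<^sub>v v = s \<cdot>\<^sub>v v" and s: "s \<noteq> 0"
    have orth: "u k \<bullet> v = 0" if k: "k < m" for k
    proof -
      have "s * (v \<bullet> u k) = (B *\<^sub>v v) \<bullet> u k" using vs v uc[OF k k] by simp
      also have "\<dots> = v \<bullet> (B *\<^sub>v u k)" by (rule symmetric_mat_move[OF B Bsym v(1) uc[OF k k]])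
      also have "\<dots> = 0" using Bu[OF k] v by simp
      finally show ?thesis using s comm_scalar_prod[OF v(1) uc[OF k k]] by simp
    qed
    have "outer_sum n m u c *\<^sub>v v = 0\<^sub>v n"
    proof (rule eq_vecI)
      fix a assume "a < dim_vec (0\<^sub>v n :: real vec)"
      then have a: "a < n" by simp
      show "(outer_sum n m u c *\<^sub>v v) $ a = 0\<^sub>v n $ a"
        using outer_sum_mult_vec[OF _ v(1) a] uc orth a by (simp del: index_mult_mat_vec)
    qed auto
    then have Av: "A *\<^sub>v v = s \<cdot>\<^sub>v v" using Bx[OF v(1)] vs mult_mat_vec_carrier[OF A v(1)] by simp
    let ?r = "vec_norm2 v"
    have r: "?r > 0" by (rule vec_norm2_pos[OF v])
    define w where "w = (1 / ?r) \<cdot>\<^sub>v v"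
    have w: "w \<in> carrier_vec n" unfolding w_def using v by simp
    have "w \<bullet> w = (1 / ?r) * ((1 / ?r) * (v \<bullet> v))" unfolding w_def using v by simp
    then have ww: "w \<bullet> w = 1" using r vec_norm2_pos(2)[OF v] vec_norm2_square[of v] by (simp add: power2_eq_square)
    have Aw: "A *\<^sub>v w = s \<cdot>\<^sub>v w" unfolding w_def
      using mult_mat_vec[OF A v(1), of "1 / ?r"] Av by (simp add: smult_smult_assoc mult.commute)
    have wu: "u k \<bullet> w = 0" "w \<bullet> u k = 0" if k: "k < m" for k
    proof -
      show "u k \<bullet> w = 0" unfolding w_def using orth[OF k] v uc[OF k k] by simp
      then show "w \<bullet> u k = 0" using comm_scalar_prod[OF w uc[OF k k]] by simp
    qed
    have "orthonormal_family n (Suc m) (u(m := w))"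
      using u w ww wu by (auto simp: orthonormal_family_def less_Suc_eq)
    moreover have "\<forall>j<Suc m. A *\<^sub>v (u(m := w)) j = (c(m := s)) j \<cdot>\<^sub>v (u(m := w)) j"
      using ev Aw by (auto simp: less_Suc_eq)
    ultimately have "Q (Suc m)" unfolding Q_def by blast
    then show False using maxi by force
  qed
  then have "A = outer_sum n m u c"
  proof -
    have "A $$ (i, j) = outer_sum n m u c $$ (i, j)" if "i < n" "j < n" for i j
      using arg_cong[OF \<open>B = 0\<^sub>m n n\<close>, of "\<lambda>M. M $$ (i, j)"] that A by (simp add: B_def)
    then show ?thesis using A by (intro eq_matI) auto
  qed
  then show ?thesis using u ev by blast
qed

text \<open>Invert the eigenvalues and take their roots in the spectral decomposition.\<close>

lemma inv_sqrt_exists: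
  fixes A :: "real mat"
  assumes A: "A \<in> carrier_mat n n" and sym: "transpose_mat A = A"
    and pd: "\<And>x. x \<in> carrier_vec n \<Longrightarrow> x \<noteq> 0\<^sub>v n \<Longrightarrow> 0 < x \<bullet> (A *\<^sub>v x)"
  shows "\<exists>R. R \<in> carrier_mat n n \<and> transpose_mat R = R \<and> (\<forall>v\<in>carrier_vec n. 0 \<le> v \<bullet> (R *\<^sub>v v)) \<and>
    R * R * A = 1\<^sub>m n"
proof -
  obtain m u c where u: "orthonormal_family n m u" and ev: "\<And>j. j < m \<Longrightarrow> A *\<^sub>v u j = c j \<cdot>\<^sub>v u j"
    and Au: "A = outer_sum n m u c"
    using symmetric_mat_diagonalization[OF A sym] by blast
  note uc = orthonormal_familyD(1)[OF u]
  have cpos: "c j > 0" if j: "j < m" for j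
  proof -
    have uj: "u j \<in> carrier_vec n" "u j \<bullet> u j = 1" using u j by (auto simp: orthonormal_family_def)
    then have "u j \<noteq> 0\<^sub>v n" by auto
    then have "0 < u j \<bullet> (A *\<^sub>v u j)" by (rule pd[OF uj(1)])
    then show ?thesis using ev[OF j] uj by simp
  qed
  let ?P = "outer_sum n m u (\<lambda>_. 1)"
  have P1: "?P = 1\<^sub>m n"
  proof -
    have AP: "A * ?P = A" unfolding Au using outer_sum_mult[OF u, of c "\<lambda>_. 1"] by simp
    have zero: "col (?P - 1\<^sub>m n) j = 0\<^sub>v n" if j: "j < n" for j
    proof (rule ccontr)
      assume nz: "col (?P - 1\<^sub>m n) j \<noteq> 0\<^sub>v n"
      have cc: "col (?P - 1\<^sub>m n) j \<in> carrier_vec n" by (rule carrier_vecI) simp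
      have "A * (?P - 1\<^sub>m n) = 0\<^sub>m n n"
        using A AP by (subst mult_minus_distrib_mat[of _ n n _ n]) auto
      then have "A *\<^sub>v col (?P - 1\<^sub>m n) j = 0\<^sub>v n"
        using A j col_mult2[of A n n "?P - 1\<^sub>m n" n j] by (simp add: minus_carrier_mat)
      then show False using pd[OF cc nz] cc by simp
    qed
    show ?thesis
    proof (rule eq_matI)
      fix i j assume "i < dim_row (1\<^sub>m n :: real mat)" "j < dim_col (1\<^sub>m n :: real mat)"
      then have ij: "i < n" "j < n" by auto
      have "col (?P - 1\<^sub>m n) j $ i = 0" using zero[OF ij(2)] ij by simp
      then show "?P $$ (i, j) = 1\<^sub>m n $$ (i, j)" using ij by simp
    qed auto
  qed
  let ?R = "outer_sum n m u (\<lambda>j. 1 / sqrt (c j))"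
  have "?R * ?R * A = outer_sum n m u (\<lambda>j. 1 / sqrt (c j) * (1 / sqrt (c j)) * c j)"
    unfolding Au by (simp add: outer_sum_mult[OF u])
  also have "\<dots> = ?P"
  proof -
    have "1 / sqrt (c j) * (1 / sqrt (c j)) * c j = 1" if "j < m" for j
      using cpos[OF that] by simp
    then show ?thesis unfolding outer_sum_def by (intro eq_matI) (auto intro!: sum.cong)
  qed
  finally have RRA: "?R * ?R * A = 1\<^sub>m n" using P1 by simp
  have "0 \<le> v \<bullet> (?R *\<^sub>v v)" if v: "v \<in> carrier_vec n" for v
  proof -
    have "v \<bullet> (?R *\<^sub>v v) = (\<Sum>a<n. v $ a * (\<Sum>j<m. 1 / sqrt (c j) * (u j \<bullet> v) * u j $ a))"
      unfolding scalar_prod_sum[OF mult_mat_vec_carrier[OF outer_sum_carrier v]]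
      using uc v by (intro sum.cong refl) (simp add: outer_sum_mult_vec del: index_mult_mat_vec)
    also have "\<dots> = (\<Sum>j<m. \<Sum>a<n. v $ a * (1 / sqrt (c j) * (u j \<bullet> v) * u j $ a))"
      unfolding sum_distrib_left by (rule sum.swap)
    also have "\<dots> = (\<Sum>j<m. 1 / sqrt (c j) * (u j \<bullet> v)\<^sup>2)"
    proof (intro sum.cong refl)
      fix j assume "j \<in> {..<m}"
      have "(\<Sum>a<n. v $ a * (1 / sqrt (c j) * (u j \<bullet> v) * u j $ a))
          = 1 / sqrt (c j) * (u j \<bullet> v) * (\<Sum>a<n. u j $ a * v $ a)"
        by (simp add: sum_distrib_left mult_ac)
      also have "\<dots> = 1 / sqrt (c j) * (u j \<bullet> v)\<^sup>2"
        using v by (simp add: scalar_prod_sum[of v n, symmetric] power2_eq_square)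
      finally show "(\<Sum>a<n. v $ a * (1 / sqrt (c j) * (u j \<bullet> v) * u j $ a)) = 1 / sqrt (c j) * (u j \<bullet> v)\<^sup>2" .
    qed
    also have "\<dots> \<ge> 0" using cpos by (intro sum_nonneg) (auto simp: less_imp_le)
    finally show ?thesis .
  qed
  then show ?thesis using RRA by (intro exI[of _ ?R]) (auto simp: outer_sum_symmetric)
qed

text \<open>If \<open>R\<close> and \<open>S\<close> are positive semidefinite with equal squares and \<open>v\<close> is an eigenvector of
  \<open>R - S\<close> for \<open>s\<close>, then \<open>0 = |R v|\<^sup>2 - |S v|\<^sup>2 = s (v'R v + v'S v)\<close>, which forces \<open>s = 0\<close>.\<close>

lemma psd_sqrt_unique:
  fixes R S :: "real mat"
  assumes R: "R \<in> carrier_mat n n" "transpose_mat R = R" "\<And>v. v \<in> carrier_vec n \<Longrightarrow> 0 \<le> v \<bullet> (R *\<^sub>v v)"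
    and S: "S \<in> carrier_mat n n" "transpose_mat S = S" "\<And>v. v \<in> carrier_vec n \<Longrightarrow> 0 \<le> v \<bullet> (S *\<^sub>v v)"
    and eq: "R * R = S * S"
  shows "R = S"
proof -
  have D: "R - S \<in> carrier_mat n n" by (rule minus_carrier_mat[OF S(1)])
  have "R - S = 0\<^sub>m n n"
  proof (rule symmetric_mat_zero_eigenvalues[OF D])
    show "transpose_mat (R - S) = R - S"
      using R S transpose_minus[of R n n S] by simp
    fix v s assume v: "v \<in> carrier_vec n" "v \<noteq> 0\<^sub>v n" and vs: "(R - S) *\<^sub>v v = s \<cdot>\<^sub>v v"
    have Rv: "R *\<^sub>v v \<in> carrier_vec n" and Sv: "S *\<^sub>v v \<in> carrier_vec n"
      using R S v mult_mat_vec_carrier by blast+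
    have d: "R *\<^sub>v v - S *\<^sub>v v = s \<cdot>\<^sub>v v"
      using vs minus_mult_distrib_mat_vec[OF R(1) S(1) v(1)] by simp
    have sq: "(R *\<^sub>v v) \<bullet> (R *\<^sub>v v) = (S *\<^sub>v v) \<bullet> (S *\<^sub>v v)"
    proof -
      have "(R *\<^sub>v v) \<bullet> (R *\<^sub>v v) = v \<bullet> ((R * R) *\<^sub>v v)"
        using symmetric_mat_move[OF R(1,2) v(1) Rv] R v by (simp add: assoc_mult_mat_vec[of _ n n _ n])
      moreover have "(S *\<^sub>v v) \<bullet> (S *\<^sub>v v) = v \<bullet> ((S * S) *\<^sub>v v)"
        using symmetric_mat_move[OF S(1,2) v(1) Sv] S v by (simp add: assoc_mult_mat_vec[of _ n n _ n])
      ultimately show ?thesis using eq by simp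
    qed
    have "s * (v \<bullet> (R *\<^sub>v v) + v \<bullet> (S *\<^sub>v v)) = (s \<cdot>\<^sub>v v) \<bullet> (R *\<^sub>v v) + (s \<cdot>\<^sub>v v) \<bullet> (S *\<^sub>v v)"
      using v Rv Sv by (simp add: distrib_left)
    also have "\<dots> = 0"
      unfolding d[symmetric] using Rv Sv sq comm_scalar_prod[OF Rv Sv]
      by (simp add: minus_scalar_prod_distrib[of _ n])
    finally have "s = 0 \<or> v \<bullet> (R *\<^sub>v v) + v \<bullet> (S *\<^sub>v v) = 0" by simp
    then show "s = 0"
    proof
      assume "v \<bullet> (R *\<^sub>v v) + v \<bullet> (S *\<^sub>v v) = 0"
      then have "v \<bullet> (R *\<^sub>v v) = 0" "v \<bullet> (S *\<^sub>v v) = 0"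
        using R(3)[OF v(1)] S(3)[OF v(1)] by linarith+
      then have "v \<bullet> (s \<cdot>\<^sub>v v) = 0"
        unfolding d[symmetric] using v Rv Sv by (simp add: scalar_prod_minus_distrib[of _ n])
      then show "s = 0" using v vec_norm2_pos(2)[OF v] by simp
    qed
  qed
  have "R $$ (i, j) = S $$ (i, j)" if "i < n" "j < n" for i j
    using arg_cong[OF \<open>R - S = 0\<^sub>m n n\<close>, of "\<lambda>M. M $$ (i, j)"] that R(1) S(1) by auto
  then show ?thesis using R S by (intro eq_matI) auto
qed

lemma mat_inv_sqrt_properties:
  fixes A :: "real mat"
  assumes A: "A \<in> carrier_mat n n" and sym: "transpose_mat A = A" and n: "n \<ge> 1"
    and pos: "lambda_min A > 0"
  defines "W \<equiv> mat_inv_sqrt A"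
  shows "W \<in> carrier_mat n n" "transpose_mat W = W" "W * W * A = 1\<^sub>m n" "W * A * W = 1\<^sub>m n"
proof -
  have pd: "0 < x \<bullet> (A *\<^sub>v x)" if x: "x \<in> carrier_vec n" "x \<noteq> 0\<^sub>v n" for x
    using lambda_min_quadratic_form[OF A sym n x(1)] mult_pos_pos[OF pos vec_norm2_pos(2)[OF x]] by linarith
  obtain R where R: "R \<in> carrier_mat n n" "transpose_mat R = R"
    "\<And>v. v \<in> carrier_vec n \<Longrightarrow> 0 \<le> v \<bullet> (R *\<^sub>v v)" "R * R * A = 1\<^sub>m n"
    using inv_sqrt_exists[OF A sym pd] by blast
  have RR: "R * R \<in> carrier_mat n n" using R(1) by simp
  have ARR: "A * (R * R) = 1\<^sub>m n" by (rule mat_mult_left_right_inverse[OF RR A R(4)])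
  have "W = R" unfolding W_def mat_inv_sqrt_def
  proof (rule the_equality)
    show "R \<in> carrier_mat (dim_row A) (dim_row A) \<and> transpose_mat R = R \<and>
      (\<forall>v\<in>carrier_vec (dim_row A). 0 \<le> v \<bullet> (R *\<^sub>v v)) \<and> inverts_mat (R * R) A \<and> inverts_mat A (R * R)"
      using R A ARR by (auto simp: inverts_mat_def)
    fix S assume "S \<in> carrier_mat (dim_row A) (dim_row A) \<and> transpose_mat S = S \<and>
      (\<forall>v\<in>carrier_vec (dim_row A). 0 \<le> v \<bullet> (S *\<^sub>v v)) \<and> inverts_mat (S * S) A \<and> inverts_mat A (S * S)"
    then have S: "S \<in> carrier_mat n n" "transpose_mat S = S"
      "\<And>v. v \<in> carrier_vec n \<Longrightarrow> 0 \<le> v \<bullet> (S *\<^sub>v v)" "S * S * A = 1\<^sub>m n"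
      using A by (auto simp: inverts_mat_def)
    have SS: "S * S \<in> carrier_mat n n" using S(1) by simp
    have "S * S = S * S * (A * (R * R))" using right_mult_one_mat[OF SS] by (simp only: ARR)
    also have "\<dots> = S * S * A * (R * R)" by (rule assoc_mult_mat[OF SS A RR, symmetric])
    also have "\<dots> = R * R" using left_mult_one_mat[OF RR] by (simp only: S(4))
    finally show "S = R" using psd_sqrt_unique[OF S(1,2) _ R(1,2)] S(3) R(3) by blast
  qed
  then show W: "W \<in> carrier_mat n n" "transpose_mat W = W" "W * W * A = 1\<^sub>m n" using R(1,2,4) by simp_all
  have "W * (W * A) = 1\<^sub>m n" using assoc_mult_mat[OF W(1) W(1) A] W(3) by simp
  then show "W * A * W = 1\<^sub>m n"
    using W A by (intro mat_mult_left_right_inverse[of W n "W * A"]) auto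
qed

text \<open>The square of the left-hand side is the quadratic form of the inverse of \<open>A\<close>, whose largest
  eigenvalue is the reciprocal of the least eigenvalue of \<open>A\<close>.\<close>

lemma mat_inv_sqrt_vec_norm2_le:
  fixes A :: "real mat"
  assumes A: "A \<in> carrier_mat n n" and sym: "transpose_mat A = A" and n: "n \<ge> 1"
    and pos: "lambda_min A > 0" and x: "x \<in> carrier_vec n"
  shows "vec_norm2 (mat_inv_sqrt A *\<^sub>v x) \<le> vec_norm2 x * lambda_min A powr (- 1 / 2)"
proof -
  let ?W = "mat_inv_sqrt A"
  note W = mat_inv_sqrt_properties[OF A sym n pos]
  define y where "y = ?W *\<^sub>v x"
  have y: "y \<in> carrier_vec n" unfolding y_def using mult_mat_vec_carrier[OF W(1) x] .
  have "y \<bullet> (A *\<^sub>v y) = x \<bullet> (?W *\<^sub>v (A *\<^sub>v y))"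
    using symmetric_mat_move[OF W(1,2) x mult_mat_vec_carrier[OF A y]] by (simp add: y_def)
  also have "?W *\<^sub>v (A *\<^sub>v y) = (?W * A * ?W) *\<^sub>v x"
    unfolding y_def using W(1) A x by (simp add: assoc_mult_mat_vec[of _ n n _ n])
  also have "\<dots> = x" using W(4) x by simp
  finally have "lambda_min A * (y \<bullet> y) \<le> x \<bullet> x" using lambda_min_quadratic_form[OF A sym n y] by simp
  then have "y \<bullet> y \<le> (x \<bullet> x) / lambda_min A" using pos by (simp add: field_simps)
  then have "vec_norm2 y \<le> vec_norm2 x / sqrt (lambda_min A)"
    unfolding vec_norm2_def real_sqrt_divide[symmetric] by simp
  also have "\<dots> = vec_norm2 x * lambda_min A powr (- 1 / 2)"
    using pos powr_minus_divide[of "lambda_min A" "1 / 2"] powr_half_sqrt[of "lambda_min A"] by simp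
  finally show ?thesis by (simp add: y_def)
qed

lemma moore_penrose_of_invertible:
  fixes A :: "real mat"
  assumes A: "A \<in> carrier_mat n n" and Q: "Q \<in> carrier_mat n n" and AQ: "A * Q = 1\<^sub>m n"
  shows "moore_penrose A = Q"
  unfolding moore_penrose_def
proof (rule the_equality)
  have QA: "Q * A = 1\<^sub>m n" by (rule mat_mult_left_right_inverse[OF A Q AQ])
  show "Q \<in> carrier_mat (dim_col A) (dim_row A) \<and> A * Q * A = A \<and> Q * A * Q = Q \<and>
    transpose_mat (A * Q) = A * Q \<and> transpose_mat (Q * A) = Q * A"
    using A Q AQ QA by auto
  fix P assume "P \<in> carrier_mat (dim_col A) (dim_row A) \<and> A * P * A = A \<and> P * A * P = P \<and>
    transpose_mat (A * P) = A * P \<and> transpose_mat (P * A) = P * A"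
  then have P: "P \<in> carrier_mat n n" "A * P * A = A" using A by auto
  have "Q * (A * P * A) * Q = (Q * A) * P * (A * Q)"
    using A P(1) Q by (simp add: assoc_mult_mat[of _ n n _ n _ n])
  then show "P = Q" using P A Q QA AQ by simp
qed

text \<open>Each claim compares \<open>G v\<close> with \<open>v\<close>: the norm of the difference is at most \<open>r\<close> times the norm of
  \<open>v\<close>, and \<open>r \<le> 1 / 2\<close>.\<close>

lemma near_identity_solution:
  fixes G :: "real mat"
  assumes G: "G \<in> carrier_mat n n" and dev: "spectral_norm (G - 1\<^sub>m n) \<le> r" and r: "r \<le> 1 / 2"
  shows "det G \<noteq> 0"
    "\<And>u g. u \<in> carrier_vec n \<Longrightarrow> g \<in> carrier_vec n \<Longrightarrow> G *\<^sub>v u = g \<Longrightarrow> vec_norm2 (u - g) \<le> 2 * r * vec_norm2 g"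
    "\<And>w. w \<in> carrier_vec n \<Longrightarrow> w \<bullet> (G *\<^sub>v w) \<le> 2 * (w \<bullet> w)"
proof -
  define E where "E = G - 1\<^sub>m n"
  have E: "E \<in> carrier_mat n n" unfolding E_def by (rule minus_carrier_mat) simp
  have Ex: "E *\<^sub>v x = G *\<^sub>v x - x" if "x \<in> carrier_vec n" for x
    unfolding E_def using G that by (subst minus_mult_distrib_mat_vec[of _ n n]) auto
  have Gc: "G *\<^sub>v x \<in> carrier_vec n" if "x \<in> carrier_vec n" for x using mult_mat_vec_carrier[OF G that] .
  have dev': "vec_norm2 (G *\<^sub>v x - x) \<le> r * vec_norm2 x" if x: "x \<in> carrier_vec n" for x
    using vec_norm2_mult_le_spectral_norm[OF E x] dev mult_right_mono[OF dev, of "vec_norm2 x"]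
    by (simp add: Ex[OF x] E_def[symmetric])
  have norm_le: "vec_norm2 u \<le> 2 * vec_norm2 (G *\<^sub>v u)" if u: "u \<in> carrier_vec n" for u
  proof -
    have "u = G *\<^sub>v u + (-1) \<cdot>\<^sub>v (G *\<^sub>v u - u)" using u Gc[OF u] by (intro eq_vecI) auto
    then have "vec_norm2 u \<le> vec_norm2 (G *\<^sub>v u) + vec_norm2 ((-1) \<cdot>\<^sub>v (G *\<^sub>v u - u))"
      using vec_norm2_add_le[of "G *\<^sub>v u" n "(-1) \<cdot>\<^sub>v (G *\<^sub>v u - u)"] u Gc[OF u] by simp
    also have "vec_norm2 ((-1) \<cdot>\<^sub>v (G *\<^sub>v u - u)) \<le> r * vec_norm2 u"
      using dev'[OF u] by (simp add: vec_norm2_smult)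
    also have "\<dots> \<le> 1 / 2 * vec_norm2 u" using r by (intro mult_right_mono) auto
    finally show ?thesis by simp
  qed
  show "det G \<noteq> 0"
  proof
    assume "det G = 0"
    then obtain v where v: "v \<in> carrier_vec n" "v \<noteq> 0\<^sub>v n" "G *\<^sub>v v = 0\<^sub>v n"
      using det_0_iff_vec_prod_zero[OF G] by blast
    then show False using norm_le[OF v(1)] vec_norm2_pos(1)[OF v(1,2)] by (simp add: vec_norm2_def)
  qed
  show "vec_norm2 (u - g) \<le> 2 * r * vec_norm2 g"
    if u: "u \<in> carrier_vec n" and g: "g \<in> carrier_vec n" and Gu: "G *\<^sub>v u = g" for u g
  proof -
    have r0: "0 \<le> r" using dev spectral_norm_nonneg[OF E] by (simp add: E_def)
    have "u - g = (-1) \<cdot>\<^sub>v (g - u)" using u g by (intro eq_vecI) auto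
    then have "vec_norm2 (u - g) = vec_norm2 (g - u)" by (simp add: vec_norm2_smult)
    also have "\<dots> \<le> r * vec_norm2 u" using dev'[OF u] Gu by simp
    also have "\<dots> \<le> r * (2 * vec_norm2 g)" using norm_le[OF u] Gu r0 by (intro mult_left_mono) auto
    finally show ?thesis by simp
  qed
  show "w \<bullet> (G *\<^sub>v w) \<le> 2 * (w \<bullet> w)" if w: "w \<in> carrier_vec n" for w
  proof -
    have "w \<bullet> (G *\<^sub>v w) = w \<bullet> w + w \<bullet> (G *\<^sub>v w - w)"
      using w Gc[OF w] by (simp add: scalar_prod_minus_distrib[of _ n])
    also have "w \<bullet> (G *\<^sub>v w - w) \<le> vec_norm2 w * vec_norm2 (G *\<^sub>v w - w)"
      using scalar_prod_cauchy_schwarz[OF w, of "G *\<^sub>v w - w"] w Gc[OF w] by simp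
    also have "\<dots> \<le> vec_norm2 w * (1 * vec_norm2 w)"
      using dev'[OF w] r by (intro mult_left_mono order_trans[OF dev'[OF w]] mult_right_mono) auto
    also have "\<dots> = w \<bullet> w" using vec_norm2_square[of w] by (simp add: power2_eq_square)
    finally show ?thesis by simp
  qed
qed

section \<open>A trace inequality for powers of symmetric matrices\<close>

definition mat_trace :: "real mat \<Rightarrow> real" where
  "mat_trace A = (\<Sum>i<dim_row A. A $$ (i, i))"

lemma mat_trace_mult_sum:
  assumes "A \<in> carrier_mat n m" "B \<in> carrier_mat m n"
  shows "mat_trace (A * B) = (\<Sum>i<n. \<Sum>j<m. A $$ (i, j) * B $$ (j, i))"
proof -
  have "mat_trace (A * B) = (\<Sum>i<n. (A * B) $$ (i, i))" using assms by (simp add: mat_trace_def)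
  also have "\<dots> = (\<Sum>i<n. \<Sum>j<m. A $$ (i, j) * B $$ (j, i))"
    using mult_mat_sum[OF assms] by (intro sum.cong refl) blast
  finally show ?thesis .
qed

lemma mat_trace_mult_commute:
  assumes "A \<in> carrier_mat n m" "B \<in> carrier_mat m n"
  shows "mat_trace (A * B) = mat_trace (B * A)"
  unfolding mat_trace_mult_sum[OF assms] mat_trace_mult_sum[OF assms(2,1)]
  by (subst sum.swap) (simp add: mult.commute)

lemma mat_trace_minus:
  assumes "A \<in> carrier_mat n n" "B \<in> carrier_mat n n"
  shows "mat_trace (A - B) = mat_trace A - mat_trace B"
  using assms by (simp add: mat_trace_def sum_subtractf)

lemma mat_trace_transpose_mult_sum:
  assumes "A \<in> carrier_mat n m" "B \<in> carrier_mat n m"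
  shows "mat_trace (transpose_mat A * B) = (\<Sum>i<m. \<Sum>j<n. A $$ (j, i) * B $$ (j, i))"
proof -
  have "mat_trace (transpose_mat A * B) = (\<Sum>i<m. \<Sum>j<n. transpose_mat A $$ (i, j) * B $$ (j, i))"
    using assms by (intro mat_trace_mult_sum) auto
  also have "\<dots> = (\<Sum>i<m. \<Sum>j<n. A $$ (j, i) * B $$ (j, i))"
    using assms by (intro sum.cong refl) auto
  finally show ?thesis .
qed

lemma mat_trace_transpose_self_nonneg: "A \<in> carrier_mat n m \<Longrightarrow> 0 \<le> mat_trace (transpose_mat A * A)"
  by (simp add: mat_trace_transpose_mult_sum[of A n m] sum_nonneg)

text \<open>The inequality \<open>2 a b \<le> a\<^sup>2 + b\<^sup>2\<close> for the Hilbert-Schmidt inner product \<open>tr(A'B)\<close>.\<close>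

lemma mat_trace_arith_geo:
  assumes A: "A \<in> carrier_mat n m" and B: "B \<in> carrier_mat n m"
  shows "mat_trace (transpose_mat A * B) \<le> (mat_trace (transpose_mat A * A) + mat_trace (transpose_mat B * B)) / 2"
proof -
  have "mat_trace (transpose_mat A * B) \<le> (\<Sum>i<m. \<Sum>j<n. (A $$ (j, i) * A $$ (j, i) + B $$ (j, i) * B $$ (j, i)) / 2)"
    unfolding mat_trace_transpose_mult_sum[OF A B]
  proof (intro sum_mono)
    fix i j
    show "A $$ (j, i) * B $$ (j, i) \<le> (A $$ (j, i) * A $$ (j, i) + B $$ (j, i) * B $$ (j, i)) / 2"
      using sum_squares_bound[of "A $$ (j, i)" "B $$ (j, i)"] by (simp add: power2_eq_square)
  qed
  also have "\<dots> = (mat_trace (transpose_mat A * A) + mat_trace (transpose_mat B * B)) / 2"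
    unfolding mat_trace_transpose_mult_sum[OF A A] mat_trace_transpose_mult_sum[OF B B]
    by (simp add: sum.distrib sum_divide_distrib[symmetric])
  finally show ?thesis .
qed

lemma pow_mat_add:
  fixes A :: "real mat"
  assumes A: "A \<in> carrier_mat n n"
  shows "A ^\<^sub>m (i + j) = A ^\<^sub>m i * A ^\<^sub>m j"
proof (induction j)
  case 0
  have "A ^\<^sub>m i * 1\<^sub>m n = A ^\<^sub>m i" by (rule right_mult_one_mat[of _ n n]) (simp add: A)
  then show ?case using A by simp
next
  case (Suc j)
  have "A ^\<^sub>m (i + Suc j) = (A ^\<^sub>m i * A ^\<^sub>m j) * A" using Suc by simp
  also have "\<dots> = A ^\<^sub>m i * (A ^\<^sub>m j * A)"
    using A by (intro assoc_mult_mat[of _ n n _ n _ n]) auto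
  finally show ?case by simp
qed

lemma pow_mat_symmetric:
  fixes A :: "real mat"
  assumes A: "A \<in> carrier_mat n n" and sym: "transpose_mat A = A"
  shows "transpose_mat (A ^\<^sub>m k) = A ^\<^sub>m k"
proof (induction k)
  case 0
  then show ?case by simp
next
  case (Suc k)
  have "transpose_mat (A ^\<^sub>m k * A) = A * A ^\<^sub>m k"
    using transpose_mult[of "A ^\<^sub>m k" n n A n] A Suc sym by simp
  also have "\<dots> = A ^\<^sub>m 1 * A ^\<^sub>m k" using A by simp
  also have "\<dots> = A ^\<^sub>m (k + 1)" using pow_mat_add[OF A, of 1 k] by (simp add: add.commute)
  finally show ?case by simp
qed

lemma mat_trace_pow_even:
  fixes A :: "real mat"
  assumes A: "A \<in> carrier_mat n n" and sym: "transpose_mat A = A"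
  shows "mat_trace (A ^\<^sub>m (i + j)) = mat_trace (transpose_mat (A ^\<^sub>m i) * A ^\<^sub>m j)"
  by (simp add: pow_mat_symmetric[OF A sym] pow_mat_add[OF A])

text \<open>By convexity \<open>a\<^sub>j + a\<^sub>s\<^sub>-\<^sub>j \<le> a\<^sub>0 + a\<^sub>s\<close>; add these inequalities.\<close>

lemma midpoint_convex_sum_le:
  fixes a :: "nat \<Rightarrow> real"
  assumes conv: "\<And>j. 1 \<le> j \<Longrightarrow> j < s \<Longrightarrow> a j \<le> (a (j - 1) + a (j + 1)) / 2"
  shows "(\<Sum>j\<le>s. a j) \<le> (real s + 1) / 2 * (a 0 + a s)"
proof -
  have incr: "a (i + 1) - a i \<le> a (i + d + 1) - a (i + d)" if "i + d < s" for i d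
    using that
  proof (induction d)
    case (Suc d)
    then show ?case using conv[of "i + d + 1"] by simp
  qed simp
  have half: "a j + a (s - j) \<le> a 0 + a s" if "2 * j \<le> s" for j
    using that
  proof (induction j)
    case (Suc j)
    then have "j + (s - 2 * j - 1) < s" "j + (s - 2 * j - 1) = s - j - 1" "s - j - 1 + 1 = s - j" by auto
    then have "a (j + 1) - a j \<le> a (s - j) - a (s - j - 1)"
      using incr[of j "s - 2 * j - 1"] by simp
    then show ?case using Suc by simp
  qed simp
  have pair: "a j + a (s - j) \<le> a 0 + a s" if "j \<le> s" for j
    using half[of j] half[of "s - j"] that by (cases "2 * j \<le> s") (auto simp: add.commute)
  have "(\<Sum>j\<le>s. a j) = (\<Sum>j\<le>s. a (s - j))"
    using sum.nat_diff_reindex[of a "Suc s"] by (simp add: lessThan_Suc_atMost)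
  then have "2 * (\<Sum>j\<le>s. a j) = (\<Sum>j\<le>s. a j + a (s - j))" by (simp add: sum.distrib)
  also have "\<dots> \<le> (\<Sum>j\<le>s. a 0 + a s)" using pair by (intro sum_mono) auto
  finally show ?thesis by (simp add: field_simps)
qed

text \<open>Put \<open>\<phi>(q) = tr(D H\<^sup>q D Y\<^sup>2\<^sup>s\<^sup>-\<^sup>q)\<close>.  With \<open>A\<^sub>j = H\<^sup>j D Y\<^sup>s\<^sup>-\<^sup>j\<close> one has
  \<open>\<phi>(i + j) = tr(A\<^sub>i' A\<^sub>j)\<close>, so the arithmetic-geometric mean inequality makes the even values of
  \<open>\<phi>\<close> midpoint convex and bounds each odd value by the mean of its neighbours.  The power
  difference telescopes into \<open>\<Sum>\<^sub>q \<phi>(q)\<close>, which therefore is at most the number of terms times the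
  mean of the two end values.\<close>

lemma mat_trace_power_difference_le:
  fixes H Y :: "real mat"
  assumes H: "H \<in> carrier_mat n n" "transpose_mat H = H"
    and Y: "Y \<in> carrier_mat n n" "transpose_mat Y = Y"
  defines "D \<equiv> H - Y"
  shows "mat_trace (D * H ^\<^sub>m (2 * s + 1)) - mat_trace (D * Y ^\<^sub>m (2 * s + 1))
    \<le> (2 * real s + 1) / 2 * (mat_trace (D * D * H ^\<^sub>m (2 * s)) + mat_trace (D * D * Y ^\<^sub>m (2 * s)))"
proof -
  have D: "D \<in> carrier_mat n n" unfolding D_def by (rule minus_carrier_mat[OF Y(1)])
  note [simp] = H(1) Y(1) D mult_carrier_mat[of _ n n _ n] assoc_mult_mat[of _ n n _ n _ n]
    right_mult_one_mat[of _ n n] carrier_matD[OF H(1)] carrier_matD[OF Y(1)]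
  have Dsym: "transpose_mat D = D"
    unfolding D_def using transpose_minus[OF H(1) Y(1)] H Y by simp
  define \<phi> where "\<phi> q = mat_trace (D * H ^\<^sub>m q * D * Y ^\<^sub>m (2 * s - q))" for q
  define A where "A j = H ^\<^sub>m j * D * Y ^\<^sub>m (s - j)" for j
  have Ac: "A j \<in> carrier_mat n n" for j unfolding A_def using H Y D by simp
  have At: "transpose_mat (A j) = Y ^\<^sub>m (s - j) * D * H ^\<^sub>m j" for j
  proof -
    have "transpose_mat (A j) = transpose_mat (Y ^\<^sub>m (s - j)) * transpose_mat (H ^\<^sub>m j * D)"
      unfolding A_def using H Y D by (intro transpose_mult[of _ n n _ n]) auto
    also have "transpose_mat (H ^\<^sub>m j * D) = transpose_mat D * transpose_mat (H ^\<^sub>m j)"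
      using H D by (intro transpose_mult[of _ n n _ n]) auto
    finally show ?thesis
      using H Y D by (simp add: Dsym pow_mat_symmetric[OF H] pow_mat_symmetric[OF Y])
  qed
  have inner: "mat_trace (transpose_mat (A i) * A j) = \<phi> (i + j)" if ij: "i \<le> s" "j \<le> s" for i j
  proof -
    have "transpose_mat (A i) * A j = Y ^\<^sub>m (s - i) * (D * H ^\<^sub>m (i + j) * D * Y ^\<^sub>m (s - j))"
      unfolding At unfolding A_def using H Y D by (simp add: pow_mat_add[OF H(1)])
    then have "mat_trace (transpose_mat (A i) * A j)
        = mat_trace ((D * H ^\<^sub>m (i + j) * D * Y ^\<^sub>m (s - j)) * Y ^\<^sub>m (s - i))"
      using H Y D mat_trace_mult_commute[of "Y ^\<^sub>m (s - i)" n n "D * H ^\<^sub>m (i + j) * D * Y ^\<^sub>m (s - j)"]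
      by simp
    also have "(D * H ^\<^sub>m (i + j) * D * Y ^\<^sub>m (s - j)) * Y ^\<^sub>m (s - i)
        = D * H ^\<^sub>m (i + j) * D * Y ^\<^sub>m ((s - j) + (s - i))"
      using H Y D by (simp add: pow_mat_add[OF Y(1)])
    also have "(s - j) + (s - i) = 2 * s - (i + j)" using ij by simp
    finally show ?thesis by (simp add: \<phi>_def)
  qed
  have ag: "\<phi> (i + j) \<le> (\<phi> (2 * i) + \<phi> (2 * j)) / 2" if ij: "i \<le> s" "j \<le> s" for i j
    using mat_trace_arith_geo[OF Ac Ac, of i j] inner[of i j] inner[of i i] inner[of j j] ij
    by (simp add: mult_2)
  have even: "(\<Sum>j\<le>s. \<phi> (2 * j)) \<le> (real s + 1) / 2 * (\<phi> 0 + \<phi> (2 * s))"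
  proof -
    have "\<phi> (2 * j) \<le> (\<phi> (2 * (j - 1)) + \<phi> (2 * (j + 1))) / 2" if "1 \<le> j" "j < s" for j
      using ag[of "j - 1" "j + 1"] that by (simp add: mult_2)
    from midpoint_convex_sum_le[of s "\<lambda>j. \<phi> (2 * j)", OF this] show ?thesis by simp
  qed
  have odd: "(\<Sum>j<s. \<phi> (2 * j + 1)) \<le> (\<Sum>j\<le>s. \<phi> (2 * j)) - (\<phi> 0 + \<phi> (2 * s)) / 2"
  proof -
    have "(\<Sum>j<s. \<phi> (2 * j + 1)) \<le> (\<Sum>j<s. (\<phi> (2 * j) + \<phi> (2 * Suc j)) / 2)"
    proof (rule sum_mono)
      fix j assume "j \<in> {..<s}"
      then have "\<phi> (j + (j + 1)) \<le> (\<phi> (2 * j) + \<phi> (2 * (j + 1))) / 2"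
        by (intro ag) auto
      moreover have "j + (j + 1) = 2 * j + 1" "j + 1 = Suc j" by simp_all
      ultimately show "\<phi> (2 * j + 1) \<le> (\<phi> (2 * j) + \<phi> (2 * Suc j)) / 2" by metis
    qed
    also have "\<dots> = ((\<Sum>j<s. \<phi> (2 * j)) + (\<Sum>j<s. \<phi> (2 * Suc j))) / 2"
      by (simp add: sum.distrib[symmetric] sum_divide_distrib)
    also have "(\<Sum>j<s. \<phi> (2 * j)) = (\<Sum>j\<le>s. \<phi> (2 * j)) - \<phi> (2 * s)"
      by (simp add: lessThan_Suc_atMost[symmetric])
    also have "(\<Sum>j<s. \<phi> (2 * Suc j)) = (\<Sum>j\<le>s. \<phi> (2 * j)) - \<phi> 0"
      using sum.lessThan_Suc_shift[of "\<lambda>j. \<phi> (2 * j)" s] by (simp add: lessThan_Suc_atMost)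
    finally show ?thesis by (simp add: field_simps)
  qed
  have split: "(\<Sum>q<2 * k + 1. \<phi> q) = (\<Sum>j\<le>k. \<phi> (2 * j)) + (\<Sum>j<k. \<phi> (2 * j + 1))" for k
    by (induction k) auto
  have tele: "mat_trace (D * H ^\<^sub>m (2 * s + 1)) - mat_trace (D * Y ^\<^sub>m (2 * s + 1)) = (\<Sum>q<2 * s + 1. \<phi> q)"
  proof -
    define g where "g q = mat_trace (D * H ^\<^sub>m q * Y ^\<^sub>m (2 * s + 1 - q))" for q
    have "\<phi> q = g (Suc q) - g q" if q: "q < 2 * s + 1" for q
    proof -
      have e: "2 * s + 1 - q = 1 + (2 * s - q)" "2 * s + 1 - Suc q = 2 * s - q" using q by auto
      have "D * H ^\<^sub>m q * D * Y ^\<^sub>m (2 * s - q)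
          = D * H ^\<^sub>m q * H * Y ^\<^sub>m (2 * s - q) - D * H ^\<^sub>m q * Y * Y ^\<^sub>m (2 * s - q)"
      proof -
        have "D * H ^\<^sub>m q * D = D * H ^\<^sub>m q * H - D * H ^\<^sub>m q * Y"
        proof -
          have "D * H ^\<^sub>m q * D = D * H ^\<^sub>m q * (H - Y)" by (simp only: D_def)
          also have "\<dots> = D * H ^\<^sub>m q * H - D * H ^\<^sub>m q * Y"
            by (rule mult_minus_distrib_mat[of _ n n _ n]) simp_all
          finally show ?thesis .
        qed
        then have "D * H ^\<^sub>m q * D * Y ^\<^sub>m (2 * s - q) = (D * H ^\<^sub>m q * H - D * H ^\<^sub>m q * Y) * Y ^\<^sub>m (2 * s - q)"
          by (rule arg_cong)
        also have "\<dots> = D * H ^\<^sub>m q * H * Y ^\<^sub>m (2 * s - q) - D * H ^\<^sub>m q * Y * Y ^\<^sub>m (2 * s - q)"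
          by (rule minus_mult_distrib_mat[of _ n n _ _ n]) simp_all
        finally show ?thesis .
      qed
      moreover have "D * H ^\<^sub>m q * Y * Y ^\<^sub>m (2 * s - q) = D * H ^\<^sub>m q * Y ^\<^sub>m (2 * s + 1 - q)"
        unfolding e pow_mat_add[OF Y(1)] using H Y D by simp
      moreover have "D * H ^\<^sub>m q * H * Y ^\<^sub>m (2 * s - q) = D * H ^\<^sub>m Suc q * Y ^\<^sub>m (2 * s + 1 - Suc q)"
        unfolding e using H Y D by simp
      ultimately show ?thesis
        unfolding \<phi>_def g_def using H(1) Y(1) D
        by (simp add: mat_trace_minus[of _ n] del: pow_mat.simps assoc_mult_mat)
    qed
    then have "(\<Sum>q<2 * s + 1. \<phi> q) = g (2 * s + 1) - g 0"
      by (simp add: sum_lessThan_telescope)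
    moreover have "g (2 * s + 1) = mat_trace (D * H ^\<^sub>m (2 * s + 1))"
    proof -
      have "D * H ^\<^sub>m (2 * s + 1) * 1\<^sub>m n = D * H ^\<^sub>m (2 * s + 1)"
        by (rule right_mult_one_mat[of _ n n]) (simp add: D H del: pow_mat.simps)
      then show ?thesis using Y(1) by (simp add: g_def)
    qed
    moreover have "g 0 = mat_trace (D * Y ^\<^sub>m (2 * s + 1))"
      using right_mult_one_mat[OF D] H(1) by (simp add: g_def)
    ultimately show ?thesis by simp
  qed
  have \<phi>0: "\<phi> 0 = mat_trace (D * D * Y ^\<^sub>m (2 * s))"
    using right_mult_one_mat[OF D] H(1) by (simp add: \<phi>_def)
  have \<phi>2: "\<phi> (2 * s) = mat_trace (D * D * H ^\<^sub>m (2 * s))"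
  proof -
    have "\<phi> (2 * s) = mat_trace (D * H ^\<^sub>m (2 * s) * D)"
    proof -
      have "D * H ^\<^sub>m (2 * s) * D * 1\<^sub>m n = D * H ^\<^sub>m (2 * s) * D"
        by (rule right_mult_one_mat[of _ n n]) (simp add: D H del: pow_mat.simps)
      then show ?thesis using Y(1) by (simp add: \<phi>_def)
    qed
    also have "\<dots> = mat_trace (D * (D * H ^\<^sub>m (2 * s)))"
      using D H by (intro mat_trace_mult_commute[of _ n n]) auto
    also have "D * (D * H ^\<^sub>m (2 * s)) = D * D * H ^\<^sub>m (2 * s)" using D H by simp
    finally show ?thesis .
  qed
  have "(\<Sum>q<2 * s + 1. \<phi> q) \<le> 2 * (\<Sum>j\<le>s. \<phi> (2 * j)) - (\<phi> 0 + \<phi> (2 * s)) / 2"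
    using odd unfolding split by simp
  also have "\<dots> \<le> (2 * real s + 1) / 2 * (\<phi> 0 + \<phi> (2 * s))" using even by (simp add: field_simps)
  finally show ?thesis unfolding tele \<phi>0 \<phi>2 by (simp add: add.commute)
qed

text \<open>The norms \<open>|X\<^sup>k v|\<close> grow at least geometrically with ratio \<open>|X v| / |v|\<close>, since their logarithms
  are convex in \<open>k\<close>.\<close>

lemma spectral_norm_le_of_trace_pow:
  fixes X :: "real mat"
  assumes X: "X \<in> carrier_mat n n" "transpose_mat X = X" and p: "p \<ge> 1" and e: "e > 0"
    and tr: "mat_trace (X ^\<^sub>m (2 * p)) \<le> e ^ (2 * p)"
  shows "spectral_norm X \<le> e"
proof (rule spectral_norm_le[OF X(1)])
  fix v :: "real vec" assume v: "v \<in> carrier_vec n"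
  define \<nu> where "\<nu> k = vec_norm2 (X ^\<^sub>m k *\<^sub>v v)" for k
  have c: "X ^\<^sub>m k *\<^sub>v v \<in> carrier_vec n" for k by (rule mult_mat_vec_carrier[OF _ v]) (simp add: X)
  have \<nu>0: "\<nu> 0 = vec_norm2 v" and \<nu>1: "\<nu> (Suc 0) = vec_norm2 (X *\<^sub>v v)"
    using X v by (simp_all add: \<nu>_def)
  have step: "X ^\<^sub>m Suc k *\<^sub>v v = X *\<^sub>v (X ^\<^sub>m k *\<^sub>v v)" for k
  proof -
    have "X ^\<^sub>m Suc k = X ^\<^sub>m 1 * X ^\<^sub>m k" using pow_mat_add[OF X(1), of 1 k] by simp
    then show ?thesis using X v assoc_mult_mat_vec[of X n n "X ^\<^sub>m k" n v] by simp
  qed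
  have logconv: "(\<nu> (Suc k))\<^sup>2 \<le> \<nu> k * \<nu> (Suc (Suc k))" for k
  proof -
    have "(\<nu> (Suc k))\<^sup>2 = (X ^\<^sub>m Suc k *\<^sub>v v) \<bullet> (X ^\<^sub>m Suc k *\<^sub>v v)" by (simp add: \<nu>_def vec_norm2_square del: pow_mat.simps)
    also have "\<dots> = (X ^\<^sub>m k *\<^sub>v v) \<bullet> (X ^\<^sub>m Suc (Suc k) *\<^sub>v v)"
      using symmetric_mat_move[OF X c[of k] c[of "Suc k"]] by (simp only: step)
    also have "\<dots> \<le> \<nu> k * \<nu> (Suc (Suc k))"
      unfolding \<nu>_def using scalar_prod_cauchy_schwarz[OF c c, of k "Suc (Suc k)"] by linarith
    finally show ?thesis .
  qed
  have sq: "(\<nu> p)\<^sup>2 \<le> mat_trace (X ^\<^sub>m (2 * p)) * (vec_norm2 v)\<^sup>2"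
  proof -
    let ?A = "X ^\<^sub>m p"
    have A: "?A \<in> carrier_mat n n" using X by simp
    have "(\<nu> p)\<^sup>2 = (\<Sum>i<n. ((?A *\<^sub>v v) $ i)\<^sup>2)"
      unfolding \<nu>_def vec_norm2_square scalar_prod_sum[OF c] by (simp only: power2_eq_square)
    also have "\<dots> \<le> (\<Sum>i<n. (\<Sum>j<n. (?A $$ (i, j))\<^sup>2) * (vec_norm2 v)\<^sup>2)"
    proof (rule sum_mono)
      fix i assume "i \<in> {..<n}"
      then have "(?A *\<^sub>v v) $ i = (\<Sum>j<n. ?A $$ (i, j) * v $ j)"
        using mult_mat_vec_sum[OF A v] by blast
      then have "((?A *\<^sub>v v) $ i)\<^sup>2 \<le> (\<Sum>j<n. (?A $$ (i, j))\<^sup>2) * (\<Sum>j<n. (v $ j)\<^sup>2)"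
        using Cauchy_Schwarz_ineq_sum[of "\<lambda>j. ?A $$ (i, j)" "\<lambda>j. v $ j" "{..<n}"] by simp
      also have "(\<Sum>j<n. (v $ j)\<^sup>2) = (vec_norm2 v)\<^sup>2"
        unfolding vec_norm2_square scalar_prod_sum[OF v] by (simp only: power2_eq_square)
      finally show "((?A *\<^sub>v v) $ i)\<^sup>2 \<le> (\<Sum>j<n. (?A $$ (i, j))\<^sup>2) * (vec_norm2 v)\<^sup>2" .
    qed
    also have "\<dots> = (\<Sum>i<n. \<Sum>j<n. (?A $$ (i, j))\<^sup>2) * (vec_norm2 v)\<^sup>2" by (simp add: sum_distrib_right)
    also have "(\<Sum>i<n. \<Sum>j<n. (?A $$ (i, j))\<^sup>2) = mat_trace (X ^\<^sub>m (2 * p))"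
    proof -
      have "mat_trace (X ^\<^sub>m (2 * p)) = mat_trace (transpose_mat ?A * ?A)"
        using mat_trace_pow_even[OF X, of p p] by (simp add: mult_2)
      also have "\<dots> = (\<Sum>i<n. \<Sum>j<n. ?A $$ (j, i) * ?A $$ (j, i))" by (rule mat_trace_transpose_mult_sum[OF A A])
      also have "\<dots> = (\<Sum>i<n. \<Sum>j<n. (?A $$ (i, j))\<^sup>2)"
        by (subst sum.swap) (simp add: power2_eq_square)
      finally show ?thesis by simp
    qed
    finally show ?thesis .
  qed
  show "vec_norm2 (X *\<^sub>v v) \<le> e * vec_norm2 v"
  proof (rule ccontr)
    assume "\<not> ?thesis"
    then have big: "\<nu> (Suc 0) > e * \<nu> 0" by (simp add: \<nu>0 \<nu>1)
    have nonneg: "\<nu> k \<ge> 0" for k by (simp add: \<nu>_def)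
    have pos0: "\<nu> 0 > 0"
    proof (rule ccontr)
      assume "\<not> \<nu> 0 > 0"
      then have "\<nu> 0 = 0" using nonneg[of 0] by linarith
      moreover from this have "v = 0\<^sub>v n" using \<nu>0 vec_norm2_pos(1)[OF v] by force
      ultimately show False using big X \<nu>1 by (simp add: vec_norm2_def scalar_prod_def)
    qed
    have grow: "\<nu> k > 0 \<and> \<nu> (Suc k) > e * \<nu> k" for k
    proof (induction k)
      case 0
      then show ?case using pos0 big by simp
    next
      case (Suc k)
      then have k: "\<nu> k > 0" "\<nu> (Suc k) > e * \<nu> k" by auto
      have S: "\<nu> (Suc k) > 0" using k e mult_pos_pos[of e "\<nu> k"] by linarith
      have "\<nu> k * (e * \<nu> (Suc k)) < \<nu> (Suc k) * \<nu> (Suc k)"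
        using mult_strict_right_mono[OF k(2) S] by (simp add: mult_ac)
      also have "\<dots> \<le> \<nu> k * \<nu> (Suc (Suc k))" using logconv[of k] by (simp add: power2_eq_square)
      finally show ?case using S k(1) by simp
    qed
    have pow: "\<nu> (Suc k) > e ^ Suc k * \<nu> 0" for k
    proof (induction k)
      case 0
      then show ?case using big by simp
    next
      case (Suc k)
      have "e ^ Suc (Suc k) * \<nu> 0 < e * \<nu> (Suc k)" using Suc e by (simp add: mult.assoc)
      then show ?case using grow[of "Suc k"] by linarith
    qed
    have "\<nu> p > e ^ p * \<nu> 0" using pow[of "p - 1"] p by simp
    then have "(e ^ p * \<nu> 0)\<^sup>2 < (\<nu> p)\<^sup>2"
      using e pos0 by (intro power_strict_mono) auto
    also have "\<dots> \<le> e ^ (2 * p) * (\<nu> 0)\<^sup>2"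
      using sq mult_right_mono[OF tr, of "(\<nu> 0)\<^sup>2"] unfolding \<nu>0 by simp
    also have "\<dots> = (e ^ p * \<nu> 0)\<^sup>2" by (simp add: power_mult_distrib power_mult[symmetric] mult.commute)
    finally show False by simp
  qed
qed (use e in auto)

section \<open>Matrix concentration for independent observations\<close>

text \<open>A class of statistics that is stable under the ring operations, hence under matrix powers and
  traces, and whose expectations can be computed by independence and exchangeability.\<close>

definition sample_fun :: "int set \<Rightarrow> 'x measure \<Rightarrow> ((int \<Rightarrow> 'x) \<Rightarrow> real) \<Rightarrow> bool" where
  "sample_fun J S F \<longleftrightarrow> (\<forall>x. F (restrict x J) = F x) \<and> F \<in> borel_measurable (Pi\<^sub>M J (\<lambda>_. S)) \<and>
     (\<exists>B. \<forall>x \<in> space (Pi\<^sub>M J (\<lambda>_. S)). \<bar>F x\<bar> \<le> B)"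

definition sample_mat :: "int set \<Rightarrow> 'x measure \<Rightarrow> nat \<Rightarrow> ((int \<Rightarrow> 'x) \<Rightarrow> real mat) \<Rightarrow> bool" where
  "sample_mat J S K A \<longleftrightarrow> (\<forall>x. A x \<in> carrier_mat K K) \<and>
     (\<forall>i<K. \<forall>j<K. sample_fun J S (\<lambda>x. A x $$ (i, j)))"

lemma sample_fun_const: "sample_fun J S (\<lambda>_. c)"
  by (auto simp: sample_fun_def)

lemma sample_fun_component:
  assumes "i \<in> J" "g \<in> borel_measurable S" "\<And>x. x \<in> space S \<Longrightarrow> \<bar>g x\<bar> \<le> B"
  shows "sample_fun J S (\<lambda>x. g (x i))"
  unfolding sample_fun_def
proof (intro conjI exI ballI allI)
  show "(\<lambda>x. g (x i)) \<in> borel_measurable (Pi\<^sub>M J (\<lambda>_. S))"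
    using assms(1,2) by measurable
  show "\<bar>g (x i)\<bar> \<le> B" if "x \<in> space (Pi\<^sub>M J (\<lambda>_. S))" for x
    using that assms(1,3) by (auto simp: space_PiM PiE_def)
qed (use assms in auto)

lemma sample_fun_add:
  assumes "sample_fun J S F" "sample_fun J S G"
  shows "sample_fun J S (\<lambda>x. F x + G x)"
proof -
  obtain B C where B: "\<And>x. x \<in> space (Pi\<^sub>M J (\<lambda>_. S)) \<Longrightarrow> \<bar>F x\<bar> \<le> B"
    and C: "\<And>x. x \<in> space (Pi\<^sub>M J (\<lambda>_. S)) \<Longrightarrow> \<bar>G x\<bar> \<le> C"
    using assms unfolding sample_fun_def by blast
  have "\<forall>x \<in> space (Pi\<^sub>M J (\<lambda>_. S)). \<bar>F x + G x\<bar> \<le> B + C"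
    using B C by (intro ballI order_trans[OF abs_triangle_ineq] add_mono) auto
  then show ?thesis using assms unfolding sample_fun_def by (auto intro!: exI[of _ "B + C"])
qed

lemma sample_fun_mult:
  assumes "sample_fun J S F" "sample_fun J S G"
  shows "sample_fun J S (\<lambda>x. F x * G x)"
proof -
  obtain B C where B: "\<And>x. x \<in> space (Pi\<^sub>M J (\<lambda>_. S)) \<Longrightarrow> \<bar>F x\<bar> \<le> B"
    and C: "\<And>x. x \<in> space (Pi\<^sub>M J (\<lambda>_. S)) \<Longrightarrow> \<bar>G x\<bar> \<le> C"
    using assms unfolding sample_fun_def by blast
  have "\<forall>x \<in> space (Pi\<^sub>M J (\<lambda>_. S)). \<bar>F x * G x\<bar> \<le> B * C"
    unfolding abs_mult using B C by (intro ballI mult_mono) (auto intro: order_trans[OF abs_ge_zero])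
  then show ?thesis using assms unfolding sample_fun_def by (auto intro!: exI[of _ "B * C"])
qed

lemma sample_fun_sum:
  assumes "\<And>i. i \<in> A \<Longrightarrow> sample_fun J S (F i)"
  shows "sample_fun J S (\<lambda>x. \<Sum>i\<in>A. F i x)"
  using assms
  by (induction A rule: infinite_finite_induct) (auto intro: sample_fun_const sample_fun_add)

lemma sample_fun_diff:
  assumes "sample_fun J S F" "sample_fun J S G"
  shows "sample_fun J S (\<lambda>x. F x - G x)"
  using sample_fun_add[OF assms(1) sample_fun_mult[OF sample_fun_const[of J S "-1"] assms(2)]] by simp

lemma sample_fun_divide: "sample_fun J S F \<Longrightarrow> sample_fun J S (\<lambda>x. F x / c)"
  using sample_fun_mult[OF _ sample_fun_const[of J S "1 / c"]] by simp

lemma sample_mat_mult: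
  assumes "sample_mat J S K A" "sample_mat J S K B"
  shows "sample_mat J S K (\<lambda>x. A x * B x)"
  unfolding sample_mat_def
proof (intro conjI allI impI)
  show "A x * B x \<in> carrier_mat K K" for x
    using assms by (intro mult_carrier_mat[of _ K K]) (auto simp: sample_mat_def)
  fix i j assume ij: "i < K" "j < K"
  have "(\<lambda>x. (A x * B x) $$ (i, j)) = (\<lambda>x. \<Sum>l<K. A x $$ (i, l) * B x $$ (l, j))"
    using assms ij by (intro ext mult_mat_sum[of _ K K _ K]) (auto simp: sample_mat_def)
  then show "sample_fun J S (\<lambda>x. (A x * B x) $$ (i, j))"
    using assms ij by (auto simp: sample_mat_def intro!: sample_fun_sum sample_fun_mult)
qed

lemma sample_mat_one: "sample_mat J S K (\<lambda>_. 1\<^sub>m K)"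
  by (auto simp: sample_mat_def sample_fun_const)

lemma sample_mat_pow:
  assumes "sample_mat J S K A"
  shows "sample_mat J S K (\<lambda>x. A x ^\<^sub>m k)"
proof (induction k)
  case 0
  have "dim_row (A x) = K" for x using assms by (auto simp: sample_mat_def)
  then show ?case by (simp add: sample_mat_one)
next
  case (Suc k)
  then show ?case using sample_mat_mult[OF Suc assms] by simp
qed

lemma sample_mat_trace:
  assumes "sample_mat J S K A"
  shows "sample_fun J S (\<lambda>x. mat_trace (A x))"
proof -
  have "dim_row (A x) = K" for x using assms by (auto simp: sample_mat_def)
  then show ?thesis using assms unfolding mat_trace_def
    by (auto simp: sample_mat_def intro!: sample_fun_sum)
qed

lemma sample_mat_minus:
  assumes "sample_mat J S K A" "sample_mat J S K B"
  shows "sample_mat J S K (\<lambda>x. A x - B x)"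
  unfolding sample_mat_def
proof (intro conjI allI impI)
  show "A x - B x \<in> carrier_mat K K" for x
    using assms by (intro minus_carrier_mat) (auto simp: sample_mat_def)
  fix i j assume ij: "i < K" "j < K"
  have "(A x - B x) $$ (i, j) = A x $$ (i, j) - B x $$ (i, j)" for x
  proof -
    have "B x \<in> carrier_mat K K" using assms by (auto simp: sample_mat_def)
    then show ?thesis using ij by simp
  qed
  then show "sample_fun J S (\<lambda>x. (A x - B x) $$ (i, j))"
    using assms ij by (auto simp: sample_mat_def intro!: sample_fun_diff)
qed

context prob_space
begin

lemma sample_fun_integrable:
  assumes X: "\<And>i. i \<in> J \<Longrightarrow> X i \<in> measurable M S" and F: "sample_fun J S F"
  shows "(\<lambda>w. F (\<lambda>i. X i w)) \<in> borel_measurable M" "integrable M (\<lambda>w. F (\<lambda>i. X i w))"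
proof -
  have eq: "F (\<lambda>i. X i w) = F (\<lambda>i\<in>J. X i w)" for w
    using F by (simp add: sample_fun_def)
  have R: "(\<lambda>w. \<lambda>i\<in>J. X i w) \<in> measurable M (Pi\<^sub>M J (\<lambda>_. S))"
    using X by (intro measurable_restrict) auto
  show meas: "(\<lambda>w. F (\<lambda>i. X i w)) \<in> borel_measurable M"
    unfolding eq using F by (intro measurable_compose[OF R]) (auto simp: sample_fun_def)
  obtain B where B: "\<And>x. x \<in> space (Pi\<^sub>M J (\<lambda>_. S)) \<Longrightarrow> \<bar>F x\<bar> \<le> B"
    using F unfolding sample_fun_def by blast
  have "\<bar>F (\<lambda>i. X i w)\<bar> \<le> B" if "w \<in> space M" for w
    unfolding eq by (rule B[OF measurable_space[OF R that]])
  then show "integrable M (\<lambda>w. F (\<lambda>i. X i w))"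
    by (intro integrable_const_bound[of _ B] meas) auto
qed

lemma iid_measurable: "iid M S X I \<Longrightarrow> i \<in> I \<Longrightarrow> X i \<in> measurable M S"
  by (auto simp: iid_def indep_vars_def)

lemma iid_distr: "iid M S X I \<Longrightarrow> i \<in> I \<Longrightarrow> j \<in> I \<Longrightarrow> distr M S (X i) = distr M S (X j)"
  unfolding iid_def by blast

lemma iid_indep_vars: "iid M S X I \<Longrightarrow> J \<subseteq> I \<Longrightarrow> indep_vars (\<lambda>_. S) X J"
  unfolding iid_def using indep_vars_subset by blast

lemma iid_integral_component:
  fixes g :: "'x \<Rightarrow> real"
  assumes iid: "iid M S X I" and ij: "i \<in> I" "j \<in> I" and g: "g \<in> borel_measurable S"
  shows "(\<integral>w. g (X i w) \<partial>M) = (\<integral>w. g (X j w) \<partial>M)"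
proof -
  have "distr M S (X i) = distr M S (X j)" by (rule iid_distr[OF iid ij])
  then show ?thesis
    using integral_distr[OF iid_measurable[OF iid ij(1)] g] integral_distr[OF iid_measurable[OF iid ij(2)] g]
    by simp
qed

text \<open>Distinct indices of an i.i.d. family can be renamed without changing the joint law.\<close>

lemma iid_integral_permute:
  assumes iid: "iid M S X I" and J: "J \<subseteq> I" "J \<noteq> {}"
    and \<tau>: "inj_on \<tau> J" "\<tau> \<in> J \<rightarrow> J" and F: "sample_fun J S F"
  shows "(\<integral>w. F (\<lambda>i. X (\<tau> i) w) \<partial>M) = (\<integral>w. F (\<lambda>i. X i w) \<partial>M)"
proof -
  obtain j where j: "j \<in> J" using J by blast
  define \<mu> where "\<mu> = distr M S (X j)"
  have X: "X i \<in> measurable M S" if "i \<in> J" for i using that iid_measurable[OF iid] J by blast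
  interpret \<mu>: prob_space \<mu> unfolding \<mu>_def by (rule prob_space_distr[OF X[OF j]])
  have sets_\<mu>: "sets \<mu> = sets S" by (simp add: \<mu>_def)
  have ind: "indep_vars (\<lambda>_. S) X J" by (rule iid_indep_vars[OF iid J(1)])
  have D: "distr M (Pi\<^sub>M J (\<lambda>_. S)) (\<lambda>w. \<lambda>i\<in>J. X i w) = Pi\<^sub>M J (\<lambda>_. \<mu>)"
  proof -
    have "distr M (Pi\<^sub>M J (\<lambda>_. S)) (\<lambda>w. \<lambda>i\<in>J. X i w) = Pi\<^sub>M J (\<lambda>i. distr M S (X i))"
      using indep_vars_iff_distr_eq_PiM'[OF J(2), where M' = "\<lambda>_. S" and X = X] X ind by blast
    also have "\<dots> = Pi\<^sub>M J (\<lambda>_. \<mu>)"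
      using J j unfolding \<mu>_def by (intro PiM_cong refl iid_distr[OF iid]) auto
    finally show ?thesis .
  qed
  have Fm: "F \<in> borel_measurable (Pi\<^sub>M J (\<lambda>_. S))" and Fr: "\<And>x. F (restrict x J) = F x"
    using F by (auto simp: sample_fun_def)
  have RX: "(\<lambda>w. \<lambda>i\<in>J. X i w) \<in> measurable M (Pi\<^sub>M J (\<lambda>_. S))"
    using X by (intro measurable_restrict) auto
  have Rt: "(\<lambda>x. \<lambda>i\<in>J. x (\<tau> i)) \<in> measurable (Pi\<^sub>M J (\<lambda>_. \<mu>)) (Pi\<^sub>M J (\<lambda>_. \<mu>))"
    using \<tau>(2) by (intro measurable_restrict measurable_component_singleton) auto
  have sets_eq: "sets (Pi\<^sub>M J (\<lambda>_. \<mu>)) = sets (Pi\<^sub>M J (\<lambda>_. S))"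
    by (intro sets_PiM_cong) (simp_all add: sets_\<mu>)
  have Fm': "F \<in> borel_measurable (Pi\<^sub>M J (\<lambda>_. \<mu>))" using Fm measurable_cong_sets[OF sets_eq refl] by blast
  have re: "distr (Pi\<^sub>M J (\<lambda>_. \<mu>)) (Pi\<^sub>M J (\<lambda>_. \<mu>)) (\<lambda>x. \<lambda>i\<in>J. x (\<tau> i)) = Pi\<^sub>M J (\<lambda>_. \<mu>)"
    using distr_PiM_reindex[of J "\<lambda>_. \<mu>" \<tau> J] \<tau> \<mu>.prob_space_axioms by simp
  have "(\<integral>w. F (\<lambda>i. X (\<tau> i) w) \<partial>M) = (\<integral>w. F (\<lambda>i\<in>J. (\<lambda>k\<in>J. X k w) (\<tau> i)) \<partial>M)"
  proof (intro Bochner_Integration.integral_cong refl)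
    fix w
    have "(\<lambda>i\<in>J. (\<lambda>k\<in>J. X k w) (\<tau> i)) = restrict (\<lambda>i. X (\<tau> i) w) J"
      using \<tau>(2) by (intro restrict_ext) auto
    then show "F (\<lambda>i. X (\<tau> i) w) = F (\<lambda>i\<in>J. (\<lambda>k\<in>J. X k w) (\<tau> i))" by (simp only: Fr)
  qed
  also have "\<dots> = (\<integral>x. F (\<lambda>i\<in>J. x (\<tau> i)) \<partial>distr M (Pi\<^sub>M J (\<lambda>_. S)) (\<lambda>w. \<lambda>i\<in>J. X i w))"
    using measurable_compose[OF Rt Fm'] measurable_cong_sets[OF sets_eq refl]
    by (subst integral_distr[OF RX]) auto
  also have "\<dots> = (\<integral>x. F (\<lambda>i\<in>J. x (\<tau> i)) \<partial>Pi\<^sub>M J (\<lambda>_. \<mu>))" by (simp only: D)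
  also have "\<dots> = (\<integral>x. F x \<partial>distr (Pi\<^sub>M J (\<lambda>_. \<mu>)) (Pi\<^sub>M J (\<lambda>_. \<mu>)) (\<lambda>x. \<lambda>i\<in>J. x (\<tau> i)))"
    by (rule integral_distr[OF Rt Fm', symmetric])
  also have "\<dots> = (\<integral>x. F x \<partial>distr M (Pi\<^sub>M J (\<lambda>_. S)) (\<lambda>w. \<lambda>i\<in>J. X i w))" by (simp only: re D)
  also have "\<dots> = (\<integral>w. F (\<lambda>i. X i w) \<partial>M)"
    by (subst integral_distr[OF RX Fm]) (simp add: Fr)
  finally show ?thesis .
qed

lemma iid_integral_mult:
  assumes iid: "iid M S X I" and J: "J \<subseteq> I" "k \<in> I" "k \<notin> J" and F: "sample_fun J S F"
    and g: "g \<in> borel_measurable S" "\<And>x. x \<in> space S \<Longrightarrow> \<bar>g x\<bar> \<le> B"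
  shows "(\<integral>w. F (\<lambda>i. X i w) * g (X k w) \<partial>M) = (\<integral>w. F (\<lambda>i. X i w) \<partial>M) * (\<integral>w. g (X k w) \<partial>M)"
proof (rule indep_var_lebesgue_integral)
  have X: "X i \<in> measurable M S" if "i \<in> J" for i using that iid_measurable[OF iid] J by blast
  have G: "sample_fun {k} S (\<lambda>x. g (x k))" by (rule sample_fun_component[OF _ g]) auto
  show "integrable M (\<lambda>w. F (\<lambda>i. X i w))" by (rule sample_fun_integrable[OF X F])
  show "integrable M (\<lambda>w. g (X k w))"
    using sample_fun_integrable(2)[OF _ G, of X] iid_measurable[OF iid J(2)] by auto
  have "indep_var (Pi\<^sub>M J (\<lambda>_. S)) (\<lambda>w. \<lambda>i\<in>J. X i w) (Pi\<^sub>M {k} (\<lambda>_. S)) (\<lambda>w. \<lambda>i\<in>{k}. X i w)"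
    using J by (intro indep_var_restrict[of _ _ I] iid_indep_vars[OF iid]) auto
  then have "indep_var borel (F \<circ> (\<lambda>w. \<lambda>i\<in>J. X i w)) borel ((\<lambda>x. g (x k)) \<circ> (\<lambda>w. \<lambda>i\<in>{k}. X i w))"
    using F G by (intro indep_var_compose) (auto simp: sample_fun_def)
  moreover have "F \<circ> (\<lambda>w. \<lambda>i\<in>J. X i w) = (\<lambda>w. F (\<lambda>i. X i w))"
    using F by (auto simp: sample_fun_def)
  moreover have "(\<lambda>x. g (x k)) \<circ> (\<lambda>w. \<lambda>i\<in>{k}. X i w) = (\<lambda>w. g (X k w))" by auto
  ultimately show "indep_var borel (\<lambda>w. F (\<lambda>i. X i w)) borel (\<lambda>w. g (X k w))" by simp
qed

end

lemma mat_trace_mult_linear: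
  assumes "A \<in> carrier_mat n n" "B \<in> carrier_mat n n" "H \<in> carrier_mat n n"
  shows "mat_trace ((A - B) * H) = mat_trace (A * H) - mat_trace (B * H)"
  using assms
  by (simp add: minus_mult_distrib_mat[of _ n n _ _ n] mat_trace_minus[of _ n] mult_carrier_mat[of _ n n _ n])

lemma mat_trace_uminus_mult:
  assumes "A \<in> carrier_mat n n" "H \<in> carrier_mat n n"
  shows "mat_trace ((- A) * H) = - mat_trace (A * H)"
proof -
  have "mat_trace ((- A) * H) = (\<Sum>i<n. \<Sum>j<n. (- A) $$ (i, j) * H $$ (j, i))"
    using assms by (intro mat_trace_mult_sum) auto
  also have "\<dots> = - (\<Sum>i<n. \<Sum>j<n. A $$ (i, j) * H $$ (j, i))"
    using assms by (simp add: sum_negf)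
  finally show ?thesis using assms by (simp only: mat_trace_mult_sum)
qed

text \<open>As \<open>D = (b b' - c c') / r\<close>, its square is at most \<open>2 (b b' b b' + c c' c c') / r\<^sup>2\<close> in the semidefinite
  order, and \<open>b' b\<close> and \<open>c' c\<close> are at most \<open>R\<close>.\<close>

lemma mat_trace_rank_two_le:
  fixes A :: "real mat"
  assumes A: "A \<in> carrier_mat n n" "transpose_mat A = A"
    and D: "D \<in> carrier_mat n n" "transpose_mat D = D"
    and entries: "\<And>j k. j < n \<Longrightarrow> k < n \<Longrightarrow> D $$ (j, k) = (b $ j * b $ k - c $ j * c $ k) / r"
    and b: "b \<in> carrier_vec n" "b \<bullet> b \<le> R" and c: "c \<in> carrier_vec n" "c \<bullet> c \<le> R"
  shows "mat_trace (D * D * (A * A)) \<le> 2 * R / r\<^sup>2 * (b \<bullet> ((A * A) *\<^sub>v b) + c \<bullet> ((A * A) *\<^sub>v c))"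
proof -
  have DA: "D * A \<in> carrier_mat n n" using A D by simp
  have Asym: "A $$ (i, j) = A $$ (j, i)" if "i < n" "j < n" for i j
    using arg_cong[OF A(2), of "\<lambda>M. M $$ (i, j)"] that A(1) by simp
  have "mat_trace (D * D * (A * A)) = mat_trace ((D * (D * A)) * A)"
    using A(1) D(1) by (simp add: assoc_mult_mat[of _ n n _ n _ n] mult_carrier_mat[of _ n n _ n])
  also have "\<dots> = mat_trace (A * (D * (D * A)))"
    using A(1) D(1) by (intro mat_trace_mult_commute[of _ n n]) (simp_all add: mult_carrier_mat[of _ n n _ n])
  also have "A * (D * (D * A)) = transpose_mat (D * A) * (D * A)"
    using A D transpose_mult[OF D(1) A(1)]
    by (simp add: assoc_mult_mat[of _ n n _ n _ n] mult_carrier_mat[of _ n n _ n])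
  also have "mat_trace \<dots> = (\<Sum>i<n. \<Sum>j<n. ((D * A) $$ (j, i))\<^sup>2)"
    unfolding mat_trace_transpose_mult_sum[OF DA DA] by (simp add: power2_eq_square)
  also have "\<dots> \<le> (\<Sum>i<n. \<Sum>j<n. 2 / r\<^sup>2 * ((b $ j)\<^sup>2 * ((A *\<^sub>v b) $ i)\<^sup>2 + (c $ j)\<^sup>2 * ((A *\<^sub>v c) $ i)\<^sup>2))"
  proof (intro sum_mono)
    fix i j assume "i \<in> {..<n}" "j \<in> {..<n}"
    then have ij: "i < n" "j < n" by auto
    have "(D * A) $$ (j, i) = (\<Sum>l<n. (b $ j * b $ l - c $ j * c $ l) / r * A $$ (i, l))"
      using mult_mat_sum[OF D(1) A(1) ij(2,1)] ij by (simp add: entries Asym[of _ i])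
    also have "\<dots> = (b $ j * (\<Sum>l<n. A $$ (i, l) * b $ l) - c $ j * (\<Sum>l<n. A $$ (i, l) * c $ l)) / r"
      by (simp add: sum_distrib_left sum_subtractf[symmetric] sum_divide_distrib algebra_simps)
    also have "\<dots> = (b $ j * (A *\<^sub>v b) $ i - c $ j * (A *\<^sub>v c) $ i) / r"
      using mult_mat_vec_sum[OF A(1) b(1) ij(1)] mult_mat_vec_sum[OF A(1) c(1) ij(1)] by simp
    finally have e: "(D * A) $$ (j, i) = (b $ j * (A *\<^sub>v b) $ i - c $ j * (A *\<^sub>v c) $ i) / r" .
    have "(u - v)\<^sup>2 \<le> 2 * (u\<^sup>2 + v\<^sup>2)" for u v :: real
      using zero_le_power2[of "u + v"] by (simp add: power2_eq_square algebra_simps)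
    from divide_right_mono[OF this, of "r\<^sup>2" "b $ j * (A *\<^sub>v b) $ i" "c $ j * (A *\<^sub>v c) $ i"]
    show "((D * A) $$ (j, i))\<^sup>2 \<le> 2 / r\<^sup>2 * ((b $ j)\<^sup>2 * ((A *\<^sub>v b) $ i)\<^sup>2 + (c $ j)\<^sup>2 * ((A *\<^sub>v c) $ i)\<^sup>2)"
      unfolding e by (simp add: power_divide power_mult_distrib)
  qed
  also have "\<dots> = 2 / r\<^sup>2 * ((b \<bullet> b) * ((A *\<^sub>v b) \<bullet> (A *\<^sub>v b)) + (c \<bullet> c) * ((A *\<^sub>v c) \<bullet> (A *\<^sub>v c)))"
  proof -
    have sq: "v \<bullet> v = (\<Sum>i<n. (v $ i)\<^sup>2)" if "v \<in> carrier_vec n" for v :: "real vec"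
      unfolding scalar_prod_sum[OF that] by (simp only: power2_eq_square)
    have "(\<Sum>i<n. \<Sum>j<n. (v $ j)\<^sup>2 * ((A *\<^sub>v v) $ i)\<^sup>2) = (v \<bullet> v) * ((A *\<^sub>v v) \<bullet> (A *\<^sub>v v))"
      if v: "v \<in> carrier_vec n" for v
      unfolding sq[OF v] sq[OF mult_mat_vec_carrier[OF A(1) v]]
      by (simp only: sum_distrib_right[symmetric] sum_distrib_left[symmetric])
    from this[OF b(1)] this[OF c(1)] show ?thesis
      by (simp only: sum_distrib_left[symmetric] sum.distrib)
  qed
  also have "\<dots> \<le> 2 / r\<^sup>2 * (R * ((A *\<^sub>v b) \<bullet> (A *\<^sub>v b)) + R * ((A *\<^sub>v c) \<bullet> (A *\<^sub>v c)))"
    using b(2) c(2) by (intro mult_left_mono add_mono mult_right_mono) auto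
  also have "(A *\<^sub>v b) \<bullet> (A *\<^sub>v b) = b \<bullet> ((A * A) *\<^sub>v b)"
    using symmetric_mat_move[OF A b(1) mult_mat_vec_carrier[OF A(1) b(1)]] A(1) b(1) by simp
  also have "(A *\<^sub>v c) \<bullet> (A *\<^sub>v c) = c \<bullet> ((A * A) *\<^sub>v c)"
    using symmetric_mat_move[OF A c(1) mult_mat_vec_carrier[OF A(1) c(1)]] A(1) c(1) by simp
  finally show ?thesis by (simp add: distrib_left)
qed

definition gram_deviation :: "nat \<Rightarrow> ('x \<Rightarrow> real vec) \<Rightarrow> nat \<Rightarrow> (int \<Rightarrow> 'x) \<Rightarrow> real mat" where
  "gram_deviation K p n x = mat K K (\<lambda>(j, k).
     (\<Sum>i\<in>{1..int n}. p (x i) $ j * p (x i) $ k) / real n - (if j = k then 1 else 0))"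

lemma gram_deviation_carrier [simp]: "gram_deviation K p n x \<in> carrier_mat K K"
  and gram_deviation_dims [simp]: "dim_row (gram_deviation K p n x) = K" "dim_col (gram_deviation K p n x) = K"
  by (simp_all add: gram_deviation_def)

lemma gram_deviation_symmetric: "transpose_mat (gram_deviation K p n x) = gram_deviation K p n x"
  by (rule eq_matI) (auto simp: gram_deviation_def mult_ac)

text \<open>The statistics below may also involve one further, fresh observation with the index \<open>n + 1\<close>, for
  which the observations of the sample are exchanged in turn.\<close>

locale normalized_iid_design = prob_space M for M :: "'w measure" +
  fixes S :: "'x measure" and X :: "int \<Rightarrow> 'w \<Rightarrow> 'x" and K :: nat and p :: "'x \<Rightarrow> real vec"
    and R :: real and n :: nat
  assumes iid: "iid M S X {1..}"
    and p_dim: "\<And>x. p x \<in> carrier_vec K"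
    and p_meas: "\<And>k. k < K \<Longrightarrow> (\<lambda>x. p x $ k) \<in> borel_measurable S"
    and p_bound: "\<And>x. p x \<bullet> p x \<le> R"
    and orthonormal: "\<And>j k. j < K \<Longrightarrow> k < K \<Longrightarrow>
      (\<integral>w. p (X 1 w) $ j * p (X 1 w) $ k \<partial>M) = (if j = k then 1 else 0)"
    and n_pos: "n \<ge> 1"
begin

abbreviation "G \<equiv> gram_deviation K p n"
abbreviation "J \<equiv> {1..int n + 1}"

definition summand :: "int \<Rightarrow> (int \<Rightarrow> 'x) \<Rightarrow> real mat" where
  "summand i x = mat K K (\<lambda>(j, k). (p (x i) $ j * p (x i) $ k - (if j = k then 1 else 0)) / real n)"

definition moment :: "nat \<Rightarrow> real" where
  "moment s = (\<integral>w. mat_trace (G (\<lambda>i. X i w) ^\<^sub>m s) \<partial>M)"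

lemma R_nonneg: "0 \<le> R"
  using p_bound[of undefined] scalar_prod_self_nonneg[of "p undefined"] by linarith

lemma p_component_le: "k < K \<Longrightarrow> \<bar>p x $ k\<bar> \<le> sqrt R"
proof -
  assume k: "k < K"
  have "(p x $ k)\<^sup>2 \<le> (\<Sum>i<K. (p x $ i)\<^sup>2)" using k member_le_sum[of k "{..<K}" "\<lambda>i. (p x $ i)\<^sup>2"] by simp
  also have "\<dots> = p x \<bullet> p x" unfolding scalar_prod_sum[OF p_dim] by (simp only: power2_eq_square)
  also have "\<dots> \<le> R" by (rule p_bound)
  finally show ?thesis using real_le_rsqrt[of "\<bar>p x $ k\<bar>" R] by simp
qed

lemma p_prod_le: "j < K \<Longrightarrow> k < K \<Longrightarrow> \<bar>p x $ j * p x $ k\<bar> \<le> R"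
  using mult_mono[OF p_component_le[of j x] p_component_le[of k x]] R_nonneg
  by (simp add: abs_mult)

lemma p_prod_sample_fun: "i \<in> J' \<Longrightarrow> j < K \<Longrightarrow> k < K \<Longrightarrow> sample_fun J' S (\<lambda>x. p (x i) $ j * p (x i) $ k)"
  using sample_fun_component[of i J' "\<lambda>x. p x $ j * p x $ k" S R] p_meas p_prod_le by auto

lemma G_sample_mat: "{1..int n} \<subseteq> J' \<Longrightarrow> sample_mat J' S K G"
  unfolding sample_mat_def
  by (auto simp: gram_deviation_def intro!: sample_fun_diff sample_fun_const sample_fun_divide
      sample_fun_sum p_prod_sample_fun)

lemma summand_carrier [simp]: "summand i x \<in> carrier_mat K K"
  by (simp add: summand_def)

lemma summand_sample_mat: "i \<in> J' \<Longrightarrow> sample_mat J' S K (summand i)"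
  unfolding sample_mat_def
  by (auto simp: summand_def intro!: sample_fun_diff sample_fun_const sample_fun_divide p_prod_sample_fun)

lemma X_measurable: "i \<in> J \<Longrightarrow> X i \<in> measurable M S"
  using iid_measurable[OF iid] by auto

lemma integrable_trace:
  "sample_mat J S K A \<Longrightarrow> integrable M (\<lambda>w. mat_trace (A (\<lambda>i. X i w)))"
  by (rule sample_fun_integrable(2)[OF X_measurable sample_mat_trace])

lemma sum_summands: "j < K \<Longrightarrow> k < K \<Longrightarrow> (\<Sum>i\<in>{1..int n}. summand i x $$ (j, k)) = G x $$ (j, k)"
  using n_pos by (simp add: summand_def gram_deviation_def sum_subtractf sum_divide_distrib[symmetric] diff_divide_distrib)

text \<open>The fresh summand is centred and independent of the first \<open>n\<close> observations.\<close>

lemma integral_fresh_summand: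
  assumes "sample_mat {1..int n} S K H" "sample_mat J S K H"
  shows "(\<integral>w. mat_trace (summand (int n + 1) (\<lambda>i. X i w) * H (\<lambda>i. X i w)) \<partial>M) = 0"
proof -
  let ?g = "\<lambda>j k y. (p y $ j * p y $ k - (if j = k then 1 else 0)) / real n"
  have H: "H x \<in> carrier_mat K K" for x using assms by (simp add: sample_mat_def)
  have Hs: "sample_fun {1..int n} S (\<lambda>x. H x $$ (k, j))" if "j < K" "k < K" for j k
    using assms that by (simp add: sample_mat_def)
  have gm: "?g j k \<in> borel_measurable S" if "j < K" "k < K" for j k
    using p_meas that by (intro borel_measurable_divide borel_measurable_diff borel_measurable_times) auto
  have gb: "\<bar>?g j k y\<bar> \<le> (R + 1) / real n" if "j < K" "k < K" for j k y
  proof -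
    have "\<bar>p y $ j * p y $ k - (if j = k then 1 else 0)\<bar> \<le> R + 1"
      using p_prod_le[OF that, of y] by (auto simp: abs_le_iff)
    then show ?thesis unfolding abs_divide by (simp add: divide_right_mono)
  qed
  have gE: "(\<integral>w. ?g j k (X (int n + 1) w) \<partial>M) = 0" if jk: "j < K" "k < K" for j k
  proof -
    have "(\<integral>w. ?g j k (X (int n + 1) w) \<partial>M) = (\<integral>w. ?g j k (X 1 w) \<partial>M)"
      by (rule iid_integral_component[OF iid _ _ gm[OF jk]]) auto
    also have "\<dots> = ((\<integral>w. p (X 1 w) $ j * p (X 1 w) $ k \<partial>M) - (if j = k then 1 else 0)) / real n"
      using sample_fun_integrable(2)[where X = X, OF X_measurable p_prod_sample_fun[of 1 J j k]] jk
      by (simp add: prob_space)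
    finally show ?thesis using orthonormal[OF jk] by simp
  qed
  have "(\<integral>w. mat_trace (summand (int n + 1) (\<lambda>i. X i w) * H (\<lambda>i. X i w)) \<partial>M)
      = (\<integral>w. (\<Sum>j<K. \<Sum>k<K. H (\<lambda>i. X i w) $$ (k, j) * ?g j k (X (int n + 1) w)) \<partial>M)"
    unfolding mat_trace_mult_sum[OF summand_carrier H]
    by (intro Bochner_Integration.integral_cong refl sum.cong) (simp add: summand_def mult.commute)
  also have "\<dots> = (\<Sum>j<K. \<Sum>k<K. (\<integral>w. H (\<lambda>i. X i w) $$ (k, j) * ?g j k (X (int n + 1) w) \<partial>M))"
  proof -
    have "integrable M (\<lambda>w. H (\<lambda>i. X i w) $$ (k, j) * ?g j k (X (int n + 1) w))" if jk: "j < K" "k < K" for j k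
    proof -
      have "sample_fun J S (\<lambda>x. H x $$ (k, j) * ?g j k (x (int n + 1)))"
        using assms(2) jk gm[OF jk] gb[OF jk]
        by (intro sample_fun_mult sample_fun_component[of _ J "?g j k" S "(R + 1) / real n"]) (auto simp: sample_mat_def)
      from sample_fun_integrable(2)[OF X_measurable this] show ?thesis .
    qed
    note int = this
    have "(\<integral>w. (\<Sum>j<K. \<Sum>k<K. H (\<lambda>i. X i w) $$ (k, j) * ?g j k (X (int n + 1) w)) \<partial>M)
        = (\<Sum>j<K. (\<integral>w. (\<Sum>k<K. H (\<lambda>i. X i w) $$ (k, j) * ?g j k (X (int n + 1) w)) \<partial>M))"
      using int by (intro Bochner_Integration.integral_sum Bochner_Integration.integrable_sum) auto
    also have "\<dots> = (\<Sum>j<K. \<Sum>k<K. (\<integral>w. H (\<lambda>i. X i w) $$ (k, j) * ?g j k (X (int n + 1) w) \<partial>M))"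
      using int by (intro sum.cong refl Bochner_Integration.integral_sum) auto
    finally show ?thesis .
  qed
  also have "\<dots> = 0"
  proof -
    have "(\<integral>w. H (\<lambda>i. X i w) $$ (k, j) * ?g j k (X (int n + 1) w) \<partial>M) = 0" if jk: "j < K" "k < K" for j k
      using iid_integral_mult[OF iid _ _ _ Hs[OF jk] gm[OF jk] gb[OF jk], of "int n + 1"] gE[OF jk] by auto
    then show ?thesis by (intro sum.neutral ballI) auto
  qed
  finally show ?thesis .
qed

text \<open>The fresh observation is independent of \<open>H\<close>, and its outer product has the identity as its mean.\<close>

lemma integral_fresh_quadratic_form:
  assumes H: "sample_mat {1..int n} S K H" "sample_mat J S K H"
  shows "integrable M (\<lambda>w. p (X (int n + 1) w) \<bullet> (H (\<lambda>i. X i w) *\<^sub>v p (X (int n + 1) w)))"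
    "(\<integral>w. p (X (int n + 1) w) \<bullet> (H (\<lambda>i. X i w) *\<^sub>v p (X (int n + 1) w)) \<partial>M)
      = (\<integral>w. mat_trace (H (\<lambda>i. X i w)) \<partial>M)"
proof -
  let ?g = "\<lambda>j k y. p y $ j * p y $ k"
  have Hc: "H x \<in> carrier_mat K K" for x using assms by (simp add: sample_mat_def)
  have Hs: "sample_fun {1..int n} S (\<lambda>x. H x $$ (j, k))" if "j < K" "k < K" for j k
    using assms that by (simp add: sample_mat_def)
  have gm: "?g j k \<in> borel_measurable S" if "j < K" "k < K" for j k
    using p_meas that by (intro borel_measurable_times) auto
  have int: "integrable M (\<lambda>w. H (\<lambda>i. X i w) $$ (j, k) * ?g j k (X (int n + 1) w))" if jk: "j < K" "k < K" for j k
  proof -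
    have "sample_fun J S (\<lambda>x. H x $$ (j, k) * ?g j k (x (int n + 1)))"
      using assms(2) jk gm[OF jk] by (intro sample_fun_mult p_prod_sample_fun) (auto simp: sample_mat_def)
    from sample_fun_integrable(2)[OF X_measurable this] show ?thesis .
  qed
  have gE: "(\<integral>w. ?g j k (X (int n + 1) w) \<partial>M) = (if j = k then 1 else 0)" if jk: "j < K" "k < K" for j k
    using iid_integral_component[OF iid _ _ gm[OF jk], of "int n + 1" 1] orthonormal[OF jk] by simp
  have q: "p (X (int n + 1) w) \<bullet> (H (\<lambda>i. X i w) *\<^sub>v p (X (int n + 1) w))
      = (\<Sum>j<K. \<Sum>k<K. H (\<lambda>i. X i w) $$ (j, k) * ?g j k (X (int n + 1) w))" for w
    by (rule quadratic_form_sum[OF Hc p_dim p_dim])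
  show "integrable M (\<lambda>w. p (X (int n + 1) w) \<bullet> (H (\<lambda>i. X i w) *\<^sub>v p (X (int n + 1) w)))"
    unfolding q using int by (intro Bochner_Integration.integrable_sum) auto
  have "(\<integral>w. p (X (int n + 1) w) \<bullet> (H (\<lambda>i. X i w) *\<^sub>v p (X (int n + 1) w)) \<partial>M)
      = (\<Sum>j<K. \<Sum>k<K. (\<integral>w. H (\<lambda>i. X i w) $$ (j, k) * ?g j k (X (int n + 1) w) \<partial>M))"
  proof -
    have "(\<integral>w. (\<Sum>j<K. \<Sum>k<K. H (\<lambda>i. X i w) $$ (j, k) * ?g j k (X (int n + 1) w)) \<partial>M)
        = (\<Sum>j<K. (\<integral>w. (\<Sum>k<K. H (\<lambda>i. X i w) $$ (j, k) * ?g j k (X (int n + 1) w)) \<partial>M))"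
      using int by (intro Bochner_Integration.integral_sum Bochner_Integration.integrable_sum) auto
    also have "\<dots> = (\<Sum>j<K. \<Sum>k<K. (\<integral>w. H (\<lambda>i. X i w) $$ (j, k) * ?g j k (X (int n + 1) w) \<partial>M))"
      using int by (intro sum.cong refl Bochner_Integration.integral_sum) auto
    finally show ?thesis unfolding q .
  qed
  also have "\<dots> = (\<Sum>j<K. \<Sum>k<K. if j = k then (\<integral>w. H (\<lambda>i. X i w) $$ (j, j) \<partial>M) else 0)"
  proof (intro sum.cong refl)
    fix j k assume "j \<in> {..<K}" "k \<in> {..<K}"
    then have jk: "j < K" "k < K" by auto
    show "(\<integral>w. H (\<lambda>i. X i w) $$ (j, k) * ?g j k (X (int n + 1) w) \<partial>M)
        = (if j = k then (\<integral>w. H (\<lambda>i. X i w) $$ (j, j) \<partial>M) else 0)"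
      using iid_integral_mult[OF iid _ _ _ Hs[OF jk] gm[OF jk] p_prod_le[OF jk], of "int n + 1"] gE[OF jk] by auto
  qed
  also have "\<dots> = (\<Sum>j<K. (\<integral>w. H (\<lambda>i. X i w) $$ (j, j) \<partial>M))" by (simp add: sum.delta)
  also have "\<dots> = (\<integral>w. mat_trace (H (\<lambda>i. X i w)) \<partial>M)"
  proof -
    have "integrable M (\<lambda>w. H (\<lambda>i. X i w) $$ (j, j))" if "j < K" for j
      using sample_fun_integrable(2)[where X = X and J = J and F = "\<lambda>x. H x $$ (j, j)", OF X_measurable] assms(2) that by (simp add: sample_mat_def)
    moreover have "mat_trace (H x) = (\<Sum>j<K. H x $$ (j, j))" for x
      using carrier_matD(1)[OF Hc] by (simp add: mat_trace_def)
    ultimately show ?thesis by (simp add: Bochner_Integration.integral_sum)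
  qed
  finally show "(\<integral>w. p (X (int n + 1) w) \<bullet> (H (\<lambda>i. X i w) *\<^sub>v p (X (int n + 1) w)) \<partial>M)
      = (\<integral>w. mat_trace (H (\<lambda>i. X i w)) \<partial>M)" .
qed

text \<open>The average of the outer products of the sample is the Gram matrix, that is, \<open>G\<close> plus the identity.\<close>

lemma sum_sample_quadratic_forms:
  "(\<Sum>i\<in>{1..int n}. p (x i) \<bullet> ((G x ^\<^sub>m s) *\<^sub>v p (x i)))
    = real n * (mat_trace (G x ^\<^sub>m Suc s) + mat_trace (G x ^\<^sub>m s))"
proof -
  let ?H = "G x ^\<^sub>m s"
  have H: "?H \<in> carrier_mat K K" by simp
  have "(\<Sum>i\<in>{1..int n}. p (x i) \<bullet> (?H *\<^sub>v p (x i)))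
      = (\<Sum>i\<in>{1..int n}. \<Sum>j<K. \<Sum>k<K. ?H $$ (j, k) * (p (x i) $ j * p (x i) $ k))"
    by (intro sum.cong refl quadratic_form_sum[OF H p_dim p_dim])
  also have "\<dots> = (\<Sum>j<K. \<Sum>k<K. \<Sum>i\<in>{1..int n}. ?H $$ (j, k) * (p (x i) $ j * p (x i) $ k))"
    by (subst sum.swap, rule sum.cong[OF refl], rule sum.swap)
  also have "\<dots> = (\<Sum>j<K. \<Sum>k<K. real n * (?H $$ (j, k) * G x $$ (k, j) + (if j = k then ?H $$ (j, j) else 0)))"
  proof (intro sum.cong refl)
    fix j k assume "j \<in> {..<K}" "k \<in> {..<K}"
    then have "(\<Sum>i\<in>{1..int n}. p (x i) $ j * p (x i) $ k) = real n * (G x $$ (k, j) + (if j = k then 1 else 0))"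
      using n_pos by (simp add: gram_deviation_def mult.commute)
    then show "(\<Sum>i\<in>{1..int n}. ?H $$ (j, k) * (p (x i) $ j * p (x i) $ k))
        = real n * (?H $$ (j, k) * G x $$ (k, j) + (if j = k then ?H $$ (j, j) else 0))"
      by (simp only: sum_distrib_left[symmetric]) (simp add: algebra_simps)
  qed
  also have "\<dots> = real n * ((\<Sum>j<K. \<Sum>k<K. ?H $$ (j, k) * G x $$ (k, j)) + (\<Sum>j<K. ?H $$ (j, j)))"
    by (simp add: sum_distrib_left[symmetric] sum.distrib sum.delta)
  also have "\<dots> = real n * (mat_trace (?H * G x) + mat_trace ?H)"
    unfolding mat_trace_mult_sum[OF H gram_deviation_carrier] by (simp add: mat_trace_def)
  finally show ?thesis by simp
qed

definition swap :: "int \<Rightarrow> int \<Rightarrow> int" where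
  "swap i k = (if k = i then int n + 1 else if k = int n + 1 then i else k)"

definition diff_mat :: "int \<Rightarrow> (int \<Rightarrow> 'x) \<Rightarrow> real mat" where
  "diff_mat i x = summand i x - summand (int n + 1) x"

lemma diff_mat_carrier [simp]: "diff_mat i x \<in> carrier_mat K K"
  unfolding diff_mat_def by (rule minus_carrier_mat) simp

lemma diff_mat_dims [simp]: "dim_row (diff_mat i x) = K" "dim_col (diff_mat i x) = K"
  using carrier_matD[OF diff_mat_carrier] by auto

lemma diff_mat_entry: "j < K \<Longrightarrow> k < K \<Longrightarrow> diff_mat i x $$ (j, k)
    = (p (x i) $ j * p (x i) $ k - p (x (int n + 1)) $ j * p (x (int n + 1)) $ k) / real n"
  by (simp add: diff_mat_def summand_def diff_divide_distrib)

lemma diff_mat_symmetric: "transpose_mat (diff_mat i x) = diff_mat i x"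
proof (rule eq_matI)
  fix j k assume "j < dim_row (diff_mat i x)" "k < dim_col (diff_mat i x)"
  then have "j < K" "k < K" using diff_mat_carrier[of i x] by auto
  then show "transpose_mat (diff_mat i x) $$ (j, k) = diff_mat i x $$ (j, k)"
    using carrier_matD[OF diff_mat_carrier[of i x]] by (simp add: diff_mat_entry mult.commute)
qed (use diff_mat_carrier[of i x] in auto)

lemma diff_mat_sample_mat: "i \<in> {1..int n} \<Longrightarrow> sample_mat J S K (diff_mat i)"
  unfolding diff_mat_def[abs_def] by (intro sample_mat_minus summand_sample_mat) auto

lemma diff_mat_swap:
  assumes i: "i \<in> {1..int n}"
  shows "diff_mat i (x \<circ> swap i) = - diff_mat i x"
proof (rule eq_matI)
  fix j k assume "j < dim_row (- diff_mat i x)" "k < dim_col (- diff_mat i x)"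
  then have "j < K" "k < K" using diff_mat_carrier[of i x] by auto
  then show "diff_mat i (x \<circ> swap i) $$ (j, k) = (- diff_mat i x) $$ (j, k)"
    using i carrier_matD[OF diff_mat_carrier[of i x]] by (auto simp: diff_mat_entry swap_def minus_divide_left)
qed (use diff_mat_carrier[of i x] diff_mat_carrier[of i "x \<circ> swap i"] in auto)

lemma G_swap:
  assumes i: "i \<in> {1..int n}"
  shows "G x - G (x \<circ> swap i) = diff_mat i x"
proof (rule eq_matI)
  fix j k assume "j < dim_row (diff_mat i x)" "k < dim_col (diff_mat i x)"
  then have jk: "j < K" "k < K" using diff_mat_carrier[of i x] by auto
  let ?g = "\<lambda>y. p y $ j * p y $ k"
  have "(\<Sum>l\<in>{1..int n}. ?g ((x \<circ> swap i) l)) = ?g ((x \<circ> swap i) i) + (\<Sum>l\<in>{1..int n} - {i}. ?g ((x \<circ> swap i) l))"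
    using i by (intro sum.remove) auto
  also have "(\<Sum>l\<in>{1..int n} - {i}. ?g ((x \<circ> swap i) l)) = (\<Sum>l\<in>{1..int n} - {i}. ?g (x l))"
    by (intro sum.cong refl) (auto simp: swap_def)
  also have "(x \<circ> swap i) i = x (int n + 1)" by (simp add: swap_def)
  moreover have "(\<Sum>l\<in>{1..int n}. ?g (x l)) = ?g (x i) + (\<Sum>l\<in>{1..int n} - {i}. ?g (x l))"
    using i by (intro sum.remove) auto
  ultimately have "(\<Sum>l\<in>{1..int n}. ?g (x l)) - (\<Sum>l\<in>{1..int n}. ?g ((x \<circ> swap i) l)) = ?g (x i) - ?g (x (int n + 1))"
    by simp
  then show "(G x - G (x \<circ> swap i)) $$ (j, k) = diff_mat i x $$ (j, k)"
    using jk by (simp add: gram_deviation_def diff_mat_entry diff_divide_distrib[symmetric])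
qed (use carrier_matD[OF diff_mat_carrier[of i x]] in auto)

text \<open>Write one factor of \<open>G\<close> as a sum over the observations.  Subtracting the fresh summand does not
  change the expectation, and exchanging the two observations symmetrizes it; what remains is
  \<open>tr(D(H\<^sup>2\<^sup>s\<^sup>+\<^sup>1 - Y\<^sup>2\<^sup>s\<^sup>+\<^sup>1)) / 2\<close>, where \<open>H\<close> and \<open>Y\<close> are the matrix before and after the exchange and
  \<open>D\<close> is their difference.  The trace inequality bounds it by traces of \<open>D\<^sup>2\<close> times even powers.  As
  \<open>D\<close> has rank two and entries of order \<open>1 / n\<close>, these are quadratic forms in the two exchanged basis
  vectors, and summing over the observations gives back moments.\<close>

lemma moment_recursion:
  "moment (2 * s + 2) \<le> (2 * real s + 1) * (R / real n) * (moment (2 * s + 1) + 2 * moment (2 * s))"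
proof -
  let ?x = "\<lambda>w i. X i w"
  define F1 where "F1 i x = mat_trace (diff_mat i x * G x ^\<^sub>m (2 * s + 1))" for i x
  define F2 where "F2 i x = mat_trace (diff_mat i x * diff_mat i x * G x ^\<^sub>m (2 * s))" for i x
  define q where "q i x = p (x i) \<bullet> ((G x ^\<^sub>m (2 * s)) *\<^sub>v p (x i))" for i and x :: "int \<Rightarrow> 'x"
  have GJ: "sample_mat J S K G" and G0: "sample_mat {1..int n} S K G" by (auto intro: G_sample_mat)
  have pc: "G x ^\<^sub>m t \<in> carrier_mat K K" for x t by simp
  have F1s: "sample_mat J S K (\<lambda>x. diff_mat i x * G x ^\<^sub>m (2 * s + 1))"
    and F2s: "sample_mat J S K (\<lambda>x. diff_mat i x * diff_mat i x * G x ^\<^sub>m (2 * s))" if "i \<in> {1..int n}" for i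
    using that by (intro sample_mat_mult diff_mat_sample_mat sample_mat_pow GJ; simp)+
  have F1i: "integrable M (\<lambda>w. F1 i (?x w))" and F2i: "integrable M (\<lambda>w. F2 i (?x w))" if "i \<in> {1..int n}" for i
    unfolding F1_def F2_def using integrable_trace[OF F1s[OF that]] integrable_trace[OF F2s[OF that]] by auto
  have mi: "integrable M (\<lambda>w. mat_trace (G (?x w) ^\<^sub>m t))" for t
    by (rule integrable_trace[OF sample_mat_pow[OF GJ]])
  \<comment> \<open>The exchange preserves the joint law, replaces \<open>D\<close> by \<open>- D\<close>, and \<open>H\<close> by \<open>Y\<close>.\<close>
  have exch: "2 * (\<integral>w. F1 i (?x w) \<partial>M) \<le> (2 * real s + 1) * (\<integral>w. F2 i (?x w) \<partial>M)" if i: "i \<in> {1..int n}" for i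
  proof -
    have pw: "F1 i x + F1 i (x \<circ> swap i) \<le> (2 * real s + 1) / 2 * (F2 i x + F2 i (x \<circ> swap i))" for x
    proof -
      let ?D = "diff_mat i x" and ?Y = "G (x \<circ> swap i)"
      have "F1 i (x \<circ> swap i) = - mat_trace (?D * ?Y ^\<^sub>m (2 * s + 1))"
        unfolding F1_def diff_mat_swap[OF i] by (rule mat_trace_uminus_mult[of _ K]) (simp, rule pc)
      moreover have "(- ?D) * (- ?D) = ?D * ?D"
      proof -
        have "(- ?D) * (- ?D) = - (?D * (- ?D))" using diff_mat_carrier[of i x] by (intro uminus_mult_left_mat) auto
        also have "?D * (- ?D) = - (?D * ?D)" using diff_mat_carrier[of i x] by (intro uminus_mult_right_mat) auto
        finally show ?thesis by simp
      qed
      then have "F2 i (x \<circ> swap i) = mat_trace (?D * ?D * ?Y ^\<^sub>m (2 * s))"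
        unfolding F2_def diff_mat_swap[OF i] by simp
      ultimately show ?thesis
        using mat_trace_power_difference_le[OF gram_deviation_carrier gram_deviation_symmetric
            gram_deviation_carrier gram_deviation_symmetric, of K p n x p n "x \<circ> swap i" s]
        unfolding G_swap[OF i] F1_def F2_def by simp
    qed
    have inj: "inj_on (swap i) J" using i by (auto simp: swap_def inj_on_def split: if_splits)
    have into: "swap i \<in> J \<rightarrow> J" using i by (auto simp: swap_def)
    have perm: "(\<integral>w. F (?x w \<circ> swap i) \<partial>M) = (\<integral>w. F (?x w) \<partial>M)"
      "integrable M (\<lambda>w. F (?x w \<circ> swap i))" if F: "sample_fun J S F" for F
    proof -
      show "(\<integral>w. F (?x w \<circ> swap i) \<partial>M) = (\<integral>w. F (?x w) \<partial>M)"
        using iid_integral_permute[OF iid _ _ inj into F] n_pos by (simp add: comp_def)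
      have "integrable M (\<lambda>w. F (\<lambda>k. X (swap i k) w))"
      proof (rule sample_fun_integrable(2)[OF _ F])
        fix k assume "k \<in> J"
        then show "X (swap i k) \<in> measurable M S" using into by (intro X_measurable) blast
      qed
      then show "integrable M (\<lambda>w. F (?x w \<circ> swap i))" by (simp add: comp_def)
    qed
    have s1: "sample_fun J S (F1 i)" and s2: "sample_fun J S (F2 i)"
      unfolding F1_def[abs_def] F2_def[abs_def] using F1s[OF i] F2s[OF i] by (auto intro: sample_mat_trace)
    have "(\<integral>w. F1 i (?x w) + F1 i (?x w \<circ> swap i) \<partial>M)
        \<le> (\<integral>w. (2 * real s + 1) / 2 * (F2 i (?x w) + F2 i (?x w \<circ> swap i)) \<partial>M)"
      using perm(2)[OF s1] perm(2)[OF s2] F1i[OF i] F2i[OF i] pw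
      by (intro integral_mono) auto
    then show ?thesis
      using perm[OF s1] perm[OF s2] F1i[OF i] F2i[OF i] by simp
  qed
  \<comment> \<open>Here the fresh summand is subtracted for free.\<close>
  have step: "moment (2 * s + 2) = (\<Sum>i\<in>{1..int n}. (\<integral>w. F1 i (?x w) \<partial>M))"
  proof -
    have tr: "mat_trace (G x ^\<^sub>m (2 * s + 2)) = (\<Sum>i\<in>{1..int n}. mat_trace (summand i x * G x ^\<^sub>m (2 * s + 1)))" for x
    proof -
      have "G x ^\<^sub>m (2 * s + 2) = G x * G x ^\<^sub>m (2 * s + 1)"
        using pow_mat_add[of "G x" K 1 "2 * s + 1"] by simp
      then have "mat_trace (G x ^\<^sub>m (2 * s + 2)) = (\<Sum>j<K. \<Sum>k<K. G x $$ (j, k) * (G x ^\<^sub>m (2 * s + 1)) $$ (k, j))"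
        using mat_trace_mult_sum[OF gram_deviation_carrier pc[of x "2 * s + 1"]] by simp
      also have "\<dots> = (\<Sum>j<K. \<Sum>k<K. \<Sum>i\<in>{1..int n}. summand i x $$ (j, k) * (G x ^\<^sub>m (2 * s + 1)) $$ (k, j))"
        by (intro sum.cong refl) (simp add: sum_summands[symmetric] sum_distrib_right)
      also have "\<dots> = (\<Sum>i\<in>{1..int n}. \<Sum>j<K. \<Sum>k<K. summand i x $$ (j, k) * (G x ^\<^sub>m (2 * s + 1)) $$ (k, j))"
        by (subst (2) sum.swap, rule trans[OF sum.cong[OF refl sum.swap]], subst sum.swap, rule sum.cong[OF refl], rule sum.swap)
      also have "\<dots> = (\<Sum>i\<in>{1..int n}. mat_trace (summand i x * G x ^\<^sub>m (2 * s + 1)))"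
        by (intro sum.cong refl mat_trace_mult_sum[OF summand_carrier pc, symmetric])
      finally show ?thesis .
    qed
    have si: "integrable M (\<lambda>w. mat_trace (summand i (?x w) * G (?x w) ^\<^sub>m (2 * s + 1)))" if "i \<in> J" for i
      using that by (intro integrable_trace sample_mat_mult summand_sample_mat sample_mat_pow GJ)
    have "moment (2 * s + 2) = (\<Sum>i\<in>{1..int n}. (\<integral>w. mat_trace (summand i (?x w) * G (?x w) ^\<^sub>m (2 * s + 1)) \<partial>M))"
      unfolding moment_def tr using si by (intro Bochner_Integration.integral_sum) auto
    also have "\<dots> = (\<Sum>i\<in>{1..int n}. (\<integral>w. F1 i (?x w) \<partial>M))"
    proof (intro sum.cong refl)
      fix i assume i: "i \<in> {1..int n}"
      have "(\<integral>w. F1 i (?x w) \<partial>M) = (\<integral>w. mat_trace (summand i (?x w) * G (?x w) ^\<^sub>m (2 * s + 1))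
          - mat_trace (summand (int n + 1) (?x w) * G (?x w) ^\<^sub>m (2 * s + 1)) \<partial>M)"
        unfolding F1_def diff_mat_def by (intro Bochner_Integration.integral_cong refl mat_trace_mult_linear[of _ K] summand_carrier pc)
      also have "\<dots> = (\<integral>w. mat_trace (summand i (?x w) * G (?x w) ^\<^sub>m (2 * s + 1)) \<partial>M)"
        using i si[of i] si[of "int n + 1"]
          integral_fresh_summand[OF sample_mat_pow[OF G0] sample_mat_pow[OF GJ], of "2 * s + 1"]
        by simp
      finally show "(\<integral>w. mat_trace (summand i (?x w) * G (?x w) ^\<^sub>m (2 * s + 1)) \<partial>M) = (\<integral>w. F1 i (?x w) \<partial>M)" by simp
    qed
    finally show ?thesis .
  qed
  have F2le: "F2 i x \<le> 2 * R / (real n)\<^sup>2 * (q i x + q (int n + 1) x)" for i x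
  proof -
    have e: "G x ^\<^sub>m (2 * s) = G x ^\<^sub>m s * G x ^\<^sub>m s" using pow_mat_add[of "G x" K s s] by (simp add: mult_2)
    show ?thesis unfolding F2_def q_def e
      by (rule mat_trace_rank_two_le[OF pc pow_mat_symmetric[OF gram_deviation_carrier gram_deviation_symmetric]
            diff_mat_carrier diff_mat_symmetric diff_mat_entry p_dim p_bound p_dim p_bound])
  qed
  have q0: "integrable M (\<lambda>w. q (int n + 1) (?x w))" "(\<integral>w. q (int n + 1) (?x w) \<partial>M) = moment (2 * s)"
    unfolding q_def moment_def
    using integral_fresh_quadratic_form[OF sample_mat_pow[OF G0] sample_mat_pow[OF GJ], of "2 * s"] by auto
  have "(\<Sum>i\<in>{1..int n}. (\<integral>w. F2 i (?x w) \<partial>M)) = (\<integral>w. (\<Sum>i\<in>{1..int n}. F2 i (?x w)) \<partial>M)"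
    using F2i by (intro Bochner_Integration.integral_sum[symmetric]) auto
  also have "\<dots> \<le> (\<integral>w. 2 * R / (real n)\<^sup>2 * (real n * (mat_trace (G (?x w) ^\<^sub>m (2 * s + 1)) + mat_trace (G (?x w) ^\<^sub>m (2 * s)))
      + real n * q (int n + 1) (?x w)) \<partial>M)"
  proof (rule integral_mono)
    show "integrable M (\<lambda>w. \<Sum>i\<in>{1..int n}. F2 i (?x w))" using F2i by auto
    show "integrable M (\<lambda>w. 2 * R / (real n)\<^sup>2 * (real n * (mat_trace (G (?x w) ^\<^sub>m (2 * s + 1)) + mat_trace (G (?x w) ^\<^sub>m (2 * s)))
      + real n * q (int n + 1) (?x w)))"
      by (intro integrable_mult_right Bochner_Integration.integrable_add mi q0(1))
    fix w
    have "(\<Sum>i\<in>{1..int n}. F2 i (?x w)) \<le> (\<Sum>i\<in>{1..int n}. 2 * R / (real n)\<^sup>2 * (q i (?x w) + q (int n + 1) (?x w)))"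
      by (intro sum_mono F2le)
    also have "\<dots> = 2 * R / (real n)\<^sup>2 * ((\<Sum>i\<in>{1..int n}. q i (?x w)) + real n * q (int n + 1) (?x w))"
      unfolding sum_distrib_left[symmetric] sum.distrib by simp
    also have "(\<Sum>i\<in>{1..int n}. q i (?x w)) = real n * (mat_trace (G (?x w) ^\<^sub>m (2 * s + 1)) + mat_trace (G (?x w) ^\<^sub>m (2 * s)))"
      using sum_sample_quadratic_forms[of "?x w" "2 * s"] by (simp add: q_def)
    finally show "(\<Sum>i\<in>{1..int n}. F2 i (?x w)) \<le> 2 * R / (real n)\<^sup>2 *
      (real n * (mat_trace (G (?x w) ^\<^sub>m (2 * s + 1)) + mat_trace (G (?x w) ^\<^sub>m (2 * s))) + real n * q (int n + 1) (?x w))" .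
  qed
  also have "\<dots> = 2 * R / (real n)\<^sup>2 * (real n * (moment (2 * s + 1) + moment (2 * s)) + real n * moment (2 * s))"
    using mi[of "2 * s + 1"] mi[of "2 * s"] q0 by (simp add: moment_def del: pow_mat.simps)
  also have "\<dots> = 2 * (R / real n) * (moment (2 * s + 1) + 2 * moment (2 * s))"
    using n_pos by (simp add: power2_eq_square field_simps)
  finally have F2sum: "(\<Sum>i\<in>{1..int n}. (\<integral>w. F2 i (?x w) \<partial>M)) \<le> 2 * (R / real n) * (moment (2 * s + 1) + 2 * moment (2 * s))" .
  have "2 * moment (2 * s + 2) = (\<Sum>i\<in>{1..int n}. 2 * (\<integral>w. F1 i (?x w) \<partial>M))"
    unfolding step by (simp add: sum_distrib_left)
  also have "\<dots> \<le> (\<Sum>i\<in>{1..int n}. (2 * real s + 1) * (\<integral>w. F2 i (?x w) \<partial>M))" by (intro sum_mono exch)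
  also have "\<dots> = (2 * real s + 1) * (\<Sum>i\<in>{1..int n}. (\<integral>w. F2 i (?x w) \<partial>M))" by (simp add: sum_distrib_left)
  also have "\<dots> \<le> (2 * real s + 1) * (2 * (R / real n) * (moment (2 * s + 1) + 2 * moment (2 * s)))"
    using F2sum by (intro mult_left_mono) auto
  also have "\<dots> = 2 * ((2 * real s + 1) * (R / real n) * (moment (2 * s + 1) + 2 * moment (2 * s)))" by simp
  finally show ?thesis by (simp only: mult_le_cancel_left_pos[OF zero_less_numeral])
qed

lemma moment_even_nonneg: "0 \<le> moment (2 * s)"
  unfolding moment_def
proof (rule Bochner_Integration.integral_nonneg)
  fix w
  show "0 \<le> mat_trace (G (\<lambda>i. X i w) ^\<^sub>m (2 * s))"
    using mat_trace_pow_even[OF gram_deviation_carrier gram_deviation_symmetric, of K p n "\<lambda>i. X i w" s s]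
      mat_trace_transpose_self_nonneg[of "G (\<lambda>i. X i w) ^\<^sub>m s" K K] by (simp add: mult_2)
qed

text \<open>Arithmetic-geometric mean inequality for \<open>G\<^sup>s\<close> and \<open>G\<^sup>s\<^sup>+\<^sup>1\<close>.\<close>

lemma moment_odd_le: "moment (2 * s + 1) \<le> (moment (2 * s) + moment (2 * s + 2)) / 2"
proof -
  have GJ: "sample_mat J S K G" by (auto intro: G_sample_mat)
  have mi: "integrable M (\<lambda>w. mat_trace (G (\<lambda>i. X i w) ^\<^sub>m t))" for t
    by (rule integrable_trace[OF sample_mat_pow[OF GJ]])
  have "mat_trace (G x ^\<^sub>m (2 * s + 1)) \<le> (mat_trace (G x ^\<^sub>m (2 * s)) + mat_trace (G x ^\<^sub>m (2 * s + 2))) / 2" for x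
  proof -
    have e: "s + Suc s = 2 * s + 1" "s + s = 2 * s" "Suc s + Suc s = 2 * s + 2" by auto
    note tr = mat_trace_pow_even[OF gram_deviation_carrier gram_deviation_symmetric, of K p n x]
    have "mat_trace (G x ^\<^sub>m (s + Suc s)) \<le> (mat_trace (G x ^\<^sub>m (s + s)) + mat_trace (G x ^\<^sub>m (Suc s + Suc s))) / 2"
      unfolding tr by (rule mat_trace_arith_geo[of _ K K]) (rule pow_carrier_mat[OF gram_deviation_carrier])+
    then show ?thesis unfolding e .
  qed
  then have "moment (2 * s + 1) \<le> (\<integral>w. (mat_trace (G (\<lambda>i. X i w) ^\<^sub>m (2 * s)) + mat_trace (G (\<lambda>i. X i w) ^\<^sub>m (2 * s + 2))) / 2 \<partial>M)"
    unfolding moment_def using mi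
    by (intro integral_mono Bochner_Integration.integrable_divide Bochner_Integration.integrable_add) blast+
  also have "\<dots> = (moment (2 * s) + moment (2 * s + 2)) / 2"
    unfolding moment_def using mi[of "2 * s"] mi[of "2 * s + 2"] by (simp del: pow_mat.simps)
  finally show ?thesis .
qed

text \<open>The odd moment in the recursion is replaced by the mean of its neighbours.  Its even part of the
  higher order carries a factor of at most one half and is absorbed by the left-hand side.\<close>

lemma moment_bound:
  assumes "2 * real P * (R / real n) \<le> 1" "s \<le> P"
  shows "moment (2 * s) \<le> (10 * real P * (R / real n)) ^ s * real K"
  using assms(2)
proof (induction s)
  case 0
  have "moment 0 = real K" by (simp add: moment_def mat_trace_def prob_space)
  then show ?case by simp
next
  case (Suc s)
  define \<eta> where "\<eta> = (2 * real s + 1) * (R / real n)"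
  have \<eta>0: "0 \<le> \<eta>" unfolding \<eta>_def using R_nonneg by simp
  have \<eta>P: "\<eta> \<le> 2 * real P * (R / real n)" unfolding \<eta>_def using R_nonneg Suc(2)
    by (intro mult_right_mono) auto
  have "moment (2 * s + 2) \<le> \<eta> * (moment (2 * s + 1) + 2 * moment (2 * s))"
    using moment_recursion[of s] by (simp add: \<eta>_def)
  also have "\<dots> \<le> \<eta> * ((moment (2 * s) + moment (2 * s + 2)) / 2 + 2 * moment (2 * s))"
    using \<eta>0 moment_odd_le[of s] by (intro mult_left_mono) auto
  also have "\<dots> = \<eta> / 2 * moment (2 * s + 2) + 5 / 2 * \<eta> * moment (2 * s)" by (simp add: field_simps)
  also have "\<dots> \<le> 1 / 2 * moment (2 * s + 2) + 5 / 2 * \<eta> * moment (2 * s)"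
    using \<eta>P assms(1) moment_even_nonneg[of "Suc s"] by (intro add_right_mono mult_right_mono) auto
  finally have "moment (2 * s + 2) \<le> 5 * \<eta> * moment (2 * s)" by simp
  also have "\<dots> \<le> 10 * real P * (R / real n) * moment (2 * s)"
    using \<eta>P moment_even_nonneg[of s] by (intro mult_right_mono) auto
  also have "\<dots> \<le> 10 * real P * (R / real n) * ((10 * real P * (R / real n)) ^ s * real K)"
    using Suc R_nonneg by (intro mult_left_mono) auto
  finally show ?case by (simp add: mult_ac)
qed

text \<open>Markov's inequality for the trace of the power \<open>2 P\<close>, which dominates the same power of the spectral norm.\<close>

lemma spectral_norm_tail:
  assumes P: "P \<ge> 1" "2 * real P * (R / real n) \<le> 1" and e: "e > 0"
  shows "\<exists>A\<in>sets M. (\<forall>w\<in>A. spectral_norm (G (\<lambda>i. X i w)) \<le> e) \<and>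
    measure M A \<ge> 1 - (10 * real P * (R / real n) / e\<^sup>2) ^ P * real K"
proof -
  let ?T = "\<lambda>w. mat_trace (G (\<lambda>i. X i w) ^\<^sub>m (2 * P))"
  define A where "A = {w \<in> space M. ?T w \<le> e ^ (2 * P)}"
  have GJ: "sample_mat J S K G" by (auto intro: G_sample_mat)
  have int: "integrable M ?T" by (rule integrable_trace[OF sample_mat_pow[OF GJ]])
  then have meas[measurable]: "?T \<in> borel_measurable M" by auto
  have A: "A \<in> sets M" unfolding A_def by measurable
  have nonneg: "0 \<le> ?T w" for w
    using mat_trace_pow_even[OF gram_deviation_carrier gram_deviation_symmetric, of K p n "\<lambda>i. X i w" P P]
      mat_trace_transpose_self_nonneg[of "G (\<lambda>i. X i w) ^\<^sub>m P" K K] by (simp add: mult_2)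
  have "prob (space M - A) \<le> prob {w \<in> space M. e ^ (2 * P) \<le> ?T w}"
    by (intro finite_measure_mono) (auto simp: A_def)
  also have "\<dots> \<le> moment (2 * P) / e ^ (2 * P)"
    unfolding moment_def using e nonneg by (intro integral_Markov_inequality_measure[OF int, of "{}"]) auto
  also have "\<dots> \<le> (10 * real P * (R / real n)) ^ P * real K / e ^ (2 * P)"
    using moment_bound[OF P(2), of P] e by (intro divide_right_mono) auto
  also have "\<dots> = (10 * real P * (R / real n) / e\<^sup>2) ^ P * real K"
    unfolding power_divide[of "10 * real P * (R / real n)" "e\<^sup>2"] power_mult[of e 2 P] by simp
  finally have "measure M A \<ge> 1 - (10 * real P * (R / real n) / e\<^sup>2) ^ P * real K"
    using prob_compl[OF A] by simp
  moreover have "\<forall>w\<in>A. spectral_norm (G (\<lambda>i. X i w)) \<le> e"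
    using spectral_norm_le_of_trace_pow[OF gram_deviation_carrier gram_deviation_symmetric P(1) e]
    by (auto simp: A_def)
  ultimately show ?thesis using A by blast
qed

end

section \<open>A martingale central limit theorem\<close>

text \<open>The function \<open>(1 + i x) exp (- x\<^sup>2 / 2)\<close> agrees with \<open>exp (i x)\<close> up to the second order, and both are
  bounded by \<open>1\<close> in modulus.\<close>

lemma iexp_minus_gaussian_factor_le:
  fixes x :: real
  shows "cmod (iexp x - (1 + \<i> * x) * exp (- (x\<^sup>2) / 2)) \<le> 2 * \<bar>x\<bar> ^ 3"
proof -
  let ?w = "(1 + \<i> * x) * exp (- (x\<^sup>2) / 2)"
  have w1: "cmod ?w \<le> 1"
  proof -
    have "(cmod ?w)\<^sup>2 = (1 + x\<^sup>2) * exp (- x\<^sup>2)"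
      by (simp add: norm_mult power_mult_distrib cmod_power2 flip: exp_double exp_of_real)
    also have "\<dots> \<le> exp (x\<^sup>2) * exp (- x\<^sup>2)" by (intro mult_right_mono exp_ge_add_one_self) auto
    also have "\<dots> = 1" by (simp add: exp_add[symmetric])
    finally show ?thesis by (simp add: power2_le_iff_abs_le[of 1, simplified])
  qed
  show ?thesis
  proof (cases "\<bar>x\<bar> \<le> 1")
    case False
    have "cmod (iexp x - ?w) \<le> cmod (iexp x) + cmod ?w" by (rule norm_triangle_ineq4)
    also have "\<dots> \<le> 2 * 1" using w1 by simp
    also have "\<dots> \<le> 2 * \<bar>x\<bar> ^ 3" using False by (intro mult_left_mono one_le_power) auto
    finally show ?thesis .
  next
    case True
    define y where "y = x\<^sup>2 / 2"
    have y0: "y \<ge> 0" by (simp add: y_def)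
    have e1: "1 - exp (- y) \<le> y" using exp_ge_add_one_self[of "- y"] by simp
    have e0: "0 \<le> 1 - exp (- y)" using y0 by simp
    have e2: "y - (1 - exp (- y)) \<le> y\<^sup>2 / 2"
    proof -
      have "exp (- y) \<le> 1 - y + y\<^sup>2 / 2"
      proof -
        have pos: "0 < 1 + y + y\<^sup>2 / 2" using y0 by (intro add_pos_nonneg) auto
        have "exp (- y) * (1 + y + y\<^sup>2 / 2) \<le> exp (- y) * exp y"
          using exp_lower_Taylor_quadratic[OF y0] by (intro mult_left_mono) auto
        also have "\<dots> = 1" by (simp add: exp_add[symmetric])
        also have "1 \<le> 1 + (y\<^sup>2)\<^sup>2 / 4" by simp
        also have "\<dots> = (1 - y + y\<^sup>2 / 2) * (1 + y + y\<^sup>2 / 2)" by (simp add: power2_eq_square field_simps)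
        finally show ?thesis using pos by (simp only: mult_le_cancel_right_pos)
      qed
      then show ?thesis by simp
    qed
    have a: "cmod (iexp x - (1 + \<i> * x - x\<^sup>2 / 2)) \<le> \<bar>x\<bar> ^ 3 / 6"
      using iexp_approx1[of x 2] by (simp add: numeral_3_eq_3 numeral_2_eq_2 power2_eq_square field_simps)
    have b: "cmod ((1 + \<i> * x - x\<^sup>2 / 2) - ?w) \<le> y\<^sup>2 / 2 + \<bar>x\<bar> * y"
    proof -
      have "(1 + \<i> * x - x\<^sup>2 / 2) - ?w = complex_of_real (- (y - (1 - exp (- y)))) + \<i> * complex_of_real (x * (1 - exp (- y)))"
        by (simp add: y_def algebra_simps)
      also have "cmod \<dots> \<le> \<bar>y - (1 - exp (- y))\<bar> + \<bar>x * (1 - exp (- y))\<bar>"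
        by (rule order_trans[OF norm_triangle_ineq]) (simp add: norm_mult del: of_real_minus of_real_diff of_real_mult)
      also have "\<bar>y - (1 - exp (- y))\<bar> \<le> y\<^sup>2 / 2" using e1 e2 by simp
      also have "\<bar>x * (1 - exp (- y))\<bar> \<le> \<bar>x\<bar> * y"
        unfolding abs_mult using e0 e1 by (intro mult_left_mono) auto
      finally show ?thesis by simp
    qed
    have c: "y\<^sup>2 / 2 + \<bar>x\<bar> * y \<le> 5 / 8 * \<bar>x\<bar> ^ 3"
    proof -
      have "\<bar>x\<bar> * y = \<bar>x\<bar> ^ 3 / 2" by (simp add: y_def power3_eq_cube power2_eq_square)
      moreover have "y\<^sup>2 / 2 = \<bar>x\<bar> ^ 3 * \<bar>x\<bar> / 8"
        by (simp add: y_def power3_eq_cube power2_eq_square)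
      moreover have "\<bar>x\<bar> ^ 3 * \<bar>x\<bar> \<le> \<bar>x\<bar> ^ 3 * 1" using True by (intro mult_left_mono) auto
      ultimately show ?thesis by simp
    qed
    have "cmod (iexp x - ?w) \<le> cmod (iexp x - (1 + \<i> * x - x\<^sup>2 / 2)) + cmod ((1 + \<i> * x - x\<^sup>2 / 2) - ?w)"
      using norm_triangle_ineq[of "iexp x - (1 + \<i> * x - x\<^sup>2 / 2)" "(1 + \<i> * x - x\<^sup>2 / 2) - ?w"] by simp
    also have "\<dots> \<le> \<bar>x\<bar> ^ 3 / 6 + 5 / 8 * \<bar>x\<bar> ^ 3" using a b c by linarith
    also have "\<dots> \<le> 2 * \<bar>x\<bar> ^ 3" by simp
    finally show ?thesis .
  qed
qed

context prob_space
begin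

text \<open>A finite stretch of martingale differences, given by their orthogonality to the bounded
  functions of the past.\<close>

definition mds_upto :: "nat \<Rightarrow> (nat \<Rightarrow> 'a measure) \<Rightarrow> (nat \<Rightarrow> 'a \<Rightarrow> real) \<Rightarrow> bool" where
  "mds_upto n F \<xi> \<longleftrightarrow> (\<forall>k<n. subalgebra M (F k) \<and> \<xi> k \<in> borel_measurable M \<and>
     (\<forall>j<k. \<xi> j \<in> borel_measurable (F k)) \<and>
     (\<forall>g B. g \<in> borel_measurable (F k) \<longrightarrow> (\<forall>w. \<bar>g w\<bar> \<le> B) \<longrightarrow>
        integrable M (\<lambda>w. \<xi> k w * g w) \<and> (\<integral>w. \<xi> k w * g w \<partial>M) = 0))"

definition sq_sum :: "(nat \<Rightarrow> 'a \<Rightarrow> real) \<Rightarrow> nat \<Rightarrow> 'a \<Rightarrow> real" where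
  "sq_sum \<xi> k w = (\<Sum>j<k. (\<xi> j w)\<^sup>2)"

text \<open>McLeish's product: the differences are switched off once the squared sum has exceeded \<open>2\<close>,
  which keeps the product square integrable without changing it where the squared sum is close to
  \<open>1\<close>.\<close>

definition mcleish_prod :: "real \<Rightarrow> (nat \<Rightarrow> 'a \<Rightarrow> real) \<Rightarrow> nat \<Rightarrow> 'a \<Rightarrow> complex" where
  "mcleish_prod t \<xi> k w = (\<Prod>j<k. 1 + \<i> * complex_of_real (t * (\<xi> j w * (if sq_sum \<xi> j w \<le> 2 then 1 else 0))))"

lemma mcleish_prod_Suc:
  "mcleish_prod t \<xi> (Suc k) w = mcleish_prod t \<xi> k w +
    \<i> * t * (\<xi> k w * ((if sq_sum \<xi> k w \<le> 2 then 1 else 0) * mcleish_prod t \<xi> k w))"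
  by (simp add: mcleish_prod_def algebra_simps)

text \<open>While the squared sum stays below \<open>2\<close> the bound \<open>1 + x \<le> exp x\<close> applies to every factor.  The first
  difference that carries it above \<open>2\<close> may be arbitrarily large; it contributes one factor \<open>1 + t\<^sup>2 x\<^sup>2\<close>,
  and all later factors are \<open>1\<close>.\<close>

lemma mcleish_prod_norm:
  "(sq_sum \<xi> k w \<le> 2 \<longrightarrow> (cmod (mcleish_prod t \<xi> k w))\<^sup>2 \<le> exp (t\<^sup>2 * sq_sum \<xi> k w)) \<and>
   (cmod (mcleish_prod t \<xi> k w))\<^sup>2 \<le> exp (2 * t\<^sup>2) * (1 + t\<^sup>2 * sq_sum \<xi> k w)"
proof (induction k)
  case 0
  then show ?case by (simp add: mcleish_prod_def sq_sum_def)
next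
  case (Suc k)
  let ?P = "\<lambda>k. (cmod (mcleish_prod t \<xi> k w))\<^sup>2" and ?B = "\<lambda>k. sq_sum \<xi> k w" and ?x = "\<xi> k w"
  have BS: "?B (Suc k) = ?B k + ?x\<^sup>2" by (simp add: sq_sum_def)
  have B0: "?B k \<ge> 0" by (simp add: sq_sum_def sum_nonneg)
  show ?case
  proof (cases "?B k \<le> 2")
    case True
    have P: "?P (Suc k) = ?P k * (1 + t\<^sup>2 * ?x\<^sup>2)"
    proof -
      have "(cmod (1 + \<i> * complex_of_real (t * ?x)))\<^sup>2 = 1 + t\<^sup>2 * ?x\<^sup>2"
        by (simp add: cmod_power2 power_mult_distrib)
      then show ?thesis using True by (simp add: mcleish_prod_def norm_mult power_mult_distrib)
    qed
    have IH: "?P k \<le> exp (t\<^sup>2 * ?B k)" using Suc True by blast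
    have a: "?P (Suc k) \<le> exp (t\<^sup>2 * ?B k) * (1 + t\<^sup>2 * ?x\<^sup>2)"
      unfolding P using IH by (intro mult_right_mono) (auto intro: add_nonneg_nonneg)
    have "exp (t\<^sup>2 * ?B k) * (1 + t\<^sup>2 * ?x\<^sup>2) \<le> exp (t\<^sup>2 * ?B k) * exp (t\<^sup>2 * ?x\<^sup>2)"
      by (intro mult_left_mono exp_ge_add_one_self) auto
    also have "\<dots> = exp (t\<^sup>2 * ?B (Suc k))" by (simp add: BS exp_add[symmetric] distrib_left)
    finally have b: "?P (Suc k) \<le> exp (t\<^sup>2 * ?B (Suc k))" using a by linarith
    have "exp (t\<^sup>2 * ?B k) * (1 + t\<^sup>2 * ?x\<^sup>2) \<le> exp (2 * t\<^sup>2) * (1 + t\<^sup>2 * ?B (Suc k))"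
    proof (rule mult_mono)
      show "exp (t\<^sup>2 * ?B k) \<le> exp (2 * t\<^sup>2)" using mult_left_mono[OF True, of "t\<^sup>2"] by (simp add: mult.commute)
      show "1 + t\<^sup>2 * ?x\<^sup>2 \<le> 1 + t\<^sup>2 * ?B (Suc k)" using B0 by (intro add_left_mono mult_left_mono) (auto simp: BS)
    qed auto
    then show ?thesis using a b by linarith
  next
    case False
    have "?P (Suc k) = ?P k" using False by (simp add: mcleish_prod_def)
    also have "\<dots> \<le> exp (2 * t\<^sup>2) * (1 + t\<^sup>2 * ?B k)" using Suc by blast
    also have "\<dots> \<le> exp (2 * t\<^sup>2) * (1 + t\<^sup>2 * ?B (Suc k))"
      by (intro mult_left_mono add_left_mono) (auto simp: BS)
    finally show ?thesis using False BS zero_le_power2[of ?x] by linarith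
  qed
qed

text \<open>Every new factor is \<open>1\<close> plus a multiple of the next martingale difference with a coefficient that
  depends on the past only.  That coefficient is bounded because the product so far is switched off
  once the squared sum exceeds \<open>2\<close>.\<close>

lemma mcleish_prod_integral:
  assumes mds: "mds_upto n F \<xi>" and k: "k \<le> n"
  shows "integrable M (mcleish_prod t \<xi> k) \<and> (\<integral>w. mcleish_prod t \<xi> k w \<partial>M) = 1"
  using k
proof (induction k)
  case 0
  then show ?case by (simp add: mcleish_prod_def prob_space)
next
  case (Suc k)
  then have k: "k < n" by simp
  let ?T = "\<lambda>w. (if sq_sum \<xi> k w \<le> 2 then 1 else 0) * mcleish_prod t \<xi> k w"
  have past: "\<And>j. j < k \<Longrightarrow> \<xi> j \<in> borel_measurable (F k)"
    and orth: "\<And>g B. g \<in> borel_measurable (F k) \<Longrightarrow> (\<And>w. \<bar>g w\<bar> \<le> B) \<Longrightarrow>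
        integrable M (\<lambda>w. \<xi> k w * g w) \<and> (\<integral>w. \<xi> k w * g w \<partial>M) = 0"
    using mds k unfolding mds_upto_def by blast+
  have sqm: "sq_sum \<xi> i \<in> borel_measurable (F k)" if "i \<le> k" for i
    unfolding sq_sum_def[abs_def] using past that by (intro borel_measurable_sum borel_measurable_power) auto
  have ind: "(\<lambda>w. if sq_sum \<xi> i w \<le> 2 then 1 else 0 :: real) \<in> borel_measurable (F k)" if "i \<le> k" for i
    using sqm[OF that] by measurable
  have Tm: "mcleish_prod t \<xi> k \<in> borel_measurable (F k)"
    unfolding mcleish_prod_def[abs_def] using past ind
    by (intro borel_measurable_prod borel_measurable_add borel_measurable_times borel_measurable_const
        borel_measurable_of_real) auto
  have "(\<lambda>w. complex_of_real (if sq_sum \<xi> k w \<le> 2 then 1 else 0) * mcleish_prod t \<xi> k w) \<in> borel_measurable (F k)"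
    using Tm ind[of k] by (intro borel_measurable_times borel_measurable_of_real) auto
  moreover have "(\<lambda>w. complex_of_real (if sq_sum \<xi> k w \<le> 2 then 1 else 0) * mcleish_prod t \<xi> k w) = ?T" by auto
  ultimately have Tm': "?T \<in> borel_measurable (F k)" by simp
  have bound: "cmod (?T w) \<le> exp (t\<^sup>2)" for w
  proof (cases "sq_sum \<xi> k w \<le> 2")
    case True
    then have "(cmod (mcleish_prod t \<xi> k w))\<^sup>2 \<le> exp (t\<^sup>2 * sq_sum \<xi> k w)" using mcleish_prod_norm by blast
    also have "\<dots> \<le> exp (2 * t\<^sup>2)" using mult_left_mono[OF True, of "t\<^sup>2"] by (simp add: mult.commute)
    also have "\<dots> = (exp (t\<^sup>2))\<^sup>2" by (simp add: exp_double)
    finally have "cmod (mcleish_prod t \<xi> k w) \<le> exp (t\<^sup>2)" by (rule power2_le_imp_le) auto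
    then show ?thesis using True by simp
  qed auto
  have Re: "integrable M (\<lambda>w. \<xi> k w * Re (?T w)) \<and> (\<integral>w. \<xi> k w * Re (?T w) \<partial>M) = 0"
    by (rule orth[of _ "exp (t\<^sup>2)"], rule measurable_compose[OF Tm' borel_measurable_Re], rule order_trans[OF abs_Re_le_cmod bound])
  have Im: "integrable M (\<lambda>w. \<xi> k w * Im (?T w)) \<and> (\<integral>w. \<xi> k w * Im (?T w) \<partial>M) = 0"
    by (rule orth[of _ "exp (t\<^sup>2)"], rule measurable_compose[OF Tm' borel_measurable_Im], rule order_trans[OF abs_Im_le_cmod bound])
  have dec: "complex_of_real (\<xi> k w) * ?T w = complex_of_real (\<xi> k w * Re (?T w)) + \<i> * complex_of_real (\<xi> k w * Im (?T w))" for w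
    by (subst complex_eq[of "?T w"]) (simp add: algebra_simps)
  have int: "integrable M (\<lambda>w. complex_of_real (\<xi> k w) * ?T w)"
    unfolding dec using Re Im by (intro Bochner_Integration.integrable_add integrable_mult_right integrable_of_real) auto
  have zero: "(\<integral>w. complex_of_real (\<xi> k w) * ?T w \<partial>M) = 0"
    unfolding dec using Re Im by (subst Bochner_Integration.integral_add) (auto simp del: of_real_mult)
  have eq: "mcleish_prod t \<xi> (Suc k) = (\<lambda>w. mcleish_prod t \<xi> k w + \<i> * t * (complex_of_real (\<xi> k w) * ?T w))"
    by (rule ext) (rule mcleish_prod_Suc)
  have IH: "integrable M (mcleish_prod t \<xi> k)" "(\<integral>w. mcleish_prod t \<xi> k w \<partial>M) = 1" using Suc by auto
  have int': "integrable M (\<lambda>w. \<i> * t * (complex_of_real (\<xi> k w) * ?T w))" by (intro integrable_mult_right int)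
  show ?case
    unfolding eq using Bochner_Integration.integral_add[OF IH(1) int'] Bochner_Integration.integrable_add[OF IH(1) int'] IH(2) zero
    by (simp only: Bochner_Integration.integral_mult_right_zero) simp
qed

text \<open>On the good event \<open>exp (i t S)\<close> is close to \<open>exp (- t\<^sup>2 / 2)\<close> times McLeish's product, and the product
  has expectation \<open>1\<close>.  On the exceptional event, of probability at most \<open>\<delta>\<^sup>2\<close>, the modulus of the
  product is controlled in \<open>L\<^sup>2\<close>, which leaves a contribution of order \<open>\<delta>\<close>.\<close>

lemma martingale_char_bound:
  fixes t \<delta> :: real
  assumes mds: "mds_upto n F \<xi>"
    and sq: "integrable M (sq_sum \<xi> n)" "(\<integral>w. sq_sum \<xi> n w \<partial>M) \<le> 1"
    and \<delta>: "0 < \<delta>" "\<delta> \<le> 1" and A: "A \<in> sets M" "measure M A \<ge> 1 - \<delta>\<^sup>2"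
    and good: "\<And>w. w \<in> A \<Longrightarrow> \<bar>sq_sum \<xi> n w - 1\<bar> \<le> \<delta>" "\<And>w i. w \<in> A \<Longrightarrow> i < n \<Longrightarrow> \<bar>\<xi> i w\<bar> \<le> \<delta>"
    and Z: "Z \<in> borel_measurable M" "\<And>w. w \<in> A \<Longrightarrow> \<bar>Z w - (\<Sum>i<n. \<xi> i w)\<bar> \<le> \<delta>"
  shows "cmod ((\<integral>w. iexp (t * Z w) \<partial>M) - exp (- (t\<^sup>2) / 2))
    \<le> \<delta> * (\<bar>t\<bar> + 4 * \<bar>t\<bar> ^ 3 + exp (t\<^sup>2) * t\<^sup>2 + 2 + exp (2 * t\<^sup>2) * (1 + t\<^sup>2))"
proof -
  let ?T = "mcleish_prod t \<xi> n" and ?S = "\<lambda>w. \<Sum>i<n. \<xi> i w" and ?Q = "sq_sum \<xi> n"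
  let ?c = "exp (- (t\<^sup>2) / 2) :: real"
  have T: "integrable M ?T" "(\<integral>w. ?T w \<partial>M) = 1" using mcleish_prod_integral[OF mds, of n t] by auto
  have onA: "cmod (iexp (t * Z w) - ?c * ?T w) \<le> \<delta> * (\<bar>t\<bar> + 4 * \<bar>t\<bar> ^ 3 + exp (t\<^sup>2) * t\<^sup>2)" if w: "w \<in> A" for w
  proof -
    have Q2: "?Q w \<le> 2" using good(1)[OF w] \<delta> by linarith
    have Qj: "sq_sum \<xi> j w \<le> 2" if "j < n" for j
    proof -
      have "sq_sum \<xi> j w \<le> ?Q w" unfolding sq_sum_def using that by (intro sum_mono2) auto
      then show ?thesis using Q2 by linarith
    qed
    let ?w = "\<lambda>i. (1 + \<i> * complex_of_real (t * \<xi> i w)) * exp (- ((t * \<xi> i w)\<^sup>2) / 2)"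
    have Te: "?T w * exp (- (t\<^sup>2 * ?Q w) / 2) = (\<Prod>i<n. ?w i)"
    proof -
      have "?T w = (\<Prod>i<n. 1 + \<i> * complex_of_real (t * \<xi> i w))"
        unfolding mcleish_prod_def using Qj by (intro prod.cong refl) auto
      moreover have "complex_of_real (exp (- (t\<^sup>2 * ?Q w) / 2)) = (\<Prod>i<n. complex_of_real (exp (- ((t * \<xi> i w)\<^sup>2) / 2)))"
        unfolding sq_sum_def of_real_prod[symmetric] exp_sum[symmetric, OF finite_lessThan]
        by (simp add: sum_distrib_left sum_divide_distrib sum_negf power_mult_distrib)
      ultimately show ?thesis by (simp only: prod.distrib)
    qed
    have wn: "cmod (?w i) \<le> 1" for i
    proof -
      let ?x = "t * \<xi> i w"
      have "(cmod (?w i))\<^sup>2 = (1 + ?x\<^sup>2) * (exp (- (?x\<^sup>2) / 2))\<^sup>2"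
        by (simp add: norm_mult power_mult_distrib cmod_power2)
      also have "(exp (- (?x\<^sup>2) / 2))\<^sup>2 = exp (- ?x\<^sup>2)" by (simp flip: exp_double)
      also have "(1 + ?x\<^sup>2) * exp (- ?x\<^sup>2) \<le> exp (?x\<^sup>2) * exp (- ?x\<^sup>2)"
        by (intro mult_right_mono exp_ge_add_one_self) auto
      also have "\<dots> = 1\<^sup>2" by (simp add: exp_add[symmetric])
      finally show ?thesis by (rule power2_le_imp_le) simp
    qed
    have Se: "iexp (t * ?S w) = (\<Prod>i<n. iexp (t * \<xi> i w))"
      by (simp add: exp_sum[symmetric] sum_distrib_left)
    have "cmod (iexp (t * ?S w) - ?T w * exp (- (t\<^sup>2 * ?Q w) / 2)) \<le> (\<Sum>i<n. cmod (iexp (t * \<xi> i w) - ?w i))"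
      unfolding Se Te using wn by (intro norm_prod_diff) auto
    also have "\<dots> \<le> (\<Sum>i<n. 2 * \<bar>t * \<xi> i w\<bar> ^ 3)"
      by (intro sum_mono iexp_minus_gaussian_factor_le)
    also have "\<dots> \<le> (\<Sum>i<n. 2 * \<bar>t\<bar> ^ 3 * (\<delta> * (\<xi> i w)\<^sup>2))"
    proof (intro sum_mono)
      fix i assume "i \<in> {..<n}"
      then have "\<bar>\<xi> i w\<bar> * \<bar>\<xi> i w\<bar>\<^sup>2 \<le> \<delta> * \<bar>\<xi> i w\<bar>\<^sup>2" using good(2)[OF w] by (intro mult_right_mono) auto
      then have "\<bar>\<xi> i w\<bar> ^ 3 \<le> \<delta> * (\<xi> i w)\<^sup>2" by (simp add: power3_eq_cube power2_eq_square mult.assoc)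
      then show "2 * \<bar>t * \<xi> i w\<bar> ^ 3 \<le> 2 * \<bar>t\<bar> ^ 3 * (\<delta> * (\<xi> i w)\<^sup>2)"
        unfolding abs_mult power_mult_distrib mult.assoc by (intro mult_left_mono) auto
    qed
    also have "\<dots> = 2 * \<bar>t\<bar> ^ 3 * (\<delta> * ?Q w)" by (simp only: sq_sum_def sum_distrib_left)
    also have "\<dots> \<le> 2 * \<bar>t\<bar> ^ 3 * (\<delta> * 2)" using Q2 \<delta> by (intro mult_left_mono) auto
    also have "\<dots> = \<delta> * (4 * \<bar>t\<bar> ^ 3)" by simp
    finally have 1: "cmod (iexp (t * ?S w) - ?T w * exp (- (t\<^sup>2 * ?Q w) / 2)) \<le> \<delta> * (4 * \<bar>t\<bar> ^ 3)" .
    have 2: "cmod (?T w * exp (- (t\<^sup>2 * ?Q w) / 2) - ?c * ?T w) \<le> \<delta> * (exp (t\<^sup>2) * t\<^sup>2)"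
    proof -
      have Tn: "cmod (?T w) \<le> exp (t\<^sup>2)"
      proof -
        have "(cmod (?T w))\<^sup>2 \<le> exp (t\<^sup>2 * ?Q w)" using mcleish_prod_norm Q2 by blast
        also have "\<dots> \<le> exp (2 * t\<^sup>2)" using mult_left_mono[OF Q2, of "t\<^sup>2"] by (simp add: mult.commute)
        also have "\<dots> = (exp (t\<^sup>2))\<^sup>2" by (simp add: exp_double)
        finally show ?thesis by (rule power2_le_imp_le) auto
      qed
      have lip: "\<bar>exp (- a) - exp (- b)\<bar> \<le> \<bar>a - b\<bar>" if "a \<ge> 0" "b \<ge> 0" for a b :: real
      proof -
        have *: "exp (- a) - exp (- b) \<le> b - a" if "a \<ge> 0" "a \<le> b" for a b :: real
        proof -
          have "exp (- a) - exp (- b) = exp (- a) * (1 - exp (- (b - a)))" by (simp add: right_diff_distrib exp_add[symmetric])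
          also have "\<dots> \<le> 1 * (b - a)" proof (intro mult_mono)
            show "1 - exp (- (b - a)) \<le> b - a" using exp_ge_add_one_self[of "- (b - a)"] by linarith
          qed (use that in auto)
          finally show ?thesis by simp
        qed
        show ?thesis using *[of a b] *[of b a] that by (cases "a \<le> b") auto
      qed
      have Q0: "?Q w \<ge> 0" by (simp add: sq_sum_def sum_nonneg)
      have "\<bar>exp (- (t\<^sup>2 * ?Q w / 2)) - exp (- (t\<^sup>2 / 2))\<bar> \<le> \<bar>t\<^sup>2 * ?Q w / 2 - t\<^sup>2 / 2\<bar>"
        using Q0 by (intro lip) auto
      also have "\<dots> = t\<^sup>2 / 2 * \<bar>?Q w - 1\<bar>"
      proof -
        have "t\<^sup>2 * ?Q w / 2 - t\<^sup>2 / 2 = t\<^sup>2 / 2 * (?Q w - 1)" by (simp add: field_simps)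
        then show ?thesis by (simp only: abs_mult) simp
      qed
      also have "\<dots> \<le> t\<^sup>2 * \<delta>" using good(1)[OF w] by (intro mult_mono) auto
      finally have e: "\<bar>exp (- (t\<^sup>2 * ?Q w) / 2) - ?c\<bar> \<le> t\<^sup>2 * \<delta>" by simp
      have "?T w * exp (- (t\<^sup>2 * ?Q w) / 2) - ?c * ?T w = ?T w * complex_of_real (exp (- (t\<^sup>2 * ?Q w) / 2) - ?c)"
        by (simp add: algebra_simps)
      also have "cmod \<dots> \<le> exp (t\<^sup>2) * (t\<^sup>2 * \<delta>)"
        unfolding norm_mult norm_of_real using Tn e by (intro mult_mono) auto
      finally show ?thesis by (simp add: mult_ac)
    qed
    have 3: "cmod (iexp (t * Z w) - iexp (t * ?S w)) \<le> \<delta> * \<bar>t\<bar>"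
    proof -
      have "iexp (t * Z w) - iexp (t * ?S w) = iexp (t * ?S w) * (iexp (t * Z w - t * ?S w) - 1)"
        by (simp add: right_diff_distrib exp_add[symmetric])
      then have "cmod (iexp (t * Z w) - iexp (t * ?S w)) = cmod (iexp (t * Z w - t * ?S w) - 1)"
        by (simp add: norm_mult)
      also have "\<dots> \<le> \<bar>t * Z w - t * ?S w\<bar>" using iexp_approx1[of "t * Z w - t * ?S w" 0] by simp
      also have "\<dots> = \<bar>t\<bar> * \<bar>Z w - ?S w\<bar>" by (simp add: right_diff_distrib[symmetric] abs_mult)
      also have "\<dots> \<le> \<bar>t\<bar> * \<delta>" using Z(2)[OF w] by (intro mult_left_mono) auto
      finally show ?thesis by (simp add: mult.commute)
    qed
    have "iexp (t * Z w) - ?c * ?T w = (iexp (t * Z w) - iexp (t * ?S w)) +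
      ((iexp (t * ?S w) - ?T w * exp (- (t\<^sup>2 * ?Q w) / 2)) + (?T w * exp (- (t\<^sup>2 * ?Q w) / 2) - ?c * ?T w))" by simp
    also have "cmod \<dots> \<le> \<delta> * \<bar>t\<bar> + (\<delta> * (4 * \<bar>t\<bar> ^ 3) + \<delta> * (exp (t\<^sup>2) * t\<^sup>2))"
      by (intro order_trans[OF norm_triangle_ineq] add_mono 1 2 3)
    finally show ?thesis by (simp add: distrib_left)
  qed
  have offA: "cmod (iexp (t * Z w) - ?c * ?T w) \<le> 1 + (\<delta> * (cmod (?T w))\<^sup>2 + 1 / \<delta>)" for w
  proof -
    have "cmod (iexp (t * Z w) - ?c * ?T w) \<le> 1 + ?c * cmod (?T w)"
      by (rule order_trans[OF norm_triangle_ineq4]) (simp add: norm_mult)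
    also have "?c * cmod (?T w) \<le> 1 * cmod (?T w)" by (intro mult_right_mono) auto
    also have "1 * cmod (?T w) \<le> \<delta> * (cmod (?T w))\<^sup>2 + 1 / \<delta>"
    proof -
      let ?u = "cmod (?T w)"
      have "0 \<le> (\<delta> * ?u - 1)\<^sup>2 + \<delta> * ?u" using \<delta> by simp
      then have "\<delta> * ?u \<le> \<delta> * (\<delta> * ?u\<^sup>2 + 1 / \<delta>)" using \<delta> by (simp add: power2_eq_square algebra_simps)
      then show ?thesis using \<delta>(1) by simp
    qed
    finally show ?thesis by simp
  qed
  define C1 where "C1 = \<bar>t\<bar> + 4 * \<bar>t\<bar> ^ 3 + exp (t\<^sup>2) * t\<^sup>2"
  have C1: "C1 \<ge> 0" by (simp add: C1_def)
  have Tsq: "(cmod (?T w))\<^sup>2 \<le> exp (2 * t\<^sup>2) * (1 + t\<^sup>2 * ?Q w)" for w using mcleish_prod_norm by blast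
  have pw: "cmod (iexp (t * Z w) - ?c * ?T w) \<le> \<delta> * C1 + (\<delta> * (exp (2 * t\<^sup>2) * (1 + t\<^sup>2 * ?Q w))
      + (1 + 1 / \<delta>) * indicator (space M - A) w)" if "w \<in> space M" for w
  proof (cases "w \<in> A")
    case True
    have "0 \<le> ?Q w" by (simp add: sq_sum_def sum_nonneg)
    then have "0 \<le> \<delta> * (exp (2 * t\<^sup>2) * (1 + t\<^sup>2 * ?Q w))" using \<delta> by simp
    then show ?thesis using onA[OF True] True by (simp add: C1_def)
  next
    case False
    have "\<delta> * (cmod (?T w))\<^sup>2 \<le> \<delta> * (exp (2 * t\<^sup>2) * (1 + t\<^sup>2 * ?Q w))" using Tsq \<delta> by (intro mult_left_mono) auto
    moreover have "0 \<le> \<delta> * C1" using \<delta> C1 by simp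
    ultimately show ?thesis using offA[of w] False that by simp
  qed
  have iZ: "integrable M (\<lambda>w. iexp (t * Z w))" using Z(1) by (intro integrable_iexp) auto
  have icT: "integrable M (\<lambda>w. ?c * ?T w)" by (intro integrable_mult_right T(1))
  have iA: "integrable M (indicator (space M - A) :: 'a \<Rightarrow> real)" using A(1) by (intro integrable_const_bound[of _ 1]) (auto simp: indicator_def)
  have PA: "prob (space M - A) \<le> \<delta>\<^sup>2" using prob_compl[OF A(1)] A(2) by simp
  have "(\<integral>w. iexp (t * Z w) \<partial>M) - exp (- (t\<^sup>2) / 2) = (\<integral>w. iexp (t * Z w) - ?c * ?T w \<partial>M)"
    using iZ icT T by (simp add: exp_of_real[symmetric])
  also have "cmod \<dots> \<le> (\<integral>w. cmod (iexp (t * Z w) - ?c * ?T w) \<partial>M)" by (rule integral_norm_bound)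
  also have "\<dots> \<le> (\<integral>w. \<delta> * C1 + (\<delta> * (exp (2 * t\<^sup>2) * (1 + t\<^sup>2 * ?Q w))
      + (1 + 1 / \<delta>) * indicator (space M - A) w) \<partial>M)"
    by (rule integral_mono; (intro integrable_norm Bochner_Integration.integrable_diff Bochner_Integration.integrable_add
        integrable_mult_right integrable_const iZ T(1) sq(1) iA | rule pw, assumption))
  also have "\<dots> = \<delta> * C1 + (\<delta> * (exp (2 * t\<^sup>2) * (1 + t\<^sup>2 * (\<integral>w. ?Q w \<partial>M))) + (1 + 1 / \<delta>) * prob (space M - A))"
    using sq(1) iA A(1) by (simp add: prob_space)
  also have "\<dots> \<le> \<delta> * C1 + (\<delta> * (exp (2 * t\<^sup>2) * (1 + t\<^sup>2 * 1)) + (1 + 1 / \<delta>) * \<delta>\<^sup>2)"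
    using sq(2) PA \<delta> by (intro add_mono mult_left_mono) auto
  also have "(1 + 1 / \<delta>) * \<delta>\<^sup>2 = \<delta> * (\<delta> + 1)" using \<delta> by (simp add: power2_eq_square field_simps)
  also have "\<dots> \<le> \<delta> * 2" using \<delta> by (intro mult_left_mono) auto
  finally show ?thesis by (simp add: C1_def algebra_simps)
qed

text \<open>Levy's continuity theorem.  The squared sum and the largest difference need to be controlled with
  high probability only, and the statistic \<open>Z\<close> needs to be close to the martingale with high
  probability only.\<close>

theorem martingale_clt:
  fixes Z :: "nat \<Rightarrow> 'a \<Rightarrow> real" and \<xi> :: "nat \<Rightarrow> nat \<Rightarrow> 'a \<Rightarrow> real"
  assumes Z: "\<And>n. Z n \<in> borel_measurable M"
    and mds: "\<forall>\<^sub>F n in sequentially. mds_upto n F (\<xi> n) \<and> integrable M (sq_sum (\<xi> n) n) \<and> (\<integral>w. sq_sum (\<xi> n) n w \<partial>M) \<le> 1"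
    and good: "\<And>\<delta>. 0 < \<delta> \<Longrightarrow> \<delta> \<le> 1 \<Longrightarrow> \<forall>\<^sub>F n in sequentially. \<exists>A\<in>sets M. measure M A \<ge> 1 - \<delta>\<^sup>2 \<and>
      (\<forall>w\<in>A. \<bar>sq_sum (\<xi> n) n w - 1\<bar> \<le> \<delta> \<and> (\<forall>i<n. \<bar>\<xi> n i w\<bar> \<le> \<delta>) \<and> \<bar>Z n w - (\<Sum>i<n. \<xi> n i w)\<bar> \<le> \<delta>)"
  shows "weak_conv_m (\<lambda>n. distr M borel (Z n)) std_normal_distribution"
proof (rule levy_continuity)
  show "real_distribution (distr M borel (Z n))" for n by (rule real_distribution_distr[OF Z])
  show "real_distribution std_normal_distribution" by (rule real_dist_normal_dist)
  fix t :: real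
  define C where "C = \<bar>t\<bar> + 4 * \<bar>t\<bar> ^ 3 + exp (t\<^sup>2) * t\<^sup>2 + 2 + exp (2 * t\<^sup>2) * (1 + t\<^sup>2)"
  have C: "C > 0" unfolding C_def by (intro add_nonneg_pos add_pos_nonneg) (auto intro!: add_nonneg_nonneg)
  have ch: "char (distr M borel (Z n)) t = (\<integral>w. iexp (t * Z n w) \<partial>M)" for n
    unfolding char_def using Z by (subst integral_distr) auto
  show "(\<lambda>n. char (distr M borel (Z n)) t) \<longlonglongrightarrow> char std_normal_distribution t"
    unfolding tendsto_iff
  proof (intro allI impI)
    fix e :: real assume e: "e > 0"
    define \<delta> where "\<delta> = min 1 (e / (2 * C))"
    have \<delta>: "0 < \<delta>" "\<delta> \<le> 1" using e C by (auto simp: \<delta>_def)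
    have "\<delta> * C \<le> e / (2 * C) * C" using C by (intro mult_right_mono) (auto simp: \<delta>_def)
    then have \<delta>C: "\<delta> * C < e" using C e by simp
    show "\<forall>\<^sub>F n in sequentially. dist (char (distr M borel (Z n)) t) (char std_normal_distribution t) < e"
      using mds good[OF \<delta>]
    proof eventually_elim
      case (elim n)
      then obtain A where A: "A \<in> sets M" "measure M A \<ge> 1 - \<delta>\<^sup>2"
        "\<And>w. w \<in> A \<Longrightarrow> \<bar>sq_sum (\<xi> n) n w - 1\<bar> \<le> \<delta>" "\<And>w i. w \<in> A \<Longrightarrow> i < n \<Longrightarrow> \<bar>\<xi> n i w\<bar> \<le> \<delta>"
        "\<And>w. w \<in> A \<Longrightarrow> \<bar>Z n w - (\<Sum>i<n. \<xi> n i w)\<bar> \<le> \<delta>" by blast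
      have "cmod ((\<integral>w. iexp (t * Z n w) \<partial>M) - exp (- (t\<^sup>2) / 2)) \<le> \<delta> * C"
        unfolding C_def by (rule martingale_char_bound[OF _ _ _ \<delta> A(1-4) Z A(5)]) (use elim in auto)
      then show ?case using \<delta>C
        by (simp add: ch dist_norm char_std_normal_distribution exp_of_real[symmetric])
    qed
  qed
qed

end

section \<open>No single observation dominates\<close>

text \<open>Stated with bounds instead of suprema, so that independence is the case in which all coefficients
  but the first are \<open>0\<close>.\<close>

definition mixing_coeffs :: "'w measure \<Rightarrow> (int \<Rightarrow> 'w \<Rightarrow> 'x::topological_space) \<Rightarrow> (nat \<Rightarrow> real) \<Rightarrow> bool" where
  "mixing_coeffs M X a \<longleftrightarrow> a \<longlonglongrightarrow> 0 \<and> (\<forall>k m A B. 1 \<le> m \<longrightarrow>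
     A \<in> sigma_sets (space M) (preimages M X {1..m}) \<longrightarrow>
     B \<in> sigma_sets (space M) (preimages M X {m + int k..}) \<longrightarrow>
     \<bar>measure M (A \<inter> B) - measure M A * measure M B\<bar> \<le> a k)"

lemma preimages_subset_sets:
  assumes "\<And>i. X i \<in> borel_measurable M"
  shows "preimages M X J \<subseteq> sets M"
proof
  fix U assume "U \<in> preimages M X J"
  then obtain j A where "U = X j -` A \<inter> space M" "A \<in> sets borel" by (auto simp: preimages_def)
  then show "U \<in> sets M" using measurable_sets[OF assms, of A j] by simp
qed

lemma sigma_sets_preimages_measurable:
  assumes "\<And>i. X i \<in> borel_measurable M" "A \<in> sigma_sets (space M) (preimages M X J)"
  shows "A \<in> sets M"
  by (rule subsetD[OF sets.sigma_sets_subset[OF preimages_subset_sets[of X M J, OF assms(1)]] assms(2)])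

lemma sigma_sets_preimages_mono:
  assumes "J \<subseteq> J'"
  shows "sigma_sets (space M) (preimages M X J) \<subseteq> sigma_sets (space M) (preimages M X J')"
proof (rule sigma_sets_mono')
  show "preimages M X J \<subseteq> preimages M X J'" using assms by (auto simp: preimages_def)
qed

context prob_space
begin

lemma prob_dependence_le_1: "\<bar>prob A - prob B * prob C\<bar> \<le> 1"
proof -
  have "0 \<le> prob B * prob C" "prob B * prob C \<le> 1" by (auto intro: mult_le_one)
  moreover have "0 \<le> prob A" "prob A \<le> 1" by auto
  ultimately show ?thesis by linarith
qed

lemma prob_Un_le: "A \<in> sets M \<Longrightarrow> B \<in> sets M \<Longrightarrow> prob (A \<union> B) \<le> prob A + prob B"
  by (rule measure_subadditive) auto

lemma weakly_dependent_mixing: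
  assumes "weakly_dependent M X"
  shows "mixing_coeffs M X (alpha_coeff M X)"
  unfolding mixing_coeffs_def
proof (intro conjI allI impI)
  show "alpha_coeff M X \<longlonglongrightarrow> 0" using assms by (simp add: weakly_dependent_def)
  fix k :: nat and m :: int and A B
  assume *: "1 \<le> m" "A \<in> sigma_sets (space M) (preimages M X {1..m})"
    "B \<in> sigma_sets (space M) (preimages M X {m + int k..})"
  show "\<bar>prob (A \<inter> B) - prob A * prob B\<bar> \<le> alpha_coeff M X k"
    unfolding alpha_coeff_def
  proof (rule cSup_upper)
    show "\<bar>prob (A \<inter> B) - prob A * prob B\<bar> \<in> {\<bar>prob (A \<inter> B) - prob A * prob B\<bar> |A B m. 1 \<le> m \<and>
      A \<in> sigma_sets (space M) (preimages M X {1..m}) \<and> B \<in> sigma_sets (space M) (preimages M X {m + int k..})}"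
      using * by blast
    show "bdd_above {\<bar>prob (A \<inter> B) - prob A * prob B\<bar> |A B m. 1 \<le> m \<and>
      A \<in> sigma_sets (space M) (preimages M X {1..m}) \<and> B \<in> sigma_sets (space M) (preimages M X {m + int k..})}"
      by (rule bdd_aboveI[of _ 1]) (auto simp: prob_dependence_le_1)
  qed
qed

lemma iid_mixing:
  fixes X :: "int \<Rightarrow> 'a \<Rightarrow> 'x::topological_space"
  assumes iid: "iid M borel X {1..}" and X: "\<And>i. X i \<in> borel_measurable M"
  shows "mixing_coeffs M X (\<lambda>k. if k = 0 then 1 else 0)"
  unfolding mixing_coeffs_def
proof (intro conjI allI impI)
  show "(\<lambda>k::nat. if k = 0 then 1 else 0 :: real) \<longlonglongrightarrow> 0"
    by (rule tendsto_eventually) (auto simp: eventually_sequentially intro!: exI[of _ 1])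
  fix k :: nat and m :: int and A B
  assume m: "1 \<le> m" and A: "A \<in> sigma_sets (space M) (preimages M X {1..m})"
    and B: "B \<in> sigma_sets (space M) (preimages M X {m + int k..})"
  show "\<bar>prob (A \<inter> B) - prob A * prob B\<bar> \<le> (if k = 0 then 1 else 0)"
  proof (cases "k = 0")
    case False
    let ?E = "\<lambda>i. {X i -` A \<inter> space M |A. A \<in> sets borel}"
    let ?I = "\<lambda>b. case_bool {1..m} {m + int k..} b"
    have pre: "preimages M X J = (\<Union>i\<in>J. ?E i)" for J by (simp add: preimages_def)
    have ind: "indep_sets ?E {1..}" using iid unfolding iid_def indep_vars_def2 by simp
    have "indep_sets (\<lambda>b. sigma_sets (space M) (\<Union>i\<in>?I b. ?E i)) UNIV"
    proof (rule indep_sets_collect_sigma)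
      show "indep_sets ?E (\<Union>b\<in>UNIV. ?I b)"
        by (rule indep_sets_mono_index[OF _ ind]) (use m in \<open>auto simp: UNIV_bool\<close>)
      show "Int_stable (?E i)" for i
      proof (rule Int_stableI)
        fix a b assume "a \<in> ?E i" "b \<in> ?E i"
        then obtain A B where "a = X i -` A \<inter> space M" "b = X i -` B \<inter> space M" "A \<in> sets borel" "B \<in> sets borel" by blast
        then have "a \<inter> b = X i -` (A \<inter> B) \<inter> space M" "A \<inter> B \<in> sets borel" by auto
        then show "a \<inter> b \<in> ?E i" by blast
      qed
      show "disjoint_family_on ?I UNIV" using False by (auto simp: disjoint_family_on_def UNIV_bool split: bool.splits)
    qed
    then have "indep_sets (case_bool (sigma_sets (space M) (preimages M X {1..m}))
        (sigma_sets (space M) (preimages M X {m + int k..}))) UNIV"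
      by (rule indep_sets_cong[THEN iffD1, rotated -1]) (auto simp: pre split: bool.splits)
    then have "indep_set (sigma_sets (space M) (preimages M X {1..m})) (sigma_sets (space M) (preimages M X {m + int k..}))"
      by (simp add: indep_set_def)
    then show ?thesis using indep_setD[OF _ A B] False by simp
  qed (simp add: prob_dependence_le_1)
qed

text \<open>Each further block is nearly independent of all the previous ones, at the cost of one mixing
  coefficient.\<close>

lemma mixing_blocks:
  assumes X: "\<And>i. X i \<in> borel_measurable M" and mix: "mixing_coeffs M X a" and k: "1 \<le> k" "k < h"
    and E: "\<And>b. E b \<in> sigma_sets (space M) (preimages M X {int (b * h) + 1..int (b * h) + int h + 1 - int k})"
    and p: "\<And>b. prob (E b) = p" and a0: "0 \<le> a k"
  shows "prob (\<Inter>b\<in>{..r}. E b) \<ge> p ^ Suc r - real r * a k \<and>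
    (\<Inter>b\<in>{..r}. E b) \<in> sigma_sets (space M) (preimages M X {1..int (Suc r * h) + 1 - int k})"
proof (induction r)
  case 0
  then show ?case using p[of 0] E[of 0] by simp
next
  case (Suc r)
  let ?C = "\<Inter>b\<in>{..r}. E b" and ?m = "int (Suc r * h) + 1 - int k"
  have p01: "0 \<le> p" "p \<le> 1" using measure_nonneg[of M "E 0"] prob_le_1[of "E 0"] unfolding p by auto
  have C: "?C \<in> sigma_sets (space M) (preimages M X {1..?m})" using Suc by blast
  have E1: "E (Suc r) \<in> sigma_sets (space M) (preimages M X {?m + int k..})"
    by (rule subsetD[OF sigma_sets_preimages_mono E[of "Suc r"]]) auto
  have split: "(\<Inter>b\<in>{..Suc r}. E b) = ?C \<inter> E (Suc r)" by (auto simp: atMost_Suc)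
  have m1: "1 \<le> ?m"
  proof -
    have "int k \<le> int h" using k by simp
    also have "int h \<le> int (Suc r * h)" by (simp only: of_nat_le_iff) simp
    finally show ?thesis by simp
  qed
  have "\<bar>prob (?C \<inter> E (Suc r)) - prob ?C * p\<bar> \<le> a k"
    using mix m1 C E1 p[of "Suc r"] unfolding mixing_coeffs_def by metis
  then have "prob (?C \<inter> E (Suc r)) \<ge> prob ?C * p - a k" by linarith
  moreover have "prob ?C * p \<ge> (p ^ Suc r - real r * a k) * p" using Suc p01 by (intro mult_right_mono) auto
  moreover have "(p ^ Suc r - real r * a k) * p \<ge> p ^ Suc (Suc r) - real r * a k"
    using mult_left_mono[OF p01(2), of "real r * a k"] a0 by (simp add: algebra_simps)
  ultimately have 1: "prob (\<Inter>b\<in>{..Suc r}. E b) \<ge> p ^ Suc (Suc r) - real (Suc r) * a k"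
    unfolding split by (simp add: algebra_simps)
  let ?J = "{1..int (Suc (Suc r) * h) + 1 - int k}"
  interpret S: sigma_algebra "space M" "sigma_sets (space M) (preimages M X ?J)"
    by (rule sigma_algebra_sigma_sets) (auto simp: preimages_def)
  have "?C \<in> sigma_sets (space M) (preimages M X ?J)"
    by (rule subsetD[OF sigma_sets_preimages_mono C]) auto
  moreover have "E (Suc r) \<in> sigma_sets (space M) (preimages M X ?J)"
    by (rule subsetD[OF sigma_sets_preimages_mono E[of "Suc r"]]) auto
  ultimately have "?C \<inter> E (Suc r) \<in> sigma_sets (space M) (preimages M X ?J)" by (rule S.Int)
  then show ?case using 1 unfolding split by simp
qed

lemma stationary_prob_exists:
  fixes X :: "int \<Rightarrow> 'a \<Rightarrow> 'x::topological_space"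
  assumes X: "\<And>i. X i \<in> borel_measurable M" and st: "strictly_stationary M borel X UNIV" and J: "finite J"
    and z: "z \<in> borel_measurable borel"
  shows "prob {w\<in>space M. \<exists>j\<in>J. z (X (j + s) w) > (d :: real)} = prob {w\<in>space M. \<exists>j\<in>J. z (X j w) > d}"
proof -
  let ?P = "Pi\<^sub>M J (\<lambda>_. borel :: 'x measure)"
  let ?U = "{x\<in>space ?P. \<exists>j\<in>J. z (x j) > d}"
  have U: "?U \<in> sets ?P"
  proof -
    have "?U = (\<Union>j\<in>J. {x\<in>space ?P. z (x j) > d})" by auto
    also have "\<dots> \<in> sets ?P"
    proof (intro sets.finite_UN J)
      fix j assume j: "j \<in> J"
      have "(\<lambda>x. z (x j)) \<in> borel_measurable ?P"
        using measurable_compose[OF measurable_component_singleton[OF j, of "\<lambda>_. borel"] z] by simp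
      then show "{x\<in>space ?P. z (x j) > d} \<in> sets ?P" by measurable
    qed
    finally show ?thesis .
  qed
  have meas: "measure (distr M ?P (\<lambda>w. \<lambda>j\<in>J. X (j + t) w)) ?U = prob {w\<in>space M. \<exists>j\<in>J. z (X (j + t) w) > d}" for t
  proof -
    have R: "(\<lambda>w. \<lambda>j\<in>J. X (j + t) w) \<in> measurable M ?P" using X by (intro measurable_restrict) auto
    have "(\<lambda>w. \<lambda>j\<in>J. X (j + t) w) -` ?U \<inter> space M = {w\<in>space M. \<exists>j\<in>J. z (X (j + t) w) > d}"
      by (auto simp: space_PiM)
    then show ?thesis using measure_distr[OF R U] by simp
  qed
  have "distr M ?P (\<lambda>w. \<lambda>j\<in>J. X (j + s) w) = distr M ?P (\<lambda>w. \<lambda>j\<in>J. X (j + 0) w)"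
    using st J unfolding strictly_stationary_def by simp
  then show ?thesis using meas[of s] meas[of 0] by simp
qed

text \<open>Cut the sample into \<open>m\<close> blocks separated by short gaps, with \<open>m d \<ge> 2\<close>.  If the maximum over a
  block exceeded \<open>d\<close> with a probability bounded away from \<open>0\<close>, then by mixing this would happen in all
  blocks at once with a probability bounded away from \<open>0\<close>, and the sum would exceed \<open>2\<close>.\<close>

lemma max_small_bound:
  fixes X :: "int \<Rightarrow> 'a \<Rightarrow> 'x::topological_space" and z :: "'x \<Rightarrow> real"
  assumes X: "\<And>i. X i \<in> borel_measurable M" and st: "strictly_stationary M borel X UNIV"
    and mix: "mixing_coeffs M X a" and a0: "0 \<le> a k" and k: "1 \<le> k"
    and z: "z \<in> borel_measurable borel" "\<And>x. 0 \<le> z x"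
    and tail: "prob {w\<in>space M. z (X 1 w) > d} \<le> q"
    and d: "d > 0" and m: "m \<ge> 1" "real m * d \<ge> 2" and n: "k < n div m"
    and \<eta>: "0 < \<eta>" "prob {w\<in>space M. (\<Sum>i\<in>{1..int n}. z (X i w)) \<ge> 2} + real m * a k \<le> \<eta> ^ m"
  shows "prob {w\<in>space M. \<exists>i\<in>{1..int n}. z (X i w) > d} \<le> real m * \<eta> + real (m * (k + 1)) * q"
proof -
  define h where "h = n div m"
  \<comment> \<open>Consecutive blocks have distance \<open>k\<close>: the last \<open>k - 1\<close> indices of each are left out.\<close>
  let ?I = "\<lambda>b. {int (b * h) + 1..int (b * h) + int h + 1 - int k}"
  define E where "E b = {w\<in>space M. \<exists>i\<in>?I b. z (X i w) > d}" for b
  define p where "p = prob (E 0)"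
  have zX[measurable]: "(\<lambda>w. z (X i w)) \<in> borel_measurable M" for i by (rule measurable_compose[OF X z(1)])
  have Es: "E b \<in> sigma_sets (space M) (preimages M X (?I b))" for b
  proof -
    interpret S: sigma_algebra "space M" "sigma_sets (space M) (preimages M X (?I b))"
      by (rule sigma_algebra_sigma_sets) (auto simp: preimages_def)
    have "E b = (\<Union>i\<in>?I b. X i -` {x. z x > d} \<inter> space M)" by (auto simp: E_def)
    also have "\<dots> \<in> sigma_sets (space M) (preimages M X (?I b))"
    proof (intro S.finite_UN finite_atLeastAtMost_int)
      fix i assume i: "i \<in> ?I b"
      have "{x. z x > d} \<in> sets borel" using borel_measurable_less[OF borel_measurable_const z(1), of d] by simp
      then have "X i -` {x. z x > d} \<inter> space M \<in> preimages M X (?I b)"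
        unfolding preimages_def using i by blast
      then show "X i -` {x. z x > d} \<inter> space M \<in> sigma_sets (space M) (preimages M X (?I b))"
        by (rule sigma_sets.Basic)
    qed
    finally show ?thesis .
  qed
  have Em: "E b \<in> sets M" for b by (rule sigma_sets_preimages_measurable[OF X Es])
  have Ep: "prob (E b) = p" for b
  proof -
    have "(\<exists>i\<in>?I b. Q i) \<longleftrightarrow> (\<exists>j\<in>?I 0. Q (j + int (b * h)))" for Q
    proof
      assume "\<exists>i\<in>?I b. Q i"
      then obtain i where "i \<in> ?I b" "Q i" by blast
      then show "\<exists>j\<in>?I 0. Q (j + int (b * h))" by (intro bexI[of _ "i - int (b * h)"]) auto
    next
      assume "\<exists>j\<in>?I 0. Q (j + int (b * h))"
      then obtain j where "j \<in> ?I 0" "Q (j + int (b * h))" by blast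
      then show "\<exists>i\<in>?I b. Q i" by (intro bexI[of _ "j + int (b * h)"]) auto
    qed
    then have "E b = {w\<in>space M. \<exists>j\<in>?I 0. z (X (j + int (b * h)) w) > d}" by (simp only: E_def)
    then show ?thesis using stationary_prob_exists[OF X st _ z(1), where J = "?I 0" and s = "int (b * h)" and d = d] by (simp add: p_def E_def)
  qed
  have "p ^ m \<le> \<eta> ^ m"
  proof -
    obtain r where r: "m = Suc r" using m by (cases m) auto
    have sub: "(\<Inter>b\<in>{..r}. E b) \<subseteq> {w\<in>space M. (\<Sum>i\<in>{1..int n}. z (X i w)) \<ge> 2}"
    proof
      fix w assume w: "w \<in> (\<Inter>b\<in>{..r}. E b)"
      then have "\<forall>b\<in>{..r}. \<exists>i. i \<in> ?I b \<and> z (X i w) > d" unfolding E_def by blast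
      from bchoice[OF this] obtain c where "\<forall>b\<in>{..r}. c b \<in> ?I b \<and> z (X (c b) w) > d" by blast
      then have c: "\<And>b. b \<le> r \<Longrightarrow> c b \<in> ?I b" "\<And>b. b \<le> r \<Longrightarrow> z (X (c b) w) > d" by blast+
      have lt: "c b < c b'" if "b < b'" "b' \<le> r" for b b'
      proof -
        have "b * h + h \<le> b' * h" using mult_le_mono1[of "Suc b" b' h] that by simp
        then have "int (b * h + h) \<le> int (b' * h)" by (simp only: of_nat_le_iff)
        then have "int (b * h) + int h \<le> int (b' * h)" by simp
        then show ?thesis using c(1)[of b] c(1)[of b'] that k by auto
      qed
      have inj: "inj_on c {..r}"
        by (rule linorder_inj_onI) (use lt in force)+
      have le_n: "int (b * h) + int h \<le> int n" if "b \<le> r" for b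
      proof -
        have "Suc b * h \<le> m * h" using that r by (intro mult_le_mono1) auto
        also have "m * h \<le> n" by (simp add: h_def)
        finally have "int (Suc b * h) \<le> int n" by (simp only: of_nat_le_iff)
        then show ?thesis by simp
      qed
      have sub: "c ` {..r} \<subseteq> {1..int n}"
      proof (rule image_subsetI)
        fix b assume "b \<in> {..r}"
        then have "c b \<in> ?I b" "int (b * h) + int h \<le> int n" using c(1) le_n by auto
        moreover have "0 \<le> int (b * h)" "1 \<le> int k" using k by auto
        ultimately show "c b \<in> {1..int n}" unfolding atLeastAtMost_iff by linarith
      qed
      have "2 \<le> real m * d" by (rule m)
      also have "\<dots> = (\<Sum>b\<in>{..r}. d)" by (simp add: r)
      also have "\<dots> \<le> (\<Sum>b\<in>{..r}. z (X (c b) w))" using c(2) by (intro sum_mono) (auto intro: less_imp_le)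
      also have "\<dots> = (\<Sum>i\<in>c ` {..r}. z (X i w))" using inj by (simp add: sum.reindex)
      also have "\<dots> \<le> (\<Sum>i\<in>{1..int n}. z (X i w))" using sub z(2) by (intro sum_mono2) auto
      finally have "2 \<le> (\<Sum>i\<in>{1..int n}. z (X i w))" .
      then show "w \<in> {w\<in>space M. (\<Sum>i\<in>{1..int n}. z (X i w)) \<ge> 2}" using w by (auto simp: E_def)
    qed
    have "p ^ m - real r * a k \<le> prob (\<Inter>b\<in>{..r}. E b)"
      using mixing_blocks[OF X mix k _ Es Ep a0, of r] n by (simp add: r h_def)
    also have "\<dots> \<le> prob {w\<in>space M. (\<Sum>i\<in>{1..int n}. z (X i w)) \<ge> 2}"
      by (rule finite_measure_mono[OF sub]) measurable
    finally show ?thesis using \<eta>(2) a0 r by (simp add: algebra_simps)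
  qed
  then have p\<eta>: "p \<le> \<eta>" using m \<eta>(1) power_mono_iff[of p \<eta> m] by (simp add: p_def)
  let ?L = "{1..int n} - (\<Union>b<m. ?I b)"
  have sub: "{w\<in>space M. \<exists>i\<in>{1..int n}. z (X i w) > d} \<subseteq> (\<Union>b<m. E b) \<union> (\<Union>i\<in>?L. {w\<in>space M. z (X i w) > d})"
    by (auto simp: E_def)
  have cardL: "card ?L \<le> m * (k + 1)"
  proof -
    have "?L \<subseteq> (\<Union>b<m. {int (b * h) + int h + 2 - int k..int (b * h) + int h}) \<union> {int (m * h) + 1..int n}"
    proof
      fix i assume i: "i \<in> ?L"
      show "i \<in> (\<Union>b<m. {int (b * h) + int h + 2 - int k..int (b * h) + int h}) \<union> {int (m * h) + 1..int n}"
      proof (cases "i \<le> int (m * h)")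
        case True
        have h0: "h > 0" using n by (simp add: h_def)
        define j where "j = nat (i - 1)"
        have j1: "i = int j + 1" using i by (auto simp: j_def)
        then have "int j < int (m * h)" using True by linarith
        then have j: "i = int j + 1" "j < m * h" using j1 by (simp_all only: of_nat_less_iff)
        define b where "b = j div h"
        have b: "b < m" using j(2) by (simp add: b_def less_mult_imp_div_less)
        have "j = b * h + j mod h" "j mod h < h" using h0 by (auto simp: b_def)
        then have "int (b * h) + 1 \<le> i" "i \<le> int (b * h) + int h" using j(1) by linarith+
        moreover have "i \<notin> ?I b" using i b by blast
        ultimately have "i \<in> {int (b * h) + int h + 2 - int k..int (b * h) + int h}"
          unfolding atLeastAtMost_iff by linarith
        then show ?thesis using b by blast
      qed (use i in auto)
    qed
    then have "card ?L \<le> card ((\<Union>b<m. {int (b * h) + int h + 2 - int k..int (b * h) + int h}) \<union> {int (m * h) + 1..int n})"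
      by (intro card_mono) auto
    also have "\<dots> \<le> (\<Sum>b<m. card {int (b * h) + int h + 2 - int k..int (b * h) + int h}) + card {int (m * h) + 1..int n}"
      by (rule order_trans[OF card_Un_le add_right_mono[OF card_UN_le]]) auto
    also have "\<dots> \<le> (\<Sum>b<m. k) + m"
    proof (intro add_mono sum_mono)
      show "card {int (b * h) + int h + 2 - int k..int (b * h) + int h} \<le> k" for b by simp
      have "n = m * h + n mod m" "n mod m < m" using m(1) by (simp_all add: h_def)
      then have "n < m * h + m" by linarith
      then have "int n < int (m * h) + int m" by (simp only: of_nat_add[symmetric] of_nat_less_iff)
      then show "card {int (m * h) + 1..int n} \<le> m" by simp
    qed
    also have "\<dots> = m * (k + 1)" by simp
    finally show ?thesis .
  qed
  have q: "prob {w\<in>space M. z (X i w) > d} \<le> q" for i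
    using stationary_prob_exists[OF X st _ z(1), where J = "{1}" and s = "i - 1" and d = d] tail by simp
  have "prob {w\<in>space M. \<exists>i\<in>{1..int n}. z (X i w) > d} \<le> prob ((\<Union>b<m. E b) \<union> (\<Union>i\<in>?L. {w\<in>space M. z (X i w) > d}))"
    using Em by (intro finite_measure_mono[OF sub]) auto
  also have "\<dots> \<le> prob (\<Union>b<m. E b) + prob (\<Union>i\<in>?L. {w\<in>space M. z (X i w) > d})"
    using Em by (intro prob_Un_le) auto
  also have "\<dots> \<le> (\<Sum>b<m. prob (E b)) + (\<Sum>i\<in>?L. prob {w\<in>space M. z (X i w) > d})"
    using Em by (intro add_mono finite_measure_subadditive_finite) auto
  also have "\<dots> \<le> real m * \<eta> + real (card ?L) * q"
  proof (rule add_mono)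
    show "(\<Sum>b<m. prob (E b)) \<le> real m * \<eta>" using p\<eta> by (simp add: Ep mult_left_mono)
    show "(\<Sum>i\<in>?L. prob {w\<in>space M. z (X i w) > d}) \<le> real (card ?L) * q" by (rule sum_bounded_above[OF q])
  qed
  also have "real (card ?L) * q \<le> real (m * (k + 1)) * q"
    using cardL q[of 1] order_trans[OF measure_nonneg q[of 1]] by (intro mult_right_mono) (simp_all only: of_nat_le_iff)
  finally show ?thesis by simp
qed

end

context prob_space
begin

text \<open>Pythagoras for square integrable summands with vanishing mixed moments.\<close>

lemma orthogonal_sum_second_moment:
  fixes W :: "'i \<Rightarrow> 'a \<Rightarrow> real"
  assumes I: "finite I" and int: "\<And>i j. i \<in> I \<Longrightarrow> j \<in> I \<Longrightarrow> integrable M (\<lambda>w. W i w * W j w)"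
    and orth: "\<And>i j. i \<in> I \<Longrightarrow> j \<in> I \<Longrightarrow> i \<noteq> j \<Longrightarrow> (\<integral>w. W i w * W j w \<partial>M) = 0"
  shows "integrable M (\<lambda>w. (\<Sum>i\<in>I. W i w)\<^sup>2)"
    "(\<integral>w. (\<Sum>i\<in>I. W i w)\<^sup>2 \<partial>M) = (\<Sum>i\<in>I. (\<integral>w. (W i w)\<^sup>2 \<partial>M))"
proof -
  have e: "(\<Sum>i\<in>I. W i w)\<^sup>2 = (\<Sum>i\<in>I. \<Sum>j\<in>I. W i w * W j w)" for w
    by (simp only: power2_eq_square sum_product)
  show "integrable M (\<lambda>w. (\<Sum>i\<in>I. W i w)\<^sup>2)"
    unfolding e using int by (intro Bochner_Integration.integrable_sum) auto
  have "(\<integral>w. (\<Sum>i\<in>I. W i w)\<^sup>2 \<partial>M) = (\<Sum>i\<in>I. (\<integral>w. (\<Sum>j\<in>I. W i w * W j w) \<partial>M))"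
    unfolding e using int by (intro Bochner_Integration.integral_sum Bochner_Integration.integrable_sum) auto
  also have "\<dots> = (\<Sum>i\<in>I. \<Sum>j\<in>I. (\<integral>w. W i w * W j w \<partial>M))"
    using int by (intro sum.cong refl Bochner_Integration.integral_sum) auto
  also have "\<dots> = (\<Sum>i\<in>I. \<Sum>j\<in>I. if i = j then (\<integral>w. (W i w)\<^sup>2 \<partial>M) else 0)"
    using orth by (intro sum.cong refl) (auto simp: power2_eq_square)
  finally show "(\<integral>w. (\<Sum>i\<in>I. W i w)\<^sup>2 \<partial>M) = (\<Sum>i\<in>I. (\<integral>w. (W i w)\<^sup>2 \<partial>M))"
    using I by (simp add: sum.delta)
qed

lemma markov_square:
  assumes "integrable M (\<lambda>w. (W w)\<^sup>2)" "e > (0 :: real)" "W \<in> borel_measurable M"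
  shows "prob {w\<in>space M. \<bar>W w\<bar> > e} \<le> (\<integral>w. (W w)\<^sup>2 \<partial>M) / e\<^sup>2"
proof -
  have "prob {w\<in>space M. \<bar>W w\<bar> > e} \<le> prob {w\<in>space M. (W w)\<^sup>2 \<ge> e\<^sup>2}"
  proof (rule finite_measure_mono)
    show "{w\<in>space M. \<bar>W w\<bar> > e} \<subseteq> {w\<in>space M. (W w)\<^sup>2 \<ge> e\<^sup>2}"
      using assms(2) by (auto simp: abs_le_square_iff[symmetric])
    show "{w\<in>space M. (W w)\<^sup>2 \<ge> e\<^sup>2} \<in> sets M" using assms(3) by measurable
  qed
  also have "\<dots> \<le> (\<integral>w. (W w)\<^sup>2 \<partial>M) / e\<^sup>2"
    using assms by (intro integral_Markov_inequality_measure[of _ _ "{}"]) auto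
  finally show ?thesis .
qed

lemma stationary_integral:
  assumes X: "\<And>i. i \<in> I \<Longrightarrow> X i \<in> measurable M S" and st: "strictly_stationary M S X I" and ij: "i \<in> I" "j \<in> I"
    and g: "g \<in> borel_measurable S"
  shows "(\<integral>w. g (X i w) \<partial>M) = (\<integral>w. (g (X j w) :: real) \<partial>M)"
    "integrable M (\<lambda>w. g (X i w)) \<longleftrightarrow> integrable M (\<lambda>w. g (X j w))"
proof -
  let ?P = "Pi\<^sub>M {j} (\<lambda>_. S)"
  have R: "(\<lambda>w. \<lambda>l\<in>{j}. X (l + s) w) \<in> measurable M ?P" if "j + s \<in> I" for s
    using X that by (intro measurable_restrict) auto
  have eq: "distr M ?P (\<lambda>w. \<lambda>l\<in>{j}. X (l + (i - j)) w) = distr M ?P (\<lambda>w. \<lambda>l\<in>{j}. X l w)"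
    using st ij unfolding strictly_stationary_def by auto
  have gm: "(\<lambda>x. g (x j)) \<in> borel_measurable ?P"
    using measurable_compose[OF measurable_component_singleton[of j "{j}" "\<lambda>_. S"] g] by simp
  have 1: "(\<integral>x. g (x j) \<partial>distr M ?P (\<lambda>w. \<lambda>l\<in>{j}. X (l + s) w)) = (\<integral>w. g (X (j + s) w) \<partial>M)"
    and 2: "integrable (distr M ?P (\<lambda>w. \<lambda>l\<in>{j}. X (l + s) w)) (\<lambda>x. g (x j)) \<longleftrightarrow> integrable M (\<lambda>w. g (X (j + s) w))"
    if "j + s \<in> I" for s
    using integral_distr[OF R[OF that] gm] integrable_distr_eq[OF R[OF that] gm] by simp_all
  show "(\<integral>w. g (X i w) \<partial>M) = (\<integral>w. g (X j w) \<partial>M)" using 1[of "i - j"] 1[of 0] ij eq by simp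
  show "integrable M (\<lambda>w. g (X i w)) \<longleftrightarrow> integrable M (\<lambda>w. g (X j w))" using 2[of "i - j"] 2[of 0] ij eq by simp
qed

text \<open>With the number of blocks fixed by \<open>d\<close>, the gap is chosen large enough for the mixing coefficient to
  be negligible.  The indices inside the gaps are boundedly many, and each of them exceeds \<open>d\<close> with a
  probability of order \<open>1 / n\<close> by Markov's inequality.\<close>

lemma max_vanishes:
  fixes X :: "int \<Rightarrow> 'a \<Rightarrow> 'x::topological_space" and z :: "nat \<Rightarrow> 'x \<Rightarrow> real"
  assumes X: "\<And>i. X i \<in> borel_measurable M" and st: "strictly_stationary M borel X UNIV"
    and mix: "mixing_coeffs M X a"
    and z: "\<And>n. z n \<in> borel_measurable borel" "\<And>n x. 0 \<le> z n x" "\<And>n. integrable M (\<lambda>w. z n (X 1 w))"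
    and mean: "\<forall>\<^sub>F n in sequentially. (\<integral>w. z n (X 1 w) \<partial>M) = 1 / real n"
    and conv: "\<And>e. e > 0 \<Longrightarrow> (\<lambda>n. prob {w\<in>space M. \<bar>(\<Sum>i\<in>{1..int n}. z n (X i w)) - 1\<bar> > e}) \<longlonglongrightarrow> 0"
    and d: "d > 0"
  shows "(\<lambda>n. prob {w\<in>space M. \<exists>i\<in>{1..int n}. z n (X i w) > d}) \<longlonglongrightarrow> 0"
proof (rule tendstoI)
  fix \<eta>0 :: real assume \<eta>0: "\<eta>0 > 0"
  have zX[measurable]: "(\<lambda>w. z n (X i w)) \<in> borel_measurable M" for n i by (rule measurable_compose[OF X z(1)])
  have a_nonneg: "0 \<le> a k" for k
  proof -
    have "\<bar>prob ({} \<inter> {}) - prob {} * prob {}\<bar> \<le> a k"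
      using mix sigma_sets.Empty unfolding mixing_coeffs_def by (metis order_refl)
    then show ?thesis by simp
  qed
  \<comment> \<open>With \<open>m\<close> values above \<open>d\<close> the sum exceeds \<open>2\<close>.\<close>
  define m where "m = nat \<lceil>2 / d\<rceil>"
  have m: "m \<ge> 1" "real m * d \<ge> 2"
  proof -
    have "2 / d \<le> real m" unfolding m_def using d by linarith
    then show "real m * d \<ge> 2" using d by (simp add: field_simps)
    have "2 / d > 0" using d by simp
    then have "real m > 0" using \<open>2 / d \<le> real m\<close> by linarith
    then show "m \<ge> 1" by simp
  qed
  define \<eta> where "\<eta> = \<eta>0 / (4 * real m)"
  have \<eta>: "\<eta> > 0" using \<eta>0 m by (simp add: \<eta>_def)
  have "a \<longlonglongrightarrow> 0" using mix by (simp add: mixing_coeffs_def)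
  then have "\<forall>\<^sub>F k in sequentially. a k < \<eta> ^ m / (2 * real m)"
    using \<eta> m by (intro order_tendstoD) auto
  then obtain k0 where k0: "\<And>k. k \<ge> k0 \<Longrightarrow> a k < \<eta> ^ m / (2 * real m)" by (auto simp: eventually_sequentially)
  define k where "k = max 1 k0"
  have k: "k \<ge> 1" "real m * a k \<le> \<eta> ^ m / 2" using k0[of k] m by (auto simp: k_def field_simps)
  have ev1: "\<forall>\<^sub>F n in sequentially. prob {w\<in>space M. \<bar>(\<Sum>i\<in>{1..int n}. z n (X i w)) - 1\<bar> > 1 / 2} < \<eta> ^ m / 2"
    using conv[of "1 / 2"] \<eta> by (intro order_tendstoD) auto
  have ev2: "\<forall>\<^sub>F n in sequentially. real (m * (k + 1)) * (1 / (real n * d)) < \<eta>0 / 2"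
  proof -
    have "(\<lambda>n. real (m * (k + 1)) / d * inverse (real n)) \<longlonglongrightarrow> real (m * (k + 1)) / d * 0"
      by (intro tendsto_mult tendsto_const LIMSEQ_inverse_real_of_nat[THEN LIMSEQ_imp_Suc])
    then have "\<forall>\<^sub>F n in sequentially. real (m * (k + 1)) / d * inverse (real n) < \<eta>0 / 2"
      using \<eta>0 by (intro order_tendstoD) auto
    then show ?thesis by eventually_elim (simp add: field_simps)
  qed
  show "\<forall>\<^sub>F n in sequentially. dist (prob {w\<in>space M. \<exists>i\<in>{1..int n}. z n (X i w) > d}) 0 < \<eta>0"
    using mean ev1 ev2 eventually_ge_at_top[of "m * (k + 1)"]
  proof eventually_elim
    case (elim n)
    have n: "k < n div m"
    proof -
      have "(m * (k + 1)) div m \<le> n div m" by (rule div_le_mono[OF elim(4)])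
      then show ?thesis using m by simp
    qed
    have "prob {w\<in>space M. z n (X 1 w) > d} \<le> prob {w\<in>space M. z n (X 1 w) \<ge> d}"
      by (intro finite_measure_mono) auto
    also have "\<dots> \<le> (\<integral>w. z n (X 1 w) \<partial>M) / d"
      using z d by (intro integral_Markov_inequality_measure[of _ _ "{}"]) auto
    also have "\<dots> = 1 / (real n * d)" using elim(1) by simp
    finally have tail: "prob {w\<in>space M. z n (X 1 w) > d} \<le> 1 / (real n * d)" .
    have "prob {w\<in>space M. (\<Sum>i\<in>{1..int n}. z n (X i w)) \<ge> 2}
        \<le> prob {w\<in>space M. \<bar>(\<Sum>i\<in>{1..int n}. z n (X i w)) - 1\<bar> > 1 / 2}"
      by (intro finite_measure_mono) auto
    then have small: "prob {w\<in>space M. (\<Sum>i\<in>{1..int n}. z n (X i w)) \<ge> 2} + real m * a k \<le> \<eta> ^ m"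
      using elim(2) k(2) by linarith
    have "prob {w\<in>space M. \<exists>i\<in>{1..int n}. z n (X i w) > d} \<le> real m * \<eta> + real (m * (k + 1)) * (1 / (real n * d))"
      by (rule max_small_bound[OF X st mix a_nonneg k(1) z(1,2) tail d m n \<eta> small])
    also have "real m * \<eta> = \<eta>0 / 4" using m by (simp add: \<eta>_def)
    finally have "prob {w\<in>space M. \<exists>i\<in>{1..int n}. z n (X i w) > d} < \<eta>0"
      using elim(3) \<eta>0 by linarith
    then show ?case by simp
  qed
qed

text \<open>The sum has mean \<open>1\<close> and is close to \<open>1\<close> with high probability, so it has no mass left on the
  unlikely event that some summand is large.\<close>

lemma lindeberg_of_mixing:
  fixes X :: "int \<Rightarrow> 'a \<Rightarrow> 'x::topological_space" and z :: "nat \<Rightarrow> 'x \<Rightarrow> real"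
  assumes X: "\<And>i. X i \<in> borel_measurable M" and st: "strictly_stationary M borel X UNIV"
    and mix: "mixing_coeffs M X a"
    and z: "\<And>n. z n \<in> borel_measurable borel" "\<And>n x. 0 \<le> z n x" "\<And>n. integrable M (\<lambda>w. z n (X 1 w))"
    and mean: "\<forall>\<^sub>F n in sequentially. (\<integral>w. z n (X 1 w) \<partial>M) = 1 / real n"
    and conv: "\<And>e. e > 0 \<Longrightarrow> (\<lambda>n. prob {w\<in>space M. \<bar>(\<Sum>i\<in>{1..int n}. z n (X i w)) - 1\<bar> > e}) \<longlonglongrightarrow> 0"
    and d: "d > 0"
  shows "(\<lambda>n. real n * (\<integral>w. z n (X 1 w) * (if z n (X 1 w) > d then 1 else 0) \<partial>M)) \<longlonglongrightarrow> 0"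
proof (rule tendstoI)
  fix e0 :: real assume e0: "e0 > 0"
  have zX[measurable]: "(\<lambda>w. z n (X i w)) \<in> borel_measurable M" for n i by (rule measurable_compose[OF X z(1)])
  define e where "e = min 1 (e0 / 4)"
  have e: "0 < e" "e \<le> 1" "e \<le> e0 / 4" using e0 by (auto simp: e_def)
  have ev1: "\<forall>\<^sub>F n in sequentially. prob {w\<in>space M. \<exists>i\<in>{1..int n}. z n (X i w) > d} < e0 / 4"
    using max_vanishes[OF X st mix z mean conv d] e0 by (intro order_tendstoD) auto
  have ev2: "\<forall>\<^sub>F n in sequentially. prob {w\<in>space M. \<bar>(\<Sum>i\<in>{1..int n}. z n (X i w)) - 1\<bar> > e} < e0 / 4"
    using conv[OF e(1)] e0 by (intro order_tendstoD) auto
  show "\<forall>\<^sub>F n in sequentially. dist (real n * (\<integral>w. z n (X 1 w) * (if z n (X 1 w) > d then 1 else 0) \<partial>M)) 0 < e0"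
    using mean ev1 ev2 eventually_gt_at_top[of 0]
  proof eventually_elim
    case (elim n)
    let ?S = "\<lambda>w. \<Sum>i\<in>{1..int n}. z n (X i w)"
    let ?E = "{w\<in>space M. \<exists>i\<in>{1..int n}. z n (X i w) > d}" and ?B = "{w\<in>space M. \<bar>?S w - 1\<bar> > e}"
    let ?g = "\<lambda>x. z n x * (if z n x > d then 1 else 0 :: real)"
    have gm: "?g \<in> borel_measurable borel" using z(1)[of n] by measurable
    have zi: "integrable M (\<lambda>w. z n (X i w))" "(\<integral>w. z n (X i w) \<partial>M) = 1 / real n" for i
      using stationary_integral[of UNIV X borel i 1 "z n"] X st z(1,3) elim(1) by auto
    have gi1: "integrable M (\<lambda>w. ?g (X i w))" for i
      using measurable_compose[OF X gm] z(2) by (intro Bochner_Integration.integrable_bound[OF zi(1)[of i]]) auto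
    have gi: "(\<integral>w. ?g (X i w) \<partial>M) = (\<integral>w. ?g (X 1 w) \<partial>M)" for i
      using stationary_integral(1)[of UNIV X borel i 1 ?g] X st gm by auto
    have E[measurable]: "?E \<in> sets M" and B[measurable]: "?B \<in> sets M" by measurable
    have iE: "integrable M (indicator ?E :: 'a \<Rightarrow> real)" "integrable M (indicator ?B :: 'a \<Rightarrow> real)"
      using E B by (auto intro!: integrable_const_bound[of _ 1] simp: indicator_def)
    have iS: "integrable M ?S" using zi by auto
    have "real n * (\<integral>w. ?g (X 1 w) \<partial>M) = (\<integral>w. (\<Sum>i\<in>{1..int n}. ?g (X i w)) \<partial>M)"
    proof -
      have "(\<integral>w. (\<Sum>i\<in>{1..int n}. ?g (X i w)) \<partial>M) = (\<Sum>i\<in>{1..int n}. (\<integral>w. ?g (X i w) \<partial>M))"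
        by (rule Bochner_Integration.integral_sum) (rule gi1)
      also have "\<dots> = (\<Sum>i\<in>{1..int n}. (\<integral>w. ?g (X 1 w) \<partial>M))" by (intro sum.cong refl gi)
      finally show ?thesis by simp
    qed
    also have "\<dots> \<le> (\<integral>w. ?S w - (1 - e) * (1 - indicator ?E w - indicator ?B w) \<partial>M)"
    proof (rule integral_mono)
      show "integrable M (\<lambda>w. \<Sum>i\<in>{1..int n}. ?g (X i w))" using gi1 by auto
      show "integrable M (\<lambda>w. ?S w - (1 - e) * (1 - indicator ?E w - indicator ?B w))"
        by (intro Bochner_Integration.integrable_diff integrable_mult_right integrable_const iS iE)
      fix w assume w: "w \<in> space M"
      have le: "(\<Sum>i\<in>{1..int n}. ?g (X i w)) \<le> ?S w" using z(2) by (intro sum_mono) auto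
      show "(\<Sum>i\<in>{1..int n}. ?g (X i w)) \<le> ?S w - (1 - e) * (1 - indicator ?E w - indicator ?B w)"
      proof (cases "w \<in> ?E \<or> w \<in> ?B")
        case True
        then have "1 - indicator ?E w - indicator ?B w \<le> (0::real)" by (auto simp: indicator_def)
        then have "(1 - e) * (1 - indicator ?E w - indicator ?B w) \<le> 0" using e by (intro mult_nonneg_nonpos) auto
        then show ?thesis using le by linarith
      next
        case False
        then have "(\<Sum>i\<in>{1..int n}. ?g (X i w)) = 0" using w by (intro sum.neutral) auto
        moreover have "?S w \<ge> 1 - e" using False w by auto
        moreover have "indicator ?E w = (0::real)" "indicator ?B w = (0::real)" using False by (auto simp: indicator_def)
        ultimately show ?thesis by simp
      qed
    qed
    also have "\<dots> = (\<integral>w. ?S w \<partial>M) - (1 - e) * (1 - prob ?E - prob ?B)"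
      using iS iE E B by (simp add: prob_space)
    also have "(\<integral>w. ?S w \<partial>M) = 1"
      using zi elim(4) by (subst Bochner_Integration.integral_sum) auto
    also have "1 - (1 - e) * (1 - prob ?E - prob ?B) \<le> e + prob ?E + prob ?B"
    proof -
      have "0 \<le> e * (prob ?E + prob ?B)" using e by simp
      then show ?thesis by (simp add: algebra_simps)
    qed
    also have "\<dots> < e0" using elim(2,3) e e0 by linarith
    finally have "real n * (\<integral>w. ?g (X 1 w) \<partial>M) < e0" .
    moreover have "0 \<le> real n * (\<integral>w. ?g (X 1 w) \<partial>M)" using z(2) by (intro mult_nonneg_nonneg Bochner_Integration.integral_nonneg) auto
    ultimately show ?case by simp
  qed
qed

text \<open>Where the noise is at most \<open>l\<close> in modulus, \<open>\<epsilon>\<^sup>2 z > d\<close> forces \<open>z > d / l\<^sup>2\<close>, and the Lindeberg condition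
  for \<open>z\<close> applies.  The part of the noise beyond \<open>l\<close> has uniformly small conditional variance.\<close>

lemma lindeberg_noise:
  fixes X1 :: "'a \<Rightarrow> 'x::topological_space" and z :: "nat \<Rightarrow> 'x \<Rightarrow> real" and \<epsilon> :: "'a \<Rightarrow> real"
  assumes X: "X1 \<in> borel_measurable M" and \<epsilon>: "\<epsilon> \<in> borel_measurable M" "integrable M (\<lambda>w. (\<epsilon> w)\<^sup>2)"
    and var: "\<And>\<phi> B. \<phi> \<in> borel_measurable borel \<Longrightarrow> (\<And>x. 0 \<le> \<phi> x) \<Longrightarrow> (\<And>x. \<phi> x \<le> B) \<Longrightarrow>
      (\<integral>w. (\<epsilon> w)\<^sup>2 * \<phi> (X1 w) \<partial>M) \<le> C * (\<integral>w. \<phi> (X1 w) \<partial>M)" and C: "C > 0"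
    and tail: "\<And>t. t > 0 \<Longrightarrow> \<exists>l>0. \<forall>\<phi> B. \<phi> \<in> borel_measurable borel \<longrightarrow> (\<forall>x. 0 \<le> \<phi> x) \<longrightarrow> (\<forall>x. \<phi> x \<le> B) \<longrightarrow>
      (\<integral>w. ((\<epsilon> w)\<^sup>2 * (if \<bar>\<epsilon> w\<bar> > l then 1 else 0)) * \<phi> (X1 w) \<partial>M) \<le> t * (\<integral>w. \<phi> (X1 w) \<partial>M)"
    and z: "\<And>n. z n \<in> borel_measurable borel" "\<And>n x. 0 \<le> z n x" "\<And>n x. z n x \<le> B n"
    and mean: "\<forall>\<^sub>F n in sequentially. (\<integral>w. z n (X1 w) \<partial>M) = 1 / real n"
    and lind: "\<And>d. d > 0 \<Longrightarrow> (\<lambda>n. real n * (\<integral>w. z n (X1 w) * (if z n (X1 w) > d then 1 else 0) \<partial>M)) \<longlonglongrightarrow> 0"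
    and d: "d > 0"
  shows "(\<lambda>n. real n * (\<integral>w. ((\<epsilon> w)\<^sup>2 * z n (X1 w)) * (if (\<epsilon> w)\<^sup>2 * z n (X1 w) > d then 1 else 0) \<partial>M)) \<longlonglongrightarrow> 0"
proof (rule tendstoI)
  fix e :: real assume e: "e > 0"
  have e2: "e / 2 > 0" using e by simp
  from tail[OF e2] obtain l where l1: "l > 0" and l2: "\<forall>\<phi> B. \<phi> \<in> borel_measurable borel \<longrightarrow> (\<forall>x. 0 \<le> \<phi> x) \<longrightarrow> (\<forall>x. \<phi> x \<le> B) \<longrightarrow>
      (\<integral>w. ((\<epsilon> w)\<^sup>2 * (if \<bar>\<epsilon> w\<bar> > l then 1 else 0)) * \<phi> (X1 w) \<partial>M) \<le> e / 2 * (\<integral>w. \<phi> (X1 w) \<partial>M)" by blast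
  have l: "l > 0" "\<And>\<phi> B. \<phi> \<in> borel_measurable borel \<Longrightarrow> (\<And>x. 0 \<le> \<phi> x) \<Longrightarrow> (\<And>x. \<phi> x \<le> B) \<Longrightarrow>
      (\<integral>w. ((\<epsilon> w)\<^sup>2 * (if \<bar>\<epsilon> w\<bar> > l then 1 else 0)) * \<phi> (X1 w) \<partial>M) \<le> e / 2 * (\<integral>w. \<phi> (X1 w) \<partial>M)"
    using l1 l2 by blast+
  have dl: "d / l\<^sup>2 > 0" using d l by simp
  have "\<forall>\<^sub>F n in sequentially. real n * (\<integral>w. z n (X1 w) * (if z n (X1 w) > d / l\<^sup>2 then 1 else 0) \<partial>M) < e / (2 * C)"
    using lind[OF dl] e C by (intro order_tendstoD) auto
  then show "\<forall>\<^sub>F n in sequentially. dist (real n * (\<integral>w. ((\<epsilon> w)\<^sup>2 * z n (X1 w)) *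
      (if (\<epsilon> w)\<^sup>2 * z n (X1 w) > d then 1 else 0) \<partial>M)) 0 < e"
    using mean eventually_gt_at_top[of 0]
  proof eventually_elim
    case (elim n)
    let ?h = "\<lambda>x. z n x * (if z n x > d / l\<^sup>2 then 1 else 0 :: real)"
    let ?w = "\<lambda>w. ((\<epsilon> w)\<^sup>2 * z n (X1 w)) * (if (\<epsilon> w)\<^sup>2 * z n (X1 w) > d then 1 else 0 :: real)"
    let ?t = "\<lambda>w. ((\<epsilon> w)\<^sup>2 * (if \<bar>\<epsilon> w\<bar> > l then 1 else 0 :: real)) * z n (X1 w)"
    have hm: "?h \<in> borel_measurable borel" using z(1)[of n] by measurable
    have h0: "0 \<le> ?h x" "?h x \<le> B n" for x using z(2,3)[of n x] by (auto intro: order_trans)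
    note [measurable] = \<epsilon>(1) measurable_compose[OF X z(1)] measurable_compose[OF X hm]
    have B0: "0 \<le> B n" using z(2)[of n undefined] z(3)[of n undefined] by linarith
    have ib: "integrable M (\<lambda>w. B n * (\<epsilon> w)\<^sup>2)" by (intro integrable_mult_right \<epsilon>(2))
    have bnd: "\<bar>(\<epsilon> w)\<^sup>2 * u\<bar> \<le> \<bar>B n * (\<epsilon> w)\<^sup>2\<bar>" if "0 \<le> u" "u \<le> B n" for u w
      using that B0 by (simp add: abs_mult mult.commute[of "B n"] mult_left_mono)
    have i1: "integrable M ?w"
    proof (rule Bochner_Integration.integrable_bound[OF ib])
      show "AE w in M. norm (?w w) \<le> norm (B n * (\<epsilon> w)\<^sup>2)" using bnd[OF z(2,3)] B0 by auto
    qed measurable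
    have i2: "integrable M ?t"
    proof (rule Bochner_Integration.integrable_bound[OF ib])
      show "AE w in M. norm (?t w) \<le> norm (B n * (\<epsilon> w)\<^sup>2)" using bnd[OF z(2,3)] B0 by auto
    qed measurable
    have i3: "integrable M (\<lambda>w. (\<epsilon> w)\<^sup>2 * ?h (X1 w))"
    proof (rule Bochner_Integration.integrable_bound[OF ib])
      show "AE w in M. norm ((\<epsilon> w)\<^sup>2 * ?h (X1 w)) \<le> norm (B n * (\<epsilon> w)\<^sup>2)"
        unfolding real_norm_def using bnd[OF h0] by (intro AE_I2)
    qed measurable
    have pw: "?w w \<le> ?t w + (\<epsilon> w)\<^sup>2 * ?h (X1 w)" for w
    proof (cases "\<bar>\<epsilon> w\<bar> > l")
      case True
      then show ?thesis using z(2)[of n "X1 w"] by auto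
    next
      case False
      then have "(\<epsilon> w)\<^sup>2 \<le> l\<^sup>2" using l(1) by (simp add: abs_le_square_iff[symmetric])
      then have "(\<epsilon> w)\<^sup>2 * z n (X1 w) \<le> l\<^sup>2 * z n (X1 w)" using z(2) by (intro mult_right_mono)
      then have "(\<epsilon> w)\<^sup>2 * z n (X1 w) > d \<Longrightarrow> z n (X1 w) > d / l\<^sup>2" using l(1) by (simp add: field_simps)
      then show ?thesis using z(2)[of n "X1 w"] by auto
    qed
    have "(\<integral>w. ?w w \<partial>M) \<le> (\<integral>w. ?t w + (\<epsilon> w)\<^sup>2 * ?h (X1 w) \<partial>M)"
      by (rule integral_mono[OF i1 Bochner_Integration.integrable_add[OF i2 i3] pw])
    also have "\<dots> = (\<integral>w. ?t w \<partial>M) + (\<integral>w. (\<epsilon> w)\<^sup>2 * ?h (X1 w) \<partial>M)" by (rule Bochner_Integration.integral_add[OF i2 i3])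
    also have "\<dots> \<le> e / 2 * (\<integral>w. z n (X1 w) \<partial>M) + C * (\<integral>w. ?h (X1 w) \<partial>M)"
      by (intro add_mono l(2)[OF z] var[OF hm h0])
    finally have "real n * (\<integral>w. ?w w \<partial>M) \<le> real n * (e / 2 * (\<integral>w. z n (X1 w) \<partial>M) + C * (\<integral>w. ?h (X1 w) \<partial>M))"
      by (intro mult_left_mono) auto
    also have "\<dots> = e / 2 + C * (real n * (\<integral>w. ?h (X1 w) \<partial>M))"
      using elim(2,3) by (simp add: distrib_left)
    also have "\<dots> < e / 2 + C * (e / (2 * C))" using elim(1) C by (intro add_strict_left_mono mult_strict_left_mono)
    also have "\<dots> = e" using C by simp
    finally have "real n * (\<integral>w. ?w w \<partial>M) < e" .
    moreover have "0 \<le> real n * (\<integral>w. ?w w \<partial>M)" using z(2) by (intro mult_nonneg_nonneg Bochner_Integration.integral_nonneg) auto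
    ultimately show ?case by simp
  qed
qed

text \<open>Truncate: the truncated sum has small variance, and the rest has small mean by the Lindeberg
  condition.\<close>

lemma wlln_triangular_iid:
  fixes P :: "int \<Rightarrow> 'a \<Rightarrow> 's" and g :: "nat \<Rightarrow> 's \<Rightarrow> real"
  assumes iid: "iid M S P {1..}"
    and g: "\<And>n. g n \<in> borel_measurable S" "\<And>n x. 0 \<le> g n x" "\<And>n. integrable M (\<lambda>w. g n (P 1 w))"
    and mean: "\<forall>\<^sub>F n in sequentially. (\<integral>w. g n (P 1 w) \<partial>M) = 1 / real n"
    and lind: "\<And>d. d > 0 \<Longrightarrow> (\<lambda>n. real n * (\<integral>w. g n (P 1 w) * (if g n (P 1 w) > d then 1 else 0) \<partial>M)) \<longlonglongrightarrow> 0"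
    and e: "e > 0"
  shows "(\<lambda>n. prob {w\<in>space M. \<bar>(\<Sum>i\<in>{1..int n}. g n (P i w)) - 1\<bar> > e}) \<longlonglongrightarrow> 0"
proof (rule tendstoI)
  fix r :: real assume r: "r > 0"
  define d where "d = e\<^sup>2 * r / 8"
  have d: "d > 0" using e r by (simp add: d_def)
  have Pm: "P i \<in> measurable M S" if "i \<ge> 1" for i using iid_measurable[OF iid] that by auto
  define \<delta> where "\<delta> = min (e / 4) (e * r / 16)"
  have \<delta>: "\<delta> > 0" "\<delta> \<le> e / 4" "\<delta> \<le> e * r / 16" using e r by (auto simp: \<delta>_def)
  have "\<forall>\<^sub>F n in sequentially. real n * (\<integral>w. g n (P 1 w) * (if g n (P 1 w) > d then 1 else 0) \<partial>M) < \<delta>"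
    using lind[OF d] \<delta>(1) by (intro order_tendstoD) auto
  then show "\<forall>\<^sub>F n in sequentially. dist (prob {w\<in>space M. \<bar>(\<Sum>i\<in>{1..int n}. g n (P i w)) - 1\<bar> > e}) 0 < r"
    using mean eventually_gt_at_top[of 0]
  proof eventually_elim
    case (elim n)
    let ?big = "\<lambda>x. g n x * (if g n x > d then 1 else 0 :: real)"
    let ?small = "\<lambda>x. g n x * (if g n x > d then 0 else 1 :: real)"
    define \<mu> where "\<mu> = (\<integral>w. ?small (P 1 w) \<partial>M)"
    define L where "L = (\<integral>w. ?big (P 1 w) \<partial>M)"
    let ?u = "\<lambda>x. ?small x - \<mu>"
    have bm: "?big \<in> borel_measurable S" and sm: "?small \<in> borel_measurable S" using g(1)[of n] by measurable
    have um: "?u \<in> borel_measurable S" using sm by measurable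
    have s_bd: "0 \<le> ?small x" "?small x \<le> d" for x using g(2)[of n x] d by auto
    have gP[measurable]: "(\<lambda>w. g n (P i w)) \<in> borel_measurable M" if "i \<in> {1..int n}" for i
      by (rule measurable_compose[OF Pm g(1)]) (use that in auto)
    have i_s: "integrable M (\<lambda>w. ?small (P i w))" if "i \<ge> 1" for i
    proof (rule integrable_const_bound[of _ d])
      show "(\<lambda>w. ?small (P i w)) \<in> borel_measurable M" by (rule measurable_compose[OF Pm[OF that] sm])
      show "AE w in M. norm (?small (P i w)) \<le> d"
        unfolding real_norm_def abs_of_nonneg[OF s_bd(1)] using s_bd(2) by (intro AE_I2)
    qed
    have i_b1: "integrable M (\<lambda>w. ?big (P 1 w))"
      using measurable_compose[OF Pm bm] g(2) by (intro Bochner_Integration.integrable_bound[OF g(3)[of n]]) auto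
    have "(\<integral>w. g n (P 1 w) \<partial>M) = (\<integral>w. ?small (P 1 w) + ?big (P 1 w) \<partial>M)"
      by (intro Bochner_Integration.integral_cong) auto
    also have "\<dots> = \<mu> + L" unfolding \<mu>_def L_def using i_s[of 1] i_b1 by (intro Bochner_Integration.integral_add) auto
    finally have \<mu>L: "\<mu> + L = 1 / real n" using elim(2) by simp
    have nL: "real n * L < \<delta>" using elim(1) by (simp add: L_def)
    have L0: "0 \<le> L" unfolding L_def using g(2) by (intro Bochner_Integration.integral_nonneg) auto
    have \<mu>0: "0 \<le> \<mu>" unfolding \<mu>_def using s_bd(1) by (intro Bochner_Integration.integral_nonneg)
    have \<mu>d: "\<mu> \<le> d"
    proof -
      have "\<mu> \<le> (\<integral>w. d \<partial>M)" unfolding \<mu>_def by (rule integral_mono[OF i_s[OF order_refl] integrable_const s_bd(2)])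
      then show ?thesis by (simp add: prob_space)
    qed
    have u_bd: "\<bar>?u x\<bar> \<le> d" for x using s_bd[of x] \<mu>0 \<mu>d by (simp add: abs_le_iff)
    have uE: "(\<integral>w. ?u (P i w) \<partial>M) = 0" if "i \<ge> 1" for i
    proof -
      have "(\<integral>w. ?u (P i w) \<partial>M) = (\<integral>w. ?u (P 1 w) \<partial>M)"
        using that by (intro iid_integral_component[OF iid _ _ um]) auto
      also have "\<dots> = \<mu> - \<mu>" unfolding \<mu>_def using i_s[of 1] by (simp add: prob_space)
      finally show ?thesis by simp
    qed
    let ?U = "\<lambda>w. \<Sum>i\<in>{1..int n}. ?u (P i w)"
    have uu: "integrable M (\<lambda>w. ?u (P i w) * ?u (P j w))" if "i \<ge> 1" "j \<ge> 1" for i j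
    proof (rule integrable_const_bound[of _ "d * d"])
      show "(\<lambda>w. ?u (P i w) * ?u (P j w)) \<in> borel_measurable M"
        by (intro borel_measurable_times measurable_compose[OF Pm[OF that(1)] um] measurable_compose[OF Pm[OF that(2)] um])
      show "AE w in M. norm (?u (P i w) * ?u (P j w)) \<le> d * d"
        unfolding real_norm_def abs_mult using u_bd d by (intro AE_I2 mult_mono) auto
    qed
    have orth: "(\<integral>w. ?u (P i w) * ?u (P j w) \<partial>M) = 0" if "i \<ge> 1" "j \<ge> 1" "i \<noteq> j" for i j
    proof -
      have "sample_fun {i} S (\<lambda>x. ?u (x i))" by (rule sample_fun_component[OF _ um u_bd]) auto
      from iid_integral_mult[OF iid _ _ _ this um u_bd, of j] that
      have "(\<integral>w. ?u (P i w) * ?u (P j w) \<partial>M) = (\<integral>w. ?u (P i w) \<partial>M) * (\<integral>w. ?u (P j w) \<partial>M)" by auto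
      then show ?thesis using uE[OF that(1)] by simp
    qed
    have U2: "integrable M (\<lambda>w. (?U w)\<^sup>2)" "(\<integral>w. (?U w)\<^sup>2 \<partial>M) = (\<Sum>i\<in>{1..int n}. (\<integral>w. (?u (P i w))\<^sup>2 \<partial>M))"
      using orthogonal_sum_second_moment[of "{1..int n}" "\<lambda>i w. ?u (P i w)"] uu orth by auto
    have u2: "(\<integral>w. (?u (P i w))\<^sup>2 \<partial>M) \<le> d / real n" if "i \<ge> 1" for i
    proof -
      have "(\<integral>w. (?u (P i w))\<^sup>2 \<partial>M) = (\<integral>w. (?u (P 1 w))\<^sup>2 \<partial>M)"
        using that um by (intro iid_integral_component[OF iid, of i 1 "\<lambda>x. (?u x)\<^sup>2"]) auto
      also have "\<dots> \<le> (\<integral>w. d * ?small (P 1 w) - 2 * \<mu> * ?small (P 1 w) + \<mu>\<^sup>2 \<partial>M)"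
      proof (rule integral_mono)
        show "integrable M (\<lambda>w. (?u (P 1 w))\<^sup>2)" using uu[of 1 1] unfolding power2_eq_square by simp
        show "integrable M (\<lambda>w. d * ?small (P 1 w) - 2 * \<mu> * ?small (P 1 w) + \<mu>\<^sup>2)"
          by (intro Bochner_Integration.integrable_add Bochner_Integration.integrable_diff integrable_mult_right integrable_const i_s order_refl)
        fix w
        have "?small (P 1 w) * ?small (P 1 w) \<le> d * ?small (P 1 w)" by (rule mult_right_mono[OF s_bd(2) s_bd(1)])
        moreover have "(s - \<mu>)\<^sup>2 \<le> d * s - 2 * \<mu> * s + \<mu>\<^sup>2" if "s * s \<le> d * s" for s :: real
          using that by (simp add: power2_eq_square algebra_simps)
        ultimately show "(?u (P 1 w))\<^sup>2 \<le> d * ?small (P 1 w) - 2 * \<mu> * ?small (P 1 w) + \<mu>\<^sup>2" by blast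
      qed
      also have "\<dots> = d * \<mu> - 2 * \<mu> * \<mu> + \<mu>\<^sup>2"
        using i_s[OF order_refl] by (simp add: prob_space \<mu>_def del: mult_if_delta mult_cancel_left)
      also have "\<dots> \<le> d * \<mu>" by (simp add: power2_eq_square \<mu>0)
      also have "\<dots> \<le> d * (1 / real n)" using \<mu>L L0 d by (intro mult_left_mono) auto
      finally show ?thesis by simp
    qed
    have "(\<integral>w. (?U w)\<^sup>2 \<partial>M) \<le> (\<Sum>i\<in>{1..int n}. d / real n)" unfolding U2(2) using u2 by (intro sum_mono) auto
    then have U2d: "(\<integral>w. (?U w)\<^sup>2 \<partial>M) \<le> d" using elim(3) by simp
    let ?R = "\<lambda>w. \<Sum>i\<in>{1..int n}. ?big (P i w)"
    have bi: "integrable M (\<lambda>w. ?big (P i w))" "(\<integral>w. ?big (P i w) \<partial>M) = L" if "i \<ge> 1" for i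
    proof -
      have di: "distr M S (P i) = distr M S (P 1)" using that by (intro iid_distr[OF iid]) auto
      show "integrable M (\<lambda>w. ?big (P i w))"
        using integrable_distr_eq[OF Pm[OF that] bm] integrable_distr_eq[OF Pm[OF order_refl] bm] i_b1 by (simp add: di)
      show "(\<integral>w. ?big (P i w) \<partial>M) = L"
        unfolding L_def using that by (intro iid_integral_component[OF iid _ _ bm]) auto
    qed
    have Ri: "integrable M ?R" using bi by auto
    have RE: "(\<integral>w. ?R w \<partial>M) = real n * L" using bi by (subst Bochner_Integration.integral_sum) auto
    have Um: "?U \<in> borel_measurable M" by (intro borel_measurable_sum measurable_compose[OF Pm um]) auto
    have R0: "0 \<le> ?R w" for w using g(2) by (intro sum_nonneg) auto
    have sub: "{w\<in>space M. \<bar>(\<Sum>i\<in>{1..int n}. g n (P i w)) - 1\<bar> > e}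
        \<subseteq> {w\<in>space M. \<bar>?U w\<bar> > e / 2} \<union> {w\<in>space M. ?R w \<ge> e / 4}"
    proof
      fix w assume w: "w \<in> {w\<in>space M. \<bar>(\<Sum>i\<in>{1..int n}. g n (P i w)) - 1\<bar> > e}"
      have "(\<Sum>i\<in>{1..int n}. g n (P i w)) = (\<Sum>i\<in>{1..int n}. (?u (P i w) + ?big (P i w)) + \<mu>)"
        by (intro sum.cong refl) auto
      also have "\<dots> = ?U w + ?R w + real n * \<mu>" unfolding sum.distrib by simp
      also have "real n * \<mu> = 1 - real n * L" using \<mu>L elim(3) by (simp add: field_simps)
      finally have "(\<Sum>i\<in>{1..int n}. g n (P i w)) - 1 = ?U w + ?R w - real n * L" by simp
      moreover have "real n * L < e / 4" "0 \<le> real n * L" using nL \<delta> L0 by auto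
      ultimately have "\<bar>?U w\<bar> > e / 2 \<or> ?R w \<ge> e / 4" using w R0[of w] by auto
      then show "w \<in> {w\<in>space M. \<bar>?U w\<bar> > e / 2} \<union> {w\<in>space M. ?R w \<ge> e / 4}" using w by auto
    qed
    have m1: "{w\<in>space M. \<bar>?U w\<bar> > e / 2} \<in> sets M" using Um by measurable
    have m2: "{w\<in>space M. ?R w \<ge> e / 4} \<in> sets M" using borel_measurable_integrable[OF Ri] by measurable
    have "prob {w\<in>space M. \<bar>(\<Sum>i\<in>{1..int n}. g n (P i w)) - 1\<bar> > e}
        \<le> prob {w\<in>space M. \<bar>?U w\<bar> > e / 2} + prob {w\<in>space M. ?R w \<ge> e / 4}"
      by (rule order_trans[OF finite_measure_mono[OF sub] prob_Un_le]) (use m1 m2 in auto)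
    also have "prob {w\<in>space M. \<bar>?U w\<bar> > e / 2} \<le> (\<integral>w. (?U w)\<^sup>2 \<partial>M) / (e / 2)\<^sup>2"
      using e by (intro markov_square U2(1) Um) auto
    also have "\<dots> \<le> d / (e / 2)\<^sup>2" using U2d by (intro divide_right_mono) auto
    also have "\<dots> = r / 2" using e by (simp add: d_def power_divide)
    also have "prob {w\<in>space M. ?R w \<ge> e / 4} \<le> real n * L / (e / 4)"
      using integral_Markov_inequality_measure[OF Ri, of "{}" "e / 4"] R0 e by (simp add: RE)
    also have "real n * L / (e / 4) \<le> \<delta> / (e / 4)" using nL e by (intro divide_right_mono) auto
    also have "\<dots> \<le> (e * r / 16) / (e / 4)" using \<delta> e by (intro divide_right_mono) auto
    also have "\<dots> = r / 4" using e by simp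
    finally show ?case using r by simp
  qed
qed

end

section \<open>Noise sums with random weights\<close>

text \<open>The determinant is a polynomial in the entries.\<close>

lemma det_measurable:
  fixes A :: "'s \<Rightarrow> real mat"
  assumes A: "\<And>x. A x \<in> carrier_mat n n"
    and meas: "\<And>i j. i < n \<Longrightarrow> j < n \<Longrightarrow> (\<lambda>x. A x $$ (i, j)) \<in> borel_measurable N"
  shows "(\<lambda>x. det (A x)) \<in> borel_measurable N"
proof -
  have "det (A x) = (\<Sum>p\<in>{p. p permutes {0..<n}}. signof p * (\<Prod>i = 0..<n. A x $$ (i, p i)))" for x
    using A[of x] by (auto simp: Determinant.det_def)
  moreover have "(\<lambda>x. \<Sum>p\<in>{p. p permutes {0..<n}}. signof p * (\<Prod>i = 0..<n. A x $$ (i, p i))) \<in> borel_measurable N"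
  proof (intro borel_measurable_sum borel_measurable_times borel_measurable_const borel_measurable_prod)
    fix p i assume "p \<in> {p. p permutes {0..<n}}" "i \<in> {0..<n}"
    then have "i < n" "p i < n" using permutes_in_image[of p "{0..<n}" i] by auto
    then show "(\<lambda>x. A x $$ (i, p i)) \<in> borel_measurable N" by (rule meas)
  qed
  ultimately show ?thesis by simp
qed

lemma adj_mat_measurable:
  fixes A :: "'s \<Rightarrow> real mat"
  assumes A: "\<And>x. A x \<in> carrier_mat n n"
    and meas: "\<And>i j. i < n \<Longrightarrow> j < n \<Longrightarrow> (\<lambda>x. A x $$ (i, j)) \<in> borel_measurable N"
    and ij: "i < n" "j < n"
  shows "(\<lambda>x. adj_mat (A x) $$ (i, j)) \<in> borel_measurable N"
proof -
  have dims: "dim_row (A x) = n" "dim_col (A x) = n" for x using A[of x] by auto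
  have e: "adj_mat (A x) $$ (i, j) = (-1) ^ (j + i) * det (mat_delete (A x) j i)" for x
    using ij dims by (simp add: adj_mat_def cofactor_def)
  have "(\<lambda>x. det (mat_delete (A x) j i)) \<in> borel_measurable N"
  proof (rule det_measurable)
    show "mat_delete (A x) j i \<in> carrier_mat (n - 1) (n - 1)" for x by (simp add: mat_delete_def dims)
    fix k l assume "k < n - 1" "l < n - 1"
    then show "(\<lambda>x. mat_delete (A x) j i $$ (k, l)) \<in> borel_measurable N"
      by (simp add: mat_delete_def dims meas)
  qed
  then show ?thesis unfolding e by (intro borel_measurable_times borel_measurable_const)
qed

text \<open>The solution of \<open>A u = g\<close> by Cramer's rule, which is a measurable function of the entries.\<close>

definition cramer_solution :: "real mat \<Rightarrow> real vec \<Rightarrow> real vec" where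
  "cramer_solution A g = ((1 / det A) \<cdot>\<^sub>m adj_mat A) *\<^sub>v g"

lemma cramer_solution_carrier:
  assumes "A \<in> carrier_mat n n" "g \<in> carrier_vec n"
  shows "cramer_solution A g \<in> carrier_vec n"
  unfolding cramer_solution_def using adj_mat(1)[OF assms(1)]
  by (intro mult_mat_vec_carrier[of _ n n] assms(2)) simp

lemma cramer_solution:
  assumes "A \<in> carrier_mat n n" "g \<in> carrier_vec n" "det A \<noteq> 0"
  shows "A *\<^sub>v cramer_solution A g = g"
proof -
  note inv = det_nonzero_inverse[OF assms(1,3)]
  have "A *\<^sub>v cramer_solution A g = (A * ((1 / det A) \<cdot>\<^sub>m adj_mat A)) *\<^sub>v g"
    unfolding cramer_solution_def by (rule assoc_mult_mat_vec[OF assms(1) inv(1) assms(2), symmetric])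
  then show ?thesis using inv(2) assms(2) by simp
qed

lemma cramer_solution_measurable:
  assumes A: "\<And>x. A x \<in> carrier_mat n n"
    and meas: "\<And>i j. i < n \<Longrightarrow> j < n \<Longrightarrow> (\<lambda>x. A x $$ (i, j)) \<in> borel_measurable N"
    and g: "g \<in> carrier_vec n" and i: "i < n"
  shows "(\<lambda>x. cramer_solution (A x) g $ i) \<in> borel_measurable N"
proof -
  have "cramer_solution (A x) g $ i = (\<Sum>j<n. 1 / det (A x) * adj_mat (A x) $$ (i, j) * g $ j)" for x
  proof -
    have ad: "adj_mat (A x) \<in> carrier_mat n n" by (rule adj_mat(1)[OF A])
    then have c: "(1 / det (A x)) \<cdot>\<^sub>m adj_mat (A x) \<in> carrier_mat n n" by simp
    show ?thesis unfolding cramer_solution_def mult_mat_vec_sum[OF c g i]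
      using ad i by (intro sum.cong refl) auto
  qed
  then show ?thesis
    using det_measurable[OF A meas] adj_mat_measurable[OF A meas i]
    by (simp only:) (intro borel_measurable_sum borel_measurable_times borel_measurable_divide borel_measurable_const; simp)
qed

context prob_space
begin

text \<open>Fubini's theorem: it is enough to compare the integrals over \<open>U\<close> for every fixed value of \<open>V\<close>.\<close>

lemma indep_integral_mono:
  fixes h k :: "'u \<times> 'u \<Rightarrow> real" and S T :: "'u measure"
  assumes ind: "indep_var S U T V" and h: "h \<in> borel_measurable (S \<Otimes>\<^sub>M T)" and k: "k \<in> borel_measurable (S \<Otimes>\<^sub>M T)"
    and hi: "integrable M (\<lambda>\<omega>. h (U \<omega>, V \<omega>))" and ki: "integrable M (\<lambda>\<omega>. k (U \<omega>, V \<omega>))"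
    and le: "\<And>v. v \<in> space T \<Longrightarrow> (\<integral>\<omega>. h (U \<omega>, v) \<partial>M) \<le> (\<integral>\<omega>. k (U \<omega>, v) \<partial>M)"
  shows "(\<integral>\<omega>. h (U \<omega>, V \<omega>) \<partial>M) \<le> (\<integral>\<omega>. k (U \<omega>, V \<omega>) \<partial>M)"
proof -
  have U: "U \<in> measurable M S" and V: "V \<in> measurable M T" using indep_var_rv1[OF ind] indep_var_rv2[OF ind] by auto
  let ?P = "distr M S U" and ?Q = "distr M T V"
  interpret P: prob_space ?P by (rule prob_space_distr[OF U])
  interpret Q: prob_space ?Q by (rule prob_space_distr[OF V])
  interpret PQ: pair_prob_space ?P ?Q ..
  have D: "distr M (S \<Otimes>\<^sub>M T) (\<lambda>\<omega>. (U \<omega>, V \<omega>)) = ?P \<Otimes>\<^sub>M ?Q"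
    using ind unfolding indep_var_distribution_eq by simp
  have UV: "(\<lambda>\<omega>. (U \<omega>, V \<omega>)) \<in> measurable M (S \<Otimes>\<^sub>M T)" using U V by measurable
  have repr: "(\<integral>\<omega>. f (U \<omega>, V \<omega>) \<partial>M) = (\<integral>v. (\<integral>\<omega>. f (U \<omega>, v) \<partial>M) \<partial>?Q)"
    "integrable ?Q (\<lambda>v. \<integral>\<omega>. f (U \<omega>, v) \<partial>M)"
    if f: "f \<in> borel_measurable (S \<Otimes>\<^sub>M T)" "integrable M (\<lambda>\<omega>. f (U \<omega>, V \<omega>))" for f :: "'u \<times> 'u \<Rightarrow> real"
  proof -
    have fi: "integrable (?P \<Otimes>\<^sub>M ?Q) (\<lambda>(u, v). f (u, v))"
      using f integrable_distr_eq[OF UV f(1)] unfolding D by simp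
    have inner: "(\<integral>u. f (u, v) \<partial>?P) = (\<integral>\<omega>. f (U \<omega>, v) \<partial>M)" if "v \<in> space T" for v
      using that by (intro integral_distr[OF U] measurable_compose[OF _ f(1)]) measurable
    have "(\<integral>\<omega>. f (U \<omega>, V \<omega>) \<partial>M) = (\<integral>w. f w \<partial>(?P \<Otimes>\<^sub>M ?Q))"
      unfolding D[symmetric] by (rule integral_distr[OF UV f(1), symmetric])
    also have "\<dots> = (\<integral>v. (\<integral>u. f (u, v) \<partial>?P) \<partial>?Q)" using PQ.integral_snd[OF fi] by simp
    also have "\<dots> = (\<integral>v. (\<integral>\<omega>. f (U \<omega>, v) \<partial>M) \<partial>?Q)"
      using inner by (intro Bochner_Integration.integral_cong refl) simp
    finally show "(\<integral>\<omega>. f (U \<omega>, V \<omega>) \<partial>M) = (\<integral>v. (\<integral>\<omega>. f (U \<omega>, v) \<partial>M) \<partial>?Q)" .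
    have "integrable ?Q (\<lambda>v. \<integral>\<omega>. f (U \<omega>, v) \<partial>M) \<longleftrightarrow> integrable ?Q (\<lambda>v. \<integral>u. f (u, v) \<partial>?P)"
      using inner by (intro Bochner_Integration.integrable_cong refl) simp
    then show "integrable ?Q (\<lambda>v. \<integral>\<omega>. f (U \<omega>, v) \<partial>M)" using PQ.integrable_snd[OF fi] by simp
  qed
  show ?thesis unfolding repr(1)[OF h hi] repr(1)[OF k ki]
    by (rule integral_mono[OF repr(2)[OF h hi] repr(2)[OF k ki]]) (use le in simp)
qed

text \<open>Weights that depend on all regressors at once: given the regressors the noise terms are
  independent, centred and have bounded variance.  The pair carrying one noise term is integrated
  first, with the others held fixed.\<close>

lemma iid_noise_sum_second_moment:
  fixes X :: "int \<Rightarrow> 'a \<Rightarrow> 'x::second_countable_topology" and \<epsilon> :: "int \<Rightarrow> 'a \<Rightarrow> real"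
    and A :: "int \<Rightarrow> (int \<Rightarrow> 'x) \<Rightarrow> real"
  assumes ind: "indep_vars (\<lambda>_. borel) (\<lambda>i w. (X i w, \<epsilon> i w)) {1..int n}"
    and X: "\<And>i. X i \<in> borel_measurable M" and \<epsilon>: "\<And>i. \<epsilon> i \<in> borel_measurable M"
    and \<epsilon>2: "\<And>i. 1 \<le> i \<Longrightarrow> integrable M (\<lambda>w. (\<epsilon> i w)\<^sup>2)"
    and centred: "\<And>i \<phi> B. 1 \<le> i \<Longrightarrow> \<phi> \<in> borel_measurable borel \<Longrightarrow> (\<And>x. \<bar>\<phi> x\<bar> \<le> B) \<Longrightarrow> (\<integral>w. \<epsilon> i w * \<phi> (X i w) \<partial>M) = 0"
    and var: "\<And>i \<phi> B. 1 \<le> i \<Longrightarrow> \<phi> \<in> borel_measurable borel \<Longrightarrow> (\<And>x. 0 \<le> \<phi> x) \<Longrightarrow> (\<And>x. \<phi> x \<le> B) \<Longrightarrow>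
      (\<integral>w. (\<epsilon> i w)\<^sup>2 * \<phi> (X i w) \<partial>M) \<le> C * (\<integral>w. \<phi> (X i w) \<partial>M)"
    and A: "\<And>i. i \<in> {1..int n} \<Longrightarrow> A i \<in> borel_measurable (Pi\<^sub>M {1..int n} (\<lambda>_. borel))"
      "\<And>i x. \<bar>A i x\<bar> \<le> B" "\<And>i x. A i (restrict x {1..int n}) = A i x"
  shows "integrable M (\<lambda>w. (\<Sum>i\<in>{1..int n}. \<epsilon> i w * A i (\<lambda>j. X j w))\<^sup>2)"
    "(\<integral>w. (\<Sum>i\<in>{1..int n}. \<epsilon> i w * A i (\<lambda>j. X j w))\<^sup>2 \<partial>M)
      \<le> C * (\<Sum>i\<in>{1..int n}. (\<integral>w. (A i (\<lambda>j. X j w))\<^sup>2 \<partial>M))"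
proof -
  let ?I = "{1..int n}" and ?x = "\<lambda>w j. X j w"
  let ?PX = "Pi\<^sub>M ?I (\<lambda>_. borel :: 'x measure)"
  let ?S = "borel :: ('x \<times> real) measure"
  have B0: "0 \<le> B" using A(2)[of undefined undefined] by linarith
  have pair[measurable]: "(\<lambda>w. (X i w, \<epsilon> i w)) \<in> measurable M ?S" for i
    using X[of i] \<epsilon>[of i] by (simp add: borel_prod[symmetric])
  have RX: "(\<lambda>w. \<lambda>j\<in>?I. X j w) \<in> measurable M ?PX" using X by (intro measurable_restrict) auto
  have comp: "(\<lambda>w. F (?x w)) \<in> borel_measurable M" if "F \<in> borel_measurable ?PX" "\<And>x. F (restrict x ?I) = F x"
    for F :: "(int \<Rightarrow> 'x) \<Rightarrow> real"
    using measurable_compose[OF RX that(1)] by (simp add: that(2))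
  have ee: "integrable M (\<lambda>w. \<epsilon> i w * \<epsilon> j w)" if "1 \<le> i" "1 \<le> j" for i j
  proof (rule Bochner_Integration.integrable_bound[OF Bochner_Integration.integrable_add[OF \<epsilon>2[OF that(1)] \<epsilon>2[OF that(2)]]])
    show "(\<lambda>w. \<epsilon> i w * \<epsilon> j w) \<in> borel_measurable M" using \<epsilon> by measurable
    have "\<bar>a * b\<bar> \<le> a\<^sup>2 + b\<^sup>2" for a b :: real
    proof -
      have "0 \<le> \<bar>a\<bar> * \<bar>b\<bar>" by simp
      then show ?thesis using sum_squares_bound[of "\<bar>a\<bar>" "\<bar>b\<bar>"] unfolding abs_mult power2_abs by linarith
    qed
    then show "AE w in M. norm (\<epsilon> i w * \<epsilon> j w) \<le> norm ((\<epsilon> i w)\<^sup>2 + (\<epsilon> j w)\<^sup>2)" by auto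
  qed
  have eeF: "integrable M (\<lambda>w. \<epsilon> i w * \<epsilon> j w * F (?x w))"
    if "1 \<le> i" "1 \<le> j" "F \<in> borel_measurable ?PX" "\<And>x. F (restrict x ?I) = F x" "\<And>x. \<bar>F x\<bar> \<le> b" for i j F b
  proof -
    have "integrable M (\<lambda>w. F (?x w) *\<^sub>R (\<epsilon> i w * \<epsilon> j w))"
    proof (rule Bochner_Integration.integrable_bound[OF integrable_mult_right[OF ee[OF that(1,2)], of b]])
      show "(\<lambda>w. F (?x w) *\<^sub>R (\<epsilon> i w * \<epsilon> j w)) \<in> borel_measurable M"
        using comp[OF that(3,4)] \<epsilon> by measurable
      have "0 \<le> b" using that(5)[of undefined] by linarith
      then show "AE w in M. norm (F (?x w) *\<^sub>R (\<epsilon> i w * \<epsilon> j w)) \<le> norm (b * (\<epsilon> i w * \<epsilon> j w))"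
        using that(5) by (auto simp: abs_mult intro!: mult_right_mono)
    qed
    then show ?thesis by (simp add: mult_ac)
  qed
  let ?PP = "\<lambda>i. Pi\<^sub>M {i} (\<lambda>_. ?S) \<Otimes>\<^sub>M Pi\<^sub>M (?I - {i}) (\<lambda>_. ?S)"
  have split: "(\<integral>w. H (X i w, \<epsilon> i w) (\<lambda>j\<in>?I - {i}. (X j w, \<epsilon> j w)) (?x w) \<partial>M)
      \<le> (\<integral>w. L (X i w, \<epsilon> i w) (\<lambda>j\<in>?I - {i}. (X j w, \<epsilon> j w)) (?x w) \<partial>M)"
    if i: "i \<in> ?I"
      and Hm: "(\<lambda>(u, v). H (u i) v (\<lambda>j\<in>?I. if j = i then fst (u i) else fst (v j))) \<in> borel_measurable (?PP i)"
      and Lm: "(\<lambda>(u, v). L (u i) v (\<lambda>j\<in>?I. if j = i then fst (u i) else fst (v j))) \<in> borel_measurable (?PP i)"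
      and Hr: "\<And>u v x. H u v (restrict x ?I) = H u v x" and Lr: "\<And>u v x. L u v (restrict x ?I) = L u v x"
      and Hi: "integrable M (\<lambda>w. H (X i w, \<epsilon> i w) (\<lambda>j\<in>?I - {i}. (X j w, \<epsilon> j w)) (?x w))"
      and Li: "integrable M (\<lambda>w. L (X i w, \<epsilon> i w) (\<lambda>j\<in>?I - {i}. (X j w, \<epsilon> j w)) (?x w))"
      and le: "\<And>v. (\<integral>w. H (X i w, \<epsilon> i w) v (\<lambda>j\<in>?I. if j = i then X i w else fst (v j)) \<partial>M)
        \<le> (\<integral>w. L (X i w, \<epsilon> i w) v (\<lambda>j\<in>?I. if j = i then X i w else fst (v j)) \<partial>M)"
    for i and H L :: "('x \<times> real) \<Rightarrow> (int \<Rightarrow> 'x \<times> real) \<Rightarrow> (int \<Rightarrow> 'x) \<Rightarrow> real"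
  proof -
    let ?U = "\<lambda>w. \<lambda>j\<in>{i}. (X j w, \<epsilon> j w)" and ?V = "\<lambda>w. \<lambda>j\<in>?I - {i}. (X j w, \<epsilon> j w)"
    have iv: "indep_var (Pi\<^sub>M {i} (\<lambda>_. ?S)) ?U (Pi\<^sub>M (?I - {i}) (\<lambda>_. ?S)) ?V"
      using i by (intro indep_var_restrict[OF ind]) auto
    have ui: "?U w i = (X i w, \<epsilon> i w)" for w by simp
    have cfg: "(\<lambda>j\<in>?I. if j = i then fst (X i w, \<epsilon> i w) else fst (?V w j)) = restrict (?x w) ?I" for w by auto
    let ?h = "\<lambda>(u, v). H (u i) v (\<lambda>j\<in>?I. if j = i then fst (u i) else fst (v j))"
      and ?l = "\<lambda>(u, v). L (u i) v (\<lambda>j\<in>?I. if j = i then fst (u i) else fst (v j))"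
    have h1: "?h (?U w, ?V w) = H (X i w, \<epsilon> i w) (?V w) (?x w)"
      and l1: "?l (?U w, ?V w) = L (X i w, \<epsilon> i w) (?V w) (?x w)" for w
      by (simp_all only: prod.case ui cfg) (simp_all only: Hr Lr)
    have h2: "?h (?U w, v) = H (X i w, \<epsilon> i w) v (\<lambda>j\<in>?I. if j = i then X i w else fst (v j))"
      and l2: "?l (?U w, v) = L (X i w, \<epsilon> i w) v (\<lambda>j\<in>?I. if j = i then X i w else fst (v j))" for w v
      by (simp_all only: prod.case ui fst_conv)
    have "(\<integral>w. ?h (?U w, ?V w) \<partial>M) \<le> (\<integral>w. ?l (?U w, ?V w) \<partial>M)"
    proof (rule indep_integral_mono[OF iv Hm Lm])
      show "integrable M (\<lambda>w. ?h (?U w, ?V w))" unfolding h1 by (rule Hi)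
      show "integrable M (\<lambda>w. ?l (?U w, ?V w))" unfolding l1 by (rule Li)
      show "(\<integral>w. ?h (?U w, v) \<partial>M) \<le> (\<integral>w. ?l (?U w, v) \<partial>M)" for v unfolding h2 l2 by (rule le)
    qed
    then show ?thesis unfolding h1 l1 .
  qed
  have cfgm: "(\<lambda>(u, v). (\<lambda>j\<in>?I. if j = i then fst (u i) else fst (v j))) \<in> measurable (?PP i) ?PX"
    if "i \<in> ?I" for i
    unfolding split_beta'
  proof (rule measurable_restrict)
    fix j assume j: "j \<in> ?I"
    have f: "fst \<in> measurable ?S borel" by (simp add: borel_prod[symmetric])
    show "(\<lambda>x. if j = i then fst (fst x i) else fst (snd x j)) \<in> borel_measurable (?PP i)"
    proof (cases "j = i")
      case True
      have "(\<lambda>u. u i) \<in> measurable (Pi\<^sub>M {i} (\<lambda>_. ?S)) ?S" by (intro measurable_component_singleton) auto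
      from measurable_compose[OF measurable_compose[OF measurable_fst this] f] show ?thesis using True by simp
    next
      case False
      then have "(\<lambda>v. v j) \<in> measurable (Pi\<^sub>M (?I - {i}) (\<lambda>_. ?S)) ?S" using j by (intro measurable_component_singleton) auto
      from measurable_compose[OF measurable_compose[OF measurable_snd this] f] show ?thesis using False by simp
    qed
  qed
  have Fcfg: "(\<lambda>(u, v). F (\<lambda>j\<in>?I. if j = i then fst (u i) else fst (v j))) \<in> borel_measurable (?PP i)"
    if "i \<in> ?I" "F \<in> borel_measurable ?PX" for i and F :: "(int \<Rightarrow> 'x) \<Rightarrow> real"
    using measurable_compose[OF cfgm[OF that(1)] that(2)] by (simp add: split_beta')
  have Fone: "(\<lambda>x. F (\<lambda>j\<in>?I. if j = i then x else fst (v j))) \<in> borel_measurable borel"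
    if "F \<in> borel_measurable ?PX" for F :: "(int \<Rightarrow> 'x) \<Rightarrow> real" and i and v :: "int \<Rightarrow> 'x \<times> real"
    by (rule measurable_compose[OF _ that]) (intro measurable_restrict, auto)
  have sndm: "snd \<in> borel_measurable ?S" by (simp add: borel_prod[symmetric])
  have snd1: "(\<lambda>(u, v). snd (u i)) \<in> borel_measurable (?PP i)" for i
  proof -
    have "(\<lambda>u. u i) \<in> measurable (Pi\<^sub>M {i} (\<lambda>_. ?S)) ?S" by (intro measurable_component_singleton) auto
    from measurable_compose[OF measurable_compose[OF measurable_fst this] sndm] show ?thesis by (simp add: split_beta')
  qed
  have snd2: "(\<lambda>(u, v). snd (v j)) \<in> borel_measurable (?PP i)" if "j \<in> ?I" "j \<noteq> i" for i j
  proof -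
    have "(\<lambda>v. v j) \<in> measurable (Pi\<^sub>M (?I - {i}) (\<lambda>_. ?S)) ?S" using that by (intro measurable_component_singleton) auto
    from measurable_compose[OF measurable_compose[OF measurable_snd this] sndm] show ?thesis by (simp add: split_beta')
  qed
  have orth_le: "(\<integral>w. \<epsilon> i w * \<epsilon> j w * F (?x w) \<partial>M) \<le> 0"
    if ij: "i \<in> ?I" "j \<in> ?I" "i \<noteq> j" and F: "F \<in> borel_measurable ?PX" "\<And>x. F (restrict x ?I) = F x" "\<And>x. \<bar>F x\<bar> \<le> b" for i j F b
  proof -
    have "(\<integral>w. snd (X i w, \<epsilon> i w) * snd ((\<lambda>j\<in>?I - {i}. (X j w, \<epsilon> j w)) j) * F (?x w) \<partial>M) \<le> (\<integral>w. 0 \<partial>M)"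
    proof (rule split[OF ij(1), of "\<lambda>u v x. snd u * snd (v j) * F x" "\<lambda>_ _ _. 0"])
      show "(\<lambda>(u, v). snd (u i) * snd (v j) * F (\<lambda>j\<in>?I. if j = i then fst (u i) else fst (v j))) \<in> borel_measurable (?PP i)"
        using borel_measurable_times[OF borel_measurable_times[OF snd1 snd2[OF ij(2)]] Fcfg[OF ij(1) F(1)]] ij(3)
        by (simp add: split_beta')
      show "integrable M (\<lambda>w. snd (X i w, \<epsilon> i w) * snd ((\<lambda>j\<in>?I - {i}. (X j w, \<epsilon> j w)) j) * F (?x w))"
        using eeF[of i j F b] ij F by simp
      fix v :: "int \<Rightarrow> 'x \<times> real"
      let ?\<phi> = "\<lambda>x. F (\<lambda>j\<in>?I. if j = i then x else fst (v j))"
      have "(\<integral>w. \<epsilon> i w * ?\<phi> (X i w) \<partial>M) = 0"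
        using ij by (intro centred[OF _ Fone[OF F(1)] F(3)]) auto
      moreover have "snd (X i w, \<epsilon> i w) * snd (v j) * ?\<phi> (X i w) = snd (v j) * (\<epsilon> i w * ?\<phi> (X i w))" for w
        by (simp only: snd_conv mult_ac)
      ultimately show "(\<integral>w. snd (X i w, \<epsilon> i w) * snd (v j) * F (\<lambda>j\<in>?I. if j = i then X i w else fst (v j)) \<partial>M) \<le> (\<integral>w. 0 \<partial>M)"
        by (simp only: Bochner_Integration.integral_mult_right_zero) simp
    qed (use F in auto)
    then show ?thesis using ij by simp
  qed
  have orth: "(\<integral>w. \<epsilon> i w * \<epsilon> j w * F (?x w) \<partial>M) = 0"
    if ij: "i \<in> ?I" "j \<in> ?I" "i \<noteq> j" and F: "F \<in> borel_measurable ?PX" "\<And>x. F (restrict x ?I) = F x" "\<And>x. \<bar>F x\<bar> \<le> b" for i j F b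
  proof -
    have "(\<integral>w. \<epsilon> i w * \<epsilon> j w * (- F (?x w)) \<partial>M) \<le> 0"
      using F by (intro orth_le[OF ij, of "\<lambda>x. - F x" b]) auto
    then show ?thesis using orth_le[OF ij F] by simp
  qed
  have sq_le: "(\<integral>w. \<epsilon> i w * \<epsilon> i w * F (?x w) \<partial>M) \<le> C * (\<integral>w. F (?x w) \<partial>M)"
    if i: "i \<in> ?I" and F: "F \<in> borel_measurable ?PX" "\<And>x. F (restrict x ?I) = F x" "\<And>x. \<bar>F x\<bar> \<le> b" "\<And>x. 0 \<le> F x" for i F b
  proof -
    have "(\<integral>w. snd (X i w, \<epsilon> i w) * snd (X i w, \<epsilon> i w) * F (?x w) \<partial>M) \<le> (\<integral>w. C * F (?x w) \<partial>M)"
    proof (rule split[OF i, of "\<lambda>u v x. snd u * snd u * F x" "\<lambda>_ _ x. C * F x"])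
      show "(\<lambda>(u, v). snd (u i) * snd (u i) * F (\<lambda>j\<in>?I. if j = i then fst (u i) else fst (v j))) \<in> borel_measurable (?PP i)"
        using borel_measurable_times[OF borel_measurable_times[OF snd1 snd1] Fcfg[OF i F(1)]] by (simp add: split_beta')
      show "(\<lambda>(u, v). C * F (\<lambda>j\<in>?I. if j = i then fst (u i) else fst (v j))) \<in> borel_measurable (?PP i)"
        using borel_measurable_times[OF borel_measurable_const Fcfg[OF i F(1)]] by (simp add: split_beta')
      show "integrable M (\<lambda>w. snd (X i w, \<epsilon> i w) * snd (X i w, \<epsilon> i w) * F (?x w))"
        using eeF[of i i F b] i F by simp
      have "integrable M (\<lambda>w. F (?x w))" using comp[OF F(1,2)] F(3) by (intro integrable_const_bound[of _ b]) auto
      then show "integrable M (\<lambda>w. C * F (?x w))" by (rule integrable_mult_right)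
      fix v :: "int \<Rightarrow> 'x \<times> real"
      let ?\<phi> = "\<lambda>x. F (\<lambda>j\<in>?I. if j = i then x else fst (v j))"
      have "(\<integral>w. (\<epsilon> i w)\<^sup>2 * ?\<phi> (X i w) \<partial>M) \<le> C * (\<integral>w. ?\<phi> (X i w) \<partial>M)"
        using i by (intro var[OF _ Fone[OF F(1)] F(4)]) (auto intro: order_trans[OF abs_ge_self F(3)])
      then show "(\<integral>w. snd (X i w, \<epsilon> i w) * snd (X i w, \<epsilon> i w) * F (\<lambda>j\<in>?I. if j = i then X i w else fst (v j)) \<partial>M)
          \<le> (\<integral>w. C * F (\<lambda>j\<in>?I. if j = i then X i w else fst (v j)) \<partial>M)"
        by (simp add: power2_eq_square)
    qed (use F in auto)
    then show ?thesis by simp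
  qed
  let ?W = "\<lambda>i w. \<epsilon> i w * A i (?x w)"
  have AA: "(\<lambda>x. A i x * A j x) \<in> borel_measurable ?PX" "\<And>x. \<bar>A i x * A j x\<bar> \<le> B * B"
    "\<And>x. A i (restrict x ?I) * A j (restrict x ?I) = A i x * A j x" if "i \<in> ?I" "j \<in> ?I" for i j
    using A that B0 by (auto simp: abs_mult intro!: mult_mono)
  have prod: "?W i w * ?W j w = \<epsilon> i w * \<epsilon> j w * (A i (?x w) * A j (?x w))" for i j w by (simp only: mult_ac)
  have WW: "integrable M (\<lambda>w. ?W i w * ?W j w)" if "i \<in> ?I" "j \<in> ?I" for i j
    unfolding prod using that by (intro eeF[of i j "\<lambda>x. A i x * A j x" "B * B"] AA) auto
  have W0: "(\<integral>w. ?W i w * ?W j w \<partial>M) = 0" if "i \<in> ?I" "j \<in> ?I" "i \<noteq> j" for i j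
    unfolding prod using that by (intro orth[of i j "\<lambda>x. A i x * A j x" "B * B"] AA) auto
  show "integrable M (\<lambda>w. (\<Sum>i\<in>?I. ?W i w)\<^sup>2)"
    by (rule orthogonal_sum_second_moment(1)[OF finite_atLeastAtMost_int WW W0])
  have "(\<integral>w. (\<Sum>i\<in>?I. ?W i w)\<^sup>2 \<partial>M) = (\<Sum>i\<in>?I. (\<integral>w. (?W i w)\<^sup>2 \<partial>M))"
    by (rule orthogonal_sum_second_moment(2)[OF finite_atLeastAtMost_int WW W0])
  also have "\<dots> \<le> (\<Sum>i\<in>?I. C * (\<integral>w. (A i (?x w))\<^sup>2 \<partial>M))"
  proof (rule sum_mono)
    fix i assume i: "i \<in> ?I"
    have "(\<integral>w. \<epsilon> i w * \<epsilon> i w * (A i (?x w) * A i (?x w)) \<partial>M) \<le> C * (\<integral>w. A i (?x w) * A i (?x w) \<partial>M)"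
      by (rule sq_le[OF i AA(1,3,2)]) (use i in auto)
    then show "(\<integral>w. (?W i w)\<^sup>2 \<partial>M) \<le> C * (\<integral>w. (A i (?x w))\<^sup>2 \<partial>M)"
      unfolding power2_eq_square prod .
  qed
  finally show "(\<integral>w. (\<Sum>i\<in>?I. ?W i w)\<^sup>2 \<partial>M) \<le> C * (\<Sum>i\<in>?I. (\<integral>w. (A i (?x w))\<^sup>2 \<partial>M))"
    by (simp add: sum_distrib_left)
qed

end

section \<open>The series estimator in coordinates\<close>

lemma sum_observations: "(\<Sum>i<n. f (int i + 1)) = (\<Sum>i\<in>{1..int n}. f i)"
  by (rule sum.reindex_bij_witness[of _ "\<lambda>i. nat (i - 1)" "\<lambda>i. int i + 1"]) auto

locale sieve_design = prob_space M for M :: "'w measure" +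
  fixes X :: "int \<Rightarrow> 'w \<Rightarrow> 'x::topological_space" and K :: nat and p :: "'x \<Rightarrow> real vec"
  assumes X_meas: "\<And>i. X i \<in> borel_measurable M"
    and K_pos: "K \<ge> 1"
    and p_dim: "\<And>x. p x \<in> carrier_vec K"
    and p_meas: "\<And>k. k < K \<Longrightarrow> (\<lambda>x. p x $ k) \<in> borel_measurable borel"
    and p_bounded: "\<exists>B. \<forall>x. \<forall>k<K. \<bar>p x $ k\<bar> \<le> B"
    and pos: "lambda_min (gram M (X 1) K p) > 0"
begin

abbreviation "\<Gamma> \<equiv> gram M (X 1) K p"
abbreviation "W \<equiv> mat_inv_sqrt \<Gamma>"
abbreviation "q \<equiv> normalized_vec M (X 1) K p"

lemma gram_carrier: "\<Gamma> \<in> carrier_mat K K" by (simp add: weighted_gram_def)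

lemma gram_symmetric: "transpose_mat \<Gamma> = \<Gamma>"
  by (rule eq_matI) (auto simp: weighted_gram_def mult_ac)

lemmas W = mat_inv_sqrt_properties[OF gram_carrier gram_symmetric K_pos pos]

lemma inner_p_measurable:
  assumes c: "c \<in> carrier_vec K"
  shows "(\<lambda>x. c \<bullet> p x) \<in> borel_measurable borel" "\<exists>B. \<forall>x. \<bar>c \<bullet> p x\<bar> \<le> B"
proof -
  show "(\<lambda>x. c \<bullet> p x) \<in> borel_measurable borel"
    unfolding scalar_prod_sum[OF p_dim] using p_meas
    by (intro borel_measurable_sum borel_measurable_times borel_measurable_const) auto
  obtain B where B: "\<And>x k. k < K \<Longrightarrow> \<bar>p x $ k\<bar> \<le> B" using p_bounded by blast
  have "\<bar>c \<bullet> p x\<bar> \<le> (\<Sum>k<K. \<bar>c $ k\<bar> * B)" for x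
    unfolding scalar_prod_sum[OF p_dim]
    by (rule order_trans[OF sum_abs sum_mono]) (use B in \<open>auto simp: abs_mult intro!: mult_left_mono\<close>)
  then show "\<exists>B. \<forall>x. \<bar>c \<bullet> p x\<bar> \<le> B" by blast
qed

lemma gram_bilinear:
  assumes c: "c \<in> carrier_vec K" and d: "d \<in> carrier_vec K"
  shows "(\<integral>w. (c \<bullet> p (X 1 w)) * (d \<bullet> p (X 1 w)) \<partial>M) = c \<bullet> (\<Gamma> *\<^sub>v d)"
proof -
  obtain B where B: "\<And>x k. k < K \<Longrightarrow> \<bar>p x $ k\<bar> \<le> B" using p_bounded by blast
  have int: "integrable M (\<lambda>w. p (X 1 w) $ j * p (X 1 w) $ k)" if "j < K" "k < K" for j k
  proof (rule integrable_const_bound[of _ "B * B"])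
    show "(\<lambda>w. p (X 1 w) $ j * p (X 1 w) $ k) \<in> borel_measurable M"
      using that by (intro borel_measurable_times measurable_compose[OF X_meas p_meas])
    have "0 \<le> B" using order_trans[OF abs_ge_zero B[OF that(1), of undefined]] .
    then show "AE w in M. norm (p (X 1 w) $ j * p (X 1 w) $ k) \<le> B * B"
      unfolding real_norm_def abs_mult using B that by (intro AE_I2 mult_mono) auto
  qed
  have "(c \<bullet> p x) * (d \<bullet> p x) = (\<Sum>j<K. \<Sum>k<K. c $ j * d $ k * (p x $ j * p x $ k))" for x
    unfolding scalar_prod_sum[OF p_dim] sum_product by (simp only: mult_ac)
  then have "(\<integral>w. (c \<bullet> p (X 1 w)) * (d \<bullet> p (X 1 w)) \<partial>M)
      = (\<integral>w. (\<Sum>j<K. \<Sum>k<K. c $ j * d $ k * (p (X 1 w) $ j * p (X 1 w) $ k)) \<partial>M)" by simp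
  also have "\<dots> = (\<Sum>j<K. (\<integral>w. (\<Sum>k<K. c $ j * d $ k * (p (X 1 w) $ j * p (X 1 w) $ k)) \<partial>M))"
    using int by (intro Bochner_Integration.integral_sum Bochner_Integration.integrable_sum integrable_mult_right) auto
  also have "\<dots> = (\<Sum>j<K. \<Sum>k<K. (\<integral>w. c $ j * d $ k * (p (X 1 w) $ j * p (X 1 w) $ k) \<partial>M))"
    using int by (intro sum.cong refl Bochner_Integration.integral_sum integrable_mult_right) auto
  also have "\<dots> = (\<Sum>j<K. \<Sum>k<K. \<Gamma> $$ (j, k) * (c $ j * d $ k))"
    by (intro sum.cong refl) (auto simp: weighted_gram_def)
  also have "\<dots> = c \<bullet> (\<Gamma> *\<^sub>v d)" by (rule quadratic_form_sum[OF gram_carrier c d, symmetric])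
  finally show ?thesis .
qed

lemma q_dim: "q x \<in> carrier_vec K"
  unfolding normalized_vec_def by (rule mult_mat_vec_carrier[OF W(1) p_dim])

lemma W_carrier: "c \<in> carrier_vec K \<Longrightarrow> W *\<^sub>v c \<in> carrier_vec K"
  by (rule mult_mat_vec_carrier[OF W(1)])

lemma inner_q: "c \<in> carrier_vec K \<Longrightarrow> c \<bullet> q x = (W *\<^sub>v c) \<bullet> p x"
  unfolding normalized_vec_def by (rule symmetric_mat_move[OF W(1,2) _ p_dim, symmetric])

lemma inner_q_measurable:
  assumes c: "c \<in> carrier_vec K"
  shows "(\<lambda>x. c \<bullet> q x) \<in> borel_measurable borel" "\<exists>B. \<forall>x. \<bar>c \<bullet> q x\<bar> \<le> B"
  unfolding inner_q[OF c] using inner_p_measurable[OF W_carrier[OF c]] by auto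

lemma q_bilinear:
  assumes c: "c \<in> carrier_vec K" and d: "d \<in> carrier_vec K"
  shows "(\<integral>w. (c \<bullet> q (X 1 w)) * (d \<bullet> q (X 1 w)) \<partial>M) = c \<bullet> d"
proof -
  have "(\<integral>w. (c \<bullet> q (X 1 w)) * (d \<bullet> q (X 1 w)) \<partial>M) = (W *\<^sub>v c) \<bullet> (\<Gamma> *\<^sub>v (W *\<^sub>v d))"
    unfolding inner_q[OF c] inner_q[OF d] by (rule gram_bilinear[OF W_carrier[OF c] W_carrier[OF d]])
  also have "\<dots> = c \<bullet> (W *\<^sub>v (\<Gamma> *\<^sub>v (W *\<^sub>v d)))"
    by (rule symmetric_mat_move[OF W(1,2) c mult_mat_vec_carrier[OF gram_carrier W_carrier[OF d]]])
  also have "W *\<^sub>v (\<Gamma> *\<^sub>v (W *\<^sub>v d)) = (W * \<Gamma> * W) *\<^sub>v d"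
    using assoc_mult_mat_vec[OF mult_carrier_mat[OF W(1) gram_carrier] W(1) d]
      assoc_mult_mat_vec[OF W(1) gram_carrier W_carrier[OF d]] by simp
  also have "\<dots> = d" using W(4) d by simp
  finally show ?thesis .
qed

lemma q_component:
  assumes k: "k < K"
  shows "(\<lambda>x. q x $ k) \<in> borel_measurable borel" "\<exists>B. \<forall>x. \<bar>q x $ k\<bar> \<le> B"
proof -
  have e: "unit_vec K k \<bullet> q x = q x $ k" for x using k q_dim by simp
  show "(\<lambda>x. q x $ k) \<in> borel_measurable borel" "\<exists>B. \<forall>x. \<bar>q x $ k\<bar> \<le> B"
    using inner_q_measurable[of "unit_vec K k"] unfolding e by auto
qed

lemma q_orthonormal:
  "j < K \<Longrightarrow> k < K \<Longrightarrow> (\<integral>w. q (X 1 w) $ j * q (X 1 w) $ k \<partial>M) = (if j = k then 1 else 0)"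
  using q_bilinear[of "unit_vec K j" "unit_vec K k"] q_dim by simp

text \<open>In the orthonormalized basis the coordinates of the representer are the values of the functional on
  the basis functions.  Uniqueness holds because the Gram matrix is invertible.\<close>

lemma riesz_representer_eq:
  assumes \<phi>: "\<phi> \<in> carrier_vec K" and F: "\<And>c. c \<in> carrier_vec K \<Longrightarrow> F (\<lambda>x. c \<bullet> p x) = c \<bullet> \<phi>"
  shows "riesz_representer M (X 1) F (fun_span K p) = (\<lambda>x. (W *\<^sub>v \<phi>) \<bullet> q x)"
  unfolding riesz_representer_def
proof (rule the_equality)
  let ?d = "W *\<^sub>v (W *\<^sub>v \<phi>)"
  have W\<phi>: "W *\<^sub>v \<phi> \<in> carrier_vec K" and d: "?d \<in> carrier_vec K" using \<phi> W_carrier by auto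
  have v: "(\<lambda>x. (W *\<^sub>v \<phi>) \<bullet> q x) = (\<lambda>x. ?d \<bullet> p x)" using inner_q[OF W\<phi>] by simp
  have dG: "\<Gamma> *\<^sub>v ?d = \<phi>"
  proof -
    have "\<Gamma> * (W * W) = 1\<^sub>m K" by (rule mat_mult_left_right_inverse[OF mult_carrier_mat[OF W(1) W(1)] gram_carrier W(3)])
    then show ?thesis
      using assoc_mult_mat_vec[OF gram_carrier mult_carrier_mat[OF W(1) W(1)] \<phi>] assoc_mult_mat_vec[OF W(1) W(1) \<phi>] \<phi> by simp
  qed
  have rep: "(\<integral>w. (e \<bullet> p (X 1 w)) * (c \<bullet> p (X 1 w)) \<partial>M) = c \<bullet> (\<Gamma> *\<^sub>v e)"
    if "c \<in> carrier_vec K" "e \<in> carrier_vec K" for c e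
    using gram_bilinear[OF that] by (simp only: mult.commute)
  show "(\<lambda>x. (W *\<^sub>v \<phi>) \<bullet> q x) \<in> fun_span K p \<and>
    (\<forall>u\<in>fun_span K p. F u = (\<integral>w. (W *\<^sub>v \<phi>) \<bullet> q (X 1 w) * u (X 1 w) \<partial>M))"
  proof (intro conjI ballI)
    show "(\<lambda>x. (W *\<^sub>v \<phi>) \<bullet> q x) \<in> fun_span K p" unfolding v fun_span_def using d by blast
    fix u assume "u \<in> fun_span K p"
    then obtain c where c: "c \<in> carrier_vec K" "u = (\<lambda>x. c \<bullet> p x)" by (auto simp: fun_span_def)
    show "F u = (\<integral>w. (W *\<^sub>v \<phi>) \<bullet> q (X 1 w) * u (X 1 w) \<partial>M)"
      using rep[OF c(1) d] F[OF c(1)] by (simp add: c(2) inner_q[OF W\<phi>] dG)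
  qed
  fix v' assume v': "v' \<in> fun_span K p \<and> (\<forall>u\<in>fun_span K p. F u = (\<integral>w. v' (X 1 w) * u (X 1 w) \<partial>M))"
  then obtain e where e: "e \<in> carrier_vec K" "v' = (\<lambda>x. e \<bullet> p x)" by (auto simp: fun_span_def)
  have Ge: "\<Gamma> *\<^sub>v e \<in> carrier_vec K" by (rule mult_mat_vec_carrier[OF gram_carrier e(1)])
  have eq: "c \<bullet> \<phi> = c \<bullet> (\<Gamma> *\<^sub>v e)" if c: "c \<in> carrier_vec K" for c
  proof -
    have "(\<lambda>x. c \<bullet> p x) \<in> fun_span K p" using c by (auto simp: fun_span_def)
    then have "F (\<lambda>x. c \<bullet> p x) = (\<integral>w. v' (X 1 w) * (c \<bullet> p (X 1 w)) \<partial>M)" using v' by blast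
    then show ?thesis using rep[OF c e(1)] F[OF c] by (simp add: e(2))
  qed
  have "\<phi> = \<Gamma> *\<^sub>v e"
  proof (rule eq_vecI)
    fix i assume "i < dim_vec (\<Gamma> *\<^sub>v e)"
    then have "i < K" using Ge by (metis carrier_vecD)
    then show "\<phi> $ i = (\<Gamma> *\<^sub>v e) $ i" using eq[of "unit_vec K i"] \<phi> Ge by (simp del: index_mult_mat_vec)
  qed (use \<phi> Ge in \<open>metis carrier_vecD\<close>)
  then have "?d = (W * W * \<Gamma>) *\<^sub>v e"
    using assoc_mult_mat_vec[OF mult_carrier_mat[OF W(1) W(1)] gram_carrier e(1)] assoc_mult_mat_vec[OF W(1) W(1) Ge] by simp
  then have "?d = e" using W(3) e(1) by simp
  then show "v' = (\<lambda>x. (W *\<^sub>v \<phi>) \<bullet> q x)" unfolding v using e(2) by simp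
qed

lemma L2_norm_inner_q:
  "c \<in> carrier_vec K \<Longrightarrow> L2_norm M (X 1) (\<lambda>x. c \<bullet> q x) = vec_norm2 c"
  using q_bilinear[of c c] by (simp add: L2_norm_def vec_norm2_def power2_eq_square)

abbreviation "sample_gram n w \<equiv>
  (1 / real n) \<cdot>\<^sub>m (transpose_mat (design_mat X K q n w) * design_mat X K q n w)"

lemma sample_gram_deviation:
  assumes n: "n \<ge> 1"
  shows "sample_gram n w - 1\<^sub>m K = gram_deviation K q n (\<lambda>i. X i w)"
proof (rule eq_matI)
  fix j k assume "j < dim_row (gram_deviation K q n (\<lambda>i. X i w))" "k < dim_col (gram_deviation K q n (\<lambda>i. X i w))"
  then have jk: "j < K" "k < K" by auto
  have D: "design_mat X K q n w \<in> carrier_mat n K" by (simp add: design_mat_def)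
  have "(transpose_mat (design_mat X K q n w) * design_mat X K q n w) $$ (j, k)
      = (\<Sum>i<n. q (X (int i + 1) w) $ j * q (X (int i + 1) w) $ k)"
    using jk D by (subst mult_mat_sum[of _ K n _ K]) (auto simp: design_mat_def)
  also have "\<dots> = (\<Sum>i\<in>{1..int n}. q (X i w) $ j * q (X i w) $ k)" by (rule sum_observations)
  finally show "(sample_gram n w - 1\<^sub>m K) $$ (j, k) = gram_deviation K q n (\<lambda>i. X i w) $$ (j, k)"
    using jk by (simp add: gram_deviation_def design_mat_def del: index_mult_mat(1))
qed (auto simp: design_mat_def)

lemma sample_gram_carrier: "sample_gram n w \<in> carrier_mat K K"
  by (auto simp: design_mat_def)

lemma sample_gram_form:
  assumes n: "n \<ge> 1" and c: "c \<in> carrier_vec K"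
  shows "c \<bullet> (sample_gram n w *\<^sub>v c) = (\<Sum>i\<in>{1..int n}. (c \<bullet> q (X i w))\<^sup>2) / real n"
proof -
  let ?B = "design_mat X K q n w"
  have B: "?B \<in> carrier_mat n K" by (simp add: design_mat_def)
  have Bc: "?B *\<^sub>v c \<in> carrier_vec n" by (rule mult_mat_vec_carrier[OF B c])
  have row: "(?B *\<^sub>v c) $ i = c \<bullet> q (X (int i + 1) w)" if i: "i < n" for i
    unfolding mult_mat_vec_sum[OF B c i] scalar_prod_sum[OF q_dim] using i
    by (intro sum.cong refl) (simp add: design_mat_def)
  have BB: "transpose_mat ?B * ?B \<in> carrier_mat K K" using B by simp
  have "sample_gram n w *\<^sub>v c = (1 / real n) \<cdot>\<^sub>v (transpose_mat ?B *\<^sub>v (?B *\<^sub>v c))"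
  proof -
    have "sample_gram n w *\<^sub>v c = (1 / real n) \<cdot>\<^sub>v ((transpose_mat ?B * ?B) *\<^sub>v c)"
      using BB c by (intro eq_vecI) (auto simp: row_smult simp del: index_mult_mat)
    then show ?thesis using B c by simp
  qed
  then have "c \<bullet> (sample_gram n w *\<^sub>v c) = (1 / real n) * (c \<bullet> (transpose_mat ?B *\<^sub>v (?B *\<^sub>v c)))"
    using c B by simp
  also have "c \<bullet> (transpose_mat ?B *\<^sub>v (?B *\<^sub>v c)) = (?B *\<^sub>v c) \<bullet> (?B *\<^sub>v c)"
    using transpose_vec_mult_scalar[OF B c Bc] comm_scalar_prod[of c K "transpose_mat ?B *\<^sub>v (?B *\<^sub>v c)"] B c by simp
  also have "\<dots> = (\<Sum>i<n. (c \<bullet> q (X (int i + 1) w))\<^sup>2)"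
    unfolding scalar_prod_sum[OF Bc] using row by (intro sum.cong refl) (simp add: power2_eq_square del: index_mult_mat_vec)
  also have "\<dots> = (\<Sum>i\<in>{1..int n}. (c \<bullet> q (X i w))\<^sup>2)" by (rule sum_observations)
  finally show ?thesis by simp
qed

text \<open>In normalized coordinates the coefficient vector solves the normal equations with the noise as
  response, and its pairing with \<open>\<phi>\<close> is read off by moving the inverse Gram matrix to \<open>\<phi>\<close>.\<close>

lemma series_difference:
  assumes n: "n \<ge> 1" and det: "det (sample_gram n w) \<noteq> 0"
    and Y: "\<And>i. i \<in> {1..int n} \<Longrightarrow> Y i w = H i w + \<epsilon> i w"
  shows "\<exists>\<beta>\<in>carrier_vec K. (\<forall>x. series_ls X K p Y n w x - series_ls X K p H n w x = \<beta> \<bullet> p x) \<and>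
    (\<forall>\<phi>\<in>carrier_vec K. \<beta> \<bullet> \<phi> =
      (\<Sum>i\<in>{1..int n}. \<epsilon> i w * (cramer_solution (sample_gram n w) (W *\<^sub>v \<phi>) \<bullet> q (X i w))) / real n)"
proof -
  let ?B = "design_mat X K p n w" and ?Bq = "design_mat X K q n w" and ?G = "sample_gram n w"
  let ?A = "transpose_mat ?B * ?B"
  have B: "?B \<in> carrier_mat n K" by (simp add: design_mat_def)
  have Bt: "transpose_mat ?B \<in> carrier_mat K n" using B by simp
  have A: "?A \<in> carrier_mat K K" using B by simp
  have Bq: "?Bq = ?B * W"
  proof (rule eq_matI)
    fix i k assume "i < dim_row (?B * W)" "k < dim_col (?B * W)"
    then have ik: "i < n" "k < K" using B W(1) by auto
    have Wsym: "W $$ (k, l) = W $$ (l, k)" if "l < K" for l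
      using arg_cong[OF W(2), of "\<lambda>A. A $$ (k, l)"] that ik W(1) by simp
    have "?Bq $$ (i, k) = (W *\<^sub>v p (X (int i + 1) w)) $ k" using ik by (simp add: design_mat_def normalized_vec_def del: index_mult_mat_vec)
    also have "\<dots> = (\<Sum>l<K. W $$ (k, l) * p (X (int i + 1) w) $ l)" by (rule mult_mat_vec_sum[OF W(1) p_dim ik(2)])
    also have "\<dots> = (\<Sum>l<K. ?B $$ (i, l) * W $$ (l, k))" using ik Wsym by (intro sum.cong refl) (simp add: design_mat_def)
    also have "\<dots> = (?B * W) $$ (i, k)" by (rule mult_mat_sum[OF B W(1) ik, symmetric])
    finally show "?Bq $$ (i, k) = (?B * W) $$ (i, k)" .
  qed (use W(1) in \<open>auto simp: design_mat_def\<close>)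
  have G: "?G \<in> carrier_mat K K" by (rule sample_gram_carrier)
  have AW: "W * ?A * W = real n \<cdot>\<^sub>m ?G"
  proof -
    have "transpose_mat ?Bq * ?Bq = (W * transpose_mat ?B) * (?B * W)"
      unfolding Bq using transpose_mult[OF B W(1)] W(2) by simp
    also have "\<dots> = W * (transpose_mat ?B * (?B * W))" by (rule assoc_mult_mat[OF W(1) Bt mult_carrier_mat[OF B W(1)]])
    also have "transpose_mat ?B * (?B * W) = ?A * W" by (rule assoc_mult_mat[OF Bt B W(1), symmetric])
    also have "W * (?A * W) = W * ?A * W" by (rule assoc_mult_mat[OF W(1) A W(1), symmetric])
    finally have "W * ?A * W = transpose_mat ?Bq * ?Bq" by simp
    also have "\<dots> = real n \<cdot>\<^sub>m ?G" using n by (intro eq_matI) auto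
    finally show ?thesis .
  qed
  note inv = det_nonzero_inverse[OF G det]
  define Gi where "Gi = (1 / det ?G) \<cdot>\<^sub>m adj_mat ?G"
  have Gi: "Gi \<in> carrier_mat K K" "?G * Gi = 1\<^sub>m K" using inv by (auto simp: Gi_def)
  define Q where "Q = (1 / real n) \<cdot>\<^sub>m (W * (Gi * W))"
  have Q: "Q \<in> carrier_mat K K" unfolding Q_def using W(1) Gi(1) by (simp add: mult_carrier_mat[of _ K K _ K])
  note sq = mult_carrier_mat[of _ K K _ K] assoc_mult_mat[of _ K K _ K _ K] W(1) A G Gi(1) gram_carrier
  have WWG: "W * (W * \<Gamma>) = 1\<^sub>m K" and GWW: "\<Gamma> * (W * W) = 1\<^sub>m K"
  proof -
    show "W * (W * \<Gamma>) = 1\<^sub>m K" using W(3) assoc_mult_mat[OF W(1) W(1) gram_carrier] by simp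
    show "\<Gamma> * (W * W) = 1\<^sub>m K" by (rule mat_mult_left_right_inverse[OF mult_carrier_mat[OF W(1) W(1)] gram_carrier W(3)])
  qed
  have AQ: "?A * Q = 1\<^sub>m K"
  proof -
    \<comment> \<open>\<open>\<Gamma> W\<close> is the inverse of \<open>W\<close>.\<close>
    have GW: "(\<Gamma> * W) * W = 1\<^sub>m K" using GWW assoc_mult_mat[OF gram_carrier W(1) W(1)] by simp
    have c1: "\<Gamma> * W \<in> carrier_mat K K" and c2: "?A * W \<in> carrier_mat K K" and c3: "Gi * W \<in> carrier_mat K K"
      and c4: "W * (Gi * W) \<in> carrier_mat K K" and c5: "W * (?A * W) \<in> carrier_mat K K" by (simp_all add: sq)
    have WAW: "W * (?A * W) = real n \<cdot>\<^sub>m ?G" using AW assoc_mult_mat[OF W(1) A W(1)] by simp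
    have "?A * W = (\<Gamma> * W * W) * (?A * W)" unfolding GW by (rule left_mult_one_mat[OF c2, symmetric])
    also have "\<dots> = (\<Gamma> * W) * (W * (?A * W))" by (rule assoc_mult_mat[OF c1 W(1) c2])
    also have "\<dots> = (\<Gamma> * W) * (real n \<cdot>\<^sub>m ?G)" by (simp only: WAW)
    also have "\<dots> = real n \<cdot>\<^sub>m ((\<Gamma> * W) * ?G)" by (rule mult_smult_distrib[OF c1 G])
    finally have AW': "?A * W = real n \<cdot>\<^sub>m ((\<Gamma> * W) * ?G)" .
    have c6: "(\<Gamma> * W) * ?G \<in> carrier_mat K K" by (rule mult_carrier_mat[OF c1 G])
    have "?A * (W * (Gi * W)) = (?A * W) * (Gi * W)" by (rule assoc_mult_mat[OF A W(1) c3, symmetric])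
    also have "\<dots> = real n \<cdot>\<^sub>m (((\<Gamma> * W) * ?G) * (Gi * W))" unfolding AW' by (rule mult_smult_assoc_mat[OF c6 c3])
    also have "((\<Gamma> * W) * ?G) * (Gi * W) = (\<Gamma> * W) * (?G * (Gi * W))" by (rule assoc_mult_mat[OF c1 G c3])
    also have "?G * (Gi * W) = (?G * Gi) * W" by (rule assoc_mult_mat[OF G Gi(1) W(1), symmetric])
    also have "(?G * Gi) * W = W" unfolding Gi(2) by (rule left_mult_one_mat[OF W(1)])
    also have "(\<Gamma> * W) * W = 1\<^sub>m K" by (rule GW)
    finally have "?A * (W * (Gi * W)) = real n \<cdot>\<^sub>m 1\<^sub>m K" .
    then have "?A * Q = (1 / real n) \<cdot>\<^sub>m (real n \<cdot>\<^sub>m 1\<^sub>m K)" unfolding Q_def using mult_smult_distrib[OF A c4, of "1 / real n"] by simp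
    also have "\<dots> = 1\<^sub>m K" using n by (intro eq_matI) auto
    finally show ?thesis .
  qed
  have MP: "moore_penrose ?A = Q" by (rule moore_penrose_of_invertible[OF A Q AQ])
  have Asym: "transpose_mat ?A = ?A" using transpose_mult[OF Bt B] by simp
  define ev where "ev = sample_vec \<epsilon> n w"
  have sv: "sample_vec Z n w \<in> carrier_vec n" for Z by (simp add: sample_vec_def)
  have ev: "ev \<in> carrier_vec n" by (simp add: ev_def sv)
  define \<beta> where "\<beta> = Q *\<^sub>v (transpose_mat ?B *\<^sub>v ev)"
  have Be: "transpose_mat ?B *\<^sub>v z \<in> carrier_vec K" if "z \<in> carrier_vec n" for z by (rule mult_mat_vec_carrier[OF Bt that])
  have \<beta>: "\<beta> \<in> carrier_vec K" unfolding \<beta>_def by (rule mult_mat_vec_carrier[OF Q Be[OF ev]])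
  have diff: "series_ls X K p Y n w x - series_ls X K p H n w x = \<beta> \<bullet> p x" for x
  proof -
    have "sample_vec Y n w = sample_vec H n w + ev"
      using Y by (intro eq_vecI) (auto simp: sample_vec_def ev_def)
    then have "Q *\<^sub>v (transpose_mat ?B *\<^sub>v sample_vec Y n w) = Q *\<^sub>v (transpose_mat ?B *\<^sub>v sample_vec H n w) + \<beta>"
      using mult_add_distrib_mat_vec[OF Bt sv ev] mult_add_distrib_mat_vec[OF Q Be[OF sv] Be[OF ev]] by (simp add: \<beta>_def)
    moreover have "Q *\<^sub>v (transpose_mat ?B *\<^sub>v sample_vec H n w) \<in> carrier_vec K" by (rule mult_mat_vec_carrier[OF Q Be[OF sv]])
    ultimately show ?thesis
      unfolding series_ls_def Let_def MP
      using scalar_prod_add_distrib[OF p_dim _ \<beta>] comm_scalar_prod[OF p_dim \<beta>] by simp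
  qed
  have pair: "\<beta> \<bullet> \<phi> = (\<Sum>i\<in>{1..int n}. \<epsilon> i w * (cramer_solution ?G (W *\<^sub>v \<phi>) \<bullet> q (X i w))) / real n"
    if \<phi>: "\<phi> \<in> carrier_vec K" for \<phi>
  proof -
    define y where "y = Q *\<^sub>v \<phi>"
    have y: "y \<in> carrier_vec K" unfolding y_def by (rule mult_mat_vec_carrier[OF Q \<phi>])
    have Ay: "?A *\<^sub>v y = \<phi>" unfolding y_def using assoc_mult_mat_vec[OF A Q \<phi>] AQ \<phi> by simp
    have A\<beta>: "?A *\<^sub>v \<beta> = transpose_mat ?B *\<^sub>v ev"
      unfolding \<beta>_def using assoc_mult_mat_vec[OF A Q Be[OF ev]] AQ Be[OF ev] by simp
    define u where "u = cramer_solution ?G (W *\<^sub>v \<phi>)"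
    have u: "u \<in> carrier_vec K" unfolding u_def by (rule cramer_solution_carrier[OF G W_carrier[OF \<phi>]])
    have yu: "y = (1 / real n) \<cdot>\<^sub>v (W *\<^sub>v u)"
    proof -
      have cc: "W * (Gi * W) \<in> carrier_mat K K" by (simp add: sq)
      have "y = (1 / real n) \<cdot>\<^sub>v ((W * (Gi * W)) *\<^sub>v \<phi>)"
        unfolding y_def Q_def using cc \<phi> by (intro eq_vecI) (auto simp: row_smult simp del: index_mult_mat)
      also have "(W * (Gi * W)) *\<^sub>v \<phi> = W *\<^sub>v u"
        unfolding u_def cramer_solution_def Gi_def[symmetric]
        using assoc_mult_mat_vec[OF W(1) mult_carrier_mat[OF Gi(1) W(1)] \<phi>] assoc_mult_mat_vec[OF Gi(1) W(1) \<phi>] by simp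
      finally show ?thesis .
    qed
    have By: "(?B *\<^sub>v y) $ i = (u \<bullet> q (X (int i + 1) w)) / real n" if i: "i < n" for i
    proof -
      have "(?B *\<^sub>v y) $ i = y \<bullet> p (X (int i + 1) w)"
        unfolding mult_mat_vec_sum[OF B y i] scalar_prod_sum[OF p_dim] using i
        by (intro sum.cong refl) (simp add: design_mat_def)
      also have "\<dots> = (1 / real n) * ((W *\<^sub>v u) \<bullet> p (X (int i + 1) w))"
        unfolding yu using W_carrier[OF u] p_dim by (simp add: smult_scalar_prod_distrib[of _ K])
      finally show ?thesis by (simp add: inner_q[OF u])
    qed
    have Byc: "?B *\<^sub>v y \<in> carrier_vec n" by (rule mult_mat_vec_carrier[OF B y])
    have "\<beta> \<bullet> \<phi> = \<beta> \<bullet> (?A *\<^sub>v y)" by (simp only: Ay)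
    also have "\<dots> = (?A *\<^sub>v \<beta>) \<bullet> y" by (rule symmetric_mat_move[OF A Asym \<beta> y, symmetric])
    also have "\<dots> = ev \<bullet> (?B *\<^sub>v y)" unfolding A\<beta> by (rule transpose_vec_mult_scalar[OF B y ev])
    also have "\<dots> = (\<Sum>i<n. \<epsilon> (int i + 1) w * (u \<bullet> q (X (int i + 1) w)) / real n)"
      unfolding scalar_prod_sum[OF Byc] using By by (intro sum.cong refl) (simp add: ev_def sample_vec_def del: index_mult_mat_vec)
    also have "\<dots> = (\<Sum>i<n. \<epsilon> (int i + 1) w * (u \<bullet> q (X (int i + 1) w))) / real n" by (simp add: sum_divide_distrib)
    also have "(\<Sum>i<n. \<epsilon> (int i + 1) w * (u \<bullet> q (X (int i + 1) w))) = (\<Sum>i\<in>{1..int n}. \<epsilon> i w * (u \<bullet> q (X i w)))"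
      by (rule sum_observations)
    finally show ?thesis by (simp add: u_def)
  qed
  show ?thesis using \<beta> diff pair by (intro bexI[of _ \<beta>]) auto
qed

end

section \<open>Conditioning on the past and on a regressor\<close>

lemma past_algebra_sets:
  assumes "\<And>i. X i \<in> borel_measurable M" "\<And>i. \<epsilon> i \<in> borel_measurable M"
  shows "space (past_algebra M X \<epsilon> i) = space M"
    "sets (past_algebra M X \<epsilon> i) = sigma_sets (space M) (preimages M X {..i} \<union> preimages M \<epsilon> {..<i})"
    "subalgebra M (past_algebra M X \<epsilon> i)"
proof -
  let ?G = "preimages M X {..i} \<union> preimages M \<epsilon> {..<i}"
  have G: "?G \<subseteq> sets M" using preimages_subset_sets[of X M] preimages_subset_sets[of \<epsilon> M] assms by blast
  then have "?G \<subseteq> Pow (space M)" using sets.sets_into_space by blast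
  then show s: "space (past_algebra M X \<epsilon> i) = space M" "sets (past_algebra M X \<epsilon> i) = sigma_sets (space M) ?G"
    by (simp_all add: past_algebra_def)
  show "subalgebra M (past_algebra M X \<epsilon> i)"
    unfolding subalgebra_def s using sets.sigma_sets_subset[OF G] by blast
qed

lemma past_algebra_measurable:
  assumes "\<And>i. X i \<in> borel_measurable M" "\<And>i. \<epsilon> i \<in> borel_measurable M"
  shows "j \<le> i \<Longrightarrow> X j \<in> borel_measurable (past_algebra M X \<epsilon> i)"
    "j < i \<Longrightarrow> \<epsilon> j \<in> borel_measurable (past_algebra M X \<epsilon> i)"
proof -
  note s = past_algebra_sets[where X = X and \<epsilon> = \<epsilon> and i = i, OF assms]
  show "X j \<in> borel_measurable (past_algebra M X \<epsilon> i)" if "j \<le> i"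
  proof (rule measurableI)
    fix A :: "'b set" assume "A \<in> sets borel"
    then have "X j -` A \<inter> space M \<in> preimages M X {..i}" using that by (auto simp: preimages_def)
    then show "X j -` A \<inter> space (past_algebra M X \<epsilon> i) \<in> sets (past_algebra M X \<epsilon> i)"
      unfolding s by (intro sigma_sets.Basic) blast
  qed simp
  show "\<epsilon> j \<in> borel_measurable (past_algebra M X \<epsilon> i)" if "j < i"
  proof (rule measurableI)
    fix A :: "real set" assume "A \<in> sets borel"
    then have "\<epsilon> j -` A \<inter> space M \<in> preimages M \<epsilon> {..<i}" using that by (auto simp: preimages_def)
    then show "\<epsilon> j -` A \<inter> space (past_algebra M X \<epsilon> i) \<in> sets (past_algebra M X \<epsilon> i)"
      unfolding s by (intro sigma_sets.Basic) blast
  qed simp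
qed

text \<open>The defining identity says that two measures on the range of \<open>X0\<close> agree, so that all integrals with
  respect to them agree.\<close>

lemma cond_exp_given_nn_integral:
  assumes c: "is_cond_exp_given M \<X> X0 Z g" and X0: "X0 \<in> borel_measurable M" "\<And>w. w \<in> space M \<Longrightarrow> X0 w \<in> \<X>"
    and Z: "Z \<in> borel_measurable M" and \<phi>: "\<phi> \<in> borel_measurable borel"
  shows "(\<integral>\<^sup>+w. ennreal (Z w) * \<phi> (X0 w) \<partial>M) = (\<integral>\<^sup>+w. g (X0 w) * \<phi> (X0 w) \<partial>M)"
proof -
  have "X0 \<in> measurable M (restrict_space borel \<X>)" using X0 by (intro measurable_restrict_space2) auto
  then have gm: "(\<lambda>w. g (X0 w)) \<in> borel_measurable M"
    using c unfolding is_cond_exp_given_def by (blast intro: measurable_compose)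
  have Zm: "(\<lambda>w. ennreal (Z w)) \<in> borel_measurable M" using Z by measurable
  let ?N = "\<lambda>f. distr (density M f) borel X0"
  have Xd: "X0 \<in> measurable (density M f) borel" for f :: "_ \<Rightarrow> ennreal" using X0(1) by simp
  have em: "emeasure (?N f) A = (\<integral>\<^sup>+w. f w * indicator A (X0 w) \<partial>M)" if "f \<in> borel_measurable M" "A \<in> sets borel" for f A
  proof -
    have "emeasure (?N f) A = emeasure (density M f) (X0 -` A \<inter> space M)"
      using that by (simp add: emeasure_distr[OF Xd])
    also have "\<dots> = (\<integral>\<^sup>+w. f w * indicator (X0 -` A \<inter> space M) w \<partial>M)"
      using that X0(1) by (intro emeasure_density measurable_sets) auto
    also have "\<dots> = (\<integral>\<^sup>+w. f w * indicator A (X0 w) \<partial>M)"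
      by (intro nn_integral_cong) (auto simp: indicator_def)
    finally show ?thesis .
  qed
  have "?N (\<lambda>w. ennreal (Z w)) = ?N (\<lambda>w. g (X0 w))"
  proof (rule measure_eqI)
    fix A assume "A \<in> sets (?N (\<lambda>w. ennreal (Z w)))"
    then have A: "A \<in> sets borel" by simp
    show "emeasure (?N (\<lambda>w. ennreal (Z w))) A = emeasure (?N (\<lambda>w. g (X0 w))) A"
      unfolding em[OF Zm A] em[OF gm A] using c A unfolding is_cond_exp_given_def by blast
  qed simp
  moreover have "(\<integral>\<^sup>+x. \<phi> x \<partial>?N f) = (\<integral>\<^sup>+w. f w * \<phi> (X0 w) \<partial>M)" if "f \<in> borel_measurable M" for f
    using that X0(1) \<phi> by (subst nn_integral_distr[OF Xd], simp, subst nn_integral_density) auto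
  ultimately show ?thesis using Zm gm by metis
qed

section \<open>Events of high probability\<close>

context prob_space
begin

text \<open>The number \<open>t\<close> is fixed before \<open>n\<close>, and the events for different \<open>t\<close> are unrelated.  This makes it
  possible to choose auxiliary constants depending on \<open>t\<close>, as in \<open>whp_conditional\<close> below.\<close>

definition whp :: "(nat \<Rightarrow> 'a \<Rightarrow> bool) \<Rightarrow> bool" where
  "whp P \<longleftrightarrow> (\<forall>t>0. \<forall>\<^sub>F n in sequentially. \<exists>A\<in>sets M. prob A \<ge> 1 - t \<and> (\<forall>w\<in>A. P n w))"

lemma whp_of_wp: "wp_approaching_one M P \<Longrightarrow> whp P"
  unfolding whp_def wp_approaching_one_def
proof (intro allI impI)
  fix t :: real assume t: "t > 0"
  assume "\<exists>A. (\<forall>n. A n \<in> sets M \<and> (\<forall>w\<in>A n. P n w)) \<and> (\<lambda>n. prob (A n)) \<longlonglongrightarrow> 1"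
  then obtain A where A: "\<And>n. A n \<in> sets M" "\<And>n w. w \<in> A n \<Longrightarrow> P n w" "(\<lambda>n. prob (A n)) \<longlonglongrightarrow> 1" by blast
  have "\<forall>\<^sub>F n in sequentially. prob (A n) > 1 - t" using A(3) t by (intro order_tendstoD) auto
  then show "\<forall>\<^sub>F n in sequentially. \<exists>A\<in>sets M. prob A \<ge> 1 - t \<and> (\<forall>w\<in>A. P n w)"
    by eventually_elim (use A in \<open>auto intro!: bexI[of _ "A _"] less_imp_le\<close>)
qed

text \<open>The auxiliary event \<open>Q\<close> may depend on the probability \<open>t\<close> that is given up.\<close>

lemma whp_conditional:
  assumes "\<And>t. t > 0 \<Longrightarrow> \<exists>Q. whp Q \<and> (\<forall>\<^sub>F n in sequentially. \<exists>A\<in>sets M. prob A \<ge> 1 - t \<and> (\<forall>w\<in>A. Q n w \<longrightarrow> P n w))"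
  shows "whp P"
  unfolding whp_def
proof (intro allI impI)
  fix t :: real assume "t > 0"
  then have t: "t / 2 > 0" by simp
  from assms[OF t] obtain Q where Q: "whp Q"
    "\<forall>\<^sub>F n in sequentially. \<exists>A\<in>sets M. prob A \<ge> 1 - t / 2 \<and> (\<forall>w\<in>A. Q n w \<longrightarrow> P n w)" by blast
  from Q(1) t have "\<forall>\<^sub>F n in sequentially. \<exists>A\<in>sets M. prob A \<ge> 1 - t / 2 \<and> (\<forall>w\<in>A. Q n w)" unfolding whp_def by blast
  then show "\<forall>\<^sub>F n in sequentially. \<exists>A\<in>sets M. prob A \<ge> 1 - t \<and> (\<forall>w\<in>A. P n w)"
    using Q(2)
  proof eventually_elim
    case (elim n)
    then obtain A B where AB: "A \<in> sets M" "prob A \<ge> 1 - t / 2" "\<forall>w\<in>A. Q n w" "B \<in> sets M" "prob B \<ge> 1 - t / 2"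
      "\<forall>w\<in>B. Q n w \<longrightarrow> P n w" by blast
    have "prob (A \<union> B) + prob (A \<inter> B) = prob A + prob B" using AB by (simp add: finite_measure_Union' finite_measure_Diff' Int_commute)
    then have "prob (A \<inter> B) \<ge> 1 - t" using AB prob_le_1[of "A \<union> B"] by linarith
    then show ?case using AB by (intro bexI[of _ "A \<inter> B"]) auto
  qed
qed

lemma whp_conj:
  assumes P: "whp P" and Q: "whp Q"
  shows "whp (\<lambda>n w. P n w \<and> Q n w)"
proof (rule whp_conditional)
  fix t :: real assume "t > 0"
  then have "\<forall>\<^sub>F n in sequentially. \<exists>A\<in>sets M. prob A \<ge> 1 - t \<and> (\<forall>w\<in>A. Q n w)"
    using Q unfolding whp_def by blast
  then have "\<forall>\<^sub>F n in sequentially. \<exists>A\<in>sets M. prob A \<ge> 1 - t \<and> (\<forall>w\<in>A. P n w \<longrightarrow> P n w \<and> Q n w)"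
    by (rule eventually_mono) blast
  with P show "\<exists>R. whp R \<and> (\<forall>\<^sub>F n in sequentially. \<exists>A\<in>sets M. prob A \<ge> 1 - t \<and> (\<forall>w\<in>A. R n w \<longrightarrow> P n w \<and> Q n w))"
    by (intro exI[of _ P] conjI)
qed

lemma whp_mono:
  assumes "whp P" and "\<forall>\<^sub>F n in sequentially. \<forall>w\<in>space M. P n w \<longrightarrow> Q n w"
  shows "whp Q"
  unfolding whp_def
proof (intro allI impI)
  fix t :: real assume "t > 0"
  with assms(1) have "\<forall>\<^sub>F n in sequentially. \<exists>A\<in>sets M. prob A \<ge> 1 - t \<and> (\<forall>w\<in>A. P n w)" unfolding whp_def by blast
  then show "\<forall>\<^sub>F n in sequentially. \<exists>A\<in>sets M. prob A \<ge> 1 - t \<and> (\<forall>w\<in>A. Q n w)"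
    using assms(2)
  proof eventually_elim
    case (elim n)
    then show ?case using sets.sets_into_space by blast
  qed
qed

lemma whp_of_prob:
  assumes lim: "(\<lambda>n. prob {w\<in>space M. B n w}) \<longlonglongrightarrow> 0"
    and meas: "\<forall>\<^sub>F n in sequentially. {w\<in>space M. B n w} \<in> sets M"
  shows "whp (\<lambda>n w. \<not> B n w)"
  unfolding whp_def
proof (intro allI impI)
  fix t :: real assume t: "t > 0"
  have "\<forall>\<^sub>F n in sequentially. prob {w\<in>space M. B n w} < t" using lim t by (intro order_tendstoD) auto
  then show "\<forall>\<^sub>F n in sequentially. \<exists>A\<in>sets M. prob A \<ge> 1 - t \<and> (\<forall>w\<in>A. \<not> B n w)"
    using meas
  proof eventually_elim
    case (elim n)
    then show ?case using prob_compl[OF elim(2)] by (intro bexI[of _ "space M - {w\<in>space M. B n w}"]) auto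
  qed
qed

lemma prob_of_whp:
  assumes "whp (\<lambda>n w. \<not> B n w)" and meas: "\<And>n. {w\<in>space M. B n w} \<in> sets M"
  shows "(\<lambda>n. prob {w\<in>space M. B n w}) \<longlonglongrightarrow> 0"
proof (rule tendstoI)
  fix t :: real assume t: "t > 0"
  then have "t / 2 > 0" by simp
  with assms(1) have "\<forall>\<^sub>F n in sequentially. \<exists>A\<in>sets M. prob A \<ge> 1 - t / 2 \<and> (\<forall>w\<in>A. \<not> B n w)" unfolding whp_def by blast
  then show "\<forall>\<^sub>F n in sequentially. dist (prob {w\<in>space M. B n w}) 0 < t"
  proof eventually_elim
    case (elim n)
    then obtain A where A: "A \<in> sets M" "prob A \<ge> 1 - t / 2" "\<forall>w\<in>A. \<not> B n w" by blast
    have "prob {w\<in>space M. B n w} \<le> prob (space M - A)" using A by (intro finite_measure_mono) auto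
    then show ?case using A t prob_compl[OF A(1)] by simp
  qed
qed

section \<open>Moments of the noise\<close>

text \<open>A function of \<open>X i\<close> is measurable for the past, so the conditional variance bound can be integrated
  against it.\<close>

lemma noise_second_moment:
  assumes X: "\<And>i. X i \<in> borel_measurable M" and \<epsilon>: "\<And>i. \<epsilon> i \<in> borel_measurable M"
    and bd: "AE w in M. nn_cond_exp M (past_algebra M X \<epsilon> i) (\<lambda>w. ennreal ((\<epsilon> i w)\<^sup>2)) w \<le> ennreal C" and C: "C > 0"
  shows "integrable M (\<lambda>w. (\<epsilon> i w)\<^sup>2)"
    "\<And>\<phi> B. \<phi> \<in> borel_measurable borel \<Longrightarrow> (\<And>x. 0 \<le> \<phi> x) \<Longrightarrow> (\<And>x. \<phi> x \<le> B) \<Longrightarrow>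
      (\<integral>w. (\<epsilon> i w)\<^sup>2 * \<phi> (X i w) \<partial>M) \<le> C * (\<integral>w. \<phi> (X i w) \<partial>M)"
proof -
  let ?F = "past_algebra M X \<epsilon> i" and ?e = "\<lambda>w. ennreal ((\<epsilon> i w)\<^sup>2)"
  interpret F: finite_measure_subalgebra M ?F
    by unfold_locales (rule past_algebra_sets(3)[OF X \<epsilon>])
  have em: "?e \<in> borel_measurable M" using \<epsilon>[of i] by measurable
  have nn: "(\<integral>\<^sup>+w. ennreal (\<phi> (X i w)) * ?e w \<partial>M) \<le> (\<integral>\<^sup>+w. ennreal (\<phi> (X i w)) * ennreal C \<partial>M)"
    if \<phi>: "\<phi> \<in> borel_measurable borel" for \<phi>
  proof -
    have "(\<lambda>w. \<phi> (X i w)) \<in> borel_measurable ?F"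
      by (rule measurable_compose[OF past_algebra_measurable(1)[OF X \<epsilon> order_refl] \<phi>])
    then have "(\<lambda>w. ennreal (\<phi> (X i w))) \<in> borel_measurable ?F" by measurable
    from F.nn_cond_exp_intg[OF this em]
    have "(\<integral>\<^sup>+w. ennreal (\<phi> (X i w)) * ?e w \<partial>M) = (\<integral>\<^sup>+w. ennreal (\<phi> (X i w)) * nn_cond_exp M ?F ?e w \<partial>M)" by simp
    also have "\<dots> \<le> (\<integral>\<^sup>+w. ennreal (\<phi> (X i w)) * ennreal C \<partial>M)"
      using bd by (intro nn_integral_mono_AE) (auto elim!: eventually_mono intro: mult_left_mono)
    finally show ?thesis .
  qed
  have "(\<integral>\<^sup>+w. ?e w \<partial>M) \<le> ennreal C" using nn[of "\<lambda>_. 1"] emeasure_space_1 by simp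
  then have "(\<integral>\<^sup>+w. ?e w \<partial>M) < \<infinity>" by (rule order.strict_trans1) simp
  then show sq: "integrable M (\<lambda>w. (\<epsilon> i w)\<^sup>2)" using \<epsilon>[of i] by (intro integrableI_nonneg) auto
  fix \<phi> :: "'b \<Rightarrow> real" and B
  assume \<phi>: "\<phi> \<in> borel_measurable borel" "\<And>x. 0 \<le> \<phi> x" "\<And>x. \<phi> x \<le> B"
  have \<phi>X: "(\<lambda>w. \<phi> (X i w)) \<in> borel_measurable M" by (rule measurable_compose[OF X \<phi>(1)])
  have i\<phi>: "integrable M (\<lambda>w. \<phi> (X i w))" using \<phi> by (intro integrable_const_bound[of _ B] \<phi>X) auto
  have "0 \<le> B" using \<phi>(2)[of undefined] \<phi>(3)[of undefined] by linarith
  then have ie: "integrable M (\<lambda>w. (\<epsilon> i w)\<^sup>2 * \<phi> (X i w))"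
    using \<phi> \<phi>X \<epsilon>[of i] by (intro Bochner_Integration.integrable_bound[OF integrable_mult_right[OF sq, of B]])
      (auto simp: abs_mult mult.commute intro!: mult_right_mono)
  have "ennreal (\<integral>w. (\<epsilon> i w)\<^sup>2 * \<phi> (X i w) \<partial>M) = (\<integral>\<^sup>+w. ennreal (\<phi> (X i w)) * ?e w \<partial>M)"
    using \<phi>(2) by (subst nn_integral_eq_integral[OF ie, symmetric]) (auto simp: ennreal_mult'' mult.commute intro!: nn_integral_cong)
  also have "\<dots> \<le> (\<integral>\<^sup>+w. ennreal (\<phi> (X i w)) * ennreal C \<partial>M)" by (rule nn[OF \<phi>(1)])
  also have "\<dots> = (\<integral>\<^sup>+w. ennreal (C * \<phi> (X i w)) \<partial>M)"
    using C \<phi>(2) by (intro nn_integral_cong) (simp add: ennreal_mult'' mult.commute)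
  also have "\<dots> = ennreal (\<integral>w. C * \<phi> (X i w) \<partial>M)"
    using C \<phi>(2) i\<phi> by (intro nn_integral_eq_integral) auto
  also have "(\<integral>w. C * \<phi> (X i w) \<partial>M) = C * (\<integral>w. \<phi> (X i w) \<partial>M)" by simp
  finally show "(\<integral>w. (\<epsilon> i w)\<^sup>2 * \<phi> (X i w) \<partial>M) \<le> C * (\<integral>w. \<phi> (X i w) \<partial>M)"
    using C \<phi>(2) by (subst (asm) ennreal_le_iff) (auto intro!: mult_nonneg_nonneg Bochner_Integration.integral_nonneg)
qed

lemma noise_orthogonal:
  assumes X: "\<And>i. X i \<in> borel_measurable M" and \<epsilon>: "\<And>i. \<epsilon> i \<in> borel_measurable M"
    and mds: "AE w in M. real_cond_exp M (past_algebra M X \<epsilon> i) (\<epsilon> i) w = 0"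
    and g: "g \<in> borel_measurable (past_algebra M X \<epsilon> i)" "integrable M (\<lambda>w. g w * \<epsilon> i w)"
  shows "(\<integral>w. g w * \<epsilon> i w \<partial>M) = 0"
proof -
  let ?F = "past_algebra M X \<epsilon> i"
  interpret F: finite_measure_subalgebra M ?F
    by unfold_locales (rule past_algebra_sets(3)[OF X \<epsilon>])
  have "(\<integral>w. g w * \<epsilon> i w \<partial>M) = (\<integral>w. g w * real_cond_exp M ?F (\<epsilon> i) w \<partial>M)"
    using F.real_cond_exp_intg(2)[OF g(2,1) \<epsilon>] by simp
  also have "\<dots> = 0" using mds by (intro integral_eq_zero_AE) auto
  finally show ?thesis .
qed

end

text \<open>The consequences of the conditional moment assumptions that are used: orthogonality to functions of
  the past, and the variance bound integrated against functions of the regressor.\<close>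

locale martingale_noise = prob_space M for M :: "'w measure" +
  fixes X :: "int \<Rightarrow> 'w \<Rightarrow> 'x::topological_space" and \<epsilon> :: "int \<Rightarrow> 'w \<Rightarrow> real" and C :: real
  assumes X_borel: "\<And>i. X i \<in> borel_measurable M"
    and eps_meas: "\<And>i. \<epsilon> i \<in> borel_measurable M"
    and C_pos: "C > 0"
    and eps_sq: "\<And>i. 1 \<le> i \<Longrightarrow> integrable M (\<lambda>w. (\<epsilon> i w)\<^sup>2)"
    and eps_var: "\<And>i \<phi> B. 1 \<le> i \<Longrightarrow> \<phi> \<in> borel_measurable borel \<Longrightarrow> (\<And>x. 0 \<le> \<phi> x) \<Longrightarrow> (\<And>x. \<phi> x \<le> B) \<Longrightarrow>
      (\<integral>w. (\<epsilon> i w)\<^sup>2 * \<phi> (X i w) \<partial>M) \<le> C * (\<integral>w. \<phi> (X i w) \<partial>M)"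
    and eps_orth: "\<And>i g. 1 \<le> i \<Longrightarrow> g \<in> borel_measurable (past_algebra M X \<epsilon> i) \<Longrightarrow> integrable M (\<lambda>w. g w * \<epsilon> i w) \<Longrightarrow>
      (\<integral>w. g w * \<epsilon> i w \<partial>M) = 0"
    and stationary: "strictly_stationary M borel X UNIV"
begin

lemma eps_prod_integrable:
  assumes ij: "1 \<le> i" "1 \<le> j" and g: "g \<in> borel_measurable M" "\<And>w. \<bar>g w\<bar> \<le> B"
  shows "integrable M (\<lambda>w. g w * (\<epsilon> i w * \<epsilon> j w))"
proof (rule Bochner_Integration.integrable_bound[OF integrable_mult_right[OF Bochner_Integration.integrable_add[OF eps_sq[OF ij(1)] eps_sq[OF ij(2)]], of B]])
  show "(\<lambda>w. g w * (\<epsilon> i w * \<epsilon> j w)) \<in> borel_measurable M" using g(1) eps_meas by measurable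
  have B: "0 \<le> B" using g(2)[of undefined] by linarith
  have "\<bar>a * b\<bar> \<le> a\<^sup>2 + b\<^sup>2" for a b :: real
  proof -
    have "0 \<le> \<bar>a\<bar> * \<bar>b\<bar>" by simp
    then show ?thesis using sum_squares_bound[of "\<bar>a\<bar>" "\<bar>b\<bar>"] unfolding abs_mult power2_abs by linarith
  qed
  then have "\<bar>g w\<bar> * \<bar>\<epsilon> i w * \<epsilon> j w\<bar> \<le> B * ((\<epsilon> i w)\<^sup>2 + (\<epsilon> j w)\<^sup>2)" for w
    using g(2) B by (intro mult_mono) auto
  then show "AE w in M. norm (g w * (\<epsilon> i w * \<epsilon> j w)) \<le> norm (B * ((\<epsilon> i w)\<^sup>2 + (\<epsilon> j w)\<^sup>2))"
    using B by (simp add: abs_mult)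
qed

lemma eps_integrable:
  assumes i: "1 \<le> i" and g: "g \<in> borel_measurable M" "\<And>w. \<bar>g w\<bar> \<le> B"
  shows "integrable M (\<lambda>w. g w * \<epsilon> i w)"
proof (rule Bochner_Integration.integrable_bound[OF integrable_mult_right[OF Bochner_Integration.integrable_add[OF eps_sq[OF i] integrable_const], of B 1]])
  show "(\<lambda>w. g w * \<epsilon> i w) \<in> borel_measurable M" using g(1) eps_meas by measurable
  have B: "0 \<le> B" using g(2)[of undefined] by linarith
  have "\<bar>a\<bar> \<le> a\<^sup>2 + 1" for a :: real
  proof -
    have "0 \<le> \<bar>a\<bar>" by simp
    then show ?thesis using sum_squares_bound[of "\<bar>a\<bar>" 1] unfolding power2_abs by simp
  qed
  then have "\<bar>g w\<bar> * \<bar>\<epsilon> i w\<bar> \<le> B * ((\<epsilon> i w)\<^sup>2 + 1)" for w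
    using g(2) B by (intro mult_mono) auto
  then show "AE w in M. norm (g w * \<epsilon> i w) \<le> norm (B * ((\<epsilon> i w)\<^sup>2 + 1))"
    using B by (simp add: abs_mult)
qed

end

section \<open>Replacing the sample Gram matrix by the identity\<close>

locale sieve_noise = sieve_design M X K p + martingale_noise M X \<epsilon> C
  for M :: "'w measure" and X :: "int \<Rightarrow> 'w \<Rightarrow> 'x::second_countable_topology" and K p \<epsilon> C
begin

abbreviation "deviation n w \<equiv> spectral_norm (sample_gram n w - 1\<^sub>m K)"
abbreviation "weight_shift n \<gamma> w \<equiv> cramer_solution (sample_gram n w) \<gamma> - \<gamma>"
abbreviation "residual n \<gamma> w \<equiv> (\<Sum>i\<in>{1..int n}. \<epsilon> i w * (weight_shift n \<gamma> w \<bullet> q (X i w))) / sqrt (real n)"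

text \<open>The vector \<open>weight_shift\<close> is the error of replacing the solution \<open>u\<close> of \<open>G u = \<gamma>\<close> by \<open>\<gamma>\<close>.\<close>

lemma shift_small:
  assumes n: "n \<ge> 1" and \<gamma>: "\<gamma> \<in> carrier_vec K" "vec_norm2 \<gamma> = 1" and dev: "deviation n \<omega> \<le> \<eta>" "\<eta> \<le> 1 / 2"
  shows "det (sample_gram n \<omega>) \<noteq> 0" "weight_shift n \<gamma> \<omega> \<in> carrier_vec K" "vec_norm2 (weight_shift n \<gamma> \<omega>) \<le> 2 * \<eta>"
    "(\<Sum>i\<in>{1..int n}. (weight_shift n \<gamma> \<omega> \<bullet> q (X i \<omega>))\<^sup>2) / real n \<le> 8 * \<eta>\<^sup>2"
proof -
  note near = near_identity_solution[OF sample_gram_carrier dev]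
  show det: "det (sample_gram n \<omega>) \<noteq> 0" by (rule near(1))
  have u: "cramer_solution (sample_gram n \<omega>) \<gamma> \<in> carrier_vec K" by (rule cramer_solution_carrier[OF sample_gram_carrier \<gamma>(1)])
  then show w: "weight_shift n \<gamma> \<omega> \<in> carrier_vec K" using \<gamma> by simp
  show le: "vec_norm2 (weight_shift n \<gamma> \<omega>) \<le> 2 * \<eta>"
    using near(2)[OF u \<gamma>(1) cramer_solution[OF sample_gram_carrier \<gamma>(1) det]] \<gamma>(2) by simp
  have "(\<Sum>i\<in>{1..int n}. (weight_shift n \<gamma> \<omega> \<bullet> q (X i \<omega>))\<^sup>2) / real n = weight_shift n \<gamma> \<omega> \<bullet> (sample_gram n \<omega> *\<^sub>v weight_shift n \<gamma> \<omega>)"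
    by (rule sample_gram_form[OF n w, symmetric])
  also have "\<dots> \<le> 2 * (vec_norm2 (weight_shift n \<gamma> \<omega>))\<^sup>2" unfolding vec_norm2_square by (rule near(3)[OF w])
  also have "\<dots> \<le> 2 * (2 * \<eta>)\<^sup>2" by (intro mult_left_mono power_mono[OF le]) auto
  finally show "(\<Sum>i\<in>{1..int n}. (weight_shift n \<gamma> \<omega> \<bullet> q (X i \<omega>))\<^sup>2) / real n \<le> 8 * \<eta>\<^sup>2" by (simp add: power2_eq_square)
qed

text \<open>The weights are cut off to zero where their empirical second moment exceeds the bound that holds
  for a small Gram deviation.  The cut-off weights are functions of the regressors whose squares have
  a bounded sum, so \<open>iid_noise_sum_second_moment\<close> bounds the second moment of the noise sum.\<close>

lemma residual_iid:
  assumes n: "n \<ge> 1" and \<gamma>: "\<gamma> \<in> carrier_vec K" "vec_norm2 \<gamma> = 1" and \<eta>: "\<eta> \<le> 1 / 2" and \<delta>: "\<delta> > 0"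
    and ind: "indep_vars (\<lambda>_. borel) (\<lambda>i w. (X i w, \<epsilon> i w)) {1..int n}"
  shows "\<exists>A\<in>sets M. prob A \<ge> 1 - 8 * C * \<eta>\<^sup>2 / \<delta>\<^sup>2 \<and> (\<forall>w\<in>A. deviation n w \<le> \<eta> \<longrightarrow> \<bar>residual n \<gamma> w\<bar> \<le> \<delta>)"
proof -
  let ?I = "{1..int n}" and ?PX = "Pi\<^sub>M {1..int n} (\<lambda>_. borel :: 'x measure)"
  define \<theta> where "\<theta> = 8 * \<eta>\<^sup>2"
  have \<theta>0: "0 \<le> \<theta>" by (simp add: \<theta>_def)
  define Gf where "Gf x = gram_deviation K q n x + 1\<^sub>m K" for x
  have Gf: "Gf x \<in> carrier_mat K K" for x by (simp add: Gf_def)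
  have GfX: "sample_gram n w = Gf (\<lambda>i. X i w)" for w
    unfolding Gf_def sample_gram_deviation[OF n, symmetric] using sample_gram_carrier[of n w]
    by (intro eq_matI) auto
  have Gfr: "Gf (restrict x ?I) = Gf x" for x
    unfolding Gf_def gram_deviation_def by (auto intro!: arg_cong2[where f = "(+)"] eq_matI sum.cong)
  define Wf where "Wf x = cramer_solution (Gf x) \<gamma> - \<gamma>" for x
  have Wf: "Wf x \<in> carrier_vec K" for x unfolding Wf_def using cramer_solution_carrier[OF Gf \<gamma>(1)] \<gamma>(1) by simp
  define qf where "qf x = (\<Sum>i\<in>?I. (Wf x \<bullet> q (x i))\<^sup>2) / real n" for x
  define A where "A i x = (if i \<in> ?I \<and> qf x \<le> \<theta> then Wf x \<bullet> q (x i) / sqrt (real n) else 0)" for i x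
  have qm: "(\<lambda>x. q (x i) $ k) \<in> borel_measurable ?PX" if "i \<in> ?I" "k < K" for i k
    using measurable_compose[OF measurable_component_singleton[OF that(1), of "\<lambda>_. borel"] q_component(1)[OF that(2)]] by simp
  have Gm: "(\<lambda>x. Gf x $$ (j, k)) \<in> borel_measurable ?PX" if "j < K" "k < K" for j k
  proof -
    have "Gf x $$ (j, k) = (\<Sum>i\<in>?I. q (x i) $ j * q (x i) $ k) / real n" for x
      using that by (simp add: Gf_def gram_deviation_def)
    then show ?thesis using qm that by (simp only:) (intro borel_measurable_divide borel_measurable_sum borel_measurable_times borel_measurable_const; blast)
  qed
  have Wm: "(\<lambda>x. Wf x $ k) \<in> borel_measurable ?PX" if "k < K" for k
  proof -
    have "Wf x $ k = cramer_solution (Gf x) \<gamma> $ k - \<gamma> $ k" for x using that \<gamma>(1) by (simp add: Wf_def)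
    then show ?thesis using cramer_solution_measurable[OF Gf Gm \<gamma>(1) that] by simp
  qed
  have dotm: "(\<lambda>x. Wf x \<bullet> q (x i)) \<in> borel_measurable ?PX" if "i \<in> ?I" for i
    unfolding scalar_prod_sum[OF q_dim] using Wm qm[OF that] by (intro borel_measurable_sum borel_measurable_times) auto
  have qfm: "qf \<in> borel_measurable ?PX" unfolding qf_def using dotm
    by (intro borel_measurable_divide borel_measurable_sum borel_measurable_power borel_measurable_const)
  have Am: "A i \<in> borel_measurable ?PX" if "i \<in> ?I" for i
  proof -
    have "{x \<in> space ?PX. qf x \<le> \<theta>} \<in> sets ?PX" using qfm by measurable
    then have "(\<lambda>x. if qf x \<le> \<theta> then Wf x \<bullet> q (x i) / sqrt (real n) else 0) \<in> borel_measurable ?PX"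
      using dotm[OF that] by (intro measurable_If borel_measurable_divide borel_measurable_const) auto
    then show ?thesis using that unfolding A_def[abs_def] by simp
  qed
  have Asum: "(\<Sum>i\<in>?I. (A i x)\<^sup>2) \<le> \<theta>" for x
  proof (cases "qf x \<le> \<theta>")
    case True
    then have "(A i x)\<^sup>2 = (Wf x \<bullet> q (x i))\<^sup>2 / real n" if "i \<in> ?I" for i
      using that by (simp add: A_def power_divide)
    then have "(\<Sum>i\<in>?I. (A i x)\<^sup>2) = (\<Sum>i\<in>?I. (Wf x \<bullet> q (x i))\<^sup>2 / real n)" by (rule sum.cong[OF refl])
    then have "(\<Sum>i\<in>?I. (A i x)\<^sup>2) = qf x" by (simp add: qf_def sum_divide_distrib)
    then show ?thesis using True by simp
  qed (simp add: A_def \<theta>0)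
  have Abd: "\<bar>A i x\<bar> \<le> sqrt \<theta>" for i x
  proof (cases "i \<in> ?I")
    case True
    then have "(A i x)\<^sup>2 \<le> (\<Sum>i\<in>?I. (A i x)\<^sup>2)" by (intro member_le_sum) auto
    then have "\<bar>A i x\<bar>\<^sup>2 \<le> \<theta>" using Asum[of x] by simp
    then show ?thesis by (rule real_le_rsqrt)
  qed (auto simp: A_def \<theta>0)
  have Wfr: "Wf (restrict x ?I) = Wf x" for x unfolding Wf_def Gfr ..
  have qfr: "qf (restrict x ?I) = qf x" for x unfolding qf_def Wfr by (intro arg_cong2[where f = "(/)"] sum.cong refl) auto
  have Ar: "A i (restrict x ?I) = A i x" for i x unfolding A_def qfr Wfr by auto
  have centred: "(\<integral>w. \<epsilon> i w * \<phi> (X i w) \<partial>M) = 0"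
    if "1 \<le> i" "\<phi> \<in> borel_measurable borel" "\<And>x. \<bar>\<phi> x\<bar> \<le> B" for i \<phi> B
  proof -
    have "(\<integral>w. \<phi> (X i w) * \<epsilon> i w \<partial>M) = 0"
    proof (rule eps_orth[OF that(1)])
      show "(\<lambda>w. \<phi> (X i w)) \<in> borel_measurable (past_algebra M X \<epsilon> i)"
        by (rule measurable_compose[OF past_algebra_measurable(1)[OF X_meas eps_meas order_refl] that(2)])
      show "integrable M (\<lambda>w. \<phi> (X i w) * \<epsilon> i w)"
        by (rule eps_integrable[OF that(1) measurable_compose[OF X_meas that(2)] that(3)])
    qed
    then show ?thesis by (simp only: mult.commute)
  qed
  let ?T = "\<lambda>w. \<Sum>i\<in>?I. \<epsilon> i w * A i (\<lambda>j. X j w)"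
  note second = iid_noise_sum_second_moment[OF ind X_meas eps_meas eps_sq centred eps_var Am Abd Ar]
  have AX: "(\<lambda>w. A i (\<lambda>j. X j w)) \<in> borel_measurable M" if "i \<in> ?I" for i
  proof -
    have "(\<lambda>w. \<lambda>j\<in>?I. X j w) \<in> measurable M ?PX" using X_meas by (intro measurable_restrict) auto
    from measurable_compose[OF this Am[OF that]] show ?thesis by (simp add: Ar)
  qed
  have Tm: "?T \<in> borel_measurable M" using AX eps_meas by (intro borel_measurable_sum borel_measurable_times)
  have Ai: "integrable M (\<lambda>w. (A i (\<lambda>j. X j w))\<^sup>2)" if "i \<in> ?I" for i
  proof (rule integrable_const_bound[of _ "(sqrt \<theta>)\<^sup>2"])
    show "AE w in M. norm ((A i (\<lambda>j. X j w))\<^sup>2) \<le> (sqrt \<theta>)\<^sup>2"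
    proof (rule AE_I2)
      fix w show "norm ((A i (\<lambda>j. X j w))\<^sup>2) \<le> (sqrt \<theta>)\<^sup>2"
        using power_mono[OF Abd[of i "\<lambda>j. X j w"], of 2] by simp
    qed
  qed (use AX[OF that] in measurable)
  have "(\<integral>w. (?T w)\<^sup>2 \<partial>M) \<le> C * (\<Sum>i\<in>?I. (\<integral>w. (A i (\<lambda>j. X j w))\<^sup>2 \<partial>M))" by (rule second(2))
  also have "(\<Sum>i\<in>?I. (\<integral>w. (A i (\<lambda>j. X j w))\<^sup>2 \<partial>M)) = (\<integral>w. (\<Sum>i\<in>?I. (A i (\<lambda>j. X j w))\<^sup>2) \<partial>M)"
    using Ai by (intro Bochner_Integration.integral_sum[symmetric])
  also have "\<dots> \<le> (\<integral>w. \<theta> \<partial>M)"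
    by (rule integral_mono) (auto intro!: Bochner_Integration.integrable_sum Ai Asum)
  finally have T2: "(\<integral>w. (?T w)\<^sup>2 \<partial>M) \<le> C * \<theta>" using C_pos by (simp add: prob_space)
  define S where "S = space M - {w\<in>space M. \<bar>?T w\<bar> > \<delta>}"
  have bad: "{w\<in>space M. \<bar>?T w\<bar> > \<delta>} \<in> sets M" using Tm by measurable
  have "prob {w\<in>space M. \<bar>?T w\<bar> > \<delta>} \<le> (\<integral>w. (?T w)\<^sup>2 \<partial>M) / \<delta>\<^sup>2" by (rule markov_square[OF second(1) \<delta> Tm])
  also have "\<dots> \<le> C * \<theta> / \<delta>\<^sup>2" using T2 by (intro divide_right_mono) auto
  finally have "prob S \<ge> 1 - 8 * C * \<eta>\<^sup>2 / \<delta>\<^sup>2" unfolding S_def prob_compl[OF bad] by (simp add: \<theta>_def mult_ac)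
  moreover have "\<bar>residual n \<gamma> w\<bar> \<le> \<delta>" if w: "w \<in> S" and dev: "deviation n w \<le> \<eta>" for w
  proof -
    have W: "weight_shift n \<gamma> w = Wf (\<lambda>i. X i w)" by (simp only: Wf_def GfX)
    have "qf (\<lambda>i. X i w) \<le> \<theta>" using shift_small(4)[OF n \<gamma> dev \<eta>] unfolding W qf_def \<theta>_def .
    then have "residual n \<gamma> w = ?T w"
      unfolding W sum_divide_distrib by (intro sum.cong refl) (simp add: A_def)
    then show ?thesis using w by (auto simp: S_def)
  qed
  moreover have "S \<in> sets M" unfolding S_def using bad by auto
  ultimately show ?thesis by blast
qed

text \<open>Here the weights may depend on future regressors, which need not be orthogonal to the noise.  The
  weight vector is therefore separated from the noise by Cauchy-Schwarz, and the \<open>K\<close> noise sums with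
  the components of \<open>q\<close> as weights are martingales.\<close>

lemma residual_mds:
  assumes n: "n \<ge> 1" and \<gamma>: "\<gamma> \<in> carrier_vec K" "vec_norm2 \<gamma> = 1" and \<eta>: "0 < \<eta>" "\<eta> \<le> 1 / 2" and \<delta>: "\<delta> > 0"
  shows "\<exists>A\<in>sets M. prob A \<ge> 1 - 4 * C * (real K * \<eta>\<^sup>2) / \<delta>\<^sup>2 \<and> (\<forall>\<omega>\<in>A. deviation n \<omega> \<le> \<eta> \<longrightarrow> \<bar>residual n \<gamma> \<omega>\<bar> \<le> \<delta>)"
proof -
  let ?I = "{1..int n}"
  define T where "T k \<omega> = (\<Sum>i\<in>?I. \<epsilon> i \<omega> * q (X i \<omega>) $ k)" for k \<omega>
  have T: "integrable M (\<lambda>\<omega>. (T k \<omega>)\<^sup>2) \<and> (\<integral>\<omega>. (T k \<omega>)\<^sup>2 \<partial>M) \<le> C * real n" if k: "k < K" for k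
  proof -
    obtain B where B: "\<And>x. \<bar>q x $ k\<bar> \<le> B" using q_component(2)[OF k] by blast
    have B0: "0 \<le> B" using B[of undefined] by linarith
    have qX: "(\<lambda>\<omega>. q (X i \<omega>) $ k) \<in> borel_measurable M" for i by (rule measurable_compose[OF X_meas q_component(1)[OF k]])
    let ?w = "\<lambda>i \<omega>. \<epsilon> i \<omega> * q (X i \<omega>) $ k"
    have re: "?w i \<omega> * ?w j \<omega> = (q (X i \<omega>) $ k * q (X j \<omega>) $ k) * (\<epsilon> i \<omega> * \<epsilon> j \<omega>)" for i j \<omega> by (simp only: mult_ac)
    have ww: "integrable M (\<lambda>\<omega>. ?w i \<omega> * ?w j \<omega>)" if "1 \<le> i" "1 \<le> j" for i j
      unfolding re using that qX B B0
      by (intro eps_prod_integrable[of _ _ _ "B * B"] borel_measurable_times) (auto simp: abs_mult intro!: mult_mono)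
    have lt: "(\<integral>\<omega>. ?w i \<omega> * ?w j \<omega> \<partial>M) = 0" if ij: "1 \<le> i" "i < j" for i j
    proof -
      let ?g = "\<lambda>\<omega>. \<epsilon> i \<omega> * q (X i \<omega>) $ k * q (X j \<omega>) $ k"
      have e: "?w i \<omega> * ?w j \<omega> = ?g \<omega> * \<epsilon> j \<omega>" for \<omega> by (simp only: mult_ac)
      have "?g \<in> borel_measurable (past_algebra M X \<epsilon> j)"
        using ij by (intro borel_measurable_times past_algebra_measurable[OF X_meas eps_meas]
            measurable_compose[OF past_algebra_measurable(1)[OF X_meas eps_meas] q_component(1)[OF k]]) auto
      then show ?thesis unfolding e using ww[of i j] ij by (intro eps_orth) (auto simp only: e)
    qed
    have orth: "(\<integral>\<omega>. ?w i \<omega> * ?w j \<omega> \<partial>M) = 0" if "i \<in> ?I" "j \<in> ?I" "i \<noteq> j" for i j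
    proof (cases "i < j")
      case True
      then show ?thesis using lt[of i j] that by simp
    next
      case False
      then have "(\<integral>\<omega>. ?w j \<omega> * ?w i \<omega> \<partial>M) = 0" using lt[of j i] that by simp
      then show ?thesis by (simp only: mult.commute)
    qed
    have sec: "integrable M (\<lambda>\<omega>. (\<Sum>i\<in>?I. ?w i \<omega>)\<^sup>2)" "(\<integral>\<omega>. (\<Sum>i\<in>?I. ?w i \<omega>)\<^sup>2 \<partial>M) = (\<Sum>i\<in>?I. (\<integral>\<omega>. (?w i \<omega>)\<^sup>2 \<partial>M))"
      using orthogonal_sum_second_moment[OF finite_atLeastAtMost_int, of 1 "int n" ?w] ww orth by auto
    have "(\<integral>\<omega>. (?w i \<omega>)\<^sup>2 \<partial>M) \<le> C" if i: "i \<in> ?I" for i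
    proof -
      have "(\<integral>\<omega>. (\<epsilon> i \<omega>)\<^sup>2 * (q (X i \<omega>) $ k)\<^sup>2 \<partial>M) \<le> C * (\<integral>\<omega>. (q (X i \<omega>) $ k)\<^sup>2 \<partial>M)"
      proof (rule eps_var[of i "\<lambda>x. (q x $ k)\<^sup>2" "B\<^sup>2"])
        show "(q x $ k)\<^sup>2 \<le> B\<^sup>2" for x using power_mono[OF B[of x], of 2] by simp
      qed (use i q_component(1)[OF k] in auto)
      also have "(\<integral>\<omega>. (q (X i \<omega>) $ k)\<^sup>2 \<partial>M) = (\<integral>\<omega>. (q (X 1 \<omega>) $ k)\<^sup>2 \<partial>M)"
        using q_component(1)[OF k] by (intro stationary_integral(1)[OF X_meas stationary, of i 1 "\<lambda>x. (q x $ k)\<^sup>2"]) auto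
      also have "\<dots> = 1" using q_orthonormal[OF k k] by (simp add: power2_eq_square)
      finally show ?thesis by (simp add: power_mult_distrib)
    qed
    then have "(\<Sum>i\<in>?I. (\<integral>\<omega>. (?w i \<omega>)\<^sup>2 \<partial>M)) \<le> (\<Sum>i\<in>?I. C)" by (rule sum_mono)
    then show ?thesis using sec by (simp add: T_def mult.commute)
  qed
  have Tm: "T k \<in> borel_measurable M" if "k < K" for k unfolding T_def
    by (intro borel_measurable_sum borel_measurable_times eps_meas measurable_compose[OF X_meas q_component(1)[OF that]])
  let ?N = "\<lambda>\<omega>. \<Sum>k<K. (T k \<omega>)\<^sup>2"
  have Ni: "integrable M ?N" using T by auto
  have NE: "(\<integral>\<omega>. ?N \<omega> \<partial>M) \<le> real K * (C * real n)"
  proof -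
    have "(\<integral>\<omega>. ?N \<omega> \<partial>M) = (\<Sum>k<K. (\<integral>\<omega>. (T k \<omega>)\<^sup>2 \<partial>M))" using T by (intro Bochner_Integration.integral_sum) auto
    also have "\<dots> \<le> (\<Sum>k<K. C * real n)" using T by (intro sum_mono) auto
    finally show ?thesis by simp
  qed
  define b where "b = \<delta>\<^sup>2 * real n / (4 * \<eta>\<^sup>2)"
  have b: "b > 0" using \<delta> n \<eta> by (simp add: b_def)
  define S where "S = {\<omega>\<in>space M. ?N \<omega> \<le> b}"
  have S: "S \<in> sets M" unfolding S_def using borel_measurable_integrable[OF Ni] by measurable
  have "prob (space M - S) \<le> prob {\<omega>\<in>space M. ?N \<omega> \<ge> b}"
    using borel_measurable_integrable[OF Ni] by (intro finite_measure_mono) (auto simp: S_def)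
  also have "\<dots> \<le> (\<integral>\<omega>. ?N \<omega> \<partial>M) / b"
    using b by (intro integral_Markov_inequality_measure[OF Ni, of "{}"]) (auto intro!: AE_I2 sum_nonneg)
  also have "\<dots> \<le> real K * (C * real n) / b" using NE b by (intro divide_right_mono) auto
  also have "\<dots> = 4 * C * (real K * \<eta>\<^sup>2) / \<delta>\<^sup>2" using n \<eta> \<delta> by (simp add: b_def field_simps)
  finally have "prob S \<ge> 1 - 4 * C * (real K * \<eta>\<^sup>2) / \<delta>\<^sup>2" using prob_compl[OF S] by simp
  moreover have "\<bar>residual n \<gamma> \<omega>\<bar> \<le> \<delta>" if \<omega>: "\<omega> \<in> S" and dev: "deviation n \<omega> \<le> \<eta>" for \<omega>
  proof -
    define w where "w = weight_shift n \<gamma> \<omega>"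
    note sh = shift_small[OF n \<gamma> dev \<eta>(2), folded w_def]
    define Tv where "Tv = vec K (\<lambda>k. T k \<omega>)"
    have Tv: "Tv \<in> carrier_vec K" by (simp add: Tv_def)
    have "(\<Sum>i\<in>?I. \<epsilon> i \<omega> * (w \<bullet> q (X i \<omega>))) = (\<Sum>i\<in>?I. \<Sum>k<K. w $ k * (\<epsilon> i \<omega> * q (X i \<omega>) $ k))"
      unfolding scalar_prod_sum[OF q_dim] sum_distrib_left by (intro sum.cong refl) (simp only: mult_ac)
    also have "\<dots> = (\<Sum>k<K. w $ k * T k \<omega>)" unfolding T_def sum_distrib_left by (rule sum.swap)
    also have "\<dots> = w \<bullet> Tv" unfolding scalar_prod_sum[OF Tv] by (intro sum.cong refl) (simp add: Tv_def)
    finally have e: "residual n \<gamma> \<omega> = (w \<bullet> Tv) / sqrt (real n)" by (simp add: w_def)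
    have "\<bar>w \<bullet> Tv\<bar> \<le> vec_norm2 w * vec_norm2 Tv" by (rule scalar_prod_cauchy_schwarz[OF sh(2) Tv])
    also have "\<dots> \<le> 2 * \<eta> * sqrt b"
    proof (rule mult_mono[OF sh(3)])
      have "Tv \<bullet> Tv = ?N \<omega>" unfolding scalar_prod_sum[OF Tv] by (intro sum.cong refl) (simp add: Tv_def power2_eq_square)
      then show "vec_norm2 Tv \<le> sqrt b" using \<omega> by (simp add: vec_norm2_def S_def)
    qed (use \<eta> in auto)
    also have "2 * \<eta> * sqrt b = \<delta> * sqrt (real n)"
      using \<eta> \<delta> by (simp add: b_def real_sqrt_divide real_sqrt_mult)
    finally have "\<bar>w \<bullet> Tv\<bar> \<le> \<delta> * sqrt (real n)" .
    then show ?thesis unfolding e using n by (simp add: abs_divide field_simps)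
  qed
  ultimately show ?thesis using S by blast
qed

end

section \<open>Consequences of stationarity and of the conditional variance bounds\<close>

lemma (in prob_space) stationary_distr_eq:
  assumes X: "\<And>i. i \<in> I \<Longrightarrow> X i \<in> measurable M S" and st: "strictly_stationary M S X I" and ij: "i \<in> I" "j \<in> I"
  shows "distr M S (X i) = distr M S (X j)"
proof (rule measure_eqI)
  fix A assume "A \<in> sets (distr M S (X i))"
  then have A: "A \<in> sets S" by simp
  have "prob (X k -` A \<inter> space M) = (\<integral>w. indicator A (X k w) \<partial>M)" if "k \<in> I" for k
  proof -
    have "(\<integral>w. indicator A (X k w) \<partial>M) = (\<integral>w. (indicator (X k -` A \<inter> space M) w :: real) \<partial>M)"
      by (intro Bochner_Integration.integral_cong) (auto simp: indicator_def)
    then show ?thesis using measurable_sets[OF X[OF that] A] by simp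
  qed
  moreover have "(\<integral>w. indicator A (X i w) \<partial>M) = (\<integral>w. (indicator A (X j w) :: real) \<partial>M)"
    using A by (intro stationary_integral(1)[OF X st ij]) auto
  ultimately show "emeasure (distr M S (X i)) A = emeasure (distr M S (X j)) A"
    using ij by (simp add: emeasure_distr[OF X A] emeasure_eq_measure)
qed simp

context prob_space
begin

text \<open>Uniform bounds on a version of the conditional expectation turn into bounds for integrals against
  nonnegative functions of the regressor.\<close>

lemma cond_exp_given_bounds:
  assumes c: "is_cond_exp_given M \<X> X0 Z g" and X0: "X0 \<in> borel_measurable M" "\<And>w. w \<in> space M \<Longrightarrow> X0 w \<in> \<X>"
    and Z: "integrable M Z" "\<And>w. 0 \<le> Z w"
    and \<phi>: "\<phi> \<in> borel_measurable borel" "\<And>x. 0 \<le> \<phi> x" "\<And>x. \<phi> x \<le> (B :: real)" and r: "0 \<le> r"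
  shows "(\<And>x. x \<in> \<X> \<Longrightarrow> ennreal r \<le> g x) \<Longrightarrow> r * (\<integral>w. \<phi> (X0 w) \<partial>M) \<le> (\<integral>w. Z w * \<phi> (X0 w) \<partial>M)"
    "(\<And>x. x \<in> \<X> \<Longrightarrow> g x \<le> ennreal r) \<Longrightarrow> (\<integral>w. Z w * \<phi> (X0 w) \<partial>M) \<le> r * (\<integral>w. \<phi> (X0 w) \<partial>M)"
proof -
  have \<phi>X: "(\<lambda>w. \<phi> (X0 w)) \<in> borel_measurable M" by (rule measurable_compose[OF X0(1) \<phi>(1)])
  have i\<phi>: "integrable M (\<lambda>w. \<phi> (X0 w))" using \<phi> by (intro integrable_const_bound[of _ B] \<phi>X) auto
  have "0 \<le> B" using \<phi>(2)[of undefined] \<phi>(3)[of undefined] by linarith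
  then have iZ: "integrable M (\<lambda>w. Z w * \<phi> (X0 w))"
    using \<phi> Z(2) \<phi>X by (intro Bochner_Integration.integrable_bound[OF integrable_mult_left[OF Z(1), of B]])
      (auto simp: abs_mult intro!: AE_I2 mult_left_mono borel_measurable_times borel_measurable_integrable[OF Z(1)])
  have "(\<lambda>x. ennreal (\<phi> x)) \<in> borel_measurable borel" using \<phi>(1) by measurable
  from cond_exp_given_nn_integral[OF c X0 borel_measurable_integrable[OF Z(1)] this]
  have eq: "(\<integral>\<^sup>+w. g (X0 w) * ennreal (\<phi> (X0 w)) \<partial>M) = (\<integral>\<^sup>+w. ennreal (Z w) * ennreal (\<phi> (X0 w)) \<partial>M)" by simp
  have L: "ennreal (\<integral>w. Z w * \<phi> (X0 w) \<partial>M) = (\<integral>\<^sup>+w. g (X0 w) * ennreal (\<phi> (X0 w)) \<partial>M)"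
    using \<phi>(2) Z(2) unfolding eq
    by (subst nn_integral_eq_integral[OF iZ, symmetric]) (auto simp: ennreal_mult'' intro!: nn_integral_cong)
  have R: "ennreal (r * (\<integral>w. \<phi> (X0 w) \<partial>M)) = (\<integral>\<^sup>+w. ennreal r * ennreal (\<phi> (X0 w)) \<partial>M)"
  proof -
    have "ennreal (\<integral>w. r * \<phi> (X0 w) \<partial>M) = (\<integral>\<^sup>+w. ennreal (r * \<phi> (X0 w)) \<partial>M)"
      using \<phi>(2) r i\<phi> by (intro nn_integral_eq_integral[symmetric]) auto
    then show ?thesis using r \<phi>(2) by (simp add: ennreal_mult'')
  qed
  have pos: "0 \<le> (\<integral>w. Z w * \<phi> (X0 w) \<partial>M)" "0 \<le> r * (\<integral>w. \<phi> (X0 w) \<partial>M)"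
    using Z(2) \<phi>(2) r by (auto intro!: Bochner_Integration.integral_nonneg mult_nonneg_nonneg)
  show "r * (\<integral>w. \<phi> (X0 w) \<partial>M) \<le> (\<integral>w. Z w * \<phi> (X0 w) \<partial>M)" if "\<And>x. x \<in> \<X> \<Longrightarrow> ennreal r \<le> g x"
  proof -
    have "ennreal (r * (\<integral>w. \<phi> (X0 w) \<partial>M)) \<le> ennreal (\<integral>w. Z w * \<phi> (X0 w) \<partial>M)"
      unfolding L R using that X0(2) by (intro nn_integral_mono mult_right_mono) auto
    then show ?thesis using pos by (simp add: ennreal_le_iff)
  qed
  show "(\<integral>w. Z w * \<phi> (X0 w) \<partial>M) \<le> r * (\<integral>w. \<phi> (X0 w) \<partial>M)" if "\<And>x. x \<in> \<X> \<Longrightarrow> g x \<le> ennreal r"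
  proof -
    have "ennreal (\<integral>w. Z w * \<phi> (X0 w) \<partial>M) \<le> ennreal (r * (\<integral>w. \<phi> (X0 w) \<partial>M))"
      unfolding L R using that X0(2) by (intro nn_integral_mono mult_right_mono) auto
    then show ?thesis using pos by (simp add: ennreal_le_iff)
  qed
qed

text \<open>The noise is a function of the pair \<open>(x, y)\<close>.  As \<open>h\<close> is measurable on \<open>\<X>\<close> only, and \<open>\<X>\<close> need not
  be a Borel set, independence is first transferred to the trace of the Borel sets on the range of
  the pairs.\<close>

lemma iid_pairs_noise:
  fixes X :: "int \<Rightarrow> 'a \<Rightarrow> 'x::topological_space" and Y \<epsilon> :: "int \<Rightarrow> 'a \<Rightarrow> real"
  assumes iid: "iid M borel (\<lambda>i w. (X i w, Y i w)) {1..}"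
    and st: "strictly_stationary M borel (\<lambda>i w. (X i w, \<epsilon> i w)) {1..}"
    and range: "\<And>i w. w \<in> space M \<Longrightarrow> X i w \<in> \<X>"
    and T: "(\<lambda>(x, y). (x, y - h x)) \<in> borel_measurable (restrict_space borel (\<X> \<times> UNIV))"
    and model: "\<And>i w. 1 \<le> i \<Longrightarrow> w \<in> space M \<Longrightarrow> Y i w = h (X i w) + \<epsilon> i w"
  shows "iid M borel (\<lambda>i w. (X i w, \<epsilon> i w)) {1..}"
  unfolding iid_def
proof
  let ?V = "\<lambda>i w. (X i w, Y i w)" and ?S = "restrict_space borel (\<X> \<times> (UNIV :: real set))"
  let ?P = "\<lambda>i w. (X i w, \<epsilon> i w)"
  have V: "indep_vars (\<lambda>_. borel) ?V {1..}" using iid by (simp add: iid_def)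
  then have Vm: "\<And>i. i \<in> {1..} \<Longrightarrow> ?V i \<in> borel_measurable M" and Vi: "indep_sets (\<lambda>i. {?V i -` A \<inter> space M | A. A \<in> sets borel}) {1..}"
    unfolding indep_vars_def2 by auto
  have eq: "{?V i -` A \<inter> space M | A. A \<in> sets borel} = {?V i -` A \<inter> space M | A. A \<in> sets ?S}" for i
  proof -
    have "?V i -` A \<inter> space M = ?V i -` (\<X> \<times> UNIV \<inter> A) \<inter> space M" for A using range[of _ i] by blast
    then show ?thesis unfolding sets_restrict_space Setcompr_eq_image image_image by (intro image_cong refl)
  qed
  have S: "indep_vars (\<lambda>_. ?S) ?V {1..}"
    unfolding indep_vars_def2 eq[symmetric]
  proof (intro conjI ballI Vi)
    fix i :: int assume i: "i \<in> {1..}"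
    show "?V i \<in> measurable M ?S" using range by (intro measurable_restrict_space2 Vm[OF i]) simp
  qed
  have "indep_vars (\<lambda>_. borel) (\<lambda>i w. (\<lambda>(x, y). (x, y - h x)) (?V i w)) {1..}"
    by (rule indep_vars_compose2[OF S T])
  then have Q: "indep_sets (\<lambda>i. {(\<lambda>w. (\<lambda>(x, y). (x, y - h x)) (?V i w)) -` A \<inter> space M | A. A \<in> sets borel}) {1..}"
    unfolding indep_vars_def2 by blast
  have pre: "(\<lambda>w. (\<lambda>(x, y). (x, y - h x)) (?V i w)) -` A \<inter> space M = ?P i -` A \<inter> space M" if "i \<in> {1..}" for i A
  proof -
    have "(\<lambda>(x, y). (x, y - h x)) (?V i w) = ?P i w" if "w \<in> space M" for w
      using model[OF _ that, of i] \<open>i \<in> {1..}\<close> by simp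
    then show ?thesis by (rule vimage_inter_cong)
  qed
  have Pm: "?P i \<in> borel_measurable M" if "i \<in> {1..}" for i using st that by (simp add: strictly_stationary_def)
  have "indep_sets (\<lambda>i. {?P i -` A \<inter> space M | A. A \<in> sets borel}) {1..}"
    by (rule iffD1[OF indep_sets_cong[OF refl] Q]) (simp only: pre)
  then show "indep_vars (\<lambda>_. borel) ?P {1..}" unfolding indep_vars_def2 by (intro conjI ballI Pm)
  note Pm
  then show "\<forall>i\<in>{1..}. \<forall>j\<in>{1..}. distr M borel (?P i) = distr M borel (?P j)"
    using stationary_distr_eq[OF _ st] by blast
qed

lemma iid_fst:
  assumes iid: "iid M borel (\<lambda>i w. (X i w :: 'x::topological_space, Y i w :: real)) {1..}"
    and st: "strictly_stationary M borel X UNIV" and X: "\<And>i. X i \<in> borel_measurable M"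
  shows "iid M borel X {1..}"
  unfolding iid_def
proof
  have "fst \<in> borel_measurable (borel :: ('x \<times> real) measure)" by (intro borel_measurable_continuous_onI continuous_intros)
  from indep_vars_compose2[OF _ this, of "\<lambda>i w. (X i w, Y i w)" "{1..}"] show "indep_vars (\<lambda>_. borel) X {1..}"
    using iid by (simp add: iid_def)
  show "\<forall>i\<in>{1..}. \<forall>j\<in>{1..}. distr M borel (X i) = distr M borel (X j)"
    using stationary_distr_eq[OF X st] by blast
qed

section \<open>Concentration of the sample Gram matrix\<close>

text \<open>The squared norm of the orthonormalized basis vector is at most \<open>R = (\<zeta> \<lambda>)\<^sup>2\<close>, and the rate condition
  says that \<open>R ln K / n\<close> vanishes.\<close>

lemma gram_concentration_iid:
  fixes X :: "int \<Rightarrow> 'a \<Rightarrow> 'x::topological_space"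
  assumes design: "\<And>n. n \<ge> 1 \<Longrightarrow> sieve_design M X (K n) (p n)" and iid: "iid M borel X {1..}"
    and off: "\<And>n x. n \<ge> 1 \<Longrightarrow> x \<notin> \<X> \<Longrightarrow> p n x = 0\<^sub>v (K n)" and ne: "\<X> \<noteq> {}"
    and K: "filterlim K at_top sequentially"
    and rate: "(\<lambda>n. zeta \<X> (p n) * lambda_factor M (X 1) (K n) (p n) * sqrt (ln (real (K n)) / real n)) \<longlonglongrightarrow> 0"
    and e: "e > 0"
  shows "whp (\<lambda>n w. spectral_norm (gram_deviation (K n) (normalized_vec M (X 1) (K n) (p n)) n (\<lambda>i. X i w)) \<le> e)"
  unfolding whp_def
proof (intro allI impI)
  fix t :: real assume t: "t > 0"
  define R where "R n = (zeta \<X> (p n) * lambda_factor M (X 1) (K n) (p n))\<^sup>2" for n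
  have r0: "(\<lambda>n. (zeta \<X> (p n) * lambda_factor M (X 1) (K n) (p n) * sqrt (ln (real (K n)) / real n))\<^sup>2) \<longlonglongrightarrow> 0"
    using tendsto_power[OF rate, of 2] by simp
  have evK: "\<forall>\<^sub>F n in sequentially. K n \<ge> nat \<lceil>max (exp 1) (1 / t)\<rceil>" using K unfolding filterlim_at_top by blast
  have "\<forall>\<^sub>F n in sequentially. (zeta \<X> (p n) * lambda_factor M (X 1) (K n) (p n) * sqrt (ln (real (K n)) / real n))\<^sup>2 < min (1 / 4) (e\<^sup>2 * exp (- 2) / 20)"
    using e by (intro order_tendstoD(2)[OF r0]) auto
  then show "\<forall>\<^sub>F n in sequentially. \<exists>A\<in>sets M. prob A \<ge> 1 - t \<and>
      (\<forall>w\<in>A. spectral_norm (gram_deviation (K n) (normalized_vec M (X 1) (K n) (p n)) n (\<lambda>i. X i w)) \<le> e)"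
    using evK eventually_ge_at_top[of 1]
  proof eventually_elim
    case (elim n)
    interpret d: sieve_design M X "K n" "p n" by (rule design[OF elim(3)])
    have Kn: "real (K n) \<ge> exp 1" "real (K n) \<ge> 1 / t"
    proof -
      have "real (K n) \<ge> max (exp 1) (1 / t)" using elim(2) by linarith
      then show "real (K n) \<ge> exp 1" "real (K n) \<ge> 1 / t" by auto
    qed
    have K0: "real (K n) > 0" using Kn(1) exp_gt_zero[of "1::real"] by linarith
    have ln: "ln (real (K n)) \<ge> 1" using Kn(1) K0 by (simp add: ln_ge_iff)
    \<comment> \<open>A moment of this order makes the factor \<open>K\<close>, the trace of the identity matrix, harmless.\<close>
    define P where "P = nat \<lceil>ln (real (K n))\<rceil>"
    have P: "P \<ge> 1" "real P \<ge> ln (real (K n))" "real P \<le> 2 * ln (real (K n))"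
    proof -
      show "real P \<ge> ln (real (K n))" unfolding P_def by linarith
      then show "P \<ge> 1" using ln by linarith
      have "real P \<le> ln (real (K n)) + 1" unfolding P_def using ln by linarith
      then show "real P \<le> 2 * ln (real (K n))" using ln by linarith
    qed
    have rn: "R n * (ln (real (K n)) / real n) < min (1 / 4) (e\<^sup>2 * exp (- 2) / 20)"
      using elim(1,3) ln by (simp add: R_def power_mult_distrib)
    have R0: "0 \<le> R n" by (simp add: R_def)
    have PR: "real P * (R n / real n) \<le> 2 * (R n * (ln (real (K n)) / real n))"
      using mult_right_mono[OF P(3), of "R n / real n"] R0 by (simp add: mult_ac)
    obtain B where B: "\<And>x k. k < K n \<Longrightarrow> \<bar>p n x $ k\<bar> \<le> B" using d.p_bounded by blast
    have pn: "vec_norm2 (p n x) \<le> sqrt (real (K n) * B\<^sup>2)" for x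
    proof -
      have "(p n x $ k)\<^sup>2 \<le> B\<^sup>2" if "k < K n" for k using power_mono[OF B[OF that, of x], of 2] by simp
      then have "(\<Sum>k<K n. (p n x $ k)\<^sup>2) \<le> (\<Sum>k<K n. B\<^sup>2)" by (intro sum_mono) auto
      then show ?thesis unfolding vec_norm2_def scalar_prod_sum[OF d.p_dim] by (simp add: power2_eq_square)
    qed
    have zeta_le: "vec_norm2 (p n x) \<le> zeta \<X> (p n)" for x
    proof -
      have bdd: "bdd_above ((\<lambda>x. vec_norm2 (p n x)) ` \<X>)" using pn by (auto intro!: bdd_aboveI)
      have le: "vec_norm2 (p n x) \<le> zeta \<X> (p n)" if "x \<in> \<X>" for x unfolding zeta_def by (rule cSUP_upper[OF that bdd])
      show ?thesis
      proof (cases "x \<in> \<X>")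
        case False
        obtain y where "y \<in> \<X>" using ne by blast
        then have "0 \<le> zeta \<X> (p n)" using le[of y] vec_norm2_nonneg[of "p n y"] by linarith
        then show ?thesis using off[OF elim(3) False] by (simp add: vec_norm2_def)
      qed (rule le)
    qed
    interpret N: normalized_iid_design M borel X "K n" d.q "R n" n
    proof unfold_locales
      show "d.q x \<bullet> d.q x \<le> R n" for x
      proof -
        have "vec_norm2 (d.q x) \<le> vec_norm2 (p n x) * lambda_factor M (X 1) (K n) (p n)"
          unfolding normalized_vec_def lambda_factor_def
          by (rule mat_inv_sqrt_vec_norm2_le[OF d.gram_carrier d.gram_symmetric d.K_pos d.pos d.p_dim])
        also have "\<dots> \<le> zeta \<X> (p n) * lambda_factor M (X 1) (K n) (p n)"
          by (intro mult_right_mono zeta_le) (simp add: lambda_factor_def)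
        finally show ?thesis unfolding vec_norm2_square[symmetric] R_def by (intro power_mono) auto
      qed
    qed (use iid d.q_dim d.q_component(1) d.q_orthonormal elim(3) in auto)
    have "2 * real P * (R n / real n) \<le> 1" using PR rn by linarith
    from N.spectral_norm_tail[OF P(1) this e] obtain A where A: "A \<in> sets M"
      "\<forall>w\<in>A. spectral_norm (gram_deviation (K n) d.q n (\<lambda>i. X i w)) \<le> e"
      "prob A \<ge> 1 - (10 * real P * (R n / real n) / e\<^sup>2) ^ P * real (K n)" by blast
    have "10 * real P * (R n / real n) / e\<^sup>2 \<le> exp (- 2)"
    proof -
      have "10 * real P * (R n / real n) \<le> e\<^sup>2 * exp (- 2)" using PR rn by linarith
      from divide_right_mono[OF this, of "e\<^sup>2"] show ?thesis using e by simp
    qed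
    then have "(10 * real P * (R n / real n) / e\<^sup>2) ^ P \<le> exp (- 2) ^ P"
      using R0 by (intro power_mono) auto
    also have "exp (- 2 :: real) ^ P = exp (- 2 * real P)" by (simp add: exp_of_nat_mult[symmetric] mult.commute)
    also have "\<dots> \<le> exp (- ln (real (K n)) - ln (real (K n)))" using P(2) by simp
    also have "\<dots> = 1 / real (K n) / real (K n)" by (subst exp_diff, subst exp_minus) (use K0 in \<open>simp add: field_simps\<close>)
    finally have "(10 * real P * (R n / real n) / e\<^sup>2) ^ P \<le> 1 / real (K n) / real (K n)" .
    from mult_right_mono[OF this, of "real (K n)"]
    have "(10 * real P * (R n / real n) / e\<^sup>2) ^ P * real (K n) \<le> 1 / real (K n)" using K0 by simp
    also have "\<dots> \<le> t" using Kn(2) K0 t by (simp add: field_simps)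
    finally show ?case using A by (intro bexI[of _ A]) auto
  qed
qed

end

section \<open>Asymptotic normality of the noise sum\<close>

text \<open>The weights \<open>s n\<close> are fixed functions of the regressor with unit second moment, so the normalized
  summands form a martingale difference array.  Its squared sum has expectation exactly \<open>1\<close> by
  stationarity of the pairs.  Dividing by \<open>\<sigma>2\<close> is harmless, because the conditional variance of the
  noise is bounded away from \<open>0\<close>.\<close>

lemma (in martingale_noise) noise_sum_clt:
  fixes s :: "nat \<Rightarrow> 'x \<Rightarrow> real" and Z :: "nat \<Rightarrow> 'w \<Rightarrow> real"
  defines "\<sigma>2 \<equiv> \<lambda>n. \<integral>w. (\<epsilon> 1 w)\<^sup>2 * (s n (X 1 w))\<^sup>2 \<partial>M"
  assumes pair_st: "strictly_stationary M borel (\<lambda>i w. (X i w, \<epsilon> i w)) {1..}"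
    and mix: "mixing_coeffs M X a"
    and c: "c > 0"
    and lower: "\<And>\<phi> B. \<phi> \<in> borel_measurable borel \<Longrightarrow> (\<And>x. 0 \<le> \<phi> x) \<Longrightarrow> (\<And>x. \<phi> x \<le> B) \<Longrightarrow>
      c * (\<integral>w. \<phi> (X 1 w) \<partial>M) \<le> (\<integral>w. (\<epsilon> 1 w)\<^sup>2 * \<phi> (X 1 w) \<partial>M)"
    and tail: "\<And>t. t > 0 \<Longrightarrow> \<exists>l>0. \<forall>\<phi> B. \<phi> \<in> borel_measurable borel \<longrightarrow> (\<forall>x. 0 \<le> \<phi> x) \<longrightarrow> (\<forall>x. \<phi> x \<le> B) \<longrightarrow>
      (\<integral>w. ((\<epsilon> 1 w)\<^sup>2 * (if \<bar>\<epsilon> 1 w\<bar> > l then 1 else 0)) * \<phi> (X 1 w) \<partial>M) \<le> t * (\<integral>w. \<phi> (X 1 w) \<partial>M)"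
    and s: "\<And>n. s n \<in> borel_measurable borel" "\<And>n. \<exists>B. \<forall>x. \<bar>s n x\<bar> \<le> B"
    and unit: "\<forall>\<^sub>F n in sequentially. (\<integral>w. (s n (X 1 w))\<^sup>2 \<partial>M) = 1"
    and emp: "\<And>e. e > 0 \<Longrightarrow> whp (\<lambda>n w. \<bar>(\<Sum>i\<in>{1..int n}. (s n (X i w))\<^sup>2) / real n - 1\<bar> \<le> e)"
    and sq: "iid M borel (\<lambda>i w. (X i w, \<epsilon> i w)) {1..} \<or>
      (\<forall>e>0. whp (\<lambda>n w. \<bar>(\<Sum>i\<in>{1..int n}. (\<epsilon> i w)\<^sup>2 * (s n (X i w))\<^sup>2) / real n - \<sigma>2 n\<bar> \<le> e))"
    and Z: "\<And>n. Z n \<in> borel_measurable M"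
    and approx: "\<And>e. e > 0 \<Longrightarrow>
      whp (\<lambda>n w. \<bar>Z n w - (\<Sum>i\<in>{1..int n}. \<epsilon> i w * s n (X i w)) / (sqrt (real n) * sqrt (\<sigma>2 n))\<bar> \<le> e)"
  shows "weak_conv_m (\<lambda>n. distr M borel (Z n)) std_normal_distribution"
proof -
  obtain Bs where Bs: "\<And>n x. \<bar>s n x\<bar> \<le> Bs n" using s(2) by metis
  have sq_le: "(s n x)\<^sup>2 \<le> (Bs n)\<^sup>2" for n x using power_mono[OF Bs[of n x], of 2] by simp
  define z where "z n x = (s n x)\<^sup>2 / real n" for n x
  have zm[measurable]: "z n \<in> borel_measurable borel" for n unfolding z_def[abs_def] using s(1)[of n] by measurable
  have z0: "0 \<le> z n x" for n x by (simp add: z_def)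
  have zb: "z n x \<le> (Bs n)\<^sup>2 / real n" for n x unfolding z_def using sq_le by (intro divide_right_mono) auto
  have zX[measurable]: "(\<lambda>w. z n (X i w)) \<in> borel_measurable M" for n i by (rule measurable_compose[OF X_borel zm])
  have zi: "integrable M (\<lambda>w. z n (X 1 w))" for n
    by (rule integrable_const_bound[of _ "(Bs n)\<^sup>2 / real n"]) (use z0 zb in auto)
  have mean: "\<forall>\<^sub>F n in sequentially. (\<integral>w. z n (X 1 w) \<partial>M) = 1 / real n"
    using unit by eventually_elim (simp add: z_def)
  have conv: "(\<lambda>n. prob {w\<in>space M. \<bar>(\<Sum>i\<in>{1..int n}. z n (X i w)) - 1\<bar> > e}) \<longlonglongrightarrow> 0" if e: "e > 0" for e
  proof (rule prob_of_whp)
    show "whp (\<lambda>n w. \<not> e < \<bar>(\<Sum>i\<in>{1..int n}. z n (X i w)) - 1\<bar>)"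
      using emp[OF e] by (simp add: not_less z_def sum_divide_distrib)
  qed measurable
  note lindz = lindeberg_of_mixing[OF X_borel stationary mix zm z0 zi mean conv]
  define V where "V i n w = (\<epsilon> i w)\<^sup>2 * z n (X i w)" for i n w
  have Vm[measurable]: "V i n \<in> borel_measurable M" for i n unfolding V_def[abs_def] using eps_meas[of i] by measurable
  have V0: "0 \<le> V i n w" for i n w using z0 by (simp add: V_def)
  have lindV: "(\<lambda>n. real n * (\<integral>w. V 1 n w * (if V 1 n w > d then 1 else 0) \<partial>M)) \<longlonglongrightarrow> 0" if "d > 0" for d
    unfolding V_def
    by (rule lindeberg_noise[OF X_borel eps_meas eps_sq[OF order_refl] eps_var[OF order_refl] C_pos tail zm z0 zb mean lindz that])
  have Vi: "integrable M (V i n)" if i: "1 \<le> i" for i n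
  proof -
    have "integrable M (\<lambda>w. z n (X i w) * (\<epsilon> i w * \<epsilon> i w))"
      by (rule eps_prod_integrable[OF i i zX]) (use z0 zb in auto)
    then show ?thesis by (simp add: V_def[abs_def] power2_eq_square mult.commute)
  qed
  have bounds: "\<forall>\<^sub>F n in sequentially. c \<le> \<sigma>2 n"
    using unit
  proof eventually_elim
    case (elim n)
    have "(\<lambda>x. (s n x)\<^sup>2) \<in> borel_measurable borel" using s(1)[of n] by measurable
    from lower[OF this _ sq_le] elim show ?case by (simp add: \<sigma>2_def)
  qed
  have \<sigma>20: "0 \<le> \<sigma>2 n" for n unfolding \<sigma>2_def by (intro Bochner_Integration.integral_nonneg) simp
  have VE: "(\<integral>w. V 1 n w \<partial>M) = \<sigma>2 n / real n" for n
    by (simp add: V_def z_def \<sigma>2_def)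
  let ?P = "\<lambda>i w. (X i w, \<epsilon> i w)"
  have Pm: "?P i \<in> borel_measurable M" if "i \<in> {1..}" for i using pair_st that by (simp add: strictly_stationary_def)
  have [measurable]: "fst \<in> borel_measurable (borel :: ('x \<times> real) measure)" "snd \<in> borel_measurable (borel :: ('x \<times> real) measure)"
    by (intro borel_measurable_continuous_onI continuous_intros)+
  define v where "v n p = (snd p)\<^sup>2 * z n (fst p)" for n and p :: "'x \<times> real"
  have vm[measurable]: "v n \<in> borel_measurable borel" for n unfolding v_def[abs_def] by measurable
  have vP: "v n (?P i w) = V i n w" for n i w by (simp add: v_def V_def)
  have VEi: "(\<integral>w. V i n w \<partial>M) = \<sigma>2 n / real n" if "1 \<le> i" for i n
    using stationary_integral(1)[OF Pm pair_st, of i 1 "v n"] that VE by (simp add: vP)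
  have Vbig: "(\<integral>w. V i n w * (if V i n w > d then 1 else 0) \<partial>M) = (\<integral>w. V 1 n w * (if V 1 n w > d then 1 else 0) \<partial>M)"
    if "1 \<le> i" for i n d
  proof -
    have "(\<lambda>p. v n p * (if v n p > d then 1 else 0)) \<in> borel_measurable borel" by measurable
    from stationary_integral(1)[OF Pm pair_st _ _ this, of i 1] that show ?thesis by (simp add: vP)
  qed
  have Vbi: "integrable M (\<lambda>w. V i n w * (if V i n w > d then 1 else 0))" if "1 \<le> i" for i n d
    by (rule Bochner_Integration.integrable_bound[OF Vi[OF that, of n]]) (use V0 in \<open>auto intro!: AE_I2\<close>)
  have max: "whp (\<lambda>n w. \<not> (\<exists>i\<in>{1..int n}. V i n w > d))" if d: "d > 0" for d
  proof (rule whp_of_prob)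
    let ?b = "\<lambda>n. real n * (\<integral>w. V 1 n w * (if V 1 n w > d then 1 else 0) \<partial>M) / d"
    have le: "prob {w\<in>space M. \<exists>i\<in>{1..int n}. V i n w > d} \<le> ?b n" for n
    proof -
      have one: "prob {w\<in>space M. V i n w > d} \<le> (\<integral>w. V 1 n w * (if V 1 n w > d then 1 else 0) \<partial>M) / d" if i: "1 \<le> i" for i
      proof -
        have "prob {w\<in>space M. V i n w > d} \<le> prob {w\<in>space M. V i n w * (if V i n w > d then 1 else 0) \<ge> d}"
          by (intro finite_measure_mono) auto
        also have "\<dots> \<le> (\<integral>w. V i n w * (if V i n w > d then 1 else 0) \<partial>M) / d"
          using V0 d by (intro integral_Markov_inequality_measure[OF Vbi[OF i], of "{}"]) auto
        finally show ?thesis unfolding Vbig[OF i] .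
      qed
      have "{w\<in>space M. \<exists>i\<in>{1..int n}. V i n w > d} = (\<Union>i\<in>{1..int n}. {w\<in>space M. V i n w > d})" by auto
      then have "prob {w\<in>space M. \<exists>i\<in>{1..int n}. V i n w > d} \<le> (\<Sum>i\<in>{1..int n}. prob {w\<in>space M. V i n w > d})"
        by (simp only:) (intro finite_measure_subadditive_finite, auto)
      also have "\<dots> \<le> (\<Sum>i\<in>{1..int n}. (\<integral>w. V 1 n w * (if V 1 n w > d then 1 else 0) \<partial>M) / d)"
        using one by (intro sum_mono) auto
      finally show ?thesis by simp
    qed
    have "?b \<longlonglongrightarrow> 0 / d" using lindV[OF d] by (intro tendsto_divide tendsto_const) (use d in auto)
    then have lim: "?b \<longlonglongrightarrow> 0" by simp
    show "(\<lambda>n. prob {w\<in>space M. \<exists>i\<in>{1..int n}. V i n w > d}) \<longlonglongrightarrow> 0"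
      by (rule tendsto_sandwich[OF _ _ tendsto_const lim]) (use le in \<open>auto intro!: always_eventually\<close>)
  qed (auto intro!: always_eventually)
  have Vsum: "(\<Sum>i\<in>{1..int n}. (\<epsilon> i w)\<^sup>2 * (s n (X i w))\<^sup>2) / real n = (\<Sum>i\<in>{1..int n}. V i n w)" for n w
    by (simp add: V_def z_def sum_divide_distrib)
  have quad: "whp (\<lambda>n w. \<bar>(\<Sum>i\<in>{1..int n}. V i n w) / \<sigma>2 n - 1\<bar> \<le> e)" if e: "e > 0" for e
    using sq
  proof
    assume iidP: "iid M borel ?P {1..}"
    let ?g = "\<lambda>n p. v n p / \<sigma>2 n"
    have g0: "0 \<le> ?g n p" for n p using z0 \<sigma>20 by (simp add: v_def)
    have gm: "?g n \<in> borel_measurable borel" for n by measurable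
    have gi: "integrable M (\<lambda>w. ?g n (?P 1 w))" for n unfolding vP using Vi[of 1 n] by simp
    have gmean: "\<forall>\<^sub>F n in sequentially. (\<integral>w. ?g n (?P 1 w) \<partial>M) = 1 / real n"
      using bounds by eventually_elim (use c in \<open>simp add: vP VE\<close>)
    have glind: "(\<lambda>n. real n * (\<integral>w. ?g n (?P 1 w) * (if ?g n (?P 1 w) > d then 1 else 0) \<partial>M)) \<longlonglongrightarrow> 0" if d: "d > 0" for d
    proof (rule tendsto_sandwich[OF _ _ tendsto_const])
      have "d * c > 0" using d c by simp
      from tendsto_divide[OF lindV[OF this] tendsto_const, of c]
      show "(\<lambda>n. real n * (\<integral>w. V 1 n w * (if V 1 n w > d * c then 1 else 0) \<partial>M) / c) \<longlonglongrightarrow> 0" using c by simp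
      show "\<forall>\<^sub>F n in sequentially. 0 \<le> real n * (\<integral>w. ?g n (?P 1 w) * (if ?g n (?P 1 w) > d then 1 else 0) \<partial>M)"
        using g0 by (intro always_eventually allI mult_nonneg_nonneg Bochner_Integration.integral_nonneg) auto
      show "\<forall>\<^sub>F n in sequentially. real n * (\<integral>w. ?g n (?P 1 w) * (if ?g n (?P 1 w) > d then 1 else 0) \<partial>M)
          \<le> real n * (\<integral>w. V 1 n w * (if V 1 n w > d * c then 1 else 0) \<partial>M) / c"
        using bounds
      proof eventually_elim
        case (elim n)
        have "(\<integral>w. V 1 n w / \<sigma>2 n * (if V 1 n w / \<sigma>2 n > d then 1 else 0) \<partial>M)
            \<le> (\<integral>w. V 1 n w * (if V 1 n w > d * c then 1 else 0) / c \<partial>M)"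
        proof (rule integral_mono)
          show "integrable M (\<lambda>w. V 1 n w * (if V 1 n w > d * c then 1 else 0) / c)" using Vbi[of 1 n "d * c"] by simp
          show "integrable M (\<lambda>w. V 1 n w / \<sigma>2 n * (if V 1 n w / \<sigma>2 n > d then 1 else 0))"
            by (rule Bochner_Integration.integrable_bound[OF Bochner_Integration.integrable_divide[OF Vi[OF order_refl, of n], of "\<sigma>2 n"]])
              (auto intro!: AE_I2)
          show "V 1 n w / \<sigma>2 n * (if V 1 n w / \<sigma>2 n > d then 1 else 0) \<le> V 1 n w * (if V 1 n w > d * c then 1 else 0) / c" for w
          proof (cases "V 1 n w / \<sigma>2 n > d")
            case True
            have s0: "\<sigma>2 n > 0" using elim c by linarith
            have "d * c \<le> d * \<sigma>2 n" using elim d by (intro mult_left_mono) auto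
            also have "d * \<sigma>2 n < V 1 n w" using True s0 by (simp add: pos_less_divide_eq)
            finally have "V 1 n w > d * c" .
            moreover have "V 1 n w / \<sigma>2 n \<le> V 1 n w / c" using elim c V0 by (intro divide_left_mono mult_pos_pos s0) auto
            ultimately show ?thesis using True by simp
          next
            case False
            then show ?thesis using V0 c by simp
          qed
        qed
        then have "(\<integral>w. V 1 n w / \<sigma>2 n * (if V 1 n w / \<sigma>2 n > d then 1 else 0) \<partial>M)
            \<le> (\<integral>w. V 1 n w * (if V 1 n w > d * c then 1 else 0) \<partial>M) / c" by simp
        from mult_left_mono[OF this, of "real n"] show ?case unfolding vP by simp
      qed
    qed
    have "(\<lambda>n. prob {w\<in>space M. \<bar>(\<Sum>i\<in>{1..int n}. ?g n (?P i w)) - 1\<bar> > e}) \<longlonglongrightarrow> 0"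
      by (rule wlln_triangular_iid[OF iidP gm g0 gi gmean glind e])
    then have lim: "(\<lambda>n. prob {w\<in>space M. \<bar>(\<Sum>i\<in>{1..int n}. V i n w) / \<sigma>2 n - 1\<bar> > e}) \<longlonglongrightarrow> 0"
      by (simp add: vP sum_divide_distrib)
    have "whp (\<lambda>n w. \<not> \<bar>(\<Sum>i\<in>{1..int n}. V i n w) / \<sigma>2 n - 1\<bar> > e)"
      by (rule whp_of_prob[OF lim]) (intro always_eventually allI, measurable)
    then show ?thesis by (simp add: not_less)
  next
    assume "\<forall>e>0. whp (\<lambda>n w. \<bar>(\<Sum>i\<in>{1..int n}. (\<epsilon> i w)\<^sup>2 * (s n (X i w))\<^sup>2) / real n - \<sigma>2 n\<bar> \<le> e)"
    moreover have "e * c > 0" using e c by simp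
    ultimately have "whp (\<lambda>n w. \<bar>(\<Sum>i\<in>{1..int n}. V i n w) - \<sigma>2 n\<bar> \<le> e * c)" unfolding Vsum by blast
    then show ?thesis
    proof (rule whp_mono)
      show "\<forall>\<^sub>F n in sequentially. \<forall>w\<in>space M. \<bar>(\<Sum>i\<in>{1..int n}. V i n w) - \<sigma>2 n\<bar> \<le> e * c \<longrightarrow>
          \<bar>(\<Sum>i\<in>{1..int n}. V i n w) / \<sigma>2 n - 1\<bar> \<le> e"
        using bounds
      proof eventually_elim
        case (elim n)
        have s0: "\<sigma>2 n > 0" using elim c by linarith
        show ?case
        proof (intro ballI impI)
          fix w assume "\<bar>(\<Sum>i\<in>{1..int n}. V i n w) - \<sigma>2 n\<bar> \<le> e * c"
          also have "e * c \<le> e * \<sigma>2 n" using elim e by (intro mult_left_mono) auto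
          finally have "\<bar>(\<Sum>i\<in>{1..int n}. V i n w) - \<sigma>2 n\<bar> / \<sigma>2 n \<le> e" using s0 by (simp add: pos_divide_le_eq)
          moreover have "(\<Sum>i\<in>{1..int n}. V i n w) / \<sigma>2 n - 1 = ((\<Sum>i\<in>{1..int n}. V i n w) - \<sigma>2 n) / \<sigma>2 n"
            using s0 by (simp add: diff_divide_distrib)
          ultimately show "\<bar>(\<Sum>i\<in>{1..int n}. V i n w) / \<sigma>2 n - 1\<bar> \<le> e" using s0 by (simp add: abs_divide)
        qed
      qed
    qed
  qed
  define \<xi> where "\<xi> n k w = \<epsilon> (int k + 1) w * s n (X (int k + 1) w) / (sqrt (real n) * sqrt (\<sigma>2 n))" for n k w
  have \<xi>2: "(\<xi> n k w)\<^sup>2 = V (int k + 1) n w / \<sigma>2 n" for n k w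
    using \<sigma>20[of n] by (simp add: \<xi>_def V_def z_def power_divide power_mult_distrib)
  have sqs: "sq_sum (\<xi> n) n w = (\<Sum>i\<in>{1..int n}. V i n w) / \<sigma>2 n" for n w
    unfolding sq_sum_def \<xi>2 sum_divide_distrib by (rule sum_observations)
  have \<xi>sum: "(\<Sum>i<n. \<xi> n i w) = (\<Sum>i\<in>{1..int n}. \<epsilon> i w * s n (X i w)) / (sqrt (real n) * sqrt (\<sigma>2 n))" for n w
    unfolding \<xi>_def sum_divide_distrib by (rule sum_observations)
  have sX: "(\<lambda>w. s n (X i w)) \<in> borel_measurable M" for n i by (rule measurable_compose[OF X_borel s(1)])
  define F where "F k = past_algebra M X \<epsilon> (int k + 1)" for k
  show ?thesis
  proof (rule martingale_clt[OF Z])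
    show "\<forall>\<^sub>F n in sequentially. mds_upto n F (\<xi> n) \<and> integrable M (sq_sum (\<xi> n) n) \<and> (\<integral>w. sq_sum (\<xi> n) n w \<partial>M) \<le> 1"
      using bounds eventually_ge_at_top[of 1]
    proof eventually_elim
      case (elim n)
      have s0: "\<sigma>2 n > 0" using elim c by linarith
      have "mds_upto n F (\<xi> n)"
        unfolding mds_upto_def
      proof (intro allI impI conjI)
        fix k assume "k < n"
        show "subalgebra M (F k)" unfolding F_def by (rule past_algebra_sets(3)[OF X_borel eps_meas])
        show "\<xi> n k \<in> borel_measurable M" unfolding \<xi>_def[abs_def]
          by (intro borel_measurable_divide borel_measurable_times eps_meas sX borel_measurable_const)
        show "\<xi> n j \<in> borel_measurable (F k)" if "j < k" for j
          unfolding \<xi>_def[abs_def] F_def using that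
          by (intro borel_measurable_divide borel_measurable_times borel_measurable_const past_algebra_measurable[OF X_borel eps_meas]
              measurable_compose[OF past_algebra_measurable(1)[OF X_borel eps_meas] s(1)]) auto
        fix g :: "'w \<Rightarrow> real" and B assume g: "g \<in> borel_measurable (F k)" "\<forall>w. \<bar>g w\<bar> \<le> B"
        let ?h = "\<lambda>w. s n (X (int k + 1) w) * g w / (sqrt (real n) * sqrt (\<sigma>2 n))"
        have e: "\<xi> n k w * g w = ?h w * \<epsilon> (int k + 1) w" for w by (simp add: \<xi>_def)
        have hm: "?h \<in> borel_measurable (F k)"
          using g(1) unfolding F_def
          by (intro borel_measurable_divide borel_measurable_times borel_measurable_const
              measurable_compose[OF past_algebra_measurable(1)[OF X_borel eps_meas order_refl] s(1)])
        have "\<bar>?h w\<bar> \<le> Bs n * B / (sqrt (real n) * sqrt (\<sigma>2 n))" for w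
          unfolding abs_divide abs_mult using g(2) Bs[of n] \<sigma>20[of n] order_trans[OF abs_ge_zero Bs[of n undefined]] order_trans[OF abs_ge_zero g(2)[rule_format, of undefined]]
          by (intro frac_le mult_mono) (use s0 elim(2) in auto)
        from eps_integrable[OF _ measurable_from_subalg[OF past_algebra_sets(3)[OF X_borel eps_meas] hm[unfolded F_def]] this]
        have hi: "integrable M (\<lambda>w. ?h w * \<epsilon> (int k + 1) w)" by simp
        then show "integrable M (\<lambda>w. \<xi> n k w * g w)" unfolding e .
        show "(\<integral>w. \<xi> n k w * g w \<partial>M) = 0" unfolding e
          by (rule eps_orth[OF _ hm[unfolded F_def] hi]) simp
      qed
      moreover have "integrable M (sq_sum (\<xi> n) n)" proof -
        have "sq_sum (\<xi> n) n = (\<lambda>w. (\<Sum>i\<in>{1..int n}. V i n w) / \<sigma>2 n)" by (rule ext) (rule sqs)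
        moreover have "integrable M (\<lambda>w. \<Sum>i\<in>{1..int n}. V i n w)"
          using Vi by (intro Bochner_Integration.integrable_sum) auto
        ultimately show ?thesis by (simp only: integrable_divide)
      qed
      moreover have "(\<integral>w. sq_sum (\<xi> n) n w \<partial>M) = 1"
      proof -
        have "(\<integral>w. sq_sum (\<xi> n) n w \<partial>M) = (\<integral>w. (\<Sum>i\<in>{1..int n}. V i n w) \<partial>M) / \<sigma>2 n" unfolding sqs by simp
        also have "(\<integral>w. (\<Sum>i\<in>{1..int n}. V i n w) \<partial>M) = (\<Sum>i\<in>{1..int n}. \<sigma>2 n / real n)"
          using Vi VEi by (subst Bochner_Integration.integral_sum) auto
        finally show ?thesis using s0 elim(2) by simp
      qed
      ultimately show ?case by simp
    qed
    fix \<delta> :: real assume \<delta>: "0 < \<delta>" "\<delta> \<le> 1"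
    have d: "\<delta>\<^sup>2 * c > 0" using \<delta> c by simp
    have "whp (\<lambda>n w. \<bar>sq_sum (\<xi> n) n w - 1\<bar> \<le> \<delta> \<and> (\<forall>i<n. \<bar>\<xi> n i w\<bar> \<le> \<delta>) \<and> \<bar>Z n w - (\<Sum>i<n. \<xi> n i w)\<bar> \<le> \<delta>)"
    proof (rule whp_mono[OF whp_conj[OF quad[OF \<delta>(1)] whp_conj[OF max[OF d] approx[OF \<delta>(1)]]]])
      show "\<forall>\<^sub>F n in sequentially. \<forall>w\<in>space M. \<bar>(\<Sum>i\<in>{1..int n}. V i n w) / \<sigma>2 n - 1\<bar> \<le> \<delta> \<and>
          \<not> (\<exists>i\<in>{1..int n}. V i n w > \<delta>\<^sup>2 * c) \<and>
          \<bar>Z n w - (\<Sum>i\<in>{1..int n}. \<epsilon> i w * s n (X i w)) / (sqrt (real n) * sqrt (\<sigma>2 n))\<bar> \<le> \<delta> \<longrightarrow>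
          \<bar>sq_sum (\<xi> n) n w - 1\<bar> \<le> \<delta> \<and> (\<forall>i<n. \<bar>\<xi> n i w\<bar> \<le> \<delta>) \<and> \<bar>Z n w - (\<Sum>i<n. \<xi> n i w)\<bar> \<le> \<delta>"
        using bounds
      proof eventually_elim
        case (elim n)
        have s0: "\<sigma>2 n > 0" using elim c by linarith
        have "\<bar>\<xi> n k w\<bar> \<le> \<delta>" if k: "k < n" and V: "\<not> (\<exists>i\<in>{1..int n}. V i n w > \<delta>\<^sup>2 * c)" for k w
        proof -
          have "V (int k + 1) n w \<le> \<delta>\<^sup>2 * c" using V k by (auto simp: not_less)
          also have "\<dots> \<le> \<delta>\<^sup>2 * \<sigma>2 n" using elim by (intro mult_left_mono) auto
          finally have "(\<xi> n k w)\<^sup>2 \<le> \<delta>\<^sup>2" unfolding \<xi>2 using s0 by (simp add: pos_divide_le_eq)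
          then show ?thesis using \<delta> by (simp add: abs_le_square_iff[symmetric])
        qed
        then show ?case unfolding sqs \<xi>sum by blast
      qed
    qed
    then show "\<forall>\<^sub>F n in sequentially. \<exists>A\<in>sets M. prob A \<ge> 1 - \<delta>\<^sup>2 \<and>
      (\<forall>w\<in>A. \<bar>sq_sum (\<xi> n) n w - 1\<bar> \<le> \<delta> \<and> (\<forall>i<n. \<bar>\<xi> n i w\<bar> \<le> \<delta>) \<and> \<bar>Z n w - (\<Sum>i<n. \<xi> n i w)\<bar> \<le> \<delta>)"
      using \<delta> unfolding whp_def by simp
  qed
qed

section \<open>Functions on the support and the sieve space\<close>

text \<open>Boundedness on \<open>\<X>\<close> already implies square integrability, since \<open>X0\<close> takes its values there.\<close>

lemma (in prob_space) L2_Linf_I: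
  assumes X0: "X0 \<in> borel_measurable M" "\<And>w. w \<in> space M \<Longrightarrow> X0 w \<in> \<X>"
    and g: "g \<in> borel_measurable (restrict_space borel \<X>)" "\<And>x. x \<in> \<X> \<Longrightarrow> \<bar>g x\<bar> \<le> B"
  shows "g \<in> L2_Linf M \<X> X0"
  unfolding L2_Linf_def
proof (intro CollectI conjI g(1))
  have "X0 \<in> measurable M (restrict_space borel \<X>)" using X0 by (intro measurable_restrict_space2) auto
  then have "(\<lambda>w. g (X0 w)) \<in> borel_measurable M" by (rule measurable_compose[OF _ g(1)])
  moreover have "(g (X0 w))\<^sup>2 \<le> B\<^sup>2" if "w \<in> space M" for w
    using power_mono[OF g(2)[OF X0(2)[OF that]], of 2] by simp
  ultimately show "integrable M (\<lambda>w. (g (X0 w))\<^sup>2)"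
    by (intro integrable_const_bound[of _ "B\<^sup>2"] borel_measurable_power) (auto intro!: AE_I2)
  show "bounded (g ` \<X>)" using g(2) by (intro boundedI[of _ B]) auto
qed

lemma (in prob_space) L2_Linf_combination:
  assumes X0: "X0 \<in> borel_measurable M" "\<And>w. w \<in> space M \<Longrightarrow> X0 w \<in> \<X>"
    and u: "u \<in> L2_Linf M \<X> X0" and v: "v \<in> L2_Linf M \<X> X0"
  shows "(\<lambda>x. a * u x + c * v x) \<in> L2_Linf M \<X> X0"
proof -
  obtain A B where AB: "\<And>x. x \<in> \<X> \<Longrightarrow> \<bar>u x\<bar> \<le> A" "\<And>x. x \<in> \<X> \<Longrightarrow> \<bar>v x\<bar> \<le> B"
    using u v unfolding L2_Linf_def bounded_iff by fastforce
  have "\<bar>a * u x + c * v x\<bar> \<le> \<bar>a\<bar> * A + \<bar>c\<bar> * B" if "x \<in> \<X>" for x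
  proof -
    have "\<bar>a * u x + c * v x\<bar> \<le> \<bar>a\<bar> * \<bar>u x\<bar> + \<bar>c\<bar> * \<bar>v x\<bar>" by (simp add: abs_mult[symmetric] abs_triangle_ineq)
    also have "\<dots> \<le> \<bar>a\<bar> * A + \<bar>c\<bar> * B" using AB[OF that] by (intro add_mono mult_left_mono) auto
    finally show ?thesis .
  qed
  moreover have "(\<lambda>x. a * u x + c * v x) \<in> borel_measurable (restrict_space borel \<X>)"
    using u v by (intro borel_measurable_add borel_measurable_times borel_measurable_const) (auto simp: L2_Linf_def)
  ultimately show ?thesis by (intro L2_Linf_I[OF X0]) auto
qed

text \<open>Linearity for two functions extends to the finite sums that make up the sieve space.\<close>

lemma (in prob_space) pathwise_deriv_span:
  assumes X0: "X0 \<in> borel_measurable M" "\<And>w. w \<in> space M \<Longrightarrow> X0 w \<in> \<X>"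
    and lin: "pathwise_linear_on (L2_Linf M \<X> X0) f h"
    and p: "\<And>x. p x \<in> carrier_vec K" "\<And>k. k < K \<Longrightarrow> (\<lambda>x. p x $ k) \<in> L2_Linf M \<X> X0"
    and c: "c \<in> carrier_vec K"
  shows "(\<lambda>x. c \<bullet> p x) \<in> L2_Linf M \<X> X0"
    "pathwise_deriv f h (\<lambda>x. c \<bullet> p x) = c \<bullet> vec K (\<lambda>k. pathwise_deriv f h (\<lambda>x. p x $ k))"
proof -
  let ?L = "L2_Linf M \<X> X0" and ?Df = "pathwise_deriv f h"
  have comb: "?Df (\<lambda>x. a * u x + b * v x) = a * ?Df u + b * ?Df v" if "u \<in> ?L" "v \<in> ?L" for u v a b
    using lin that unfolding pathwise_linear_on_def by blast
  have zero: "(\<lambda>x. 0) \<in> ?L" by (rule L2_Linf_I[OF X0, of _ 0]) auto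
  have "(\<lambda>x. \<Sum>k<m. c $ k * p x $ k) \<in> ?L \<and> ?Df (\<lambda>x. \<Sum>k<m. c $ k * p x $ k) = (\<Sum>k<m. c $ k * ?Df (\<lambda>x. p x $ k))"
    if "m \<le> K" for m
    using that
  proof (induction m)
    case 0
    show ?case using zero comb[OF zero zero, of 0 0] by simp
  next
    case (Suc m)
    then have IH: "(\<lambda>x. \<Sum>k<m. c $ k * p x $ k) \<in> ?L" "?Df (\<lambda>x. \<Sum>k<m. c $ k * p x $ k) = (\<Sum>k<m. c $ k * ?Df (\<lambda>x. p x $ k))"
      and pm: "(\<lambda>x. p x $ m) \<in> ?L" using p(2) by auto
    show ?case
      using L2_Linf_combination[OF X0 IH(1) pm, of 1 "c $ m"] comb[OF IH(1) pm, of 1 "c $ m"] IH(2) by simp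
  qed
  from this[OF order_refl] show "(\<lambda>x. c \<bullet> p x) \<in> ?L" "?Df (\<lambda>x. c \<bullet> p x) = c \<bullet> vec K (\<lambda>k. ?Df (\<lambda>x. p x $ k))"
    unfolding scalar_prod_sum[OF p(1)] by (simp_all add: scalar_prod_sum[of _ K])
qed

text \<open>The basis functions are measurable on \<open>\<X>\<close> only, but their truncations live on the compact set \<open>D n\<close>,
  which is Borel, and so they are Borel functions on the whole space.\<close>

lemma (in prob_space) sieve_design_sieve_vec:
  fixes X :: "int \<Rightarrow> 'a \<Rightarrow> real ^ 'd"
  assumes X: "\<And>i. X i \<in> borel_measurable M" and D: "D n \<subseteq> \<X>" "compact (D n)" and K: "K \<ge> 1"
    and b: "\<And>k. k < K \<Longrightarrow> (\<lambda>x. b K k x * indicator (D n) x) \<in> L2_Linf M \<X> (X 1)"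
    and pos: "lambda_min (gram M (X 1) K (sieve_vec b D K n)) > 0"
  shows "sieve_design M X K (sieve_vec b D K n)"
proof unfold_locales
  show "sieve_vec b D K n x \<in> carrier_vec K" for x by (simp add: sieve_vec_def)
  have comp: "sieve_vec b D K n x $ k = b K k x * indicator (D n) x" if "k < K" for k x using that by (simp add: sieve_vec_def)
  have D_borel: "D n \<in> sets borel" using compact_imp_closed[OF D(2)] by (rule borel_closed)
  show "(\<lambda>x. sieve_vec b D K n x $ k) \<in> borel_measurable borel" if k: "k < K" for k
  proof -
    have "(\<lambda>x. b K k x * indicator (D n) x) \<in> borel_measurable (restrict_space borel (D n))"
      using b[OF k] by (intro measurable_restrict_mono[OF _ D(1)]) (simp add: L2_Linf_def)
    then have "(\<lambda>x. indicator (D n) x *\<^sub>R (b K k x * indicator (D n) x)) \<in> borel_measurable borel"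
      using D_borel by (subst (asm) borel_measurable_restrict_space_iff) auto
    moreover have "indicator (D n) x *\<^sub>R (b K k x * indicator (D n) x) = sieve_vec b D K n x $ k" for x
      unfolding comp[OF k] by (simp add: indicator_def)
    ultimately show ?thesis by simp
  qed
  have "\<exists>B. \<forall>x. \<bar>b K k x * indicator (D n) x\<bar> \<le> B" if k: "k < K" for k
  proof -
    from b[OF k] obtain B where B: "\<And>x. x \<in> \<X> \<Longrightarrow> \<bar>b K k x * indicator (D n) x\<bar> \<le> B"
      unfolding L2_Linf_def bounded_iff by fastforce
    have "\<bar>b K k x * indicator (D n) x\<bar> \<le> max B 0" for x
      using B[of x] D(1) by (cases "x \<in> D n") (auto simp: le_max_iff_disj)
    then show ?thesis by blast
  qed
  then obtain B where B: "\<And>k x. k < K \<Longrightarrow> \<bar>b K k x * indicator (D n) x\<bar> \<le> B k" by metis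
  have "\<bar>sieve_vec b D K n x $ k\<bar> \<le> (\<Sum>k<K. \<bar>B k\<bar>)" if k: "k < K" for x k
  proof -
    have "\<bar>sieve_vec b D K n x $ k\<bar> \<le> \<bar>B k\<bar>" using B[OF k, of x] by (simp add: comp[OF k])
    also have "\<dots> \<le> (\<Sum>k<K. \<bar>B k\<bar>)" using k by (intro member_le_sum) auto
    finally show ?thesis .
  qed
  then show "\<exists>B. \<forall>x. \<forall>k<K. \<bar>sieve_vec b D K n x $ k\<bar> \<le> B" by blast
qed (use X K pos in auto)

section \<open>Weighted Gram matrices\<close>

lemma quadratic_form_le_spectral_norm:
  assumes A: "A \<in> carrier_mat n n" and c: "c \<in> carrier_vec n" "vec_norm2 c = 1"
  shows "\<bar>c \<bullet> (A *\<^sub>v c)\<bar> \<le> spectral_norm A"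
  using scalar_prod_cauchy_schwarz[OF c(1) mult_mat_vec_carrier[OF A c(1)]] vec_norm2_mult_le_spectral_norm[OF A c(1)] c(2)
  by simp

context sieve_noise
begin

lemma inner_q_square: "c \<in> carrier_vec K \<Longrightarrow> (c \<bullet> q x)\<^sup>2 = (\<Sum>j<K. \<Sum>k<K. c $ j * c $ k * (q x $ j * q x $ k))"
  unfolding scalar_prod_sum[OF q_dim] power2_eq_square sum_product by (simp only: mult_ac)

lemma noise_gram_form:
  assumes c: "c \<in> carrier_vec K"
  shows "c \<bullet> (weighted_gram M (\<lambda>w. (\<epsilon> 1 w)\<^sup>2) (X 1) K q *\<^sub>v c) = (\<integral>w. (\<epsilon> 1 w)\<^sup>2 * (c \<bullet> q (X 1 w))\<^sup>2 \<partial>M)"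
proof -
  let ?Om = "weighted_gram M (\<lambda>w. (\<epsilon> 1 w)\<^sup>2) (X 1) K q"
  have Om: "?Om \<in> carrier_mat K K" by (simp add: weighted_gram_def)
  have int: "integrable M (\<lambda>w. (\<epsilon> 1 w)\<^sup>2 * (q (X 1 w) $ j * q (X 1 w) $ k))" if jk: "j < K" "k < K" for j k
  proof -
    obtain A where A: "\<And>x. \<bar>q x $ j\<bar> \<le> A" using q_component(2)[OF jk(1)] by blast
    obtain B where B: "\<And>x. \<bar>q x $ k\<bar> \<le> B" using q_component(2)[OF jk(2)] by blast
    have "integrable M (\<lambda>w. (q (X 1 w) $ j * q (X 1 w) $ k) * (\<epsilon> 1 w * \<epsilon> 1 w))"
      using A B order_trans[OF abs_ge_zero A[of undefined]] jk
      by (intro eps_prod_integrable[of _ _ _ "A * B"] borel_measurable_times measurable_compose[OF X_meas q_component(1)])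
        (auto simp: abs_mult intro!: mult_mono)
    then show ?thesis by (simp only: power2_eq_square mult_ac)
  qed
  have "(\<integral>w. (\<epsilon> 1 w)\<^sup>2 * (c \<bullet> q (X 1 w))\<^sup>2 \<partial>M)
      = (\<integral>w. (\<Sum>j<K. \<Sum>k<K. c $ j * c $ k * ((\<epsilon> 1 w)\<^sup>2 * (q (X 1 w) $ j * q (X 1 w) $ k))) \<partial>M)"
    unfolding inner_q_square[OF c] sum_distrib_left by (simp only: mult_ac)
  also have "\<dots> = (\<Sum>j<K. (\<integral>w. (\<Sum>k<K. c $ j * c $ k * ((\<epsilon> 1 w)\<^sup>2 * (q (X 1 w) $ j * q (X 1 w) $ k))) \<partial>M))"
    using int by (intro Bochner_Integration.integral_sum Bochner_Integration.integrable_sum integrable_mult_right) auto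
  also have "\<dots> = (\<Sum>j<K. \<Sum>k<K. (\<integral>w. c $ j * c $ k * ((\<epsilon> 1 w)\<^sup>2 * (q (X 1 w) $ j * q (X 1 w) $ k)) \<partial>M))"
    using int by (intro sum.cong refl Bochner_Integration.integral_sum integrable_mult_right) auto
  also have "\<dots> = (\<Sum>j<K. \<Sum>k<K. ?Om $$ (j, k) * (c $ j * c $ k))"
    by (intro sum.cong refl) (auto simp: weighted_gram_def)
  also have "\<dots> = c \<bullet> (?Om *\<^sub>v c)" by (rule quadratic_form_sum[OF Om c c, symmetric])
  finally show ?thesis by simp
qed

lemma noise_sample_gram_form:
  assumes c: "c \<in> carrier_vec K"
  shows "c \<bullet> (weighted_sample_gram (\<lambda>i w. (\<epsilon> i w)\<^sup>2) X K q n w *\<^sub>v c) = (\<Sum>i\<in>{1..int n}. (\<epsilon> i w)\<^sup>2 * (c \<bullet> q (X i w))\<^sup>2) / real n"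
proof -
  let ?Om = "weighted_sample_gram (\<lambda>i w. (\<epsilon> i w)\<^sup>2) X K q n w"
  have Om: "?Om \<in> carrier_mat K K" by (simp add: weighted_sample_gram_def)
  have "c \<bullet> (?Om *\<^sub>v c) = (\<Sum>j<K. \<Sum>k<K. ?Om $$ (j, k) * (c $ j * c $ k))" by (rule quadratic_form_sum[OF Om c c])
  also have "\<dots> = (\<Sum>j<K. \<Sum>k<K. (\<Sum>i\<in>{1..int n}. (\<epsilon> i w)\<^sup>2 * (c $ j * c $ k * (q (X i w) $ j * q (X i w) $ k)))) / real n"
    unfolding sum_divide_distrib[of _ _ "real n"]
    by (intro sum.cong refl) (simp add: weighted_sample_gram_def sum_distrib_left sum_divide_distrib mult_ac)
  also have "(\<Sum>j<K. \<Sum>k<K. (\<Sum>i\<in>{1..int n}. (\<epsilon> i w)\<^sup>2 * (c $ j * c $ k * (q (X i w) $ j * q (X i w) $ k))))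
      = (\<Sum>j<K. \<Sum>i\<in>{1..int n}. \<Sum>k<K. (\<epsilon> i w)\<^sup>2 * (c $ j * c $ k * (q (X i w) $ j * q (X i w) $ k)))"
    by (intro sum.cong refl sum.swap)
  also have "\<dots> = (\<Sum>i\<in>{1..int n}. \<Sum>j<K. \<Sum>k<K. (\<epsilon> i w)\<^sup>2 * (c $ j * c $ k * (q (X i w) $ j * q (X i w) $ k)))"
    by (rule sum.swap)
  also have "\<dots> = (\<Sum>i\<in>{1..int n}. (\<epsilon> i w)\<^sup>2 * (c \<bullet> q (X i w))\<^sup>2)"
    unfolding inner_q_square[OF c] sum_distrib_left ..
  finally show ?thesis .
qed

text \<open>The difference of the two estimators, paired with the functional: in the direction of the
  representer the noise sum appears, up to the error of replacing the sample Gram matrix by the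
  identity.\<close>

lemma series_difference_linear_part:
  assumes n: "n \<ge> 1" and \<phi>: "\<phi> \<in> carrier_vec K" and \<gamma>: "\<gamma> \<in> carrier_vec K" "vec_norm2 \<gamma> = 1" "W *\<^sub>v \<phi> = r \<cdot>\<^sub>v \<gamma>"
    and dev: "deviation n w \<le> 1 / 2"
    and Y: "\<And>i. i \<in> {1..int n} \<Longrightarrow> Y i w = H i w + \<epsilon> i w"
  shows "\<exists>\<beta>\<in>carrier_vec K. (\<forall>x. series_ls X K p Y n w x - series_ls X K p H n w x = \<beta> \<bullet> p x) \<and>
    sqrt (real n) * (\<beta> \<bullet> \<phi>) = r * ((\<Sum>i\<in>{1..int n}. \<epsilon> i w * (\<gamma> \<bullet> q (X i w))) / sqrt (real n) + residual n \<gamma> w)"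
proof -
  note sh = shift_small[OF n \<gamma>(1,2) dev order_refl]
  from series_difference[where Y = Y and H = H and \<epsilon> = \<epsilon>, OF n sh(1) Y] obtain \<beta> where \<beta>: "\<beta> \<in> carrier_vec K"
    "\<And>x. series_ls X K p Y n w x - series_ls X K p H n w x = \<beta> \<bullet> p x"
    "\<And>\<phi>. \<phi> \<in> carrier_vec K \<Longrightarrow> \<beta> \<bullet> \<phi> =
      (\<Sum>i\<in>{1..int n}. \<epsilon> i w * (cramer_solution (sample_gram n w) (W *\<^sub>v \<phi>) \<bullet> q (X i w))) / real n" by blast
  let ?G = "sample_gram n w" and ?u = "cramer_solution (sample_gram n w) \<gamma>"
  have u: "?u \<in> carrier_vec K" by (rule cramer_solution_carrier[OF sample_gram_carrier \<gamma>(1)])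
  have adj: "(1 / det ?G) \<cdot>\<^sub>m adj_mat ?G \<in> carrier_mat K K" using adj_mat(1)[OF sample_gram_carrier[of n w]] by simp
  have "cramer_solution ?G (W *\<^sub>v \<phi>) = r \<cdot>\<^sub>v ?u"
    unfolding \<gamma>(3) cramer_solution_def by (rule mult_mat_vec[OF adj \<gamma>(1)])
  then have dot: "cramer_solution ?G (W *\<^sub>v \<phi>) \<bullet> q x = r * (\<gamma> \<bullet> q x + weight_shift n \<gamma> w \<bullet> q x)" for x
    using minus_scalar_prod_distrib[OF u \<gamma>(1) q_dim] u q_dim by simp
  define S1 where "S1 = (\<Sum>i\<in>{1..int n}. \<epsilon> i w * (\<gamma> \<bullet> q (X i w)))"
  define S2 where "S2 = (\<Sum>i\<in>{1..int n}. \<epsilon> i w * (weight_shift n \<gamma> w \<bullet> q (X i w)))"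
  have "\<beta> \<bullet> \<phi> = r * (S1 + S2) / real n"
    unfolding \<beta>(3)[OF \<phi>] dot S1_def S2_def sum.distrib[symmetric] sum_distrib_left by (simp only: algebra_simps)
  then have "sqrt (real n) * (\<beta> \<bullet> \<phi>) = r * (S1 / sqrt (real n) + S2 / sqrt (real n))"
    using n by (simp add: field_simps)
  then have "sqrt (real n) * (\<beta> \<bullet> \<phi>) = r * ((\<Sum>i\<in>{1..int n}. \<epsilon> i w * (\<gamma> \<bullet> q (X i w))) / sqrt (real n) + residual n \<gamma> w)"
    unfolding S1_def S2_def .
  then show ?thesis using \<beta> by blast
qed

end

section \<open>The plug-in estimator\<close>

theorem theorem3p1:
  fixes M :: "'w measure"
    and \<X> :: "(real ^ 'd) set"
    and X :: "int \<Rightarrow> 'w \<Rightarrow> real ^ 'd"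
    and Y \<epsilon> :: "int \<Rightarrow> 'w \<Rightarrow> real"
    and h0 :: "real ^ 'd \<Rightarrow> real"
    and f :: "(real ^ 'd \<Rightarrow> real) \<Rightarrow> real"
    and D :: "nat \<Rightarrow> (real ^ 'd) set"
    and b :: "nat \<Rightarrow> nat \<Rightarrow> real ^ 'd \<Rightarrow> real"
    and K :: "nat \<Rightarrow> nat"
    and N :: "nat \<Rightarrow> (real ^ 'd \<Rightarrow> real) set"
  defines "L \<equiv> L2_Linf M \<X> (X 1)"
  defines "Df \<equiv> pathwise_deriv f h0"
  defines "bw \<equiv> \<lambda>n. sieve_vec b D (K n) n"
  defines "bt \<equiv> \<lambda>n. normalized_vec M (X 1) (K n) (bw n)"
  defines "hhat \<equiv> \<lambda>n \<omega>. series_ls X (K n) (bw n) Y n \<omega>"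
  defines "htilde \<equiv> \<lambda>n \<omega>. series_ls X (K n) (bw n) (\<lambda>i \<omega>. h0 (X i \<omega>)) n \<omega>"
  defines "vK \<equiv> \<lambda>n. riesz_representer M (X 1) Df
                     (fun_span (K n) (bw n))"
  defines "VK \<equiv> \<lambda>n. \<integral>\<omega>. (\<epsilon> 1 \<omega> * vK n (X 1 \<omega>))\<^sup>2 \<partial>M"
  defines "Bt \<equiv> \<lambda>n \<omega>. design_mat X (K n) (bt n) n \<omega>"
  defines "Gdev \<equiv> \<lambda>n \<omega>. spectral_norm
           ((1 / real n) \<cdot>\<^sub>m (transpose_mat (Bt n \<omega>) * Bt n \<omega>) - 1\<^sub>m (K n))"
  defines "Omega_hat \<equiv> \<lambda>n \<omega>. weighted_sample_gram (\<lambda>i \<omega>. (\<epsilon> i \<omega>)\<^sup>2) X (K n) (bt n) n \<omega>"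
  defines "Omega \<equiv> \<lambda>n. weighted_gram M (\<lambda>\<omega>. (\<epsilon> 1 \<omega>)\<^sup>2) (X 1) (K n) (bt n)"
  assumes M: "prob_space M"
    and X_meas: "\<And>i. X i \<in> borel_measurable M"
    and X_range: "\<And>i \<omega>. \<omega> \<in> space M \<Longrightarrow> X i \<omega> \<in> \<X>"
    and eps_meas: "\<And>i. \<epsilon> i \<in> borel_measurable M"
    and model: "\<And>i \<omega>. i \<ge> 1 \<Longrightarrow> \<omega> \<in> space M \<Longrightarrow> Y i \<omega> = h0 (X i \<omega>) + \<epsilon> i \<omega>"
    and eps_integrable: "\<And>i. i \<ge> 1 \<Longrightarrow> integrable M (\<epsilon> i)"
    and eps_mean: "\<And>i. i \<ge> 1 \<Longrightarrow>
          AE \<omega> in M. real_cond_exp M (vimage_algebra (space M) (X i) borel) (\<epsilon> i) \<omega> = 0"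
    and h0: "h0 \<in> L"
    and D: "\<And>n. n \<ge> 1 \<Longrightarrow> D n \<subseteq> \<X> \<and> compact (D n) \<and> convex (D n) \<and> interior (D n) \<noteq> {}
              \<and> D n \<subseteq> D (Suc n)"
    and basis: "\<And>k j n. n \<ge> 1 \<Longrightarrow> j < k \<Longrightarrow> (\<lambda>x. b k j x * indicator (D n) x) \<in> L"
    and K_pos: "\<And>n. n \<ge> 1 \<Longrightarrow> K n \<ge> 1"
    and K_tendsto: "filterlim K at_top sequentially"
    and N: "\<And>n. n \<ge> 1 \<Longrightarrow> N n \<subseteq> L \<and> convex_functions (N n)"
    and f_hhat_meas: "\<And>n. n \<ge> 1 \<Longrightarrow> (\<lambda>\<omega>. f (hhat n \<omega>)) \<in> borel_measurable M"
    and X_stationary: "strictly_stationary M borel X UNIV"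
    and eps_stationary: "strictly_stationary M borel (\<lambda>i \<omega>. (X i \<omega>, \<epsilon> i \<omega>)) {1..}"
    and eps_mds: "\<And>i. i \<ge> 1 \<Longrightarrow>
          AE \<omega> in M. real_cond_exp M (past_algebra M X \<epsilon> i) (\<epsilon> i) \<omega> = 0"
    and eps_cond_var_bounded: "\<exists>C::real. \<forall>i\<ge>1.
          AE \<omega> in M. nn_cond_exp M (past_algebra M X \<epsilon> i) (\<lambda>\<omega>. ennreal ((\<epsilon> i \<omega>)\<^sup>2)) \<omega> \<le> ennreal C"
    and eps_cond_var_pos: "\<And>i. i \<ge> 1 \<Longrightarrow>
          \<exists>g. is_cond_exp_given M \<X> (X i) (\<lambda>\<omega>. (\<epsilon> i \<omega>)\<^sup>2) g \<and> (INF x\<in>\<X>. g x) > 0"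
    and eps_tail: "\<And>i (l :: nat \<Rightarrow> real).
          i \<ge> 1 \<Longrightarrow> (\<forall>n. l n > 0) \<Longrightarrow> filterlim l at_top sequentially \<Longrightarrow>
          \<exists>g. (\<forall>n. is_cond_exp_given M \<X> (X i)
                      (\<lambda>\<omega>. (\<epsilon> i \<omega>)\<^sup>2 * (if \<bar>\<epsilon> i \<omega>\<bar> > l n then 1 else 0)) (g n))
            \<and> (\<lambda>n. SUP x\<in>\<X>. g n x) \<longlonglongrightarrow> 0"
    and gram_pos: "\<And>k n. k \<ge> 1 \<Longrightarrow> n \<ge> 1 \<Longrightarrow> lambda_min (gram M (X 1) k (sieve_vec b D k n)) > 0"
    and gram_conv:
        "(iid M borel X {1..} \<and>
          (\<lambda>n. zeta \<X> (bw n) * lambda_factor M (X 1) (K n) (bw n) * sqrt (ln (real (K n)) / real n))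
            \<longlonglongrightarrow> 0)
         \<or> little_op M Gdev (\<lambda>n. 1)"
    and deriv_linear: "pathwise_linear_on L f h0"
    and linearization:
        "(\<lambda>n. SUP h\<in>N n. ennreal (sqrt (real n) * inverse (L2_norm M (X 1) (vK n)) *
              \<bar>f h - f h0 - Df (\<lambda>x. h x - h0 x)\<bar>)) \<longlonglongrightarrow> 0"
    and in_N: "wp_approaching_one M (\<lambda>n \<omega>. hhat n \<omega> \<in> N n \<and> htilde n \<omega> \<in> N n)"
    and vK_mono: "mono_on {1..} (\<lambda>n. L2_norm M (X 1) (vK n))"
    and vK_diverges: "filterlim (\<lambda>n. L2_norm M (X 1) (vK n)) at_top sequentially"
    and bias: "little_op M (\<lambda>n \<omega>. sqrt (real n) * inverse (L2_norm M (X 1) (vK n)) *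
                 \<bar>Df (\<lambda>x. htilde n \<omega> x - h0 x)\<bar>) (\<lambda>n. 1)"
    and a_or_b:
        "iid M borel (\<lambda>i \<omega>. (X i \<omega>, Y i \<omega>)) {1..}
         \<or> (weakly_dependent M X
            \<and> little_op M (\<lambda>n \<omega>. spectral_norm (Omega_hat n \<omega> - Omega n)) (\<lambda>n. 1)
            \<and> little_op M Gdev (\<lambda>n. 1 / sqrt (real (K n))))"
  shows "weak_conv_m
           (\<lambda>n. distr M borel (\<lambda>\<omega>. sqrt (real n) * (f (hhat n \<omega>) - f h0) / sqrt (VK n)))
           std_normal_distribution"
proof -
  interpret prob_space M by (rule M)
  have X1: "X 1 \<in> borel_measurable M" by (rule X_meas)
  have range1: "\<And>\<omega>. \<omega> \<in> space M \<Longrightarrow> X 1 \<omega> \<in> \<X>" by (rule X_range)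
  have ne: "\<X> \<noteq> {}" using not_empty X_range[of _ 1] by blast
  from eps_cond_var_bounded obtain C0 :: real where C0: "\<And>i. i \<ge> 1 \<Longrightarrow>
    AE \<omega> in M. nn_cond_exp M (past_algebra M X \<epsilon> i) (\<lambda>\<omega>. ennreal ((\<epsilon> i \<omega>)\<^sup>2)) \<omega> \<le> ennreal C0" by blast
  \<comment> \<open>The given bound need not be positive.\<close>
  define C where "C = max C0 1"
  have C: "C > 0" by (simp add: C_def)
  have Cb: "AE \<omega> in M. nn_cond_exp M (past_algebra M X \<epsilon> i) (\<lambda>\<omega>. ennreal ((\<epsilon> i \<omega>)\<^sup>2)) \<omega> \<le> ennreal C" if "i \<ge> 1" for i
    using C0[OF that] by (rule eventually_mono) (auto simp: C_def intro: order_trans ennreal_leI)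
  have noise: "martingale_noise M X \<epsilon> C"
  proof unfold_locales
    fix i :: int assume i: "1 \<le> i"
    note m = noise_second_moment[where X = X and \<epsilon> = \<epsilon>, OF X_meas eps_meas Cb[OF i] C]
    show "integrable M (\<lambda>\<omega>. (\<epsilon> i \<omega>)\<^sup>2)" by (rule m(1))
    show "(\<integral>\<omega>. (\<epsilon> i \<omega>)\<^sup>2 * \<phi> (X i \<omega>) \<partial>M) \<le> C * (\<integral>\<omega>. \<phi> (X i \<omega>) \<partial>M)"
      if "\<phi> \<in> borel_measurable borel" "\<And>x. 0 \<le> \<phi> x" "\<And>x. \<phi> x \<le> B" for \<phi> :: "real ^ 'd \<Rightarrow> real" and B
      using m(2)[OF that] .
    show "(\<integral>\<omega>. g \<omega> * \<epsilon> i \<omega> \<partial>M) = 0"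
      if "g \<in> borel_measurable (past_algebra M X \<epsilon> i)" "integrable M (\<lambda>\<omega>. g \<omega> * \<epsilon> i \<omega>)" for g
      by (rule noise_orthogonal[where X = X and \<epsilon> = \<epsilon>, OF X_meas eps_meas eps_mds[OF i] that])
  qed (use X_meas eps_meas C X_stationary in auto)
  interpret noise: martingale_noise M X \<epsilon> C by (rule noise)
  have eps1: "integrable M (\<lambda>\<omega>. (\<epsilon> 1 \<omega>)\<^sup>2)" by (rule noise.eps_sq) simp
  obtain c :: real where c: "c > 0" and lower: "\<And>\<phi> B. \<phi> \<in> borel_measurable borel \<Longrightarrow> (\<And>x. 0 \<le> \<phi> x) \<Longrightarrow> (\<And>x. \<phi> x \<le> B) \<Longrightarrow>
      c * (\<integral>\<omega>. \<phi> (X 1 \<omega>) \<partial>M) \<le> (\<integral>\<omega>. (\<epsilon> 1 \<omega>)\<^sup>2 * \<phi> (X 1 \<omega>) \<partial>M)"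
  proof -
    from eps_cond_var_pos[OF order_refl] obtain g where g: "is_cond_exp_given M \<X> (X 1) (\<lambda>\<omega>. (\<epsilon> 1 \<omega>)\<^sup>2) g" "(INF x\<in>\<X>. g x) > 0" by blast
    \<comment> \<open>The infimum may be infinite.\<close>
    define m where "m = min 1 (INF x\<in>\<X>. g x)"
    have m: "m > 0" "m \<le> 1" using g(2) by (auto simp: m_def)
    then have "m < \<top>" using ennreal_one_less_top order.strict_trans1 by blast
    then obtain r where r: "r \<ge> 0" "m = ennreal r" by (cases m rule: ennreal_cases) auto
    have "r > 0" using m(1) r by simp
    moreover have "ennreal r \<le> g x" if "x \<in> \<X>" for x
      using that r(2) unfolding m_def by (metis INF_lower min.coboundedI2 order_refl order_trans)
    ultimately show ?thesis
      using that[of r] cond_exp_given_bounds(1)[OF g(1) X1 range1 eps1 zero_le_power2] by (meson less_imp_le)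
  qed
  have tail: "\<exists>l>0. \<forall>\<phi> B. \<phi> \<in> borel_measurable borel \<longrightarrow> (\<forall>x. 0 \<le> \<phi> x) \<longrightarrow> (\<forall>x. \<phi> x \<le> B) \<longrightarrow>
      (\<integral>\<omega>. ((\<epsilon> 1 \<omega>)\<^sup>2 * (if \<bar>\<epsilon> 1 \<omega>\<bar> > l then 1 else 0)) * \<phi> (X 1 \<omega>) \<partial>M) \<le> t * (\<integral>\<omega>. \<phi> (X 1 \<omega>) \<partial>M)" if t: "t > 0" for t
  proof -
    \<comment> \<open>Any sequence of levels that tends to infinity would do.\<close>
    have "filterlim (\<lambda>n. real n + 1) at_top sequentially"
      by (intro filterlim_tendsto_add_at_top_iff[THEN iffD2, OF tendsto_const] filterlim_real_sequentially | simp add: add.commute[of _ 1])+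
    from eps_tail[OF order_refl _ this] obtain g where
      g: "\<And>n. is_cond_exp_given M \<X> (X 1) (\<lambda>\<omega>. (\<epsilon> 1 \<omega>)\<^sup>2 * (if \<bar>\<epsilon> 1 \<omega>\<bar> > real n + 1 then 1 else 0)) (g n)"
        "(\<lambda>n. SUP x\<in>\<X>. g n x) \<longlonglongrightarrow> 0" by auto
    have "\<forall>\<^sub>F n in sequentially. (SUP x\<in>\<X>. g n x) < ennreal t" using g(2) t by (intro order_tendstoD) auto
    then obtain n where n: "(SUP x\<in>\<X>. g n x) < ennreal t" using eventually_happens' sequentially_bot by blast
    have le: "g n x \<le> ennreal t" if "x \<in> \<X>" for x using SUP_upper[OF that, of "g n"] n by simp
    have "integrable M (\<lambda>\<omega>. (\<epsilon> 1 \<omega>)\<^sup>2 * (if \<bar>\<epsilon> 1 \<omega>\<bar> > real n + 1 then 1 else 0))"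
    proof (rule Bochner_Integration.integrable_bound[OF eps1])
      show "(\<lambda>\<omega>. (\<epsilon> 1 \<omega>)\<^sup>2 * (if \<bar>\<epsilon> 1 \<omega>\<bar> > real n + 1 then 1 else 0)) \<in> borel_measurable M" using eps_meas[of 1] by measurable
    qed (auto intro!: AE_I2)
    note bd = cond_exp_given_bounds(2)[OF g(1)[of n] X1 range1 this _ _ _ _ less_imp_le[OF t] le]
    show ?thesis
    proof (intro exI[of _ "real n + 1"] conjI allI impI)
      fix \<phi> :: "real ^ 'd \<Rightarrow> real" and B
      assume \<phi>: "\<phi> \<in> borel_measurable borel" "\<forall>x. 0 \<le> \<phi> x" "\<forall>x. \<phi> x \<le> B"
      show "(\<integral>\<omega>. ((\<epsilon> 1 \<omega>)\<^sup>2 * (if \<bar>\<epsilon> 1 \<omega>\<bar> > real n + 1 then 1 else 0)) * \<phi> (X 1 \<omega>) \<partial>M) \<le> t * (\<integral>\<omega>. \<phi> (X 1 \<omega>) \<partial>M)"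
        by (rule bd[of \<phi> B]) (use \<phi> in auto)
    qed simp
  qed
  have h0m: "h0 \<in> borel_measurable (restrict_space borel \<X>)" using h0 by (simp add: L_def L2_Linf_def)
  have iid_noise: "iid M borel (\<lambda>i \<omega>. (X i \<omega>, \<epsilon> i \<omega>)) {1..}" and iid_X: "iid M borel X {1..}"
    if iid: "iid M borel (\<lambda>i \<omega>. (X i \<omega>, Y i \<omega>)) {1..}"
  proof -
    let ?S = "restrict_space borel (\<X> \<times> UNIV) :: ((real ^ 'd) \<times> real) measure"
    have f: "fst \<in> borel_measurable ?S" and s: "snd \<in> borel_measurable ?S"
      by (intro measurable_restrict_space1 borel_measurable_continuous_onI continuous_intros)+
    have "fst \<in> measurable ?S (restrict_space borel \<X>)" by (intro measurable_restrict_space2 f) (auto simp: space_restrict_space)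
    from measurable_compose[OF this h0m] have "(\<lambda>p. (fst p, snd p - h0 (fst p))) \<in> borel_measurable ?S"
      by (intro borel_measurable_Pair f borel_measurable_diff s)
    then have "(\<lambda>(x, y). (x, y - h0 x)) \<in> borel_measurable ?S" by (simp add: case_prod_beta')
    from iid_pairs_noise[OF iid eps_stationary X_range this model] show "iid M borel (\<lambda>i \<omega>. (X i \<omega>, \<epsilon> i \<omega>)) {1..}" by simp
    show "iid M borel X {1..}" by (rule iid_fst[OF iid X_stationary X_meas])
  qed
  obtain a where mix: "mixing_coeffs M X a"
    using a_or_b weakly_dependent_mixing iid_mixing[OF iid_X X_meas] by blast
  have design: "sieve_design M X (K n) (bw n)" if n: "n \<ge> 1" for n
    unfolding bw_def using D[OF n] basis[OF n] gram_pos[OF K_pos[OF n] n]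
    by (intro sieve_design_sieve_vec[where \<X> = \<X>] X_meas K_pos[OF n]) (auto simp: L_def)
  have sn: "sieve_noise M X (K n) (bw n) \<epsilon> C" if "n \<ge> 1" for n
    by (rule sieve_noise.intro[OF design[OF that] noise])
  have off: "bw n x = 0\<^sub>v (K n)" if "n \<ge> 1" "x \<notin> \<X>" for n x
  proof -
    have "x \<notin> D n" using D[OF that(1)] that(2) by blast
    then show ?thesis by (intro eq_vecI) (auto simp: bw_def sieve_vec_def)
  qed
  define \<phi> where "\<phi> n = vec (K n) (\<lambda>k. Df (\<lambda>x. bw n x $ k))" for n
  have \<phi>: "\<phi> n \<in> carrier_vec (K n)" for n by (simp add: \<phi>_def)
  have bw_dim: "bw n x \<in> carrier_vec (K n)" for n x by (simp add: bw_def sieve_vec_def)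
  have bw_L: "(\<lambda>x. bw n x $ k) \<in> L" if "n \<ge> 1" "k < K n" for n k
    using basis[OF that] that(2) by (simp add: bw_def sieve_vec_def)
  have span: "(\<lambda>x. d \<bullet> bw n x) \<in> L" "Df (\<lambda>x. d \<bullet> bw n x) = d \<bullet> \<phi> n" if "n \<ge> 1" "d \<in> carrier_vec (K n)" for n d
    using pathwise_deriv_span[OF X1 range1 deriv_linear[unfolded L_def] bw_dim bw_L[unfolded L_def, OF that(1)] that(2)]
    by (simp_all add: L_def Df_def \<phi>_def)
  define \<psi> where "\<psi> n = mat_inv_sqrt (gram M (X 1) (K n) (bw n)) *\<^sub>v \<phi> n" for n
  define nv where "nv n = vec_norm2 (\<psi> n)" for n
  have vK_eq: "vK n = (\<lambda>x. \<psi> n \<bullet> bt n x)" and \<psi>: "\<psi> n \<in> carrier_vec (K n)" and nv: "L2_norm M (X 1) (vK n) = nv n" if n: "n \<ge> 1" for n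
  proof -
    interpret d: sieve_design M X "K n" "bw n" by (rule design[OF n])
    show v: "vK n = (\<lambda>x. \<psi> n \<bullet> bt n x)" unfolding vK_def \<psi>_def bt_def by (rule d.riesz_representer_eq[OF \<phi> span(2)[OF n]])
    show p: "\<psi> n \<in> carrier_vec (K n)" unfolding \<psi>_def by (rule d.W_carrier[OF \<phi>])
    show "L2_norm M (X 1) (vK n) = nv n" unfolding v bt_def nv_def by (rule d.L2_norm_inner_q[OF p])
  qed
  \<comment> \<open>The norm of the representer tends to infinity, so it vanishes for at most finitely many \<open>n \<ge> 1\<close>.\<close>
  define ok where "ok n \<longleftrightarrow> n \<ge> 1 \<and> nv n > 0" for n
  have ev_ok: "\<forall>\<^sub>F n in sequentially. ok n"
    using vK_diverges[unfolded filterlim_at_top_dense, rule_format, of 0] eventually_ge_at_top[of 1]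
    by eventually_elim (use nv in \<open>auto simp: ok_def\<close>)
  define \<gamma> where "\<gamma> n = (1 / nv n) \<cdot>\<^sub>v \<psi> n" for n
  have \<gamma>: "\<gamma> n \<in> carrier_vec (K n)" "vec_norm2 (\<gamma> n) = 1" "\<psi> n = nv n \<cdot>\<^sub>v \<gamma> n" if ok: "ok n" for n
    using ok \<psi>[of n] by (auto simp: \<gamma>_def ok_def vec_norm2_smult nv_def[symmetric] smult_smult_assoc)
  define s where "s n x = (if ok n then \<gamma> n \<bullet> bt n x else 0)" for n x
  have s_meas: "s n \<in> borel_measurable borel" and s_bd: "\<exists>B. \<forall>x. \<bar>s n x\<bar> \<le> B" for n
  proof -
    have "s n \<in> borel_measurable borel \<and> (\<exists>B. \<forall>x. \<bar>s n x\<bar> \<le> B)"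
    proof (cases "ok n")
      case True
      then interpret d: sieve_design M X "K n" "bw n" by (intro design) (simp add: ok_def)
      show ?thesis using d.inner_q_measurable[OF \<gamma>(1)[OF True]] True by (simp add: s_def[abs_def] bt_def)
    next
      case False
      then show ?thesis by (auto simp: s_def[abs_def])
    qed
    then show "s n \<in> borel_measurable borel" "\<exists>B. \<forall>x. \<bar>s n x\<bar> \<le> B" by auto
  qed
  have unit: "\<forall>\<^sub>F n in sequentially. (\<integral>\<omega>. (s n (X 1 \<omega>))\<^sup>2 \<partial>M) = 1"
    using ev_ok
  proof eventually_elim
    case (elim n)
    then interpret d: sieve_design M X "K n" "bw n" by (intro design) (simp add: ok_def)
    show ?case using d.q_bilinear[OF \<gamma>(1)[OF elim] \<gamma>(1)[OF elim]] \<gamma>(2)[OF elim] vec_norm2_square[of "\<gamma> n"] elim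
      by (simp add: s_def bt_def power2_eq_square)
  qed
  \<comment> \<open>The sieve variance divided by the squared norm of the representer.\<close>
  define \<sigma>2 where "\<sigma>2 n = (\<integral>\<omega>. (\<epsilon> 1 \<omega>)\<^sup>2 * (s n (X 1 \<omega>))\<^sup>2 \<partial>M)" for n
  have \<sigma>2_lower: "\<forall>\<^sub>F n in sequentially. c \<le> \<sigma>2 n"
    using unit
  proof eventually_elim
    case (elim n)
    obtain B where B: "\<And>x. \<bar>s n x\<bar> \<le> B" using s_bd by blast
    have "(\<lambda>x. (s n x)\<^sup>2) \<in> borel_measurable borel" using s_meas[of n] by measurable
    moreover have "(s n x)\<^sup>2 \<le> B\<^sup>2" for x using power_mono[OF B[of x], of 2] by simp
    ultimately have "c * (\<integral>\<omega>. (s n (X 1 \<omega>))\<^sup>2 \<partial>M) \<le> \<sigma>2 n" unfolding \<sigma>2_def by (intro lower) auto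
    then show ?case using elim by simp
  qed
  have VK_eq: "VK n = (nv n)\<^sup>2 * \<sigma>2 n" if ok: "ok n" for n
  proof -
    interpret d: sieve_design M X "K n" "bw n" using ok by (intro design) (simp add: ok_def)
    have "vK n x = nv n * s n x" for x
      using vK_eq[of n] ok \<gamma>(3)[OF ok] \<gamma>(1)[OF ok] d.q_dim[of x] by (simp add: ok_def s_def bt_def)
    then have "(\<epsilon> 1 \<omega> * vK n (X 1 \<omega>))\<^sup>2 = (nv n)\<^sup>2 * ((\<epsilon> 1 \<omega>)\<^sup>2 * (s n (X 1 \<omega>))\<^sup>2)" for \<omega>
      by (simp add: power_mult_distrib)
    then show ?thesis by (simp add: VK_def \<sigma>2_def)
  qed
  have Gdev: "whp (\<lambda>n \<omega>. Gdev n \<omega> \<le> e)" if e: "e > 0" for e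
    using gram_conv
  proof
    assume i: "iid M borel X {1..} \<and> (\<lambda>n. zeta \<X> (bw n) * lambda_factor M (X 1) (K n) (bw n) * sqrt (ln (real (K n)) / real n)) \<longlonglongrightarrow> 0"
    from gram_concentration_iid[where p = bw and K = K, OF design conjunct1[OF i] off ne K_tendsto conjunct2[OF i] e]
    have "whp (\<lambda>n \<omega>. spectral_norm (gram_deviation (K n) (bt n) n (\<lambda>i. X i \<omega>)) \<le> e)" unfolding bt_def by simp
    then show ?thesis
    proof (rule whp_mono)
      show "\<forall>\<^sub>F n in sequentially. \<forall>\<omega>\<in>space M. spectral_norm (gram_deviation (K n) (bt n) n (\<lambda>i. X i \<omega>)) \<le> e \<longrightarrow> Gdev n \<omega> \<le> e"
        using eventually_ge_at_top[of 1]
        by eventually_elim (simp add: Gdev_def Bt_def bt_def sieve_design.sample_gram_deviation[OF design])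
    qed
  next
    assume "little_op M Gdev (\<lambda>n. 1)"
    then have "whp (\<lambda>n \<omega>. \<bar>Gdev n \<omega>\<bar> \<le> e)" using e whp_of_wp unfolding little_op_def by fastforce
    then show ?thesis by (rule whp_mono) (auto intro!: always_eventually)
  qed
  have emp: "whp (\<lambda>n \<omega>. \<bar>(\<Sum>i\<in>{1..int n}. (s n (X i \<omega>))\<^sup>2) / real n - 1\<bar> \<le> e)" if e: "e > 0" for e
  proof (rule whp_mono[OF Gdev[OF e]])
    show "\<forall>\<^sub>F n in sequentially. \<forall>\<omega>\<in>space M. Gdev n \<omega> \<le> e \<longrightarrow> \<bar>(\<Sum>i\<in>{1..int n}. (s n (X i \<omega>))\<^sup>2) / real n - 1\<bar> \<le> e"
      using ev_ok
    proof eventually_elim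
      case (elim n)
      then have n: "n \<ge> 1" by (simp add: ok_def)
      interpret d: sieve_design M X "K n" "bw n" by (rule design[OF n])
      note g = \<gamma>[OF elim]
      show ?case
      proof (intro ballI impI)
        fix \<omega> assume dev: "Gdev n \<omega> \<le> e"
        let ?G = "d.sample_gram n \<omega>"
        have G: "?G \<in> carrier_mat (K n) (K n)" by (rule d.sample_gram_carrier)
        have "\<gamma> n \<bullet> ((?G - 1\<^sub>m (K n)) *\<^sub>v \<gamma> n) = \<gamma> n \<bullet> (?G *\<^sub>v \<gamma> n) - \<gamma> n \<bullet> \<gamma> n"
          using minus_mult_distrib_mat_vec[OF G one_carrier_mat g(1)] g(1)
            scalar_prod_minus_distrib[OF g(1) mult_mat_vec_carrier[OF G g(1)] g(1)] by simp
        then have "(\<Sum>i\<in>{1..int n}. (s n (X i \<omega>))\<^sup>2) / real n - 1 = \<gamma> n \<bullet> ((?G - 1\<^sub>m (K n)) *\<^sub>v \<gamma> n)"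
          using d.sample_gram_form[OF n g(1), of \<omega>] vec_norm2_square[of "\<gamma> n"] g(2) elim by (simp add: s_def bt_def)
        then have "\<bar>(\<Sum>i\<in>{1..int n}. (s n (X i \<omega>))\<^sup>2) / real n - 1\<bar> \<le> Gdev n \<omega>"
          using quadratic_form_le_spectral_norm[OF minus_carrier_mat[OF one_carrier_mat] g(1,2), of ?G] by (simp add: Gdev_def Bt_def bt_def)
        then show "\<bar>(\<Sum>i\<in>{1..int n}. (s n (X i \<omega>))\<^sup>2) / real n - 1\<bar> \<le> e" using dev by linarith
      qed
    qed
  qed
  have sq: "iid M borel (\<lambda>i \<omega>. (X i \<omega>, \<epsilon> i \<omega>)) {1..} \<or>
      (\<forall>e>0. whp (\<lambda>n \<omega>. \<bar>(\<Sum>i\<in>{1..int n}. (\<epsilon> i \<omega>)\<^sup>2 * (s n (X i \<omega>))\<^sup>2) / real n - \<sigma>2 n\<bar> \<le> e))"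
    using a_or_b
  proof
    assume b: "weakly_dependent M X \<and> little_op M (\<lambda>n \<omega>. spectral_norm (Omega_hat n \<omega> - Omega n)) (\<lambda>n. 1)
      \<and> little_op M Gdev (\<lambda>n. 1 / sqrt (real (K n)))"
    have "whp (\<lambda>n \<omega>. \<bar>(\<Sum>i\<in>{1..int n}. (\<epsilon> i \<omega>)\<^sup>2 * (s n (X i \<omega>))\<^sup>2) / real n - \<sigma>2 n\<bar> \<le> e)" if e: "e > 0" for e
    proof -
      have "whp (\<lambda>n \<omega>. \<bar>spectral_norm (Omega_hat n \<omega> - Omega n)\<bar> \<le> e * 1)"
        using b e unfolding little_op_def by (intro whp_of_wp) blast
      then show ?thesis
      proof (rule whp_mono)
        show "\<forall>\<^sub>F n in sequentially. \<forall>\<omega>\<in>space M. \<bar>spectral_norm (Omega_hat n \<omega> - Omega n)\<bar> \<le> e * 1 \<longrightarrow>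
            \<bar>(\<Sum>i\<in>{1..int n}. (\<epsilon> i \<omega>)\<^sup>2 * (s n (X i \<omega>))\<^sup>2) / real n - \<sigma>2 n\<bar> \<le> e"
          using ev_ok
        proof eventually_elim
          case (elim n)
          then have n: "n \<ge> 1" by (simp add: ok_def)
          interpret d: sieve_noise M X "K n" "bw n" \<epsilon> C by (rule sn[OF n])
          note g = \<gamma>[OF elim]
          show ?case
          proof (intro ballI impI)
            fix \<omega> assume small: "\<bar>spectral_norm (Omega_hat n \<omega> - Omega n)\<bar> \<le> e * 1"
            have H: "Omega_hat n \<omega> \<in> carrier_mat (K n) (K n)" and O: "Omega n \<in> carrier_mat (K n) (K n)"
              by (simp_all add: Omega_hat_def Omega_def weighted_gram_def weighted_sample_gram_def)
            have "\<gamma> n \<bullet> ((Omega_hat n \<omega> - Omega n) *\<^sub>v \<gamma> n) = \<gamma> n \<bullet> (Omega_hat n \<omega> *\<^sub>v \<gamma> n) - \<gamma> n \<bullet> (Omega n *\<^sub>v \<gamma> n)"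
              using minus_mult_distrib_mat_vec[OF H O g(1)]
                scalar_prod_minus_distrib[OF g(1) mult_mat_vec_carrier[OF H g(1)] mult_mat_vec_carrier[OF O g(1)]] by simp
            also have "\<gamma> n \<bullet> (Omega_hat n \<omega> *\<^sub>v \<gamma> n) = (\<Sum>i\<in>{1..int n}. (\<epsilon> i \<omega>)\<^sup>2 * (s n (X i \<omega>))\<^sup>2) / real n"
              using d.noise_sample_gram_form[OF g(1), of n \<omega>] elim by (simp add: Omega_hat_def bt_def s_def)
            also have "\<gamma> n \<bullet> (Omega n *\<^sub>v \<gamma> n) = \<sigma>2 n"
              using d.noise_gram_form[OF g(1)] elim by (simp add: Omega_def bt_def s_def \<sigma>2_def)
            finally show "\<bar>(\<Sum>i\<in>{1..int n}. (\<epsilon> i \<omega>)\<^sup>2 * (s n (X i \<omega>))\<^sup>2) / real n - \<sigma>2 n\<bar> \<le> e"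
              using quadratic_form_le_spectral_norm[OF minus_carrier_mat[OF O] g(1,2), of "Omega_hat n \<omega>"] small by simp
          qed
        qed
      qed
    qed
    then show ?thesis by blast
  qed (use iid_noise in blast)
  define \<rho> where "\<rho> n \<omega> = (\<Sum>i\<in>{1..int n}. \<epsilon> i \<omega> * ((cramer_solution ((1 / real n) \<cdot>\<^sub>m (transpose_mat (Bt n \<omega>) * Bt n \<omega>)) (\<gamma> n) - \<gamma> n)
      \<bullet> bt n (X i \<omega>))) / sqrt (real n)" for n \<omega>
  have residual: "whp (\<lambda>n \<omega>. \<bar>\<rho> n \<omega>\<bar> \<le> \<delta>)" if \<delta>: "\<delta> > 0" for \<delta>
  proof (rule whp_conditional)
    fix t :: real assume t: "t > 0"
    \<comment> \<open>Chosen so that the exceptional probability is at most \<open>t\<close>.\<close>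
    define \<eta> where "\<eta> = min (1 / 2) (sqrt (t * \<delta>\<^sup>2 / (8 * C)))"
    have \<eta>: "\<eta> > 0" "\<eta> \<le> 1 / 2" using t \<delta> C by (auto simp: \<eta>_def)
    have "\<eta>\<^sup>2 \<le> (sqrt (t * \<delta>\<^sup>2 / (8 * C)))\<^sup>2" using \<eta> by (intro power_mono) (auto simp: \<eta>_def)
    also have "\<dots> = t * \<delta>\<^sup>2 / (8 * C)" using t C by simp
    finally have t8: "8 * C * \<eta>\<^sup>2 / \<delta>\<^sup>2 \<le> t" using C \<delta> by (simp add: field_simps)
    show "\<exists>Q. whp Q \<and> (\<forall>\<^sub>F n in sequentially. \<exists>A\<in>sets M. prob A \<ge> 1 - t \<and> (\<forall>\<omega>\<in>A. Q n \<omega> \<longrightarrow> \<bar>\<rho> n \<omega>\<bar> \<le> \<delta>))"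
      using a_or_b
    proof
      assume iid: "iid M borel (\<lambda>i \<omega>. (X i \<omega>, Y i \<omega>)) {1..}"
      show ?thesis
      proof (rule exI[of _ "\<lambda>n \<omega>. Gdev n \<omega> \<le> \<eta>"], rule conjI[OF Gdev[OF \<eta>(1)]])
        show "\<forall>\<^sub>F n in sequentially. \<exists>A\<in>sets M. prob A \<ge> 1 - t \<and> (\<forall>\<omega>\<in>A. Gdev n \<omega> \<le> \<eta> \<longrightarrow> \<bar>\<rho> n \<omega>\<bar> \<le> \<delta>)"
          using ev_ok
        proof eventually_elim
          case (elim n)
          then have n: "n \<ge> 1" by (simp add: ok_def)
          interpret d: sieve_noise M X "K n" "bw n" \<epsilon> C by (rule sn[OF n])
          have ind: "indep_vars (\<lambda>_. borel) (\<lambda>i \<omega>. (X i \<omega>, \<epsilon> i \<omega>)) {1..int n}"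
            by (rule iid_indep_vars[OF iid_noise[OF iid]]) auto
          from d.residual_iid[OF n \<gamma>(1,2)[OF elim] \<eta>(2) \<delta> ind] t8 show ?case
            unfolding \<rho>_def Gdev_def Bt_def bt_def by (meson diff_left_mono order_trans)
        qed
      qed
    next
      assume b: "weakly_dependent M X \<and> little_op M (\<lambda>n \<omega>. spectral_norm (Omega_hat n \<omega> - Omega n)) (\<lambda>n. 1)
        \<and> little_op M Gdev (\<lambda>n. 1 / sqrt (real (K n)))"
      show ?thesis
      proof (rule exI[of _ "\<lambda>n \<omega>. \<bar>Gdev n \<omega>\<bar> \<le> \<eta> * (1 / sqrt (real (K n)))"], rule conjI)
        show "whp (\<lambda>n \<omega>. \<bar>Gdev n \<omega>\<bar> \<le> \<eta> * (1 / sqrt (real (K n))))"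
          using b \<eta>(1) unfolding little_op_def by (intro whp_of_wp) blast
        show "\<forall>\<^sub>F n in sequentially. \<exists>A\<in>sets M. prob A \<ge> 1 - t \<and> (\<forall>\<omega>\<in>A. \<bar>Gdev n \<omega>\<bar> \<le> \<eta> * (1 / sqrt (real (K n))) \<longrightarrow> \<bar>\<rho> n \<omega>\<bar> \<le> \<delta>)"
          using ev_ok
        proof eventually_elim
          case (elim n)
          then have n: "n \<ge> 1" by (simp add: ok_def)
          interpret d: sieve_noise M X "K n" "bw n" \<epsilon> C by (rule sn[OF n])
          \<comment> \<open>The factor \<open>K\<close> in the bound for the residual cancels.\<close>
          let ?\<eta> = "\<eta> * (1 / sqrt (real (K n)))"
          have K1: "real (K n) \<ge> 1" using K_pos[OF n] by simp
          have h: "0 < ?\<eta>" using \<eta>(1) K1 by simp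
          have "?\<eta> \<le> \<eta> * 1" using \<eta>(1) K1 by (intro mult_left_mono) auto
          then have h2: "?\<eta> \<le> 1 / 2" using \<eta>(2) by linarith
          have "4 * C * (real (K n) * ?\<eta>\<^sup>2) / \<delta>\<^sup>2 = 4 * C * \<eta>\<^sup>2 / \<delta>\<^sup>2"
            using K1 by (simp add: power_mult_distrib power_divide)
          also have "\<dots> \<le> 8 * C * \<eta>\<^sup>2 / \<delta>\<^sup>2" using C by (intro divide_right_mono mult_right_mono) auto
          finally have "4 * C * (real (K n) * ?\<eta>\<^sup>2) / \<delta>\<^sup>2 \<le> t" using t8 by linarith
          moreover from d.residual_mds[OF n \<gamma>(1,2)[OF elim] h h2 \<delta>] obtain A where A: "A \<in> sets M"
            "prob A \<ge> 1 - 4 * C * (real (K n) * ?\<eta>\<^sup>2) / \<delta>\<^sup>2" "\<And>\<omega>. \<omega> \<in> A \<Longrightarrow> Gdev n \<omega> \<le> ?\<eta> \<Longrightarrow> \<bar>\<rho> n \<omega>\<bar> \<le> \<delta>"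
            unfolding \<rho>_def Gdev_def Bt_def bt_def by blast
          ultimately have "prob A \<ge> 1 - t" by linarith
          then show ?case using A by (intro bexI[of _ A]) auto
        qed
      qed
    qed
  qed
  have lin: "\<forall>\<^sub>F n in sequentially. \<forall>h\<in>N n. sqrt (real n) * inverse (nv n) * \<bar>f h - f h0 - Df (\<lambda>x. h x - h0 x)\<bar> \<le> e"
    if e: "e > 0" for e
  proof -
    have "\<forall>\<^sub>F n in sequentially. (SUP h\<in>N n. ennreal (sqrt (real n) * inverse (L2_norm M (X 1) (vK n)) *
        \<bar>f h - f h0 - Df (\<lambda>x. h x - h0 x)\<bar>)) < ennreal e"
      using linearization e by (intro order_tendstoD) auto
    then show ?thesis using eventually_ge_at_top[of 1]
    proof eventually_elim
      case (elim n)
      show ?case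
      proof
        fix h assume h: "h \<in> N n"
        have "ennreal (sqrt (real n) * inverse (nv n) * \<bar>f h - f h0 - Df (\<lambda>x. h x - h0 x)\<bar>) \<le> ennreal e"
          using order_trans[OF SUP_upper[OF h] less_imp_le[OF elim(1)]] nv[OF elim(2)] by simp
        then show "sqrt (real n) * inverse (nv n) * \<bar>f h - f h0 - Df (\<lambda>x. h x - h0 x)\<bar> \<le> e" using e by (simp add: ennreal_le_iff)
      qed
    qed
  qed
  define Z where "Z n \<omega> = sqrt (real n) * (f (hhat n \<omega>) - f h0) / sqrt (VK n)" for n \<omega>
  have Zm: "Z n \<in> borel_measurable M" for n
  proof (cases "n \<ge> 1")
    case True
    then show ?thesis unfolding Z_def[abs_def]
      by (intro borel_measurable_divide borel_measurable_times borel_measurable_diff f_hhat_meas borel_measurable_const)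
  next
    case False
    then have "n = 0" by simp
    then show ?thesis by (simp add: Z_def[abs_def])
  qed
  have approx: "whp (\<lambda>n \<omega>. \<bar>Z n \<omega> - (\<Sum>i\<in>{1..int n}. \<epsilon> i \<omega> * s n (X i \<omega>)) / (sqrt (real n) * sqrt (\<sigma>2 n))\<bar> \<le> e)" if e: "e > 0" for e
  proof -
    \<comment> \<open>Three error terms, each divided by \<open>sqrt (\<sigma>2 n) \<ge> sqrt c\<close>.\<close>
    define \<delta> where "\<delta> = e * sqrt c / 3"
    have \<delta>: "\<delta> > 0" using e c by (simp add: \<delta>_def)
    have bias': "whp (\<lambda>n \<omega>. \<bar>sqrt (real n) * inverse (L2_norm M (X 1) (vK n)) * \<bar>Df (\<lambda>x. htilde n \<omega> x - h0 x)\<bar>\<bar> \<le> \<delta> * 1)"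
      using bias \<delta> unfolding little_op_def by (intro whp_of_wp) blast
    have half: "(1 :: real) / 2 > 0" by simp
    show ?thesis
    proof (rule whp_mono[OF whp_conj[OF whp_of_wp[OF in_N] whp_conj[OF bias' whp_conj[OF Gdev[OF half] residual[OF \<delta>]]]]])
      show "\<forall>\<^sub>F n in sequentially. \<forall>\<omega>\<in>space M. (hhat n \<omega> \<in> N n \<and> htilde n \<omega> \<in> N n) \<and>
          \<bar>sqrt (real n) * inverse (L2_norm M (X 1) (vK n)) * \<bar>Df (\<lambda>x. htilde n \<omega> x - h0 x)\<bar>\<bar> \<le> \<delta> * 1 \<and>
          Gdev n \<omega> \<le> 1 / 2 \<and> \<bar>\<rho> n \<omega>\<bar> \<le> \<delta> \<longrightarrow>
          \<bar>Z n \<omega> - (\<Sum>i\<in>{1..int n}. \<epsilon> i \<omega> * s n (X i \<omega>)) / (sqrt (real n) * sqrt (\<sigma>2 n))\<bar> \<le> e"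
        using ev_ok \<sigma>2_lower lin[OF \<delta>]
      proof eventually_elim
        case (elim n)
        then have n: "n \<ge> 1" and nv0: "nv n > 0" by (auto simp: ok_def)
        interpret d: sieve_noise M X "K n" "bw n" \<epsilon> C by (rule sn[OF n])
        show ?case
        proof (intro ballI impI)
          fix \<omega> assume \<omega>: "\<omega> \<in> space M" and good: "(hhat n \<omega> \<in> N n \<and> htilde n \<omega> \<in> N n) \<and>
            \<bar>sqrt (real n) * inverse (L2_norm M (X 1) (vK n)) * \<bar>Df (\<lambda>x. htilde n \<omega> x - h0 x)\<bar>\<bar> \<le> \<delta> * 1 \<and>
            Gdev n \<omega> \<le> 1 / 2 \<and> \<bar>\<rho> n \<omega>\<bar> \<le> \<delta>"
          let ?S = "\<Sum>i\<in>{1..int n}. \<epsilon> i \<omega> * s n (X i \<omega>)"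
          have dev: "d.deviation n \<omega> \<le> 1 / 2" using good by (simp add: Gdev_def Bt_def bt_def)
          from d.series_difference_linear_part[where Y = Y and H = "\<lambda>i \<omega>. h0 (X i \<omega>)",
              OF n \<phi> \<gamma>(1,2)[OF elim(1)] \<gamma>(3)[OF elim(1), unfolded \<psi>_def] dev] model[OF _ \<omega>]
          obtain \<beta> where \<beta>: "\<beta> \<in> carrier_vec (K n)" "\<And>x. hhat n \<omega> x - htilde n \<omega> x = \<beta> \<bullet> bw n x"
            "sqrt (real n) * (\<beta> \<bullet> \<phi> n) = nv n * (?S / sqrt (real n) + \<rho> n \<omega>)"
            using elim(1) by (auto simp: hhat_def htilde_def \<rho>_def Bt_def bt_def s_def)
          define u where "u = (\<lambda>x. htilde n \<omega> x - h0 x)"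
          have "htilde n \<omega> \<in> L" using N[OF n] good by blast
          from L2_Linf_combination[OF X1 range1 this[unfolded L_def] h0[unfolded L_def], of 1 "- 1"]
          have uL: "u \<in> L" by (simp add: L_def u_def)
          have "(\<lambda>x. hhat n \<omega> x - h0 x) = (\<lambda>x. 1 * u x + 1 * (\<beta> \<bullet> bw n x))"
            using \<beta>(2) by (intro ext) (simp add: u_def algebra_simps)
          then have "Df (\<lambda>x. hhat n \<omega> x - h0 x) = 1 * Df u + 1 * Df (\<lambda>x. \<beta> \<bullet> bw n x)"
            using deriv_linear uL span(1)[OF n \<beta>(1)] unfolding pathwise_linear_on_def Df_def by metis
          then have Dsum: "Df (\<lambda>x. hhat n \<omega> x - h0 x) = Df u + \<beta> \<bullet> \<phi> n" using span(2)[OF n \<beta>(1)] by simp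
          define A where "A = sqrt (real n) * inverse (nv n) * (f (hhat n \<omega>) - f h0 - Df (\<lambda>x. hhat n \<omega> x - h0 x))"
          define B where "B = sqrt (real n) * inverse (nv n) * Df u"
          have A: "\<bar>A\<bar> \<le> \<delta>" using elim(3) good nv0 by (auto simp: A_def abs_mult)
          have B: "\<bar>B\<bar> \<le> \<delta>" using good nv[OF n] nv0 by (simp add: B_def abs_mult u_def)
          have "sqrt (real n) * inverse (nv n) * (\<beta> \<bullet> \<phi> n) = ?S / sqrt (real n) + \<rho> n \<omega>"
            using \<beta>(3) nv0 by (simp add: field_simps)
          then have dec: "sqrt (real n) * inverse (nv n) * (f (hhat n \<omega>) - f h0) = A + B + \<rho> n \<omega> + ?S / sqrt (real n)"
            unfolding A_def B_def Dsum by (simp add: algebra_simps)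
          have \<sigma>0: "\<sigma>2 n > 0" using elim(2) c by linarith
          have "sqrt (VK n) = nv n * sqrt (\<sigma>2 n)" using VK_eq[OF elim(1)] nv0 by (simp add: real_sqrt_mult)
          then have "Z n \<omega> = sqrt (real n) * inverse (nv n) * (f (hhat n \<omega>) - f h0) / sqrt (\<sigma>2 n)"
            by (simp add: Z_def divide_inverse mult_ac)
          then have "Z n \<omega> - ?S / (sqrt (real n) * sqrt (\<sigma>2 n)) = (A + B + \<rho> n \<omega>) / sqrt (\<sigma>2 n)"
            unfolding dec by (simp add: add_divide_distrib)
          then have "\<bar>Z n \<omega> - ?S / (sqrt (real n) * sqrt (\<sigma>2 n))\<bar> = \<bar>A + B + \<rho> n \<omega>\<bar> / sqrt (\<sigma>2 n)" using \<sigma>0 by simp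
          also have "\<dots> \<le> (3 * \<delta>) / sqrt c"
            using A B good c elim(2) by (intro frac_le) auto
          also have "\<dots> = e" using c by (simp add: \<delta>_def)
          finally show "\<bar>Z n \<omega> - ?S / (sqrt (real n) * sqrt (\<sigma>2 n))\<bar> \<le> e" .
        qed
      qed
    qed
  qed
  have "weak_conv_m (\<lambda>n. distr M borel (Z n)) std_normal_distribution"
    by (rule noise.noise_sum_clt[OF eps_stationary mix c lower tail s_meas s_bd unit emp sq[unfolded \<sigma>2_def] Zm approx[unfolded \<sigma>2_def]])
  then show ?thesis unfolding Z_def[abs_def] .
qed

end
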